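(* Consider the system $$\frac{dx}{dt}=xy,\qquad \frac{dy}{dt}=2x^2-y^2 .$$ After a series of blowing-ups at ten points (including infinitely near ones), starting from $\mathbb{P}^2\supset\mathbb{C}^2\ni(x,y)$, one obtains a rational surface of type $E_7^{(1)}$. The phase space $\mathcal{X}$ of the system is obtained by gluing four copies $U_j\times\mathbb{C}=\mathbb{C}^2\times\mathbb{C}\ni(x_j,y_j,t)$, $j=0,1,2,3$, via the birational transformations $$\begin{aligned} 0)\;& x_0=x,\quad y_0=y,\\ 1)\;& x_1=xy,\quad y_1=\frac1y,\\ 2)\;& x_2=xy^3-y^4,\quad y_2=\frac1y,\\ 3)\;& x_3=xy^3+y^4,\quad y_3=\frac1y . \end{aligned}$$
   Context: Gluing: points of different charts with the same $t$ are identified through the given birational relations wherever these are biregular. Phase space: the resulting complex manifold $\mathcal{X}$, fibred over the $t$-line $B$ (here $B=\mathbb{C}$), is the phase space (space of initial conditions) of the system if (i) rewritten in the coordinates $(x_j,y_j)$ of every chart, the system has right-hand sides that are polynomials in $(x_j,y_j)$ with coefficients holomorphic in $t$; and (ii) every solution $(x(t),y(t))$ that is meromorphic near a point $t_0\in B$ extends holomorphically across $t_0$ as a map into $\mathcal{X}$ (so poles of solutions become ordinary points of $\mathcal{X}$). Type: a rational surface of type $R$ (an affine Dynkin diagram) here means a smooth projective rational surface $S$ containing the fibre $\mathcal{X}_t$ as an open subset such that $S\setminus\mathcal{X}_t$ is a union of smooth rational curves of self-intersection $-2$ whose dual intersection graph is the diagram $R$. *)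

theory Defs
  imports "HOL-Complex_Analysis.Complex_Analysis"
begin

no_notation fps_nth (infixl \<open>$\<close> 75)

section \<open>Complex manifolds\<close>

text \<open>
  Holomorphy in several variables: real Frechet differentiability with complex-linear derivative
  at every point of an open set. Both predicates include openness of the set.
\<close>

definition hol_fun_on :: "(complex^('n::finite)) set \<Rightarrow> (complex^'n \<Rightarrow> complex) \<Rightarrow> bool" where
  "hol_fun_on W f \<longleftrightarrow> open W \<and>
     (\<forall>x\<in>W. \<exists>D. (f has_derivative D) (at x) \<and> (\<forall>c v. D (c *s v) = c * D v))"

definition hol_map_on :: "(complex^('m::finite)) set \<Rightarrow> (complex^'m \<Rightarrow> complex^('n::finite)) \<Rightarrow> bool" where
  "hol_map_on W f \<longleftrightarrow> (\<forall>i. hol_fun_on W (\<lambda>x. f x $ i))"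

text \<open>
  A manifold is given by an atlas alone: its points are the points covered by the charts, and its
  topology is the one making all charts homeomorphisms onto open subsets of coordinate space.
  Values of a chart map outside its domain are irrelevant.
\<close>

type_synonym ('a, 'n) atlas = "('a set \<times> ('a \<Rightarrow> complex^'n)) set"

definition pts :: "('a, 'n::finite) atlas \<Rightarrow> 'a set" where
  "pts A = (\<Union>(U, \<phi>)\<in>A. U)"

definition mtop :: "('a, 'n::finite) atlas \<Rightarrow> 'a topology" where
  "mtop A = topology (\<lambda>W. W \<subseteq> pts A \<and> (\<forall>(U, \<phi>)\<in>A. open (\<phi> ` (U \<inter> W))))"

definition is_atlas :: "('a, 'n::finite) atlas \<Rightarrow> bool" where
  "is_atlas A \<longleftrightarrow>
     (\<forall>(U, \<phi>)\<in>A. inj_on \<phi> U \<and> open (\<phi> ` U) \<and>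
        (\<forall>(V, \<psi>)\<in>A. hol_map_on (\<phi> ` (U \<inter> V)) (\<psi> \<circ> inv_into U \<phi>)))"

definition complex_manifold :: "('a, 'n::finite) atlas \<Rightarrow> bool" where
  "complex_manifold A \<longleftrightarrow> is_atlas A \<and> Hausdorff_space (mtop A) \<and> second_countable (mtop A)"

definition open_restrict :: "('a, 'n::finite) atlas \<Rightarrow> 'a set \<Rightarrow> ('a, 'n) atlas" where
  "open_restrict A W = (\<lambda>(U, \<phi>). (U \<inter> W, \<phi>)) ` A"

definition product_atlas ::
  "('a, 'm::finite) atlas \<Rightarrow> ('b, 'n::finite) atlas \<Rightarrow> ('a \<times> 'b, 'm + 'n) atlas" where
  "product_atlas A B =
     {(U \<times> V, \<lambda>(p, q). \<chi> k. case k of Inl i \<Rightarrow> \<phi> p $ i | Inr j \<Rightarrow> \<psi> q $ j)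
       | U \<phi> V \<psi>. (U, \<phi>) \<in> A \<and> (V, \<psi>) \<in> B}"

text \<open>
  Openness of the sets in \<^term>\<open>hol_map_on\<close> makes these maps continuous.
\<close>

definition holo_map :: "('a, 'm::finite) atlas \<Rightarrow> ('b, 'n::finite) atlas \<Rightarrow> ('a \<Rightarrow> 'b) \<Rightarrow> bool" where
  "holo_map A B f \<longleftrightarrow> f ` pts A \<subseteq> pts B \<and>
     (\<forall>(U, \<phi>)\<in>A. \<forall>(V, \<psi>)\<in>B. hol_map_on (\<phi> ` (U \<inter> f -` V)) (\<psi> \<circ> f \<circ> inv_into U \<phi>))"

definition biholo :: "('a, 'm::finite) atlas \<Rightarrow> ('b, 'n::finite) atlas \<Rightarrow> ('a \<Rightarrow> 'b) \<Rightarrow> bool" where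
  "biholo A B f \<longleftrightarrow>
     bij_betw f (pts A) (pts B) \<and> holo_map A B f \<and> holo_map B A (inv_into (pts A) f)"

definition open_embedding :: "('a, 'n::finite) atlas \<Rightarrow> ('b, 'n) atlas \<Rightarrow> ('a \<Rightarrow> 'b) \<Rightarrow> bool" where
  "open_embedding A B f \<longleftrightarrow>
     openin (mtop B) (f ` pts A) \<and> biholo A (open_restrict B (f ` pts A)) f"

definition inj_immersion :: "('a, 'm::finite) atlas \<Rightarrow> ('b, 'n::finite) atlas \<Rightarrow> ('a \<Rightarrow> 'b) \<Rightarrow> bool" where
  "inj_immersion A B f \<longleftrightarrow> holo_map A B f \<and> inj_on f (pts A) \<and>
     (\<forall>(U, \<phi>)\<in>A. \<forall>(V, \<psi>)\<in>B. \<forall>p\<in>U \<inter> f -` V.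
        inj (frechet_derivative (\<psi> \<circ> f \<circ> inv_into U \<phi>) (at (\<phi> p))))"

definition holo_fun :: "('a, 'n::finite) atlas \<Rightarrow> 'a set \<Rightarrow> ('a \<Rightarrow> complex) \<Rightarrow> bool" where
  "holo_fun A W g \<longleftrightarrow> openin (mtop A) W \<and>
     (\<forall>(U, \<phi>)\<in>A. hol_fun_on (\<phi> ` (U \<inter> W)) (g \<circ> inv_into U \<phi>))"

definition holo_curve_at :: "('a, 'n::finite) atlas \<Rightarrow> (complex \<Rightarrow> 'a) \<Rightarrow> complex \<Rightarrow> bool" where
  "holo_curve_at A \<psi> t0 \<longleftrightarrow>
     (\<exists>(U, \<phi>)\<in>A. \<exists>T. open T \<and> t0 \<in> T \<and> \<psi> ` T \<subseteq> U \<and>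
        (\<forall>i. (\<lambda>t. \<phi> (\<psi> t) $ i) holomorphic_on T))"

definition analytic_subset :: "('a, 'n::finite) atlas \<Rightarrow> 'a set \<Rightarrow> bool" where
  "analytic_subset A Z \<longleftrightarrow> Z \<subseteq> pts A \<and>
     (\<forall>p\<in>pts A. \<exists>W F. openin (mtop A) W \<and> p \<in> W \<and> finite F \<and> (\<forall>g\<in>F. holo_fun A W g) \<and>
        Z \<inter> W = {q \<in> W. \<forall>g\<in>F. g q = 0})"

definition affine_space :: "(complex^('n::finite), 'n) atlas" where
  "affine_space = {(UNIV, id)}"

section \<open>Projective spaces, projective and rational surfaces\<close>

text \<open>
  A point of projective space is a line through the origin, represented as a set of vectors
  containing 0. The chart for \<open>(i, \<sigma>)\<close> divides by the \<open>i\<close>-th homogeneous coordinate;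
  \<open>\<sigma>\<close> enumerates the other ones, so that it can exist only if the dimension of the space is
  one less than the number of homogeneous coordinates.
\<close>

definition pline :: "complex^('n::finite) \<Rightarrow> (complex^'n) set" where
  "pline v = range (\<lambda>c. c *s v)"

definition unit_rep :: "'n::finite \<Rightarrow> (complex^'n) set \<Rightarrow> complex^'n" where
  "unit_rep i l = (THE v. v \<in> l \<and> v $ i = 1)"

definition projective_space :: "((complex^('n::finite)) set, 'm::finite) atlas" where
  "projective_space =
     {({pline v | v. v $ i \<noteq> 0}, \<lambda>l. \<chi> k. unit_rep i l $ \<sigma> k)
       | i (\<sigma> :: 'm \<Rightarrow> 'n). bij_betw \<sigma> UNIV (- {i})}"

abbreviation P1 :: "((complex^2) set, 1) atlas" where "P1 \<equiv> projective_space"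
abbreviation P2 :: "((complex^3) set, 2) atlas" where "P2 \<equiv> projective_space"

text \<open>
  An injective holomorphic immersion into \<open>\<P>\<^sup>N\<close>, written in homogeneous coordinates
  \<open>[F p 0 : \<dots> : F p N]\<close>; only the ratios of the \<open>F p i\<close> matter.
  On a compact manifold this is a holomorphic embedding, whose image is algebraic by Chow's theorem.
\<close>

definition projective_embedding ::
  "('a, 'n::finite) atlas \<Rightarrow> nat \<Rightarrow> ('a \<Rightarrow> nat \<Rightarrow> complex) \<Rightarrow> bool" where
  "projective_embedding A N F \<longleftrightarrow>
     (\<forall>p\<in>pts A. \<exists>i\<le>N. F p i \<noteq> 0) \<and>
     (\<forall>i\<le>N. \<forall>k\<le>N. holo_fun A {p \<in> pts A. F p i \<noteq> 0} (\<lambda>p. F p k / F p i)) \<and>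
     (\<forall>p\<in>pts A. \<forall>q\<in>pts A. (\<exists>c. \<forall>i\<le>N. F q i = c * F p i) \<longrightarrow> p = q) \<and>
     (\<forall>(U, \<phi>)\<in>A. \<forall>p\<in>U. \<forall>i\<le>N. F p i \<noteq> 0 \<longrightarrow>
        (\<forall>v. (\<forall>k\<le>N. frechet_derivative
                 (\<lambda>z. F (inv_into U \<phi> z) k / F (inv_into U \<phi> z) i) (at (\<phi> p)) v = 0) \<longrightarrow> v = 0))"

text \<open>
  Bimeromorphic equivalence: a biholomorphism between the complements of nowhere dense analytic
  subsets, the closure of whose graph is analytic. Between projective manifolds this is the same
  as birational equivalence.
\<close>

definition nowhere_dense_analytic :: "('a, 'n::finite) atlas \<Rightarrow> 'a set \<Rightarrow> bool" where
  "nowhere_dense_analytic A Z \<longleftrightarrow>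
     analytic_subset A Z \<and> mtop A closure_of (pts A - Z) = pts A"

definition bimeromorphic :: "('a, 'm::finite) atlas \<Rightarrow> ('b, 'n::finite) atlas \<Rightarrow> bool" where
  "bimeromorphic A B \<longleftrightarrow>
     (\<exists>Z E f. nowhere_dense_analytic A Z \<and> nowhere_dense_analytic B E \<and>
        biholo (open_restrict A (pts A - Z)) (open_restrict B (pts B - E)) f \<and>
        analytic_subset (product_atlas A B)
          (mtop (product_atlas A B) closure_of {(p, f p) | p. p \<in> pts A - Z}))"

definition smooth_projective_rational_surface :: "('a, 2) atlas \<Rightarrow> bool" where
  "smooth_projective_rational_surface S \<longleftrightarrow>
     complex_manifold S \<and> compact_space (mtop S) \<and> connected_space (mtop S) \<and>
     (\<exists>N F. projective_embedding S N F) \<and> bimeromorphic S P2"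

section \<open>Blowing up points\<close>

text \<open>
  The blow-up of the origin of \<open>\<complex>\<^sup>2\<close>: pairs of a point and a line through it and the origin.
  On the chart where the \<open>i\<close>-th coordinate of the line is nonzero, the coordinates are \<open>z\<^sub>i\<close> and
  the slope \<open>z\<^sub>j / z\<^sub>i\<close>.
\<close>

definition blowup_origin :: "((complex^2) \<times> (complex^2) set, 2) atlas" where
  "blowup_origin =
     {({(z, pline v) | z v. v $ i \<noteq> 0 \<and> z \<in> pline v},
       \<lambda>(z, l). vector [z $ i, unit_rep i l $ j]) | i j. i \<noteq> j}"

definition is_blowup ::
  "('a, 2) atlas \<Rightarrow> 'a \<Rightarrow> ('b, 2) atlas \<Rightarrow> ('b \<Rightarrow> 'a) \<Rightarrow> bool" where
  "is_blowup A p A' \<pi> \<longleftrightarrow>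
     complex_manifold A \<and> complex_manifold A' \<and> p \<in> pts A \<and>
     biholo (open_restrict A' (pts A' - \<pi> -` {p})) (open_restrict A (pts A - {p})) \<pi> \<and>
     (\<exists>U \<phi> \<Theta>. openin (mtop A) U \<and> p \<in> U \<and> \<phi> p = 0 \<and>
        biholo (open_restrict A U) (open_restrict affine_space (\<phi> ` U)) \<phi> \<and>
        biholo (open_restrict A' (\<pi> -` U)) (open_restrict blowup_origin {(z, l). z \<in> \<phi> ` U}) \<Theta> \<and>
        (\<forall>q\<in>pts A'. \<pi> q \<in> U \<longrightarrow> fst (\<Theta> q) = \<phi> (\<pi> q)))"

text \<open>
  For maps \<open>\<pi> k : S (k + 1) \<rightarrow> S k\<close>, this is the composite \<open>S (i + m) \<rightarrow> S i\<close>.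
\<close>

primrec contraction :: "(nat \<Rightarrow> 'a \<Rightarrow> 'a) \<Rightarrow> nat \<Rightarrow> nat \<Rightarrow> 'a \<Rightarrow> 'a" where
  "contraction \<pi> i 0 = id"
| "contraction \<pi> i (Suc m) = contraction \<pi> i m \<circ> \<pi> (i + m)"

section \<open>Curves on surfaces and the type of a surface\<close>

definition smooth_rational_curve :: "('a, 2) atlas \<Rightarrow> 'a set \<Rightarrow> bool" where
  "smooth_rational_curve S C \<longleftrightarrow> (\<exists>\<gamma>. inj_immersion P1 S \<gamma> \<and> \<gamma> ` pts P1 = C)"

definition local_equation ::
  "('a, 2) atlas \<Rightarrow> 'a set \<Rightarrow> 'a set \<Rightarrow> ('a \<Rightarrow> complex) \<Rightarrow> bool" where
  "local_equation S D V s \<longleftrightarrow> holo_fun S V s \<and> D \<inter> V = {q \<in> V. s q = 0} \<and>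
     (\<forall>(U, \<phi>)\<in>S. \<forall>q\<in>U \<inter> V \<inter> D.
        frechet_derivative (s \<circ> inv_into U \<phi>) (at (\<phi> q)) \<noteq> (\<lambda>_. 0))"

definition local_parameter :: "('a, 2) atlas \<Rightarrow> 'a set \<Rightarrow> 'a \<Rightarrow> (complex \<Rightarrow> 'a) \<Rightarrow> bool" where
  "local_parameter S C p \<kappa> \<longleftrightarrow> \<kappa> 0 = p \<and>
     (\<exists>(U, \<phi>)\<in>S. \<exists>T. open T \<and> 0 \<in> T \<and> \<kappa> ` T \<subseteq> U \<inter> C \<and>
        (\<forall>i. (\<lambda>z. \<phi> (\<kappa> z) $ i) holomorphic_on T) \<and>
        (\<exists>i. deriv (\<lambda>z. \<phi> (\<kappa> z) $ i) 0 \<noteq> 0))"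

text \<open>
  The intersection number \<open>C \<cdot> D = deg O(D)|\<^sub>C\<close> of smooth compact curves (for \<open>C = D\<close>: the degree of
  the normal bundle). With local equations \<open>s p\<close> of \<open>D\<close> on neighbourhoods \<open>V p\<close> of the points
  \<open>p\<close> of \<open>C\<close>, a meromorphic section of \<open>O(D)|\<^sub>C\<close> is a family of meromorphic functions
  \<open>\<sigma> p\<close> on \<open>C \<inter> V p\<close> with \<open>\<sigma> p / \<sigma> p' = s p / s p'\<close>, and its degree is the sum of its orders,
  measured in local parameters \<open>\<kappa> p\<close> of \<open>C\<close>. The finite set \<open>P\<close> contains all zeros and
  poles; the values of the \<open>\<sigma> p\<close> on \<open>P\<close> are irrelevant.
\<close>

definition has_intersection_number :: "('a, 2) atlas \<Rightarrow> 'a set \<Rightarrow> 'a set \<Rightarrow> int \<Rightarrow> bool" where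
  "has_intersection_number S C D n \<longleftrightarrow>
     (\<exists>P V s \<kappa> \<sigma>. finite P \<and> P \<subseteq> C \<and>
        (\<forall>p\<in>C. p \<in> V p \<and> local_equation S D (V p) (s p) \<and> local_parameter S C p (\<kappa> p) \<and>
           (\<sigma> p \<circ> \<kappa> p) meromorphic_on {0} \<and>
           (p \<notin> P \<longrightarrow> (\<sigma> p \<circ> \<kappa> p) analytic_on {0}) \<and>
           (\<forall>q\<in>V p \<inter> C - P. \<sigma> p q \<noteq> 0)) \<and>
        (\<forall>p\<in>C. \<forall>p'\<in>C. \<exists>g. holo_fun S (V p \<inter> V p') g \<and>
           (\<forall>q\<in>V p \<inter> V p'. s p q = g q * s p' q) \<and>
           (\<forall>q\<in>V p \<inter> V p' \<inter> C - P. \<sigma> p q = g q * \<sigma> p' q)) \<and>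
        n = (\<Sum>p\<in>P. zorder (\<sigma> p \<circ> \<kappa> p) 0))"

text \<open>
  The surface \<open>S\<close>, containing \<open>X\<close> via \<open>\<iota>\<close>, has as type the simple graph with vertex set \<open>I\<close> and
  edge set \<open>E\<close>: vertices joined by a (simple) edge have intersection number 1, all others 0.
\<close>

definition surface_of_type ::
  "('b, 2) atlas \<Rightarrow> ('a, 2) atlas \<Rightarrow> ('a \<Rightarrow> 'b) \<Rightarrow> nat set \<Rightarrow> nat set set \<Rightarrow> bool" where
  "surface_of_type S X \<iota> I E \<longleftrightarrow>
     smooth_projective_rational_surface S \<and> open_embedding X S \<iota> \<and>
     (\<exists>C. inj_on C I \<and> pts S - \<iota> ` pts X = (\<Union>i\<in>I. C i) \<and>
        (\<forall>i\<in>I. smooth_rational_curve S (C i) \<and> has_intersection_number S (C i) (C i) (- 2)) \<and>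
        (\<forall>i\<in>I. \<forall>j\<in>I. i \<noteq> j \<longrightarrow>
           has_intersection_number S (C i) (C j) (if {i, j} \<in> E then 1 else 0) \<and>
           (C i \<inter> C j \<noteq> {} \<longleftrightarrow> {i, j} \<in> E)))"

text \<open>The affine Dynkin diagram \<open>E\<^sub>7\<^sup>(\<^sup>1\<^sup>)\<close>: a chain of seven vertices, with an eighth one at its middle.\<close>

definition E7_vertices :: "nat set" where
  "E7_vertices = {0..7}"

definition E7_edges :: "nat set set" where
  "E7_edges = {{0, 1}, {1, 2}, {2, 3}, {3, 4}, {4, 5}, {5, 6}, {3, 7}}"

section \<open>Gluing along birational maps\<close>

definition poly_fun :: "(complex^2 \<Rightarrow> complex) \<Rightarrow> bool" where
  "poly_fun P \<longleftrightarrow> (\<exists>(n::nat) c. \<forall>v. P v = (\<Sum>a\<le>n. \<Sum>b\<le>n. c a b * (v $ 1) ^ a * (v $ 2) ^ b))"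

text \<open>
  Let \<open>R\<close> be the graph of a birational map of \<open>\<complex>\<^sup>2\<close> on a dense set of arguments. The map is regular
  at \<open>v\<close> with value \<open>w\<close> if its components are quotients of polynomials whose denominators do not
  vanish at \<open>v\<close>.
\<close>

definition regular_with_value :: "((complex^2) \<times> (complex^2)) set \<Rightarrow> complex^2 \<Rightarrow> complex^2 \<Rightarrow> bool" where
  "regular_with_value R v w \<longleftrightarrow>
     (\<exists>N D. (\<forall>i::2. poly_fun (N i) \<and> poly_fun (D i) \<and> D i v \<noteq> 0 \<and> w $ i = N i v / D i v) \<and>
        (\<forall>(a, b)\<in>R. \<forall>i. D i a \<noteq> 0 \<longrightarrow> b $ i = N i a / D i a))"

text \<open>
  Chart \<open>j\<close> has coordinates \<open>(x\<^sub>j, y\<^sub>j) = c j (x, y)\<close>, the formulas being defined for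
  \<open>(x, y)\<close> in \<open>\<Omega> j\<close>. The birational transformation from chart \<open>j\<close> to chart \<open>k\<close> is
  \<open>c k \<circ> (c j)\<^sup>-\<^sup>1\<close>.
\<close>

definition transition_graph ::
  "(nat \<Rightarrow> (complex^2) set) \<Rightarrow> (nat \<Rightarrow> complex^2 \<Rightarrow> complex^2) \<Rightarrow> nat \<Rightarrow> nat \<Rightarrow>
   ((complex^2) \<times> (complex^2)) set" where
  "transition_graph \<Omega> c j k = {(c j u, c k u) | u. u \<in> \<Omega> j \<inter> \<Omega> k}"

definition xy :: "complex^3 \<Rightarrow> complex^2" where
  "xy v = vector [v $ 1, v $ 2]"

text \<open>
  The pair \<open>(j, v)\<close> is the point \<open>v = (x\<^sub>j, y\<^sub>j, t)\<close> of the \<open>j\<close>-th copy of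
  \<open>\<complex>\<^sup>2 \<times> \<complex>\<close>; points with equal \<open>t\<close> are identified where the transition is biregular.
\<close>

type_synonym glue_point = "(nat \<times> (complex^3)) set"

definition glue_rel ::
  "nat set \<Rightarrow> (nat \<Rightarrow> (complex^2) set) \<Rightarrow> (nat \<Rightarrow> complex^2 \<Rightarrow> complex^2) \<Rightarrow>
   ((nat \<times> (complex^3)) \<times> (nat \<times> (complex^3))) set" where
  "glue_rel J \<Omega> c =
     {((j, v), (k, w)). j \<in> J \<and> k \<in> J \<and> v $ 3 = w $ 3 \<and>
        regular_with_value (transition_graph \<Omega> c j k) (xy v) (xy w) \<and>
        regular_with_value (transition_graph \<Omega> c k j) (xy w) (xy v)}"

definition glue_class ::
  "nat set \<Rightarrow> (nat \<Rightarrow> (complex^2) set) \<Rightarrow> (nat \<Rightarrow> complex^2 \<Rightarrow> complex^2) \<Rightarrow>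
   nat \<Rightarrow> complex^3 \<Rightarrow> glue_point" where
  "glue_class J \<Omega> c j v = glue_rel J \<Omega> c `` {(j, v)}"

definition glued_atlas ::
  "nat set \<Rightarrow> (nat \<Rightarrow> (complex^2) set) \<Rightarrow> (nat \<Rightarrow> complex^2 \<Rightarrow> complex^2) \<Rightarrow>
   (glue_point, 3) atlas" where
  "glued_atlas J \<Omega> c =
     (\<lambda>j. (range (glue_class J \<Omega> c j), inv (glue_class J \<Omega> c j))) ` J"

definition time_of :: "glue_point \<Rightarrow> complex" where
  "time_of p = (THE t. \<exists>j v. (j, v) \<in> p \<and> v $ 3 = t)"

definition fibre :: "(glue_point, 3) atlas \<Rightarrow> complex \<Rightarrow> (glue_point, 2) atlas" where
  "fibre X t = (\<lambda>(U, \<phi>). ({p \<in> U. time_of p = t}, \<lambda>p. xy (\<phi> p))) ` X"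

section \<open>Phase spaces\<close>

definition solves :: "(complex \<Rightarrow> complex^2 \<Rightarrow> complex^2) \<Rightarrow> complex set \<Rightarrow> (complex \<Rightarrow> complex^2) \<Rightarrow> bool" where
  "solves f T u \<longleftrightarrow>
     (\<forall>t\<in>T. \<forall>i. ((\<lambda>s. u s $ i) has_field_derivative f t (u t) $ i) (at t))"

definition poly_rhs :: "(complex \<Rightarrow> complex^2 \<Rightarrow> complex^2) \<Rightarrow> bool" where
  "poly_rhs g \<longleftrightarrow>
     (\<forall>i. \<exists>(n::nat) c. (\<forall>a b. c a b holomorphic_on UNIV) \<and>
        (\<forall>t v. g t v $ i = (\<Sum>a\<le>n. \<Sum>b\<le>n. c a b t * (v $ 1) ^ a * (v $ 2) ^ b)))"

text \<open>
  The original variables \<open>(x, y)\<close> are required to be the coordinates of chart 0. The time function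
  is the third coordinate of every chart, hence a holomorphic submersion onto \<open>\<complex>\<close>. In the
  last condition only the values of \<open>u\<close> and \<open>\<psi>\<close> at times close to but different from \<open>t0\<close>
  are compared, so \<open>u\<close> may have a pole at \<open>t0\<close>.
\<close>

definition phase_space ::
  "(complex \<Rightarrow> complex^2 \<Rightarrow> complex^2) \<Rightarrow> nat set \<Rightarrow> (nat \<Rightarrow> (complex^2) set) \<Rightarrow>
   (nat \<Rightarrow> complex^2 \<Rightarrow> complex^2) \<Rightarrow> bool" where
  "phase_space f J \<Omega> c \<longleftrightarrow>
     0 \<in> J \<and> \<Omega> 0 = UNIV \<and> c 0 = id \<and>
     equiv (J \<times> UNIV) (glue_rel J \<Omega> c) \<and>
     complex_manifold (glued_atlas J \<Omega> c) \<and>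
     (\<forall>(U, \<phi>)\<in>glued_atlas J \<Omega> c. \<forall>p\<in>U. \<phi> p $ 3 = time_of p) \<and>
     time_of ` pts (glued_atlas J \<Omega> c) = UNIV \<and>
     (\<forall>j\<in>J. \<exists>g. poly_rhs g \<and>
        (\<forall>T u. open T \<and> u ` T \<subseteq> \<Omega> j \<longrightarrow> (solves f T u \<longleftrightarrow> solves g T (c j \<circ> u)))) \<and>
     (\<forall>t0 u. (\<forall>i. (\<lambda>t. u t $ i) meromorphic_on {t0}) \<and> (\<forall>\<^sub>F t in at t0. solves f {t} u) \<longrightarrow>
        (\<exists>\<psi>. holo_curve_at (glued_atlas J \<Omega> c) \<psi> t0 \<and>
           (\<forall>\<^sub>F t in at t0. \<psi> t = glue_class J \<Omega> c 0 (vector [u t $ 1, u t $ 2, t]))))"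

section \<open>The system and its charts\<close>

definition rhs :: "complex \<Rightarrow> complex^2 \<Rightarrow> complex^2" where
  "rhs t v = (let x = v $ 1; y = v $ 2 in vector [x * y, 2 * x ^ 2 - y ^ 2])"

definition chart_coord :: "nat \<Rightarrow> complex^2 \<Rightarrow> complex^2" where
  "chart_coord j v = (let x = v $ 1; y = v $ 2 in
     if j = 0 then vector [x, y]
     else if j = 1 then vector [x * y, 1 / y]
     else if j = 2 then vector [x * y ^ 3 - y ^ 4, 1 / y]
     else vector [x * y ^ 3 + y ^ 4, 1 / y])"

definition chart_dom :: "nat \<Rightarrow> (complex^2) set" where
  "chart_dom j = (if j = 0 then UNIV else {v. v $ 2 \<noteq> 0})"

definition phase_atlas :: "(glue_point, 3) atlas" where
  "phase_atlas = glued_atlas {0, 1, 2, 3} chart_dom chart_coord"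

text \<open>
  A carrier type large enough for the points of iterated blow-ups of the projective plane: a point
  of the plane together with a list of directions.
\<close>

type_synonym surface_point = "(complex^3) set \<times> (complex^2) set list"

end

(*
  In the coordinates u = x/y, v = 1/y at infinity the system has three points on the line v = 0 where it has
  to be blown up: u = 0 twice, u = 1 and u = -1 four times each, always at the point which the proper
  transforms of the solution curves pass through. Charts of the blown-up planes are written down
  explicitly; the fibres of the phase space are embedded by (x_j, y_j) into the last of them, so that the
  gluing relation, the Hausdorff property and the type can all be read off from this compact surface.
  The complement consists of the line at infinity and seven exceptional curves.
  A pole of a solution has order 1 in y = x'/x, and comparing leading terms leaves x of order 0, 1 or -1;
  in the last case w = x - a y, with a = 1 or -1, satisfies a linear equation that forces w to vanish to third order.
*)
theory Submission
  imports Defs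
begin

section \<open>Complex differentiability in several variables\<close>

text \<open>The numbers 2, 4, 4 are orders of contact: along a solution with a pole that passes into
  the tower over a, x/y - a vanishes to at least that order in 1/y. The last exceptional curve of
  each tower is crossed by solutions and stays in the phase space, apart from its point on the
  preceding curve. The curves before it remain in the boundary and form arms of 1, 3 and 3 vertices.
  The first blow-ups over the three points lower the self-intersection of the line at infinity from
  1 to -2, so this line becomes the branching vertex. The obstacle is separation: charts alone show
  neither that distinct points have disjoint neighbourhoods nor that the surface is projective. Both
  come from explicit maps to the projective plane, one for each blow-up, which tell the curves of a
  tower apart; their Segre product is an embedding. Chart changes are handled through one relation:
  a parametrisation factors locally through another one by a holomorphic substitution.\<close>

definition cdiff :: "(complex^('n::finite) \<Rightarrow> complex) \<Rightarrow> complex^'n \<Rightarrow> bool" where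
  "cdiff f x \<longleftrightarrow> (\<exists>D. (f has_derivative D) (at x) \<and> (\<forall>c v. D (c *s v) = c * D v))"

definition cdv :: "(complex^('m::finite) \<Rightarrow> complex^('n::finite)) \<Rightarrow> complex^'m \<Rightarrow> bool" where
  "cdv f x \<longleftrightarrow> (\<forall>i. cdiff (\<lambda>y. f y $ i) x)"

text \<open>The notions of the statement bundle openness with differentiability. Split off, the
  pointwise part obeys the usual rules for sums, products and compositions.\<close>

lemma hol_fun_on_iff: "hol_fun_on W f \<longleftrightarrow> open W \<and> (\<forall>x\<in>W. cdiff f x)"
  by (simp add: hol_fun_on_def cdiff_def)

lemma hol_map_on_iff: "hol_map_on W f \<longleftrightarrow> open W \<and> (\<forall>x\<in>W. cdv f x)"
  by (auto simp: hol_map_on_def cdv_def hol_fun_on_iff)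

lemma cdiff_const: "cdiff (\<lambda>_. c) x"
  unfolding cdiff_def by (rule exI[of _ "\<lambda>_. 0"]) auto

lemma cdiff_nth: "cdiff (\<lambda>y. y $ i) x"
  unfolding cdiff_def
  by (rule exI[of _ "\<lambda>y. y $ i"]) (auto intro: bounded_linear_imp_has_derivative)

lemma cdiff_add: "cdiff f x ==> cdiff g x ==> cdiff (\<lambda>y. f y + g y) x"
  unfolding cdiff_def by clarify (rule exI, rule conjI, erule (1) has_derivative_add, simp add: algebra_simps)

lemma cdiff_diff: "cdiff f x ==> cdiff g x ==> cdiff (\<lambda>y. f y - g y) x"
  unfolding cdiff_def by clarify (rule exI, rule conjI, erule (1) has_derivative_diff, simp add: algebra_simps)

lemma cdiff_mult: "cdiff f x ==> cdiff g x ==> cdiff (\<lambda>y. f y * g y) x"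
  unfolding cdiff_def by clarify (rule exI, rule conjI, erule (1) has_derivative_mult, simp add: algebra_simps)

lemma cdiff_field:
  assumes "g field_differentiable (at (f x))" "cdiff f x"
  shows "cdiff (\<lambda>y. g (f y)) x"
proof -
  obtain g' where g: "(g has_field_derivative g') (at (f x))"
    using assms(1) by (auto simp: field_differentiable_def)
  obtain D where D: "(f has_derivative D) (at x)" "\<And>c v. D (c *s v) = c * D v"
    using assms(2) by (auto simp: cdiff_def)
  have "((\<lambda>y. g (f y)) has_derivative (\<lambda>v. g' * D v)) (at x)"
    using has_derivative_compose[OF D(1) g[unfolded has_field_derivative_def]] .
  then show ?thesis unfolding cdiff_def
    by (intro exI[of _ "\<lambda>v. g' * D v"]) (auto simp: D(2))
qed

lemma cdiff_minus: "cdiff f x ==> cdiff (\<lambda>y. - f y) x"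
  using cdiff_diff[OF cdiff_const[of 0]] by simp

lemma cdiff_power: "cdiff f x ==> cdiff (\<lambda>y. f y ^ n) x"
  by (rule cdiff_field[where g="\<lambda>z. z ^ n"])
    (auto intro!: derivative_eq_intros simp: field_differentiable_def)

lemma cdiff_inverse: "cdiff f x ==> f x \<noteq> 0 ==> cdiff (\<lambda>y. inverse (f y)) x"
  by (rule cdiff_field[where g="inverse"])
    (auto intro!: derivative_eq_intros simp: field_differentiable_def)

lemma cdiff_divide: "cdiff f x ==> cdiff g x ==> g x \<noteq> 0 ==> cdiff (\<lambda>y. f y / g y) x"
  using cdiff_mult[OF _ cdiff_inverse] by (simp add: divide_inverse)

lemma cdv_nth: "cdv f x ==> cdiff (\<lambda>y. f y $ i) x"
  by (simp add: cdv_def)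

lemma cdv_lambda: "(\<And>i. cdiff (f i) x) ==> cdv (\<lambda>y. \<chi> i. f i y) x"
  by (simp add: cdv_def)

lemma cdv_ident: "cdv (\<lambda>y. y) x"
  by (simp add: cdv_def cdiff_nth)

lemma cdv_vector2: "cdiff f x ==> cdiff g x ==> cdv (\<lambda>y. vector [f y, g y] :: complex^2) x"
  by (simp add: cdv_def forall_2)

lemma cdv_vector3: "cdiff f x ==> cdiff g x ==> cdiff h x ==>
    cdv (\<lambda>y. vector [f y, g y, h y] :: complex^3) x"
  by (simp add: cdv_def forall_3)

lemmas cd = cdiff_const cdiff_nth cdiff_add cdiff_diff cdiff_mult cdiff_minus cdiff_power
  cdv_ident cdv_vector2 cdv_vector3

lemma cdv_has_derivative:
  fixes f :: "complex^('m::finite) \<Rightarrow> complex^('n::finite)"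
  assumes "cdv f x"
  obtains D where "(f has_derivative D) (at x)" "\<And>c v. D (c *s v) = c *s D v"
proof -
  obtain D where D: "\<And>i. ((\<lambda>y. f y $ i) has_derivative D i) (at x)"
      "\<And>i c v. D i (c *s v) = c * D i v"
    using assms unfolding cdv_def cdiff_def by meson
  have "(f has_derivative (\<lambda>v. \<chi> i. D i v)) (at x)"
  proof (subst has_derivative_componentwise_within, intro ballI)
    fix b :: "complex^'n" assume "b \<in> Basis"
    then obtain i u where b: "b = axis i u" by (auto simp: Basis_vec_def)
    show "((\<lambda>x. f x \<bullet> b) has_derivative (\<lambda>v. (\<chi> i. D i v) \<bullet> b)) (at x)"
      unfolding b inner_axis by (simp, rule has_derivative_inner_left, rule D(1))
  qed
  moreover have "(\<chi> i. D i (c *s v)) = c *s (\<chi> i. D i v)" for c v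
    by (simp add: D(2) vec_eq_iff)
  ultimately show thesis using that by blast
qed

lemma cdv_isCont: "cdv f x ==> isCont f x"
  by (metis cdv_has_derivative has_derivative_continuous)

lemma cdiff_isCont: "cdiff f x ==> isCont f x"
  unfolding cdiff_def using has_derivative_continuous by blast

lemma cdiff_compose:
  assumes "cdv f x" "cdiff g (f x)"
  shows "cdiff (\<lambda>y. g (f y)) x"
proof -
  obtain D where D: "(f has_derivative D) (at x)" "\<And>c v. D (c *s v) = c *s D v"
    using cdv_has_derivative[OF assms(1)] by blast
  obtain E where E: "(g has_derivative E) (at (f x))" "\<And>c v. E (c *s v) = c * E v"
    using assms(2) by (auto simp: cdiff_def)
  show ?thesis unfolding cdiff_def
    using has_derivative_compose[OF D(1) E(1)] D(2) E(2)
    by (intro exI[of _ "\<lambda>v. E (D v)"]) auto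
qed

lemma cdv_compose: "cdv f x ==> cdv g (f x) ==> cdv (\<lambda>y. g (f y)) x"
  unfolding cdv_def[of g] cdv_def[of "\<lambda>y. g (f y)"] using cdiff_compose by blast

lemma cdiff_cong:
  assumes "cdiff f x" "open W" "x \<in> W" "\<And>y. y \<in> W ==> f y = g y"
  shows "cdiff g x"
  using assms unfolding cdiff_def by (metis has_derivative_transform_within_open)

lemma cdv_cong:
  assumes "cdv f x" "open W" "x \<in> W" "\<And>y. y \<in> W ==> f y = g y"
  shows "cdv g x"
  unfolding cdv_def
proof
  fix i show "cdiff (\<lambda>y. g y $ i) x"
    by (rule cdiff_cong[OF cdv_nth[OF assms(1)] assms(2,3)]) (simp add: assms(4))
qed

lemma cdv_open_vimage:
  assumes "open W" "\<And>y. y \<in> W ==> cdv f y" "open V"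
  shows "open {y \<in> W. f y \<in> V}"
proof -
  have "continuous_on W f"
    using assms(2) cdv_isCont continuous_at_imp_continuous_on by blast
  from continuous_open_preimage[OF this assms(1,3)] show ?thesis
    by (simp add: vimage_def Int_def)
qed

lemma cdiff_frechet: "cdiff f x ==> (f has_derivative frechet_derivative f (at x)) (at x)"
  unfolding cdiff_def using frechet_derivative_at by metis

text \<open>The chain rule for the two conditions phrased with \<open>frechet_derivative\<close>:
  immersions and nonvanishing differentials of local equations. Agreement with the composite near x
  suffices, as chart changes are known only locally.\<close>

lemma frechet_cdiff_compose:
  assumes "cdv \<tau> x" "cdiff g (\<tau> x)" "open W" "x \<in> W" "\<And>y. y \<in> W ==> f y = g (\<tau> y)"
  shows "frechet_derivative f (at x) = frechet_derivative g (at (\<tau> x)) \<circ> frechet_derivative \<tau> (at x)"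
proof -
  obtain D where D: "(\<tau> has_derivative D) (at x)"
    by (rule cdv_has_derivative[OF assms(1)])
  have "((\<lambda>y. g (\<tau> y)) has_derivative (\<lambda>v. frechet_derivative g (at (\<tau> x)) (D v))) (at x)"
    by (rule has_derivative_compose[OF D cdiff_frechet[OF assms(2)]])
  then have "(f has_derivative (\<lambda>v. frechet_derivative g (at (\<tau> x)) (D v))) (at x)"
    by (rule has_derivative_transform_within_open[OF _ assms(3,4)]) (simp add: assms(5))
  from frechet_derivative_at[OF this] show ?thesis
    using frechet_derivative_at[OF D] by (simp add: fun_eq_iff)
qed

text \<open>Along the diagonal direction each coordinate vanishes for at most one real parameter.
  This is what makes sets cut out by monomials nowhere dense.\<close>

lemma open_generic:
  fixes z :: "complex^2"
  assumes "open W" "z \<in> W"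
  obtains y where "y \<in> W" "y $ 1 \<noteq> 0" "y $ 2 \<noteq> 0"
proof -
  let ?f = "\<lambda>e::real. z + of_real e *s vector [1, 1]"
  have "((\<lambda>e. ?f e) \<longlongrightarrow> z) (at 0)"
    by (rule vec_tendstoI) (auto intro!: tendsto_eq_intros)
  then have "\<forall>\<^sub>F e in at 0. ?f e \<in> W"
    using assms topological_tendstoD by blast
  moreover have "\<forall>\<^sub>F e in at (0::real). ?f e $ 1 \<noteq> 0"
  proof -
    have "\<forall>\<^sub>F e in at (0::real). e \<noteq> - Re (z $ 1)"
      by (rule eventually_neq_at_within)
    then show ?thesis
      by (rule eventually_mono) (auto simp: complex_eq_iff add_eq_0_iff)
  qed
  moreover have "\<forall>\<^sub>F e in at (0::real). ?f e $ 2 \<noteq> 0"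
  proof -
    have "\<forall>\<^sub>F e in at (0::real). e \<noteq> - Re (z $ 2)"
      by (rule eventually_neq_at_within)
    then show ?thesis
      by (rule eventually_mono) (auto simp: complex_eq_iff add_eq_0_iff)
  qed
  ultimately have "\<forall>\<^sub>F e in at (0::real). ?f e \<in> W \<and> ?f e $ 1 \<noteq> 0 \<and> ?f e $ 2 \<noteq> 0"
    by eventually_elim auto
  then obtain e where "?f e \<in> W \<and> ?f e $ 1 \<noteq> 0 \<and> ?f e $ 2 \<noteq> 0"
    using eventually_happens'[OF at_neq_bot] by blast
  then show thesis using that by blast
qed

section \<open>Atlases through local parametrisations\<close>

text \<open>\<^term>\<open>fac P z Q V\<close>: near \<^term>\<open>z\<close>, \<^term>\<open>P\<close> is \<^term>\<open>Q\<close> after a holomorphic map into \<^term>\<open>V\<close>.\<close>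

definition fac :: "(complex^('m::finite) \<Rightarrow> 'a) \<Rightarrow> complex^'m \<Rightarrow> (complex^('n::finite) \<Rightarrow> 'a) \<Rightarrow>
    (complex^'n) set \<Rightarrow> bool" where
  "fac P z Q V \<longleftrightarrow> (\<exists>W \<tau>. open W \<and> z \<in> W \<and> (\<forall>y\<in>W. \<tau> y \<in> V \<and> P y = Q (\<tau> y) \<and> cdv \<tau> y))"

lemma facI:
  "open W ==> z \<in> W ==> (\<And>y. y \<in> W ==> \<tau> y \<in> V) ==> (\<And>y. y \<in> W ==> P y = Q (\<tau> y)) ==>
   (\<And>y. y \<in> W ==> cdv \<tau> y) ==> fac P z Q V"
  unfolding fac_def by blast

lemma facD: "fac P z Q V ==> P z \<in> Q ` V"
  unfolding fac_def by (elim exE conjE) (simp add: image_iff, blast)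

lemma fac_refl: "open V ==> z \<in> V ==> fac P z P V"
  by (rule facI[of V _ "\<lambda>y. y"]) (auto intro: cd)

lemma fac_map: "fac P z Q V ==> fac (\<lambda>y. f (P y)) z (\<lambda>y. f (Q y)) V"
  unfolding fac_def by metis

text \<open>The map f is carried along so that the same rule composes chart changes and computes
  maps in charts. The second factorisation is demanded at every preimage under Q, since Q need not
  be injective.\<close>

lemma fac_trans:
  assumes "fac P z Q V" "\<And>z'. z' \<in> V ==> Q z' = P z ==> fac (\<lambda>y. f (Q y)) z' R V'"
  shows "fac (\<lambda>y. f (P y)) z R V'"
proof -
  obtain W \<tau> where W: "open W" "z \<in> W" "\<And>y. y \<in> W ==> \<tau> y \<in> V \<and> P y = Q (\<tau> y) \<and> cdv \<tau> y"
    using assms(1) unfolding fac_def by blast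
  have "fac (\<lambda>y. f (Q y)) (\<tau> z) R V'"
    by (rule assms(2)) (use W(3)[OF W(2)] in simp_all)
  then obtain W' \<tau>' where W': "open W'" "\<tau> z \<in> W'"
    "\<And>y. y \<in> W' ==> \<tau>' y \<in> V' \<and> f (Q y) = R (\<tau>' y) \<and> cdv \<tau>' y"
    unfolding fac_def by blast
  show ?thesis
    by (rule facI[of "{y \<in> W. \<tau> y \<in> W'}" _ "\<lambda>y. \<tau>' (\<tau> y)"])
      (use W W' cdv_open_vimage[OF W(1) _ W'(1), of \<tau>] in "auto intro: cdv_compose")
qed

lemma fac_trans_inj:
  assumes "fac P z Q V" "inj_on Q V" "z' \<in> V" "Q z' = P z" "fac (\<lambda>y. f (Q y)) z' R V'"
  shows "fac (\<lambda>y. f (P y)) z R V'"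
proof (rule fac_trans[OF assms(1)])
  fix z'' assume "z'' \<in> V" "Q z'' = P z"
  then have "z'' = z'" using inj_onD[OF assms(2)] assms(3,4) by simp
  then show "fac (\<lambda>y. f (Q y)) z'' R V'" using assms(5) by simp
qed

lemmas fac_trans_id = fac_trans_inj[where f="\<lambda>x. x"]

lemma cdiff_fac:
  assumes "fac P z Q V" "\<And>z'. z' \<in> V ==> Q z' = P z ==> cdiff (\<lambda>y. g (Q y)) z'"
  shows "cdiff (\<lambda>y. g (P y)) z"
proof -
  obtain W \<tau> where W: "open W" "z \<in> W" "\<And>y. y \<in> W ==> \<tau> y \<in> V \<and> P y = Q (\<tau> y) \<and> cdv \<tau> y"
    using assms(1) unfolding fac_def by blast
  have "cdiff (\<lambda>y. g (Q (\<tau> y))) z"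
    by (rule cdiff_compose[OF _ assms(2)]) (use W(3)[OF W(2)] in simp_all)
  then show ?thesis
    by (rule cdiff_cong[OF _ W(1,2)]) (use W in auto)
qed

text \<open>A local inverse of an actual member of the atlas. The topology and the notions of
  holomorphy refer to these members only, so every argument eventually descends to them.\<close>

definition lpar :: "('a, 'n::finite) atlas \<Rightarrow> (complex^'n) set \<Rightarrow> (complex^'n \<Rightarrow> 'a) \<Rightarrow> bool" where
  "lpar A V P \<longleftrightarrow> open V \<and> (\<exists>(U, \<phi>)\<in>A. P ` V \<subseteq> U \<and> (\<forall>z\<in>V. \<phi> (P z) = z))"

text \<open>The members of the maximal atlas containing \<^term>\<open>A\<close>, as parametrisations.\<close>

definition par :: "('a, 'n::finite) atlas \<Rightarrow> (complex^'n) set \<Rightarrow> (complex^'n \<Rightarrow> 'a) \<Rightarrow> bool" where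
  "par A V P \<longleftrightarrow> open V \<and> inj_on P V \<and>
     (\<forall>z\<in>V. \<exists>V' Q z'. lpar A V' Q \<and> z' \<in> V' \<and> Q z' = P z \<and> fac P z Q V' \<and> fac Q z' P V)"

lemma is_atlas_inj: "is_atlas A ==> (U, \<phi>) \<in> A ==> inj_on \<phi> U"
  by (auto simp: is_atlas_def)

lemma lpar_inj: "lpar A V P ==> inj_on P V"
  by (auto simp: lpar_def inj_on_def) metis

lemma lpar_pts: "lpar A V P ==> z \<in> V ==> P z \<in> pts A"
  by (auto simp: lpar_def pts_def)

text \<open>The required substitution is the transition map of the two charts.\<close>

lemma atlas_fac_lpar:
  assumes A: "is_atlas A" and P: "lpar A V P" and Q: "lpar A V' Q"
    and z: "z \<in> V" "z' \<in> V'" "P z = Q z'"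
  shows "fac P z Q V'"
proof -
  obtain U \<phi> where U: "(U, \<phi>) \<in> A" "P ` V \<subseteq> U" "\<And>z. z \<in> V ==> \<phi> (P z) = z" "open V"
    using P unfolding lpar_def by blast
  obtain U' \<phi>' where U': "(U', \<phi>') \<in> A" "Q ` V' \<subseteq> U'" "\<And>z. z \<in> V' ==> \<phi>' (Q z) = z" "open V'"
    using Q unfolding lpar_def by blast
  let ?\<tau> = "\<phi>' \<circ> inv_into U \<phi>" and ?W = "\<phi> ` (U \<inter> U')"
  have inj: "inj_on \<phi> U" "inj_on \<phi>' U'"
    using A U(1) U'(1) is_atlas_inj by blast+
  have hol: "open ?W" "\<And>y. y \<in> ?W ==> cdv ?\<tau> y"
    using A U(1) U'(1) unfolding is_atlas_def hol_map_on_iff by fast+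
  have inv: "inv_into U \<phi> y = P y" if "y \<in> V" for y
    using that U inj by (metis image_subset_iff inv_into_f_f)
  let ?X = "{y \<in> V \<inter> ?W. ?\<tau> y \<in> V'}"
  show ?thesis
  proof (rule facI[of ?X _ ?\<tau>])
    show "open ?X" by (rule cdv_open_vimage) (use hol U U' in "auto simp del: o_apply")
    have "P z \<in> U \<inter> U'" using z U U' by force
    then have "z \<in> ?W" using U(3) z(1) by (metis imageI)
    then show "z \<in> ?X" using z by (auto simp: inv U'(3))
    fix y assume y: "y \<in> ?X"
    then have yV: "y \<in> V" "y \<in> ?W" "?\<tau> y \<in> V'" by auto
    then obtain q where q: "q \<in> U" "q \<in> U'" "y = \<phi> q" by blast
    have PyU: "P y \<in> U" using U(2) yV(1) by blast
    have "\<phi> (P y) = \<phi> q" using U(3)[OF yV(1)] q by simp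
    then have "P y = q" using inj_onD[OF inj(1)] PyU q(1) by blast
    then have Py: "P y \<in> U'" using q by simp
    have QU: "Q (?\<tau> y) \<in> U'" using U'(2) yV(3) by blast
    have "\<phi>' (Q (?\<tau> y)) = \<phi>' (P y)" using U'(3)[OF yV(3)] inv[OF yV(1)] by simp
    then show "P y = Q (?\<tau> y)"
      using inj_onD[OF inj(2) _ QU Py] by simp
  qed (use hol in "auto simp del: o_apply")
qed

lemma lpar_par: "lpar A V P ==> par A V P"
proof -
  assume "lpar A V P"
  then have "open V" "\<And>z. z \<in> V ==> fac P z P V" by (auto simp: lpar_def intro: fac_refl)
  with \<open>lpar A V P\<close> show ?thesis unfolding par_def using lpar_inj by blast
qed

lemma par_open: "par A V P ==> open V"
  and par_inj: "par A V P ==> inj_on P V"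
  by (auto simp: par_def)

lemma par_pts: "par A V P ==> z \<in> V ==> P z \<in> pts A"
  unfolding par_def by (metis lpar_pts)

text \<open>Both sides are routed through actual charts. In this form the compatibility of the atlas
  is used from here on.\<close>

lemma par_fac:
  assumes A: "is_atlas A" and P: "par A V P" and Q: "par A V' Q"
    and z: "z \<in> V" "z' \<in> V'" "P z = Q z'"
  shows "fac P z Q V'"
proof -
  obtain V1 P1' z1 where 1: "lpar A V1 P1'" "z1 \<in> V1" "P1' z1 = P z" "fac P z P1' V1"
    using P z(1) unfolding par_def by meson
  obtain V2 P2' z2 where 2: "lpar A V2 P2'" "z2 \<in> V2" "P2' z2 = Q z'" "fac P2' z2 Q V'"
    using Q z(2) unfolding par_def by meson
  have "fac P1' z1 P2' V2" using atlas_fac_lpar[OF A 1(1) 2(1) 1(2) 2(2)] 1 2 z by simp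
  then have 3: "fac P1' z1 Q V'"
    by (rule fac_trans_id[OF _ lpar_inj[OF 2(1)] 2(2) _ 2(4)]) (use 1 2 z in simp)
  show ?thesis
    by (rule fac_trans_id[OF 1(4) lpar_inj[OF 1(1)] 1(2,3) 3])
qed

lemma par_subset:
  assumes "par A V P" "open W" "W \<subseteq> V"
  shows "par A W P"
  unfolding par_def
proof (intro conjI ballI)
  show "open W" "inj_on P W" using assms(2) inj_on_subset[OF par_inj[OF assms(1)] assms(3)] by auto
  fix z assume z: "z \<in> W"
  then obtain V' Q z' where 1: "lpar A V' Q" "z' \<in> V'" "Q z' = P z" "fac P z Q V'" "fac Q z' P V"
    using assms(1) subsetD[OF assms(3) z] unfolding par_def by meson
  have "fac Q z' P W"
    by (rule fac_trans_id[OF 1(5) par_inj[OF assms(1)] _ 1(3)[symmetric] fac_refl])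
      (use assms z in auto)
  with 1 show "\<exists>V' Q z'. lpar A V' Q \<and> z' \<in> V' \<and> Q z' = P z \<and> fac P z Q V' \<and> fac Q z' P W"
    by (intro exI conjI)
qed

lemma par_reparam:
  assumes "par A V P" "open W" "\<And>y. y \<in> W ==> \<tau> y \<in> V" "\<And>y. y \<in> W ==> cdv \<tau> y"
    "\<And>y. cdv \<tau>' y" "\<And>y. \<tau>' (\<tau> y) = y" "\<And>y. \<tau> (\<tau>' y) = y"
  shows "par A W (\<lambda>y. P (\<tau> y))"
  unfolding par_def
proof (intro conjI ballI)
  show "open W" by fact
  show "inj_on (\<lambda>y. P (\<tau> y)) W"
  proof (rule inj_onI)
    fix x y assume xy: "x \<in> W" "y \<in> W" "P (\<tau> x) = P (\<tau> y)"
    then have "\<tau> x = \<tau> y" using inj_onD[OF par_inj[OF assms(1)]] assms(3) by blast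
    then show "x = y" using assms(6) by metis
  qed
  fix z assume z: "z \<in> W"
  obtain V' Q z' where 1: "lpar A V' Q" "z' \<in> V'" "Q z' = P (\<tau> z)" "fac P (\<tau> z) Q V'" "fac Q z' P V"
    using assms(1) assms(3)[OF z] unfolding par_def by meson
  have 2: "fac (\<lambda>y. P (\<tau> y)) z P V"
    by (rule facI[of W _ \<tau>]) (use assms z in auto)
  have "fac (\<lambda>y. P (\<tau> y)) z Q V'"
    by (rule fac_trans_id[OF 2 par_inj[OF assms(1)] assms(3)[OF z] refl 1(4)])
  moreover have "fac Q z' (\<lambda>y. P (\<tau> y)) W"
  proof (rule fac_trans_id[OF 1(5) par_inj[OF assms(1)] assms(3)[OF z] 1(3)[symmetric]])
    show "fac P (\<tau> z) (\<lambda>y. P (\<tau> y)) W"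
      by (rule facI[of "{y \<in> UNIV. \<tau>' y \<in> W}" _ \<tau>'])
        (use assms z cdv_open_vimage[of UNIV \<tau>' W] in auto)
  qed
  ultimately show "\<exists>V' Q z'. lpar A V' Q \<and> z' \<in> V' \<and> Q z' = P (\<tau> z) \<and>
      fac (\<lambda>y. P (\<tau> y)) z Q V' \<and> fac Q z' (\<lambda>y. P (\<tau> y)) W"
    using 1 by (intro exI conjI)
qed

lemma chart_lpar:
  assumes "is_atlas A" "(U, \<phi>) \<in> A"
  shows "lpar A (\<phi> ` U) (inv_into U \<phi>)"
proof -
  have "inj_on \<phi> U" "open (\<phi> ` U)" using assms by (auto simp: is_atlas_def)
  then show ?thesis using assms(2) unfolding lpar_def
    by (auto intro!: bexI[of _ "(U, \<phi>)"] inv_into_into f_inv_into_f)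
qed

lemma chart_par: "is_atlas A ==> (U, \<phi>) \<in> A ==> par A (\<phi> ` U) (inv_into U \<phi>)"
  by (rule lpar_par[OF chart_lpar])

lemma pts_par:
  assumes "is_atlas A" "p \<in> pts A"
  obtains V P z where "par A V P" "z \<in> V" "P z = p"
proof -
  obtain U \<phi> where U: "(U, \<phi>) \<in> A" "p \<in> U" using assms(2) by (auto simp: pts_def)
  show thesis
    using that[OF chart_par[OF assms(1) U(1)], of "\<phi> p"] U is_atlas_inj[OF assms(1) U(1)] by auto
qed

text \<open>Each chart is described by an inverse parametrisation from the family \<^term>\<open>F\<close>.\<close>

lemma is_atlasI:
  assumes ch: "\<And>U \<phi>. (U, \<phi>) \<in> A ==> \<exists>V P. (V, P) \<in> F \<and> open V \<and> P ` V = U \<and> (\<forall>z\<in>V. \<phi> (P z) = z)"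
    and tr: "\<And>V P V' Q z z'. (V, P) \<in> F ==> (V', Q) \<in> F ==> z \<in> V ==> z' \<in> V' ==> P z = Q z' ==>
      fac P z Q V'"
  shows "is_atlas A"
  unfolding is_atlas_def
proof (clarify, intro conjI ballI)
  fix U \<phi> assume "(U, \<phi>) \<in> A"
  from ch[OF this] obtain V P where V: "(V, P) \<in> F" "open V" "P ` V = U" "\<And>z. z \<in> V ==> \<phi> (P z) = z"
    by (elim exE conjE) (rule that, (assumption | erule (1) bspec)+)
  show inj: "inj_on \<phi> U"
  proof (rule inj_onI)
    fix x y assume xy: "x \<in> U" "y \<in> U" "\<phi> x = \<phi> y"
    from xy(1,2) have "x \<in> P ` V" "y \<in> P ` V" by (simp_all add: V(3))
    then obtain a b where ab: "a \<in> V" "b \<in> V" "x = P a" "y = P b" by blast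
    then have "a = b" using V(4)[OF ab(1)] V(4)[OF ab(2)] xy(3) by simp
    with ab show "x = y" by simp
  qed
  show "open (\<phi> ` U)" using V by (auto simp: image_image)
  have inv: "inv_into U \<phi> y = P y" if "y \<in> V" for y
    using inj V that by (metis imageI inv_into_f_f)
  show "case x of (V, \<psi>) \<Rightarrow> hol_map_on (\<phi> ` (U \<inter> V)) (\<psi> \<circ> inv_into U \<phi>)" if "x \<in> A" for x
  proof -
    obtain U' \<psi> where x: "x = (U', \<psi>)" by force
    have "(U', \<psi>) \<in> A" using x that by simp
    from ch[OF this] obtain V' Q where V': "(V', Q) \<in> F" "open V'" "Q ` V' = U'" "\<And>z. z \<in> V' ==> \<psi> (Q z) = z"
      by (elim exE conjE) (rule that, (assumption | erule (1) bspec)+)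
    have eq: "\<phi> ` (U \<inter> U') = {y \<in> V. P y \<in> U'}"
      using V by (force simp: image_iff)
    have *: "\<exists>W. open W \<and> y \<in> W \<and> W \<subseteq> \<phi> ` (U \<inter> U') \<and> cdv (\<psi> \<circ> inv_into U \<phi>) y"
      if y: "y \<in> \<phi> ` (U \<inter> U')" for y
    proof -
      have yV: "y \<in> V" "P y \<in> U'" using y eq by auto
      then obtain z' where z': "z' \<in> V'" "P y = Q z'" using V' by auto
      obtain W \<tau> where W: "open W" "y \<in> W" "\<And>y. y \<in> W ==> \<tau> y \<in> V' \<and> P y = Q (\<tau> y) \<and> cdv \<tau> y"
        using tr[OF V(1) V'(1) yV(1) z'] unfolding fac_def by blast
      have "W \<inter> V \<subseteq> \<phi> ` (U \<inter> U')" using W V' eq by auto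
      moreover have "cdv (\<psi> \<circ> inv_into U \<phi>) y"
        by (rule cdv_cong[of \<tau> y "W \<inter> V"]) (use W V yV V' in "auto simp: inv")
      ultimately show ?thesis using W V yV by (intro exI[of _ "W \<inter> V"]) auto
    qed
    have "open (\<phi> ` (U \<inter> U'))" by (subst open_subopen) (use * in meson)
    then show ?thesis unfolding x prod.case hol_map_on_iff using * by blast
  qed
qed

definition patl :: "'i set \<Rightarrow> ('i \<Rightarrow> (complex^('n::finite)) set) \<Rightarrow> ('i \<Rightarrow> complex^'n \<Rightarrow> 'a) \<Rightarrow> ('a, 'n) atlas" where
  "patl I V P = (\<lambda>i. (P i ` V i, inv_into (V i) (P i))) ` I"

lemma pts_patl: "pts (patl I V P) = (\<Union>i\<in>I. P i ` V i)"
  by (auto simp: pts_def patl_def)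

lemma lpar_patl: "i \<in> I ==> open (V i) ==> inj_on (P i) (V i) ==> lpar (patl I V P) (V i) (P i)"
  by (auto simp: lpar_def patl_def)

lemma is_atlas_patl:
  assumes "\<And>i. i \<in> I ==> open (V i)" "\<And>i. i \<in> I ==> inj_on (P i) (V i)"
    "\<And>i j z z'. i \<in> I ==> j \<in> I ==> z \<in> V i ==> z' \<in> V j ==> P i z = P j z' ==> fac (P i) z (P j) (V j)"
  shows "is_atlas (patl I V P)"
proof (rule is_atlasI[where F="(\<lambda>i. (V i, P i)) ` I"])
  fix U \<phi> assume "(U, \<phi>) \<in> patl I V P"
  then obtain i where "i \<in> I" "U = P i ` V i" "\<phi> = inv_into (V i) (P i)"
    by (auto simp: patl_def)
  then show "\<exists>V' Q. (V', Q) \<in> (\<lambda>i. (V i, P i)) ` I \<and> open V' \<and> Q ` V' = U \<and> (\<forall>z\<in>V'. \<phi> (Q z) = z)"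
    using assms(1,2) by (intro exI[of _ "V i"] exI[of _ "P i"]) auto
qed (use assms in auto)

section \<open>Topology and maps of atlases\<close>

text \<open>Injectivity of the charts makes their images commute with intersections.\<close>

lemma istopology_mtop:
  assumes A: "is_atlas A"
  shows "istopology (\<lambda>W. W \<subseteq> pts A \<and> (\<forall>(U, \<phi>)\<in>A. open (\<phi> ` (U \<inter> W))))"
  unfolding istopology_def
proof (intro conjI allI impI)
  fix S T assume S: "S \<subseteq> pts A \<and> (\<forall>(U, \<phi>)\<in>A. open (\<phi> ` (U \<inter> S)))"
    and T: "T \<subseteq> pts A \<and> (\<forall>(U, \<phi>)\<in>A. open (\<phi> ` (U \<inter> T)))"
  have "open (\<phi> ` (U \<inter> (S \<inter> T)))" if "(U, \<phi>) \<in> A" for U \<phi>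
  proof -
    have "\<phi> ` (U \<inter> (S \<inter> T)) = \<phi> ` (U \<inter> S) \<inter> \<phi> ` (U \<inter> T)"
      using is_atlas_inj[OF A that] unfolding inj_on_def by blast
    then show ?thesis using S T that by auto
  qed
  then show "S \<inter> T \<subseteq> pts A" "\<forall>(U, \<phi>)\<in>A. open (\<phi> ` (U \<inter> (S \<inter> T)))" using S by auto
next
  fix K assume K: "\<forall>k\<in>K. k \<subseteq> pts A \<and> (\<forall>(U, \<phi>)\<in>A. open (\<phi> ` (U \<inter> k)))"
  have "open (\<phi> ` (U \<inter> \<Union>K))" if "(U, \<phi>) \<in> A" for U \<phi>
  proof -
    have "\<phi> ` (U \<inter> \<Union>K) = (\<Union>k\<in>K. \<phi> ` (U \<inter> k))" by blast
    moreover have "open (\<phi> ` (U \<inter> k))" if "k \<in> K" for k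
      using K that \<open>(U, \<phi>) \<in> A\<close> by fast
    ultimately show ?thesis by auto
  qed
  then show "\<Union>K \<subseteq> pts A" "\<forall>(U, \<phi>)\<in>A. open (\<phi> ` (U \<inter> \<Union>K))" using K by auto
qed

lemma openin_mtop:
  "is_atlas A ==> openin (mtop A) W \<longleftrightarrow> W \<subseteq> pts A \<and> (\<forall>(U, \<phi>)\<in>A. open (\<phi> ` (U \<inter> W)))"
  unfolding mtop_def using topology_inverse'[OF istopology_mtop] by fastforce

lemma topspace_mtop:
  assumes "is_atlas A"
  shows "topspace (mtop A) = pts A"
proof -
  have "U \<inter> pts A = U" if "(U, \<phi>) \<in> A" for U \<phi>
    using that by (auto simp: pts_def)
  then have "openin (mtop A) (pts A)"
    using assms unfolding openin_mtop[OF assms] is_atlas_def by auto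
  then show ?thesis
    by (meson assms openin_mtop openin_subset openin_topspace subset_antisym)
qed

lemma open_lpar_vimage:
  assumes A: "is_atlas A" and P: "lpar A V P" and W: "openin (mtop A) W"
  shows "open {z \<in> V. P z \<in> W}"
proof -
  obtain U \<phi> where U: "(U, \<phi>) \<in> A" "P ` V \<subseteq> U" "\<And>z. z \<in> V ==> \<phi> (P z) = z" "open V"
    using P unfolding lpar_def by blast
  have "{z \<in> V. P z \<in> W} = V \<inter> \<phi> ` (U \<inter> W)"
  proof (intro set_eqI iffI)
    fix x assume x: "x \<in> {z \<in> V. P z \<in> W}"
    then have "P x \<in> U \<inter> W" "x = \<phi> (P x)" using U(2,3) by auto
    then show "x \<in> V \<inter> \<phi> ` (U \<inter> W)" using x by blast
  next
    fix x assume "x \<in> V \<inter> \<phi> ` (U \<inter> W)"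
    then obtain q where q: "x \<in> V" "q \<in> U" "q \<in> W" "x = \<phi> q" by blast
    then have "\<phi> (P x) = \<phi> q" "P x \<in> U" using U(2,3) by auto
    then have "P x = q" using q(2) by (rule inj_onD[OF is_atlas_inj[OF A U(1)]])
    then show "x \<in> {z \<in> V. P z \<in> W}" using q by simp
  qed
  then show ?thesis using U W unfolding openin_mtop[OF A] by auto
qed

lemma open_par_vimage:
  assumes A: "is_atlas A" and P: "par A V P" and W: "openin (mtop A) W"
  shows "open {z \<in> V. P z \<in> W}"
proof (subst open_subopen, intro ballI)
  fix z assume "z \<in> {z \<in> V. P z \<in> W}"
  then have z: "z \<in> V" "P z \<in> W" by auto
  obtain V' Q z' where 1: "lpar A V' Q" "z' \<in> V'" "Q z' = P z" "fac P z Q V'"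
    using P z unfolding par_def by meson
  obtain X \<tau> where X: "open X" "z \<in> X" "\<And>y. y \<in> X ==> \<tau> y \<in> V' \<and> P y = Q (\<tau> y) \<and> cdv \<tau> y"
    using 1(4) unfolding fac_def by blast
  let ?T = "V \<inter> {y \<in> X. \<tau> y \<in> {z \<in> V'. Q z \<in> W}}"
  have "open ?T"
    by (rule open_Int[OF par_open[OF P] cdv_open_vimage[OF X(1) _ open_lpar_vimage[OF A 1(1) W]]])
      (simp add: X(3))
  moreover have "z \<in> ?T" using X(2) X(3)[OF X(2)] z by simp
  moreover have "?T \<subseteq> {z \<in> V. P z \<in> W}" using X(3) by auto
  ultimately show "\<exists>T. open T \<and> z \<in> T \<and> T \<subseteq> {z \<in> V. P z \<in> W}" by (intro exI[of _ ?T] conjI)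
qed

text \<open>At each point of the image a chart inverse factors through P near that point, so a whole
  neighbourhood lies in the image.\<close>

lemma openin_par_image:
  assumes A: "is_atlas A" and P: "par A V P"
  shows "openin (mtop A) (P ` V)"
  unfolding openin_mtop[OF A]
proof (intro conjI)
  show "P ` V \<subseteq> pts A" using par_pts[OF P] by (rule image_subsetI)
  have "open (\<phi> ` (U \<inter> P ` V))" if U: "(U, \<phi>) \<in> A" for U \<phi>
  proof -
  show "open (\<phi> ` (U \<inter> P ` V))"
  proof (subst open_subopen, intro ballI)
    fix x assume "x \<in> \<phi> ` (U \<inter> P ` V)"
    then obtain z where z: "z \<in> V" "P z \<in> U" "x = \<phi> (P z)" by blast
    have x: "inv_into U \<phi> x = P z" using z is_atlas_inj[OF A U] by simp
    have "fac (inv_into U \<phi>) x P V"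
      by (rule par_fac[OF A chart_par[OF A U] P]) (use z x in auto)
    then obtain W \<tau> where W: "open W" "x \<in> W" "\<And>y. y \<in> W ==> \<tau> y \<in> V \<and> inv_into U \<phi> y = P (\<tau> y)"
      unfolding fac_def by blast
    have "W \<inter> \<phi> ` U \<subseteq> \<phi> ` (U \<inter> P ` V)"
    proof
      fix y assume y: "y \<in> W \<inter> \<phi> ` U"
      have "inv_into U \<phi> y \<in> P ` V" using W(3)[of y] y by blast
      moreover have "inv_into U \<phi> y \<in> U" using y by (blast intro: inv_into_into)
      moreover have "\<phi> (inv_into U \<phi> y) = y" using y by (blast intro: f_inv_into_f)
      ultimately show "y \<in> \<phi> ` (U \<inter> P ` V)" by (metis IntI imageI)
    qed
    moreover have "open (W \<inter> \<phi> ` U)" using W A U by (auto simp: is_atlas_def)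
    ultimately show "\<exists>T. open T \<and> x \<in> T \<and> T \<subseteq> \<phi> ` (U \<inter> P ` V)"
      using W z(2,3) by (intro exI[of _ "W \<inter> \<phi> ` U"]) auto
  qed
  qed
  then show "\<forall>(U, \<phi>)\<in>A. open (\<phi> ` (U \<inter> P ` V))" by auto
qed

lemma openinI:
  assumes "is_atlas A" "\<And>p. p \<in> W ==> \<exists>V P. par A V P \<and> p \<in> P ` V \<and> P ` V \<subseteq> W"
  shows "openin (mtop A) W"
proof (subst openin_subopen, intro ballI)
  fix p assume "p \<in> W"
  from assms(2)[OF this] obtain V P where "par A V P" "p \<in> P ` V" "P ` V \<subseteq> W" by blast
  then show "\<exists>T. openin (mtop A) T \<and> p \<in> T \<and> T \<subseteq> W"
    using openin_par_image[OF assms(1)] by blast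
qed

lemma continuous_map_par:
  assumes "is_atlas A" "par A V P"
  shows "continuous_map (top_of_set V) (mtop A) P"
  unfolding continuous_map_def
proof (intro conjI allI impI)
  show "P \<in> topspace (top_of_set V) \<rightarrow> topspace (mtop A)"
    using assms par_pts by (fastforce simp: topspace_mtop)
  fix W assume "openin (mtop A) W"
  from open_par_vimage[OF assms this] show "openin (top_of_set V) {x \<in> topspace (top_of_set V). P x \<in> W}"
    by (simp add: open_subset)
qed

lemma continuous_mapI_par:
  assumes A: "is_atlas A"
    and "\<And>p. p \<in> pts A ==> \<exists>V P. par A V P \<and> p \<in> P ` V \<and> continuous_map (top_of_set V) X (\<lambda>z. f (P z))"
  shows "continuous_map (mtop A) X f"
  unfolding continuous_map_def topspace_mtop[OF A]
proof (intro conjI allI impI)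
  show "f \<in> pts A \<rightarrow> topspace X"
    using assms(2) by (force simp: continuous_map_def Pi_iff)
  fix W assume W: "openin X W"
  show "openin (mtop A) {x \<in> pts A. f x \<in> W}"
  proof (rule openinI[OF A])
    fix p assume p: "p \<in> {x \<in> pts A. f x \<in> W}"
    then obtain V P where V: "par A V P" "p \<in> P ` V" "continuous_map (top_of_set V) X (\<lambda>z. f (P z))"
      using assms(2)[of p] by blast
    let ?V = "{z \<in> V. f (P z) \<in> W}"
    have "openin (top_of_set V) ?V" using V(3) W by (auto simp: continuous_map_def)
    then have "open ?V" using par_open[OF V(1)] openin_open_trans by blast
    then have "par A ?V P" by (rule par_subset[OF V(1)]) auto
    moreover have "P ` ?V \<subseteq> {x \<in> pts A. f x \<in> W}" using par_pts[OF V(1)] by auto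
    ultimately show "\<exists>V P. par A V P \<and> p \<in> P ` V \<and> P ` V \<subseteq> {x \<in> pts A. f x \<in> W}"
      using V(2) p by blast
  qed
qed

text \<open>A countable base of coordinate space, transported by the finitely many chart inverses,
  is a base of the manifold.\<close>

lemma second_countable_mtop:
  fixes A :: "('a, 'n::finite) atlas"
  assumes A: "is_atlas A" and fin: "finite A"
  shows "second_countable (mtop A)"
proof -
  obtain \<B> :: "(complex^'n) set set" where B: "countable \<B>" "\<And>C. C \<in> \<B> ==> open C"
    "\<And>S. open S ==> \<exists>U. U \<subseteq> \<B> \<and> S = \<Union>U"
    using Elementary_Topology.univ_second_countable by metis
  let ?\<C> = "(\<lambda>((U, \<phi>), C). inv_into U \<phi> ` (C \<inter> \<phi> ` U)) ` (A \<times> \<B>)"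
  have par: "par A (C \<inter> \<phi> ` U) (inv_into U \<phi>)" if "(U, \<phi>) \<in> A" "C \<in> \<B>" for U \<phi> C
    by (rule par_subset[OF chart_par[OF A that(1)]])
      (use B(2)[OF that(2)] A that(1) in "auto simp: is_atlas_def")
  have "countable ?\<C>" using B(1) fin by (intro countable_image countable_SIGMA) (auto simp: countable_finite)
  moreover have "openin (mtop A) V" if "V \<in> ?\<C>" for V
    using that openin_par_image[OF A par] by auto
  moreover have "\<exists>V\<in>?\<C>. x \<in> V \<and> V \<subseteq> W" if "openin (mtop A) W" "x \<in> W" for W x
  proof -
    have "x \<in> pts A" using that openin_mtop[OF A] by auto
    then obtain U \<phi> where U: "(U, \<phi>) \<in> A" "x \<in> U" by (auto simp: pts_def)
    let ?S = "\<phi> ` (U \<inter> W)"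
    have inj: "inj_on \<phi> U" by (rule is_atlas_inj[OF A U(1)])
    have "open ?S" using that U unfolding openin_mtop[OF A] by auto
    then obtain K where K: "K \<subseteq> \<B>" "?S = \<Union>K" using B(3) by blast
    have "\<phi> x \<in> ?S" using U that by auto
    then obtain C where C: "C \<in> \<B>" "\<phi> x \<in> C" "C \<subseteq> ?S" using K by blast
    have "inv_into U \<phi> ` (C \<inter> \<phi> ` U) \<subseteq> W"
    proof (rule image_subsetI)
      fix y assume "y \<in> C \<inter> \<phi> ` U"
      then obtain q where "q \<in> U" "q \<in> W" "y = \<phi> q" using C(3) by blast
      then show "inv_into U \<phi> y \<in> W" using inj by simp
    qed
    moreover have "x \<in> inv_into U \<phi> ` (C \<inter> \<phi> ` U)"
      using C U inj by (intro image_eqI[of _ _ "\<phi> x"]) auto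
    moreover have "inv_into U \<phi> ` (C \<inter> \<phi> ` U) \<in> ?\<C>"
      by (rule image_eqI[of _ _ "((U, \<phi>), C)"]) (use U C in auto)
    ultimately show ?thesis by (intro bexI conjI)
  qed
  ultimately have "countable ?\<C> \<and> (\<forall>V\<in>?\<C>. openin (mtop A) V) \<and>
      (\<forall>U x. openin (mtop A) U \<and> x \<in> U \<longrightarrow> (\<exists>V\<in>?\<C>. x \<in> V \<and> V \<subseteq> U))"
    by meson
  then show ?thesis unfolding second_countable_def by (rule exI)
qed

text \<open>One pair of parametrisations at each point suffices; \<open>par_fac\<close> passes from
  it to all charts.\<close>

lemma holo_mapI:
  assumes A: "is_atlas A" and B: "is_atlas B"
    and loc: "\<And>p. p \<in> pts A ==> \<exists>V P z V' Q. par A V P \<and> z \<in> V \<and> P z = p \<and> par B V' Q \<and>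
      fac (\<lambda>y. f (P y)) z Q V'"
  shows "holo_map A B f"
  unfolding holo_map_def
proof (intro conjI)
  show "f ` pts A \<subseteq> pts B"
  proof
    fix q assume "q \<in> f ` pts A"
    then obtain p where p: "p \<in> pts A" "q = f p" by blast
    obtain V P z V' Q where 1: "P z = p" "par B V' Q" "par A V P" "fac (\<lambda>y. f (P y)) z Q V'"
      using loc[OF p(1)] by (elim exE conjE) (rule that)
    from facD[OF 1(4)] show "q \<in> pts B" using p(2) 1(1) par_pts[OF 1(2)] by auto
  qed
  show "\<forall>(U, \<phi>)\<in>A. \<forall>(V, \<psi>)\<in>B. hol_map_on (\<phi> ` (U \<inter> f -` V)) (\<psi> \<circ> f \<circ> inv_into U \<phi>)"
  proof clarify
    fix U \<phi> V \<psi> assume U: "(U, \<phi>) \<in> A" and V: "(V, \<psi>) \<in> B"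
    have injU: "inj_on \<phi> U" and injV: "inj_on \<psi> V" using A B U V is_atlas_inj by blast+
    have *: "\<exists>W. open W \<and> x \<in> W \<and> W \<subseteq> \<phi> ` (U \<inter> f -` V) \<and> cdv (\<psi> \<circ> f \<circ> inv_into U \<phi>) x"
      if x0: "x \<in> \<phi> ` (U \<inter> f -` V)" for x
    proof -
      obtain p where p: "p \<in> U" "f p \<in> V" "x = \<phi> p" using x0 by blast
      have x: "inv_into U \<phi> x = p" "x \<in> \<phi> ` U" using p injU by auto
      have "p \<in> pts A" using p U by (auto simp: pts_def)
      then obtain O1 P z O2 Q where 1: "par A O1 P" "z \<in> O1" "P z = p" "par B O2 Q"
        "fac (\<lambda>y. f (P y)) z Q O2" using loc[of p] by blast
      have 2: "fac (inv_into U \<phi>) x P O1"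
        by (rule par_fac[OF A chart_par[OF A U] 1(1)]) (use x 1 in auto)
      have 3: "fac (\<lambda>y. f (inv_into U \<phi> y)) x Q O2"
        by (rule fac_trans_inj[OF 2 par_inj[OF 1(1)] 1(2) _ 1(5)]) (use x 1 in simp)
      have "fac (\<lambda>y. f (inv_into U \<phi> y)) x (inv_into V \<psi>) (\<psi> ` V)"
      proof (rule fac_trans[where f="\<lambda>x. x", OF 3])
        fix z' assume z': "z' \<in> O2" "Q z' = f (inv_into U \<phi> x)"
        show "fac Q z' (inv_into V \<psi>) (\<psi> ` V)"
          by (rule par_fac[OF B 1(4) chart_par[OF B V], of _ "\<psi> (f p)"])
            (use z' x p injV in auto)
      qed
      then obtain W \<tau> where W: "open W" "x \<in> W"
        "\<And>y. y \<in> W ==> \<tau> y \<in> \<psi> ` V \<and> f (inv_into U \<phi> y) = inv_into V \<psi> (\<tau> y) \<and> cdv \<tau> y"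
        unfolding fac_def by blast
      let ?W = "W \<inter> \<phi> ` U"
      have "open ?W" using W A U by (auto simp: is_atlas_def)
      moreover have "x \<in> ?W" using x W by auto
      moreover have "?W \<subseteq> \<phi> ` (U \<inter> f -` V)"
      proof
        fix y assume y: "y \<in> ?W"
        then have "f (inv_into U \<phi> y) \<in> V" using W(3)[of y] by (auto intro: inv_into_into)
        then show "y \<in> \<phi> ` (U \<inter> f -` V)"
          using y by (intro image_eqI[of _ _ "inv_into U \<phi> y"]) (auto simp: f_inv_into_f inv_into_into)
      qed
      moreover have "cdv (\<psi> \<circ> f \<circ> inv_into U \<phi>) x"
        by (rule cdv_cong[of \<tau> x W]) (use W in "auto simp: f_inv_into_f")
      ultimately show ?thesis by (intro exI[of _ ?W] conjI)
    qed
    have "open (\<phi> ` (U \<inter> f -` V))" by (subst open_subopen) (use * in meson)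
    then show "hol_map_on (\<phi> ` (U \<inter> f -` V)) (\<psi> \<circ> f \<circ> inv_into U \<phi>)"
      unfolding hol_map_on_iff using * by blast
  qed
qed

lemma holo_map_fac:
  assumes A: "is_atlas A" and B: "is_atlas B" and f: "holo_map A B f"
    and P: "par A V P" and Q: "par B V' Q" and z: "z \<in> V" "z' \<in> V'" "f (P z) = Q z'"
  shows "fac (\<lambda>y. f (P y)) z Q V'"
proof -
  obtain U \<phi> where U: "(U, \<phi>) \<in> A" "P z \<in> U" using par_pts[OF P z(1)] by (auto simp: pts_def)
  obtain U' \<psi> where U': "(U', \<psi>) \<in> B" "Q z' \<in> U'" using par_pts[OF Q z(2)] by (auto simp: pts_def)
  have inj: "inj_on \<phi> U" "inj_on \<psi> U'" using A B U U' is_atlas_inj by blast+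
  have h: "hol_map_on (\<phi> ` (U \<inter> f -` U')) (\<psi> \<circ> f \<circ> inv_into U \<phi>)"
    using f U U' unfolding holo_map_def by fast
  have 1: "fac P z (inv_into U \<phi>) (\<phi> ` U)"
    by (rule par_fac[OF A P chart_par[OF A U(1)], of _ "\<phi> (P z)"]) (use U z inj in auto)
  have 2: "fac (\<lambda>y. f (inv_into U \<phi> y)) (\<phi> (P z)) (inv_into U' \<psi>) (\<psi> ` U')"
    by (rule facI[of "\<phi> ` (U \<inter> f -` U')" _ "\<psi> \<circ> f \<circ> inv_into U \<phi>"])
      (use h U U' z inj in "auto simp: hol_map_on_iff")
  have 3: "fac (\<lambda>y. f (P y)) z (inv_into U' \<psi>) (\<psi> ` U')"
    by (rule fac_trans_inj[OF 1 lpar_inj[OF chart_lpar[OF A U(1)]] _ _ 2]) (use U inj in auto)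
  show ?thesis
  proof (rule fac_trans[where f="\<lambda>x. x", OF 3])
    fix x assume "x \<in> \<psi> ` U'" "inv_into U' \<psi> x = f (P z)"
    then show "fac (inv_into U' \<psi>) x Q V'"
      by (intro par_fac[OF B chart_par[OF B U'(1)] Q]) (use z in auto)
  qed
qed

lemma continuous_map_fac:
  assumes B: "is_atlas B" and "open V" and "\<And>z. z \<in> V ==> \<exists>V' Q. par B V' Q \<and> fac P z Q V'"
  shows "continuous_map (top_of_set V) (mtop B) P"
  unfolding continuous_map_def topspace_mtop[OF B]
proof (intro conjI allI impI)
  show "P \<in> topspace (top_of_set V) \<rightarrow> pts B"
    using assms(3) par_pts[of B] unfolding fac_def by (force simp: Pi_iff)
  fix W assume W: "openin (mtop B) W"
  have "open {x \<in> V. P x \<in> W}"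
  proof (subst open_subopen, intro ballI)
    fix z assume "z \<in> {x \<in> V. P x \<in> W}"
    then have z: "z \<in> V" "P z \<in> W" by auto
    obtain V' Q where 1: "par B V' Q" "fac P z Q V'" using assms(3) z by blast
    obtain X \<tau> where X: "open X" "z \<in> X" "\<And>y. y \<in> X ==> \<tau> y \<in> V' \<and> P y = Q (\<tau> y) \<and> cdv \<tau> y"
      using 1(2) unfolding fac_def by blast
    let ?T = "V \<inter> {y \<in> X. \<tau> y \<in> {z \<in> V'. Q z \<in> W}}"
    have "open ?T"
      by (rule open_Int[OF assms(2) cdv_open_vimage[OF X(1) _ open_par_vimage[OF B 1(1) W]]])
        (simp add: X(3))
    moreover have "z \<in> ?T" using X(2) X(3)[OF X(2)] z by simp
    moreover have "?T \<subseteq> {x \<in> V. P x \<in> W}" using X(3) by auto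
    ultimately show "\<exists>T. open T \<and> z \<in> T \<and> T \<subseteq> {x \<in> V. P x \<in> W}" by (intro exI[of _ ?T] conjI)
  qed
  then show "openin (top_of_set V) {x \<in> topspace (top_of_set V). P x \<in> W}"
    by (simp add: open_subset)
qed

lemma holo_map_continuous:
  assumes A: "is_atlas A" and B: "is_atlas B" and f: "holo_map A B f"
  shows "continuous_map (mtop A) (mtop B) f"
proof (rule continuous_mapI_par[OF A])
  fix p assume p: "p \<in> pts A"
  then obtain V P z where P: "par A V P" "z \<in> V" "P z = p" by (rule pts_par[OF A])
  have "continuous_map (top_of_set V) (mtop B) (\<lambda>z. f (P z))"
  proof (rule continuous_map_fac[OF B par_open[OF P(1)]])
    fix z assume z: "z \<in> V"
    then have "f (P z) \<in> pts B" using f par_pts[OF P(1)] by (auto simp: holo_map_def)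
    then obtain V' Q z' where Q: "par B V' Q" "z' \<in> V'" "Q z' = f (P z)" by (rule pts_par[OF B])
    then show "\<exists>V' Q. par B V' Q \<and> fac (\<lambda>z. f (P z)) z Q V'"
      using holo_map_fac[OF A B f P(1) Q(1) z Q(2)] by auto
  qed
  then show "\<exists>V P. par A V P \<and> p \<in> P ` V \<and> continuous_map (top_of_set V) (mtop B) (\<lambda>z. f (P z))"
    using P by blast
qed

text \<open>If f turns parametrisations into parametrisations, then f and its inverse are the
  identity in these coordinates, so holomorphy of the inverse comes for free.\<close>

lemma biholoI:
  assumes A: "is_atlas A" and B: "is_atlas B" and bij: "bij_betw f (pts A) (pts B)"
    and loc: "\<And>p. p \<in> pts A ==> \<exists>V P. par A V P \<and> p \<in> P ` V \<and> par B V (\<lambda>z. f (P z))"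
  shows "biholo A B f"
  unfolding biholo_def
proof (intro conjI)
  show "bij_betw f (pts A) (pts B)" by fact
  show "holo_map A B f"
  proof (rule holo_mapI[OF A B])
    fix p assume "p \<in> pts A"
    then obtain V P z where "par A V P" "z \<in> V" "P z = p" "par B V (\<lambda>z. f (P z))" using loc by blast
    moreover from this have "fac (\<lambda>y. f (P y)) z (\<lambda>z. f (P z)) V"
      by (intro fac_refl) (auto dest: par_open)
    ultimately show "\<exists>V P z V' Q. par A V P \<and> z \<in> V \<and> P z = p \<and> par B V' Q \<and> fac (\<lambda>y. f (P y)) z Q V'"
      by blast
  qed
  show "holo_map B A (inv_into (pts A) f)"
  proof (rule holo_mapI[OF B A])
    fix q assume q: "q \<in> pts B"
    let ?g = "inv_into (pts A) f"
    have "?g q \<in> pts A" using bij q by (metis bij_betw_def inv_into_into)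
    then obtain V P z where 1: "par A V P" "z \<in> V" "P z = ?g q" "par B V (\<lambda>z. f (P z))"
      using loc[of "?g q"] by (auto simp: image_iff)
    have "f (P z) = q" using 1 bij q by (metis bij_betw_inv_into_right)
    moreover have "fac (\<lambda>y. ?g (f (P y))) z P V"
      by (rule facI[of V _ "\<lambda>y. y"])
        (use 1(2) par_open[OF 1(1)] par_pts[OF 1(1)] in "auto intro: cd simp: bij_betw_inv_into_left[OF bij]")
    ultimately show "\<exists>V P z V' Q. par B V P \<and> z \<in> V \<and> P z = q \<and> par A V' Q \<and> fac (\<lambda>y. ?g (P y)) z Q V'"
      using 1 by blast
  qed
qed

lemma holo_funI:
  assumes A: "is_atlas A" and W: "openin (mtop A) W"
    and loc: "\<And>p. p \<in> W ==> \<exists>V P z. par A V P \<and> z \<in> V \<and> P z = p \<and> cdiff (\<lambda>y. g (P y)) z"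
  shows "holo_fun A W g"
  unfolding holo_fun_def
proof (intro conjI W, clarify)
  fix U \<phi> assume U: "(U, \<phi>) \<in> A"
  have inj: "inj_on \<phi> U" by (rule is_atlas_inj[OF A U])
  show "hol_fun_on (\<phi> ` (U \<inter> W)) (g \<circ> inv_into U \<phi>)"
    unfolding hol_fun_on_iff
  proof (intro conjI ballI)
    show "open (\<phi> ` (U \<inter> W))" using W U unfolding openin_mtop[OF A] by auto
    fix x assume "x \<in> \<phi> ` (U \<inter> W)"
    then obtain p where p: "p \<in> U" "p \<in> W" "x = \<phi> p" by auto
    then have x: "inv_into U \<phi> x = p" using inj by simp
    obtain V P z where 1: "par A V P" "z \<in> V" "P z = p" "cdiff (\<lambda>y. g (P y)) z" using loc[OF p(2)] by blast
    have "fac (inv_into U \<phi>) x P V"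
      by (rule par_fac[OF A chart_par[OF A U] 1(1)]) (use x 1 p in auto)
    then show "cdiff (g \<circ> inv_into U \<phi>) x"
      unfolding o_def
    proof (rule cdiff_fac)
      fix z' assume "z' \<in> V" "P z' = inv_into U \<phi> x"
      then have "z' = z" using inj_onD[OF par_inj[OF 1(1)]] 1 x by simp
      then show "cdiff (\<lambda>y. g (P y)) z'" using 1 by simp
    qed
  qed
qed

lemma holo_fun_openin: "holo_fun A W g ==> openin (mtop A) W"
  by (simp add: holo_fun_def)

lemma holo_fun_cdiff:
  assumes A: "is_atlas A" and g: "holo_fun A W g" and P: "par A V P" and z: "z \<in> V" "P z \<in> W"
  shows "cdiff (\<lambda>y. g (P y)) z"
proof -
  obtain U \<phi> where U: "(U, \<phi>) \<in> A" "P z \<in> U" using par_pts[OF P z(1)] by (auto simp: pts_def)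
  have inj: "inj_on \<phi> U" by (rule is_atlas_inj[OF A U(1)])
  have h: "hol_fun_on (\<phi> ` (U \<inter> W)) (g \<circ> inv_into U \<phi>)"
    using g U unfolding holo_fun_def by fast
  have "fac P z (inv_into U \<phi>) (\<phi> ` U)"
    by (rule par_fac[OF A P chart_par[OF A U(1)], of _ "\<phi> (P z)"]) (use U z inj in auto)
  then show ?thesis
  proof (rule cdiff_fac)
    fix z' assume "z' \<in> \<phi> ` U" "inv_into U \<phi> z' = P z"
    then have "z' \<in> \<phi> ` (U \<inter> W)" using z U inj by (metis IntI f_inv_into_f imageI)
    then show "cdiff (\<lambda>y. g (inv_into U \<phi> y)) z'" using h unfolding hol_fun_on_iff o_def by blast
  qed
qed

lemma pts_open_restrict: "pts (open_restrict A W) = pts A \<inter> W"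
  by (auto simp: pts_def open_restrict_def)

lemma par_open_restrict:
  assumes A: "is_atlas A" and P: "par A V P" and W: "openin (mtop A) W" "P ` V \<subseteq> W"
  shows "par (open_restrict A W) V P"
  unfolding par_def
proof (intro conjI ballI)
  show "open V" "inj_on P V" using P by (auto simp: par_def)
  fix z assume z: "z \<in> V"
  then obtain V' Q z' where 1: "lpar A V' Q" "z' \<in> V'" "Q z' = P z" "fac P z Q V'" "fac Q z' P V"
    using P unfolding par_def by meson
  let ?V = "{z \<in> V'. Q z \<in> W}"
  have "open ?V" by (rule open_lpar_vimage[OF A 1(1) W(1)])
  moreover obtain U \<phi> where "(U, \<phi>) \<in> A" "Q ` V' \<subseteq> U" "\<forall>z\<in>V'. \<phi> (Q z) = z"
    using 1(1) unfolding lpar_def by blast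
  ultimately have "lpar (open_restrict A W) ?V Q"
    unfolding lpar_def open_restrict_def by (auto intro!: bexI[of _ "(U, \<phi>)"])
  moreover have "fac P z Q ?V"
    using 1(4) W(2) z par_open[OF P] unfolding fac_def
  proof (elim exE conjE)
    fix X \<tau> assume X: "open X" "z \<in> X" "\<forall>y\<in>X. \<tau> y \<in> V' \<and> P y = Q (\<tau> y) \<and> cdv \<tau> y"
    then show "\<exists>X \<tau>. open X \<and> z \<in> X \<and> (\<forall>y\<in>X. \<tau> y \<in> {z \<in> V'. Q z \<in> W} \<and> P y = Q (\<tau> y) \<and> cdv \<tau> y)"
      using par_open[OF P] W(2) z by (intro exI[of _ "X \<inter> V"] exI[of _ \<tau>]) auto
  qed
  moreover have "z' \<in> ?V" using 1 W z by auto
  ultimately show "\<exists>V' Q z'. lpar (open_restrict A W) V' Q \<and> z' \<in> V' \<and> Q z' = P z \<and> fac P z Q V' \<and> fac Q z' P V"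
    using 1 by (intro exI conjI)
qed

lemma is_atlas_open_restrict:
  assumes A: "is_atlas A" and W: "openin (mtop A) W"
  shows "is_atlas (open_restrict A W)"
proof -
  have inj: "inj_on \<phi> U" if "(U, \<phi>) \<in> A" for U \<phi> using A that is_atlas_inj by blast
  show ?thesis
  proof (rule is_atlasI[where F="(\<lambda>(U, \<phi>). (\<phi> ` (U \<inter> W), inv_into U \<phi>)) ` A"])
    fix U \<phi> assume "(U, \<phi>) \<in> open_restrict A W"
    then obtain U0 where U: "(U0, \<phi>) \<in> A" "U = U0 \<inter> W" by (auto simp: open_restrict_def)
    then have 1: "open (\<phi> ` (U0 \<inter> W))" using W unfolding openin_mtop[OF A] by auto
    have 2: "inv_into U0 \<phi> ` \<phi> ` (U0 \<inter> W) = U0 \<inter> W"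
      using inj[OF U(1)] by (simp add: inv_into_image_cancel)
    have 3: "(\<phi> ` (U0 \<inter> W), inv_into U0 \<phi>) \<in> (\<lambda>(U, \<phi>). (\<phi> ` (U \<inter> W), inv_into U \<phi>)) ` A"
      using U by (intro image_eqI[of _ _ "(U0, \<phi>)"]) auto
    show "\<exists>V P. (V, P) \<in> (\<lambda>(U, \<phi>). (\<phi> ` (U \<inter> W), inv_into U \<phi>)) ` A \<and>
        open V \<and> P ` V = U \<and> (\<forall>z\<in>V. \<phi> (P z) = z)"
      by (intro exI conjI, rule 3, rule 1) (use 2 U inj[OF U(1)] in "auto simp: f_inv_into_f")
  next
    fix V P V' Q z z' assume VP: "(V, P) \<in> (\<lambda>(U, \<phi>). (\<phi> ` (U \<inter> W), inv_into U \<phi>)) ` A"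
      "(V', Q) \<in> (\<lambda>(U, \<phi>). (\<phi> ` (U \<inter> W), inv_into U \<phi>)) ` A" and z: "z \<in> V" "z' \<in> V'" "P z = Q z'"
    have "par A V P" if VP: "(V, P) \<in> (\<lambda>(U, \<phi>). (\<phi> ` (U \<inter> W), inv_into U \<phi>)) ` A" for V P
    proof -
      obtain U \<phi> where U: "(U, \<phi>) \<in> A" "V = \<phi> ` (U \<inter> W)" "P = inv_into U \<phi>" using VP by auto
      then have "open V" using W unfolding openin_mtop[OF A] by auto
      then show ?thesis unfolding U(3) by (rule par_subset[OF chart_par[OF A U(1)]]) (use U in auto)
    qed
    from par_fac[OF A this[OF VP(1)] this[OF VP(2)] z] show "fac P z Q V'" .
  qed
qed

lemma separated_by_map:
  assumes f: "continuous_map X Y f" "Hausdorff_space Y" "f p \<noteq> f q" and p: "p \<in> topspace X" "q \<in> topspace X"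
  shows "\<exists>U V. openin X U \<and> openin X V \<and> p \<in> U \<and> q \<in> V \<and> disjnt U V"
proof -
  have "f p \<in> topspace Y" "f q \<in> topspace Y" using f(1) p by (auto simp: continuous_map_def)
  then obtain U V where U: "openin Y U" "openin Y V" "f p \<in> U" "f q \<in> V" "disjnt U V"
    using f(2,3) unfolding Hausdorff_space_def by blast
  show ?thesis
    by (rule exI[of _ "{x \<in> topspace X. f x \<in> U}"], rule exI[of _ "{x \<in> topspace X. f x \<in> V}"])
      (use f U p in "auto simp: continuous_map_def disjnt_iff")
qed

section \<open>Projective spaces\<close>

lemma pline_scale: "c \<noteq> 0 ==> pline (c *s v) = pline v"
proof -
  assume c: "c \<noteq> 0"
  have "d *s v \<in> range (\<lambda>d. d *s (c *s v))" for d
    by (rule range_eqI[of _ _ "d / c"]) (use c in "simp add: vector_smult_assoc")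
  moreover have "d *s (c *s v) \<in> range (\<lambda>d. d *s v)" for d
    by (rule range_eqI[of _ _ "d * c"]) (simp add: vector_smult_assoc)
  ultimately show ?thesis unfolding pline_def by blast
qed

lemma pline_eqD:
  assumes "pline v = pline w"
  shows "\<exists>c. v = c *s w \<and> (v \<noteq> 0 \<longrightarrow> c \<noteq> 0)"
proof -
  have "v \<in> pline v" unfolding pline_def by (rule range_eqI[of _ _ 1]) simp
  then obtain c where "v = c *s w" using assms by (auto simp: pline_def)
  then show ?thesis by (intro exI[of _ c]) auto
qed

lemma pline_eqI: "c \<noteq> 0 ==> v = c *s w ==> pline v = pline w"
  using pline_scale by metis

lemma unit_rep_pline:
  assumes "v $ i \<noteq> 0"
  shows "unit_rep i (pline v) = (1 / v $ i) *s v"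
  unfolding unit_rep_def pline_def
proof (rule the_equality)
  show "(1 / v $ i) *s v \<in> range (\<lambda>c. c *s v) \<and> ((1 / v $ i) *s v) $ i = 1"
    using assms by (intro conjI rangeI) simp
  fix w assume "w \<in> range (\<lambda>c. c *s v) \<and> w $ i = 1"
  then obtain c where c: "w = c *s v" "w $ i = 1" by blast
  then have "c = 1 / v $ i" using assms by (simp add: field_simps)
  then show "w = (1 / v $ i) *s v" using c by simp
qed

text \<open>
  Linear coordinates on projective space: \<^term>\<open>\<alpha>\<close> parametrises the affine hyperplane on which the
  linear form \<^term>\<open>l\<close> equals 1, and \<^term>\<open>\<tau>\<close> is the inverse of \<^term>\<open>\<alpha>\<close> after rescaling.
\<close>

definition lins :: "(complex^('m::finite) \<Rightarrow> complex^('n::finite)) \<Rightarrow> (complex^'n \<Rightarrow> complex^'m) \<Rightarrow>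
    (complex^'n \<Rightarrow> complex) \<Rightarrow> bool" where
  "lins \<alpha> \<tau> l \<longleftrightarrow> (\<forall>z. cdv \<alpha> z \<and> l (\<alpha> z) = 1 \<and> \<tau> (\<alpha> z) = z) \<and>
     (\<forall>v. cdiff l v \<and> (l v \<noteq> 0 \<longrightarrow> l v *s \<alpha> (\<tau> v) = v \<and> cdv \<tau> v)) \<and>
     (\<forall>c v. l (c *s v) = c * l v \<and> (c \<noteq> 0 \<longrightarrow> \<tau> (c *s v) = \<tau> v))"

lemma linsD:
  assumes "lins \<alpha> \<tau> l"
  shows "cdv \<alpha> z" "l (\<alpha> z) = 1" "\<tau> (\<alpha> z) = z" "cdiff l v" "l v \<noteq> 0 ==> l v *s \<alpha> (\<tau> v) = v"
    "l v \<noteq> 0 ==> cdv \<tau> v" "l (c *s v) = c * l v" "c \<noteq> 0 ==> \<tau> (c *s v) = \<tau> v"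
  using assms unfolding lins_def by auto

lemma lins_nz: "lins \<alpha> \<tau> l ==> \<alpha> z \<noteq> 0"
  using linsD(2)[of \<alpha> \<tau> l z] linsD(7)[of \<alpha> \<tau> l 0 0] by auto

lemma open_cdiff_nz:
  assumes "open W" "\<And>y. y \<in> W ==> cdiff f y"
  shows "open {y \<in> W. f y \<noteq> 0}"
proof -
  have "continuous_on W f"
    using assms(2) cdiff_isCont continuous_at_imp_continuous_on by blast
  from continuous_open_preimage[OF this assms(1), of "- {0}"] show ?thesis
    by (simp add: vimage_def Int_def open_Compl)
qed

text \<open>Where l does not vanish, a vector is l times a point of the affine hyperplane, so \<tau>
  of the vector G y is the affine coordinate of its line.\<close>

lemma pline_fac:
  assumes l: "lins \<alpha> \<tau> l" and X: "open X" "z \<in> X" "\<And>y. y \<in> X ==> cdv G y"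
    and z: "l (G z) \<noteq> 0" and V: "open V" "\<tau> (G z) \<in> V"
  shows "fac (\<lambda>y. pline (G y)) z (\<lambda>y. pline (\<alpha> y)) V"
proof (rule facI[of "{y \<in> {y \<in> X. l (G y) \<noteq> 0}. \<tau> (G y) \<in> V}" _ "\<lambda>y. \<tau> (G y)"])
  have cd: "cdiff (\<lambda>y. l (G y)) y" if "y \<in> X" for y
    by (rule cdiff_compose[OF X(3)[OF that] linsD(4)[OF l]])
  have cv: "cdv (\<lambda>y. \<tau> (G y)) y" if "y \<in> X" "l (G y) \<noteq> 0" for y
    by (rule cdv_compose[OF X(3)[OF that(1)] linsD(6)[OF l that(2)]])
  show "open {y \<in> {y \<in> X. l (G y) \<noteq> 0}. \<tau> (G y) \<in> V}"
    by (rule cdv_open_vimage[OF open_cdiff_nz[OF X(1) cd] _ V(1)]) (auto intro: cv)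
  show "z \<in> {y \<in> {y \<in> X. l (G y) \<noteq> 0}. \<tau> (G y) \<in> V}" using X z V by simp
  fix y assume y: "y \<in> {y \<in> {y \<in> X. l (G y) \<noteq> 0}. \<tau> (G y) \<in> V}"
  then show "\<tau> (G y) \<in> V" "cdv (\<lambda>y. \<tau> (G y)) y" using cv by auto
  show "pline (G y) = pline (\<alpha> (\<tau> (G y)))"
    by (rule pline_eqI[of "l (G y)"]) (use y linsD(5)[OF l] in auto)
qed

lemma lins_fac:
  assumes l: "lins \<alpha> \<tau> l" "lins \<alpha>' \<tau>' l'" and V: "open V" "z' \<in> V"
    and eq: "pline (\<alpha> z) = pline (\<alpha>' z')"
  shows "fac (\<lambda>y. pline (\<alpha> y)) z (\<lambda>y. pline (\<alpha>' y)) V"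
proof -
  obtain c where c: "\<alpha> z = c *s \<alpha>' z'" "c \<noteq> 0"
    using pline_eqD[OF eq] lins_nz[OF l(1)] by auto
  show ?thesis
    by (rule pline_fac[OF l(2) open_UNIV UNIV_I linsD(1)[OF l(1)] _ V(1)])
      (use c V linsD(2,3,7,8)[OF l(2)] in auto)
qed

lemma lins_inj: "lins \<alpha> \<tau> l ==> inj_on (\<lambda>z. pline (\<alpha> z)) V"
proof (rule inj_onI)
  fix x y assume l: "lins \<alpha> \<tau> l" and "pline (\<alpha> x) = pline (\<alpha> y)"
  then obtain c where "\<alpha> x = c *s \<alpha> y" "c \<noteq> 0" using pline_eqD lins_nz[OF l] by metis
  then show "x = y" using linsD(3,8)[OF l] by metis
qed

definition pchart :: "'n::finite \<Rightarrow> ('m::finite \<Rightarrow> 'n) \<Rightarrow> complex^'m \<Rightarrow> complex^'n" where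
  "pchart i \<sigma> z = (\<chi> k. if k = i then 1 else z $ inv_into UNIV \<sigma> k)"

lemma pchart_lins:
  fixes \<sigma> :: "'m::finite \<Rightarrow> 'n::finite"
  assumes s: "bij_betw \<sigma> UNIV (- {i})"
  shows "lins (pchart i \<sigma>) (\<lambda>v. \<chi> k. v $ \<sigma> k / v $ i) (\<lambda>v. v $ i)"
proof -
  have inj: "inj \<sigma>" and ran: "range \<sigma> = - {i}" using s by (auto simp: bij_betw_def)
  have ne: "\<sigma> k \<noteq> i" for k using ran by auto
  have "cdv (pchart i \<sigma>) z" for z
    unfolding cdv_def
  proof
    fix k show "cdiff (\<lambda>y. pchart i \<sigma> y $ k) z"
      by (cases "k = i") (auto simp: pchart_def intro: cd)
  qed
  moreover have "(\<chi> k. pchart i \<sigma> z $ \<sigma> k / pchart i \<sigma> z $ i) = z" for z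
    using ne inj by (simp add: pchart_def vec_eq_iff)
  moreover have "v $ i *s pchart i \<sigma> (\<chi> k. v $ \<sigma> k / v $ i) = v" if "v $ i \<noteq> 0" for v :: "complex^'n"
  proof -
    have "\<sigma> (inv_into UNIV \<sigma> k) = k" if "k \<noteq> i" for k
      using ran that by (intro f_inv_into_f) auto
    then show ?thesis using that by (simp add: pchart_def vec_eq_iff)
  qed
  moreover have "cdv (\<lambda>v. \<chi> k. v $ \<sigma> k / v $ i) v" if "v $ i \<noteq> 0" for v :: "complex^'n"
    using that by (auto simp: cdv_def intro!: cdiff_divide cd)
  moreover have "cdiff (\<lambda>v. v $ i) v" for v :: "complex^'n"
    by (rule cdiff_nth)
  ultimately show ?thesis
    unfolding lins_def by (simp add: vec_eq_iff pchart_def)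
qed

lemma pchart_props:
  assumes s: "bij_betw \<sigma> UNIV (- {i})"
  shows "range (\<lambda>z. pline (pchart i \<sigma> z)) = {pline v | v. v $ i \<noteq> 0}"
    and "(\<chi> k. unit_rep i (pline (pchart i \<sigma> z)) $ \<sigma> k) = z"
proof -
  note l = pchart_lins[OF s]
  have 1: "pchart i \<sigma> z $ i = 1" for z by (simp add: pchart_def)
  show "(\<chi> k. unit_rep i (pline (pchart i \<sigma> z)) $ \<sigma> k) = z"
    using linsD(3)[OF l, of z] by (simp add: unit_rep_pline 1 vec_eq_iff)
  have "pline v \<in> range (\<lambda>z. pline (pchart i \<sigma> z))" if "v $ i \<noteq> 0" for v
    using linsD(5)[OF l that] pline_scale[OF that] by (metis rangeI)
  then show "range (\<lambda>z. pline (pchart i \<sigma> z)) = {pline v | v. v $ i \<noteq> 0}"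
    using 1 by (auto simp: image_iff)
qed

lemma is_atlas_proj: "is_atlas (projective_space :: ((complex^('n::finite)) set, 'm::finite) atlas)"
proof (rule is_atlasI[where F="{(UNIV, \<lambda>z. pline (pchart i \<sigma> z)) | i (\<sigma> :: 'm \<Rightarrow> 'n). bij_betw \<sigma> UNIV (- {i})}"])
  fix U and \<phi> :: "(complex^'n) set \<Rightarrow> complex^'m" assume "(U, \<phi>) \<in> projective_space"
  then obtain i and \<sigma> :: "'m \<Rightarrow> 'n" where s: "bij_betw \<sigma> UNIV (- {i})" and U: "U = {pline v | v. v $ i \<noteq> 0}"
    "\<phi> = (\<lambda>l. \<chi> k. unit_rep i l $ \<sigma> k)"
    unfolding projective_space_def by blast
  show "\<exists>V P. (V, P) \<in> {(UNIV, \<lambda>z. pline (pchart i \<sigma> z)) | i (\<sigma> :: 'm \<Rightarrow> 'n). bij_betw \<sigma> UNIV (- {i})} \<and>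
      open V \<and> P ` V = U \<and> (\<forall>z\<in>V. \<phi> (P z) = z)"
    by (rule exI[of _ UNIV], rule exI[of _ "\<lambda>z. pline (pchart i \<sigma> z)"])
      (use s pchart_props[OF s] U in auto)
next
  fix V P V' Q z z'
  assume "(V, P) \<in> {(UNIV, \<lambda>z. pline (pchart i \<sigma> z)) | i (\<sigma> :: 'm \<Rightarrow> 'n). bij_betw \<sigma> UNIV (- {i})}"
    "(V', Q) \<in> {(UNIV, \<lambda>z. pline (pchart i \<sigma> z)) | i (\<sigma> :: 'm \<Rightarrow> 'n). bij_betw \<sigma> UNIV (- {i})}"
    and z: "P z = Q z'" "z \<in> V" "z' \<in> V'"
  then obtain i j and \<sigma> \<rho> :: "'m \<Rightarrow> 'n" where s: "bij_betw \<sigma> UNIV (- {i})" "bij_betw \<rho> UNIV (- {j})"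
    and P: "P = (\<lambda>z. pline (pchart i \<sigma> z))" "Q = (\<lambda>z. pline (pchart j \<rho> z))" "V' = UNIV"
    by blast
  show "fac P z Q V'" unfolding P
    by (rule lins_fac[OF pchart_lins[OF s(1)] pchart_lins[OF s(2)]]) (use z P in auto)
qed

lemma lpar_projective_space:
  assumes s: "bij_betw \<sigma> UNIV (- {i})"
  shows "lpar projective_space UNIV (\<lambda>z. pline (pchart i \<sigma> z))"
  unfolding lpar_def projective_space_def
  by (intro conjI open_UNIV bexI[of _ "({pline v | v. v $ i \<noteq> 0}, \<lambda>l. \<chi> k. unit_rep i l $ \<sigma> k)"])
    (use s pchart_props[OF s] in auto)

lemma exists_pchart:
  assumes "CARD('n::finite) = Suc CARD('m::finite)"
  obtains \<sigma> :: "'m::finite \<Rightarrow> 'n::finite" where "bij_betw \<sigma> UNIV (- {i})"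
proof -
  have "card (- {i}) = CARD('m)" using assms by (simp add: Compl_eq_Diff_UNIV card_Diff_singleton)
  then show thesis using that finite_same_card_bij[of "UNIV :: 'm set" "- {i}"] by auto
qed

text \<open>Near a given line some homogeneous coordinate is nonzero, and the standard chart for it
  is compared with \<alpha>. The cardinality condition provides the enumeration \<sigma> of that
  chart.\<close>

lemma par_lins:
  fixes \<alpha> :: "complex^('m::finite) \<Rightarrow> complex^('n::finite)"
  assumes l: "lins \<alpha> \<tau> l" and V: "open V" and card: "CARD('n) = Suc CARD('m)"
  shows "par projective_space V (\<lambda>z. pline (\<alpha> z))"
  unfolding par_def
proof (intro conjI ballI V lins_inj[OF l])
  fix z assume z: "z \<in> V"
  obtain i where i: "\<alpha> z $ i \<noteq> 0" using lins_nz[OF l, of z] by (auto simp: vec_eq_iff)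
  obtain \<sigma> :: "'m \<Rightarrow> 'n" where s: "bij_betw \<sigma> UNIV (- {i})" by (rule exists_pchart[OF card])
  note ls = pchart_lins[OF s]
  let ?w = "\<chi> k. \<alpha> z $ \<sigma> k / \<alpha> z $ i"
  have eq: "pline (pchart i \<sigma> ?w) = pline (\<alpha> z)"
    using linsD(5)[OF ls i] pline_scale[OF i] by metis
  show "\<exists>V' (Q :: complex^'m \<Rightarrow> _) z'. lpar projective_space V' Q \<and> z' \<in> V' \<and> Q z' = pline (\<alpha> z) \<and>
      fac (\<lambda>z. pline (\<alpha> z)) z Q V' \<and> fac Q z' (\<lambda>z. pline (\<alpha> z)) V"
    by (rule exI[of _ UNIV], rule exI[of _ "\<lambda>z. pline (pchart i \<sigma> z)"], rule exI[of _ ?w])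
      (use lpar_projective_space[OF s] eq z V lins_fac[OF l ls open_UNIV UNIV_I eq[symmetric]]
        lins_fac[OF ls l V z eq] in auto)
qed

lemma pts_projective_space:
  assumes card: "CARD('n::finite) = Suc CARD('m::finite)"
  shows "pts (projective_space :: ((complex^'n) set, 'm) atlas) = {pline v | v. v \<noteq> 0}"
proof -
  have 1: "pts (projective_space :: ((complex^'n) set, 'm) atlas) =
      (\<Union>(i, \<sigma>) \<in> {(i, \<sigma> :: 'm \<Rightarrow> 'n). bij_betw \<sigma> UNIV (- {i})}. {pline v | v. v $ i \<noteq> 0})"
    by (auto simp: pts_def projective_space_def)
  show ?thesis
  proof (intro set_eqI iffI)
    fix x :: "(complex^'n) set" assume "x \<in> pts (projective_space :: ((complex^'n) set, 'm) atlas)"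
    then obtain i v where "v $ i \<noteq> 0" "x = pline v" unfolding 1 by blast
    then show "x \<in> {pline v | v. v \<noteq> 0}" by force
  next
    fix x :: "(complex^'n) set" assume "x \<in> {pline v | v. v \<noteq> 0}"
    then obtain v where v: "v \<noteq> 0" "x = pline v" by blast
    then obtain i where i: "v $ i \<noteq> 0" by (auto simp: vec_eq_iff)
    obtain \<sigma> :: "'m \<Rightarrow> 'n" where s: "bij_betw \<sigma> UNIV (- {i})" by (rule exists_pchart[OF card])
    show "x \<in> pts (projective_space :: ((complex^'n) set, 'm) atlas)"
      unfolding 1 by (rule UN_I[of "(i, \<sigma>)"]) (use s v i in auto)
  qed
qed

lemma continuous_map_pline:
  assumes card: "CARD('n::finite) = Suc CARD('m::finite)"
  shows "continuous_map (top_of_set (- {0})) (mtop (projective_space :: ((complex^'n) set, 'm) atlas)) pline"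
proof (rule continuous_map_fac[OF is_atlas_proj])
  show "open (- {0 :: complex^'n})" by auto
  fix v :: "complex^'n" assume "v \<in> - {0}"
  then obtain i where i: "v $ i \<noteq> 0" by (auto simp: vec_eq_iff)
  obtain \<sigma> :: "'m \<Rightarrow> 'n" where s: "bij_betw \<sigma> UNIV (- {i})" by (rule exists_pchart[OF card])
  have "fac (\<lambda>y. pline y) v (\<lambda>y. pline (pchart i \<sigma> y)) UNIV"
    by (rule pline_fac[OF pchart_lins[OF s] open_UNIV UNIV_I cdv_ident _ open_UNIV]) (use i in auto)
  then show "\<exists>V' Q. par (projective_space :: ((complex^'n) set, 'm) atlas) V' Q \<and> fac pline v Q V'"
    using lpar_par[OF lpar_projective_space[OF s]] by auto
qed

text \<open>The unit sphere is compact and meets every line through the origin.\<close>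

lemma compact_projective_space:
  assumes card: "CARD('n::finite) = Suc CARD('m::finite)"
  shows "compact_space (mtop (projective_space :: ((complex^'n) set, 'm) atlas))"
proof -
  let ?P = "projective_space :: ((complex^'n) set, 'm) atlas"
  have "compactin (top_of_set (- {0})) (sphere (0 :: complex^'n) 1)"
    by (subst compactin_subtopology) auto
  from image_compactin[OF this continuous_map_pline[OF card]]
  have "compactin (mtop ?P) (pline ` sphere 0 1)" .
  moreover have "pline ` sphere (0 :: complex^'n) 1 = pts ?P"
  proof (intro set_eqI iffI)
    fix x assume "x \<in> pline ` sphere (0 :: complex^'n) 1"
    then show "x \<in> pts ?P" unfolding pts_projective_space[OF card] by force
  next
    fix x assume "x \<in> pts ?P"
    then obtain v :: "complex^'n" where v: "v \<noteq> 0" "x = pline v" unfolding pts_projective_space[OF card] by blast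
    let ?c = "complex_of_real (1 / norm v)"
    have eq: "?c *s v = (1 / norm v) *\<^sub>R v"
      unfolding vec_eq_iff
      by (rule allI, subst vector_scaleR_component, subst scaleR_conv_of_real, simp)
    have "pline (?c *s v) = x" using v by (subst pline_scale) auto
    moreover have "?c *s v \<in> sphere 0 1" unfolding eq using v by simp
    ultimately show "x \<in> pline ` sphere (0 :: complex^'n) 1" by blast
  qed
  ultimately show ?thesis
    by (simp add: compact_space_def topspace_mtop[OF is_atlas_proj])
qed

lemma lins_Z: "lins (\<lambda>z::complex^2. vector [z $ 1, z $ 2, 1] :: complex^3)
    (\<lambda>v. vector [v $ 1 / v $ 3, v $ 2 / v $ 3]) (\<lambda>v. v $ 3)"
  unfolding lins_def by (auto simp: vec_eq_iff forall_2 forall_3 intro!: cd cdiff_divide)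

lemma lins_X: "lins (\<lambda>z::complex^2. vector [1, z $ 1, z $ 2] :: complex^3)
    (\<lambda>v. vector [v $ 2 / v $ 1, v $ 3 / v $ 1]) (\<lambda>v. v $ 1)"
  unfolding lins_def by (auto simp: vec_eq_iff forall_2 forall_3 intro!: cd cdiff_divide)

text \<open>The shift by a puts the point [a : 1 : 0], a centre of blow-up, at the origin of the
  chart.\<close>

lemma lins_Y: "lins (\<lambda>z::complex^2. vector [a + z $ 1, 1, z $ 2] :: complex^3)
    (\<lambda>v. vector [v $ 1 / v $ 2 - a, v $ 3 / v $ 2]) (\<lambda>v. v $ 2)"
  unfolding lins_def
  by (auto simp: vec_eq_iff forall_2 forall_3 field_simps intro!: cd cdiff_divide)

lemma lins_1: "lins (\<lambda>z::complex^1. vector [1, z $ 1] :: complex^2)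
    (\<lambda>v. \<chi> i. v $ 2 / v $ 1) (\<lambda>v. v $ 1)"
  unfolding lins_def
  by (auto simp: vec_eq_iff forall_2 forall_1 field_simps intro!: cd cdv_lambda cdiff_divide)

lemma lins_2: "lins (\<lambda>z::complex^1. vector [z $ 1, 1] :: complex^2)
    (\<lambda>v. \<chi> i. v $ 1 / v $ 2) (\<lambda>v. v $ 2)"
  unfolding lins_def
  by (auto simp: vec_eq_iff forall_2 forall_1 field_simps intro!: cd cdv_lambda cdiff_divide)

section \<open>Projective maps\<close>

text \<open>The first two conditions of \<open>projective_embedding\<close>: a holomorphic map to
  projective N-space, possibly neither injective nor immersive.\<close>

definition psec :: "('a, 'n::finite) atlas \<Rightarrow> nat \<Rightarrow> ('a \<Rightarrow> nat \<Rightarrow> complex) \<Rightarrow> bool" where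
  "psec A N F \<longleftrightarrow> (\<forall>p\<in>pts A. \<exists>i\<le>N. F p i \<noteq> 0) \<and>
     (\<forall>i\<le>N. \<forall>k\<le>N. holo_fun A {p \<in> pts A. F p i \<noteq> 0} (\<lambda>p. F p k / F p i))"

lemma psecD:
  assumes "psec A N F"
  shows "p \<in> pts A ==> \<exists>i\<le>N. F p i \<noteq> 0"
    and "i \<le> N ==> k \<le> N ==> holo_fun A {p \<in> pts A. F p i \<noteq> 0} (\<lambda>p. F p k / F p i)"
  using assms by (auto simp: psec_def)

text \<open>F will come from arbitrarily chosen representatives of lines and is not holomorphic
  itself. Locally it has only to be a nonzero multiple of a holomorphic tuple G; the factor may vary
  without any regularity, because it cancels in the ratios.\<close>

lemma psecI:
  assumes A: "is_atlas A"
    and loc: "\<And>p. p \<in> pts A ==> \<exists>V P G z. par A V P \<and> z \<in> V \<and> P z = p \<and>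
      (\<forall>y\<in>V. \<forall>k\<le>N. cdiff (\<lambda>y. G y k) y) \<and>
      (\<forall>y\<in>V. \<exists>c. c \<noteq> 0 \<and> (\<forall>k\<le>N. F (P y) k = c * G y k)) \<and> (\<exists>k\<le>N. G z k \<noteq> 0)"
  shows "psec A N F"
  unfolding psec_def
proof (intro conjI ballI allI impI)
  fix p assume "p \<in> pts A"
  from loc[OF this] obtain V P G z k where "par A V P" and 1: "z \<in> V" "P z = p"
    "\<forall>y\<in>V. \<exists>c. c \<noteq> 0 \<and> (\<forall>k\<le>N. F (P y) k = c * G y k)" "k \<le> N" "(G z k :: complex) \<noteq> 0"
    by (elim exE conjE) (rule that)
  from bspec[OF 1(3,1)] obtain c where "c \<noteq> 0" "\<forall>k\<le>N. F p k = c * G z k" unfolding 1(2) by blast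
  then show "\<exists>i\<le>N. F p i \<noteq> 0" using 1(4,5) by auto
next
  fix i k assume ik: "i \<le> N" "k \<le> N"
  have main: "\<exists>V P z. par A V P \<and> z \<in> V \<and> P z = p \<and> P ` V \<subseteq> {p \<in> pts A. F p i \<noteq> 0} \<and>
      (cdiff (\<lambda>y. F (P y) k / F (P y) i) z)" if p: "p \<in> {p \<in> pts A. F p i \<noteq> 0}" for p
  proof -
    have "p \<in> pts A" using p by simp
    from loc[OF this] obtain V P G z where 1: "par A V P" "z \<in> V" "P z = p"
      "\<forall>y\<in>V. \<forall>k\<le>N. cdiff (\<lambda>y. G y k) y"
      "\<forall>y\<in>V. \<exists>c. c \<noteq> 0 \<and> (\<forall>k\<le>N. F (P y) k = c * G y k)"
      by (elim exE conjE) (rule that)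
    let ?V = "{y \<in> V. G y i \<noteq> 0}"
    have op: "open ?V" by (rule open_cdiff_nz) (use par_open[OF 1(1)] 1(4) ik in auto)
    have nz: "F (P y) i \<noteq> 0 \<longleftrightarrow> G y i \<noteq> 0" if "y \<in> V" for y
      using 1(5) that ik by (metis mult_eq_0_iff)
    have ratio: "F (P y) k / F (P y) i = G y k / G y i" if "y \<in> V" for y
    proof -
      obtain c where "c \<noteq> 0" "\<forall>k\<le>N. F (P y) k = c * G y k" using 1(5) \<open>y \<in> V\<close> by blast
      then show ?thesis using ik by simp
    qed
    have zV: "z \<in> ?V" using 1 p nz by auto
    have "cdiff (\<lambda>y. G y k / G y i) z"
      by (rule cdiff_divide) (use 1 ik zV in auto)
    then have "cdiff (\<lambda>y. F (P y) k / F (P y) i) z"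
      by (rule cdiff_cong[OF _ op zV]) (use ratio in auto)
    moreover have "par A ?V P" by (rule par_subset[OF 1(1) op]) auto
    moreover have "P ` ?V \<subseteq> {p \<in> pts A. F p i \<noteq> 0}" using nz par_pts[OF 1(1)] by auto
    ultimately show ?thesis using zV 1(3) by (intro exI conjI)
  qed
  show "holo_fun A {p \<in> pts A. F p i \<noteq> 0} (\<lambda>p. F p k / F p i)"
  proof (rule holo_funI[OF A])
    show "openin (mtop A) {p \<in> pts A. F p i \<noteq> 0}"
    proof (rule openinI[OF A])
      fix p assume "p \<in> {p \<in> pts A. F p i \<noteq> 0}"
      from main[OF this] obtain V P z where "par A V P" "z \<in> V" "P z = p" "P ` V \<subseteq> {p \<in> pts A. F p i \<noteq> 0}"
        by (elim exE conjE) (rule that)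
      then show "\<exists>V P. par A V P \<and> p \<in> P ` V \<and> P ` V \<subseteq> {p \<in> pts A. F p i \<noteq> 0}"
        by (intro exI[of _ V] exI[of _ P]) auto
    qed
    fix p assume "p \<in> {p \<in> pts A. F p i \<noteq> 0}"
    from main[OF this] obtain V P z where "par A V P" "z \<in> V" "P z = p" "cdiff (\<lambda>y. F (P y) k / F (P y) i) z"
      by (elim exE conjE) (rule that)
    then show "\<exists>V P z. par A V P \<and> z \<in> V \<and> P z = p \<and> cdiff (\<lambda>y. F (P y) k / F (P y) i) z"
      by (intro exI conjI)
  qed
qed

lemma open_holo_fun_vimage:
  assumes A: "is_atlas A" and g: "holo_fun A W g" and U: "open U"
  shows "openin (mtop A) {p \<in> W. g p \<in> U}"
proof (rule openinI[OF A])
  fix p assume p: "p \<in> {p \<in> W. g p \<in> U}"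
  have W: "openin (mtop A) W" using g by (rule holo_fun_openin)
  have "p \<in> pts A" using p W unfolding openin_mtop[OF A] by auto
  then obtain V P z where P: "par A V P" "z \<in> V" "P z = p" by (rule pts_par[OF A])
  let ?V = "{y \<in> V. P y \<in> W}"
  have opV: "open ?V" by (rule open_par_vimage[OF A P(1) W])
  have "continuous_on ?V (\<lambda>y. g (P y))"
    using holo_fun_cdiff[OF A g P(1)] cdiff_isCont by (intro continuous_at_imp_continuous_on) auto
  from continuous_open_preimage[OF this opV U] have op: "open {y \<in> ?V. g (P y) \<in> U}"
    by (simp add: vimage_def Int_def)
  have "par A {y \<in> ?V. g (P y) \<in> U} P" by (rule par_subset[OF P(1) op]) auto
  then show "\<exists>V P. par A V P \<and> p \<in> P ` V \<and> P ` V \<subseteq> {p \<in> W. g p \<in> U}"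
    using P p by (intro exI[of _ "{y \<in> ?V. g (P y) \<in> U}"] exI[of _ P]) auto
qed

lemma separated_by_psec:
  assumes A: "is_atlas A" and F: "psec A N F" and pq: "p \<in> pts A" "q \<in> pts A"
    and ne: "\<not> (\<exists>c. \<forall>i\<le>N. F q i = c * F p i)"
  shows "\<exists>U V. openin (mtop A) U \<and> openin (mtop A) V \<and> p \<in> U \<and> q \<in> V \<and> disjnt U V"
proof (cases "\<exists>i\<le>N. F p i \<noteq> 0 \<and> F q i \<noteq> 0")
  case True
  then obtain i where i: "i \<le> N" "F p i \<noteq> 0" "F q i \<noteq> 0" by blast
  have "\<exists>k\<le>N. F p k / F p i \<noteq> F q k / F q i"
  proof (rule ccontr)
    assume "\<not> ?thesis"
    then have "\<forall>k\<le>N. F q k = (F q i / F p i) * F p k" using i by (auto simp: field_simps)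
    then show False using ne by blast
  qed
  then obtain k where k: "k \<le> N" "F p k / F p i \<noteq> F q k / F q i" by blast
  obtain U V where U: "open U" "open V" "F p k / F p i \<in> U" "F q k / F q i \<in> V" "U \<inter> V = {}"
    using hausdorff[OF k(2)] by blast
  note o = open_holo_fun_vimage[OF A psecD(2)[OF F i(1) k(1)]]
  show ?thesis
    by (intro exI conjI, rule o[OF U(1)], rule o[OF U(2)]) (use U i pq in "auto simp: disjnt_iff")
next
  case False
  obtain i where i: "i \<le> N" "F p i \<noteq> 0" using psecD(1)[OF F pq(1)] by blast
  obtain j where j: "j \<le> N" "F q j \<noteq> 0" using psecD(1)[OF F pq(2)] by blast
  have 0: "F q i = 0" "F p j = 0" using False i j by auto
  \<comment> \<open>The two ratios are inverse to each other where both make sense, so the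
    neighbourhoods on which one or the other has norm below 1 are disjoint.\<close>
  have d: "False" if "norm (F x j / F x i) < 1" "norm (F x i / F x j) < 1" "F x i \<noteq> 0" "F x j \<noteq> 0" for x
    using that by (auto simp: norm_divide)
  note o = open_holo_fun_vimage[OF A psecD(2)[OF F i(1) j(1)] open_ball[of 0 1]]
    open_holo_fun_vimage[OF A psecD(2)[OF F j(1) i(1)] open_ball[of 0 1]]
  show ?thesis
    by (intro exI conjI, rule o(1), rule o(2))
      (use 0 i j pq d in "auto simp: disjnt_iff")
qed

text \<open>The Segre product. The pair (i, j) with j \<le> M is encoded as i * Suc M + j, so the
  largest index is N * Suc M + M.\<close>

definition ptensor :: "nat \<Rightarrow> ('a \<Rightarrow> nat \<Rightarrow> complex) \<Rightarrow> ('a \<Rightarrow> nat \<Rightarrow> complex) \<Rightarrow> 'a \<Rightarrow> nat \<Rightarrow> complex" where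
  "ptensor M F G p k = F p (k div Suc M) * G p (k mod Suc M)"

lemma ptensor_index: "i \<le> N ==> j \<le> M ==> ptensor M F G p (i * Suc M + j) = F p i * G p j"
  and ptensor_index_le: "i \<le> N ==> j \<le> M ==> i * Suc M + j \<le> N * Suc M + M"
  by (auto simp: ptensor_def div_mult_self3 intro: add_mono mult_le_mono simp del: mult_Suc_right)

lemma ptensor_unindex: "k \<le> N * Suc M + M ==> k div Suc M \<le> N" "k mod Suc M \<le> M"
proof -
  assume "k \<le> N * Suc M + M"
  then have "k < Suc N * Suc M" by simp
  then show "k div Suc M \<le> N" by (metis less_Suc_eq_le less_mult_imp_div_less)
qed (metis less_Suc_eq_le mod_less_divisor zero_less_Suc)

lemma holo_fun_mult:
  assumes A: "is_atlas A" and "holo_fun A W f" "holo_fun A W' g"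
  shows "holo_fun A (W \<inter> W') (\<lambda>p. f p * g p)"
proof (rule holo_funI[OF A])
  show op: "openin (mtop A) (W \<inter> W')" using assms holo_fun_openin by blast
  fix p assume p: "p \<in> W \<inter> W'"
  then have "p \<in> pts A" using op unfolding openin_mtop[OF A] by auto
  then obtain V P z where P: "par A V P" "z \<in> V" "P z = p" by (rule pts_par[OF A])
  have "cdiff (\<lambda>y. f (P y) * g (P y)) z"
    by (intro cdiff_mult holo_fun_cdiff[OF A assms(2) P(1,2)] holo_fun_cdiff[OF A assms(3) P(1,2)])
      (use p P in auto)
  then show "\<exists>V P z. par A V P \<and> z \<in> V \<and> P z = p \<and> cdiff (\<lambda>y. f (P y) * g (P y)) z"
    using P by (intro exI conjI)
qed

lemma psec_ptensor:
  assumes A: "is_atlas A" and F: "psec A N F" and G: "psec A M G"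
  shows "psec A (N * Suc M + M) (ptensor M F G)"
  unfolding psec_def
proof (intro conjI ballI allI impI)
  fix p assume p: "p \<in> pts A"
  obtain i where i: "i \<le> N" "F p i \<noteq> 0" using psecD(1)[OF F p] by blast
  obtain j where j: "j \<le> M" "G p j \<noteq> 0" using psecD(1)[OF G p] by blast
  show "\<exists>k\<le>N * Suc M + M. ptensor M F G p k \<noteq> 0"
    by (intro exI conjI, rule ptensor_index_le[OF i(1) j(1)])
      (use i j in "simp only: ptensor_index mult_eq_0_iff, simp")
next
  fix i k assume ik: "i \<le> N * Suc M + M" "k \<le> N * Suc M + M"
  note u = ptensor_unindex(1)[OF ik(1)] ptensor_unindex(1)[OF ik(2)] ptensor_unindex(2)
  have "holo_fun A ({p \<in> pts A. F p (i div Suc M) \<noteq> 0} \<inter> {p \<in> pts A. G p (i mod Suc M) \<noteq> 0})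
      (\<lambda>p. F p (k div Suc M) / F p (i div Suc M) * (G p (k mod Suc M) / G p (i mod Suc M)))"
    by (rule holo_fun_mult[OF A psecD(2)[OF F] psecD(2)[OF G]]) (use u in auto)
  moreover have "{p \<in> pts A. F p (i div Suc M) \<noteq> 0} \<inter> {p \<in> pts A. G p (i mod Suc M) \<noteq> 0} =
      {p \<in> pts A. ptensor M F G p i \<noteq> 0}"
    by (auto simp: ptensor_def)
  ultimately show "holo_fun A {p \<in> pts A. ptensor M F G p i \<noteq> 0} (\<lambda>p. ptensor M F G p k / ptensor M F G p i)"
    by (simp add: ptensor_def)
qed

definition prop_at :: "nat \<Rightarrow> ('a \<Rightarrow> nat \<Rightarrow> complex) \<Rightarrow> 'a \<Rightarrow> 'a \<Rightarrow> bool" where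
  "prop_at N F p q \<longleftrightarrow> (\<exists>c. \<forall>i\<le>N. F q i = c * F p i)"

text \<open>An index at which one factor is nonzero at q can be held fixed and divided out, which
  leaves proportionality of the other factor.\<close>

lemma prop_at_ptensor:
  assumes A: "is_atlas A" and F: "psec A N F" and G: "psec A M G" and pq: "p \<in> pts A" "q \<in> pts A"
    and pr: "prop_at (N * Suc M + M) (ptensor M F G) p q"
  shows "prop_at N F p q" "prop_at M G p q"
proof -
  obtain c where c: "\<And>k. k \<le> N * Suc M + M ==> ptensor M F G q k = c * ptensor M F G p k"
    using pr unfolding prop_at_def by blast
  have e: "F q i * G q j = c * (F p i * G p j)" if "i \<le> N" "j \<le> M" for i j
    using c[OF ptensor_index_le[OF that]] ptensor_index[OF that] by metis
  obtain i where i: "i \<le> N" "F q i \<noteq> 0" using psecD(1)[OF F pq(2)] by blast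
  obtain j where j: "j \<le> M" "G q j \<noteq> 0" using psecD(1)[OF G pq(2)] by blast
  show "prop_at N F p q" unfolding prop_at_def
    by (rule exI[of _ "c * G p j / G q j"]) (use e[OF _ j(1)] j(2) in "auto simp: field_simps")
  show "prop_at M G p q" unfolding prop_at_def
    by (rule exI[of _ "c * F p i / F q i"]) (use e[OF i(1)] i(2) in "auto simp: field_simps")
qed

text \<open>The last clause is for immersions: every affine coordinate of every member, relative to
  a suitable index j, reappears literally among the affine coordinates of the product. A tangent
  vector killed by the product is therefore killed by every member.\<close>

lemma psec_family:
  assumes A: "is_atlas A" and fs: "\<forall>(N, F)\<in>set fs. psec A N F"
  shows "\<exists>N F. psec A N F \<and>
     (\<forall>p\<in>pts A. \<forall>q\<in>pts A. prop_at N F p q \<longrightarrow> (\<forall>(M, G)\<in>set fs. prop_at M G p q)) \<and>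
     (\<forall>p\<in>pts A. \<forall>i\<le>N. F p i \<noteq> 0 \<longrightarrow> (\<forall>(M, G)\<in>set fs. \<exists>j\<le>M. G p j \<noteq> 0 \<and>
        (\<forall>k\<le>M. \<exists>l\<le>N. \<forall>q. F q i \<noteq> 0 \<longrightarrow> F q l / F q i = G q k / G q j)))"
  using fs
proof (induction fs)
  case Nil
  \<comment> \<open>The constant map to a point is the unit of the Segre product.\<close>
  have "psec A 0 (\<lambda>_ _. 1)"
  proof -
    have "holo_fun A (pts A) (\<lambda>_. 1)"
    proof (rule holo_funI[OF A])
      show "openin (mtop A) (pts A)" by (metis A openin_topspace topspace_mtop)
      fix p assume "p \<in> pts A"
      then obtain V P z where "par A V P" "z \<in> V" "P z = p" by (rule pts_par[OF A])
      then show "\<exists>V P z. par A V P \<and> z \<in> V \<and> P z = p \<and> cdiff (\<lambda>y. 1) z"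
        using cdiff_const by blast
    qed
    then show ?thesis by (auto simp: psec_def)
  qed
  then show ?case by (intro exI[of _ 0] exI[of _ "\<lambda>_ _. 1"]) auto
next
  case (Cons f fs)
  obtain M G where f: "f = (M, G)" by force
  have G: "psec A M G" using Cons.prems f by simp
  have *: "\<forall>(N, F)\<in>set fs. psec A N F" using Cons.prems by simp
  obtain N F where F: "psec A N F"
    and F1: "\<forall>p\<in>pts A. \<forall>q\<in>pts A. prop_at N F p q \<longrightarrow> (\<forall>(M, G)\<in>set fs. prop_at M G p q)"
    and F2: "\<forall>p\<in>pts A. \<forall>i\<le>N. F p i \<noteq> 0 \<longrightarrow> (\<forall>(M, G)\<in>set fs. \<exists>j\<le>M. G p j \<noteq> 0 \<and>
        (\<forall>k\<le>M. \<exists>l\<le>N. \<forall>q. F q i \<noteq> 0 \<longrightarrow> F q l / F q i = G q k / G q j))"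
    using Cons.IH[OF *] by (elim exE conjE) (rule that)
  let ?H = "ptensor M F G" and ?L = "N * Suc M + M"
  have H: "psec A ?L ?H" by (rule psec_ptensor[OF A F G])
  moreover have "\<forall>(M', G')\<in>set (f # fs). prop_at M' G' p q"
    if "p \<in> pts A" "q \<in> pts A" "prop_at ?L ?H p q" for p q
    using prop_at_ptensor[OF A F G that] F1 that f by auto
  moreover have "\<exists>j\<le>M'. G' p j \<noteq> 0 \<and> (\<forall>k\<le>M'. \<exists>l\<le>?L. \<forall>q. ?H q i \<noteq> 0 \<longrightarrow> ?H q l / ?H q i = G' q k / G' q j)"
    if p: "p \<in> pts A" and i: "i \<le> ?L" "?H p i \<noteq> 0" and MG: "(M', G') \<in> set (f # fs)" for p i M' G'
  proof -
    let ?i = "i div Suc M" and ?j = "i mod Suc M"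
    have nz: "F p ?i \<noteq> 0" "G p ?j \<noteq> 0" using i(2) by (auto simp: ptensor_def)
    have ij: "?i \<le> N" "?j \<le> M" using ptensor_unindex(1)[OF i(1)] ptensor_unindex(2) by auto
    have r1: "?H q (?i * Suc M + k) / ?H q i = G q k / G q ?j" if "?H q i \<noteq> 0" "k \<le> M" for q k
      using that ptensor_index[OF ij(1) that(2), of F G q] by (simp add: ptensor_def)
    have r2: "?H q (k * Suc M + ?j) / ?H q i = F q k / F q ?i" if "?H q i \<noteq> 0" "k \<le> N" for q k
      using that ptensor_index[OF that(2) ij(2), of F G q] by (simp add: ptensor_def)
    show ?thesis
    proof (cases "(M', G') = (M, G)")
      case True
      have "\<exists>l\<le>?L. \<forall>q. ?H q i \<noteq> 0 \<longrightarrow> ?H q l / ?H q i = G q k / G q ?j" if "k \<le> M" for k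
        by (intro exI[of _ "?i * Suc M + k"] conjI ptensor_index_le[OF ij(1) that] allI impI r1 that)
      then show ?thesis using True nz ij by (intro exI[of _ ?j]) simp
    next
      case False
      then have 2: "(M', G') \<in> set fs" using MG f by auto
      obtain j where j: "j \<le> M'" "G' p j \<noteq> 0"
        "\<forall>k\<le>M'. \<exists>l\<le>N. \<forall>q. F q ?i \<noteq> 0 \<longrightarrow> F q l / F q ?i = G' q k / G' q j"
        using F2[rule_format, OF p ij(1) nz(1) 2] unfolding prod.case by (elim exE conjE) (rule that)
      have "\<exists>l\<le>?L. \<forall>q. ?H q i \<noteq> 0 \<longrightarrow> ?H q l / ?H q i = G' q k / G' q j" if k: "k \<le> M'" for k
      proof -
        obtain l where l: "l \<le> N" "\<forall>q. F q ?i \<noteq> 0 \<longrightarrow> F q l / F q ?i = G' q k / G' q j" using j(3) k by blast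
        have "F q ?i \<noteq> 0" if "?H q i \<noteq> 0" for q using that by (auto simp: ptensor_def)
        then have "\<forall>q. ?H q i \<noteq> 0 \<longrightarrow> ?H q (l * Suc M + ?j) / ?H q i = G' q k / G' q j"
          using l(2) r2[OF _ l(1)] by simp
        then show ?thesis using ptensor_index_le[OF l(1) ij(2)] by blast
      qed
      then show ?thesis using j(1,2) by (intro exI[of _ j]) simp
    qed
  qed
  ultimately show ?case by (intro exI[of _ ?L] exI[of _ ?H]) auto
qed

text \<open>
  Maps to projective spaces which are jointly injective and contain local coordinates among their
  affine coordinates combine, by the Segre embedding, to a projective embedding.
\<close>

lemma projective_embeddingI:
  assumes A: "is_atlas A" and fs: "\<forall>(N, F)\<in>set fs. psec A N F"
    and sep: "\<And>p q. p \<in> pts A ==> q \<in> pts A ==> (\<And>N F. (N, F) \<in> set fs ==> prop_at N F p q) ==> p = q"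
    and imm: "\<And>p. p \<in> pts A ==> \<exists>V P z. par A V P \<and> z \<in> V \<and> P z = p \<and>
      (\<forall>m. \<exists>N F i k b. (N, F) \<in> set fs \<and> i \<le> N \<and> k \<le> N \<and>
        (\<forall>y\<in>V. F (P y) i \<noteq> 0 \<and> F (P y) k / F (P y) i = b + y $ m))"
  shows "\<exists>N F. projective_embedding A N F"
proof -
  obtain N F where F: "psec A N F"
    and F1: "\<forall>p\<in>pts A. \<forall>q\<in>pts A. prop_at N F p q \<longrightarrow> (\<forall>(M, G)\<in>set fs. prop_at M G p q)"
    and F2: "\<forall>p\<in>pts A. \<forall>i\<le>N. F p i \<noteq> 0 \<longrightarrow> (\<forall>(M, G)\<in>set fs. \<exists>j\<le>M. G p j \<noteq> 0 \<and>
        (\<forall>k\<le>M. \<exists>l\<le>N. \<forall>q. F q i \<noteq> 0 \<longrightarrow> F q l / F q i = G q k / G q j))"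
    using psec_family[OF A fs] by (elim exE conjE) (rule that)
  have "v = 0" if U: "(U, \<phi>) \<in> A" and p: "p \<in> U" and i: "i \<le> N" "F p i \<noteq> 0"
    and ker: "\<And>k. k \<le> N ==> frechet_derivative (\<lambda>z. F (inv_into U \<phi> z) k / F (inv_into U \<phi> z) i) (at (\<phi> p)) v = 0"
    for U \<phi> p i v
  proof -
    let ?I = "inv_into U \<phi>"
    have inj: "inj_on \<phi> U" by (rule is_atlas_inj[OF A U])
    have Ip: "?I (\<phi> p) = p" "\<phi> p \<in> \<phi> ` U" using inj p by auto
    have pA: "p \<in> pts A" using U p by (auto simp: pts_def)
    obtain V P z where P: "par A V P" "z \<in> V" "P z = p"
      and im: "\<forall>m. \<exists>N F i k b. (N, F) \<in> set fs \<and> i \<le> N \<and> k \<le> N \<and>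
        (\<forall>y\<in>V. F (P y) i \<noteq> 0 \<and> F (P y) k / F (P y) i = b + y $ m)"
      using imm[OF pA] by (elim exE conjE) (rule that)
    have "fac ?I (\<phi> p) P V" by (rule par_fac[OF A chart_par[OF A U] P(1)]) (use Ip P in auto)
    then obtain W \<tau> where W: "open W" "\<phi> p \<in> W" "\<And>y. y \<in> W ==> \<tau> y \<in> V \<and> ?I y = P (\<tau> y) \<and> cdv \<tau> y"
      unfolding fac_def by (elim exE conjE) (rule that, (assumption | erule (1) bspec)+)
    have "fac P z ?I (\<phi> ` U)" by (rule par_fac[OF A P(1) chart_par[OF A U]]) (use Ip P in auto)
    then obtain W' \<tau>' where W': "open W'" "z \<in> W'" "\<And>y. y \<in> W' ==> \<tau>' y \<in> \<phi> ` U \<and> P y = ?I (\<tau>' y) \<and> cdv \<tau>' y"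
      unfolding fac_def by (elim exE conjE) (rule that, (assumption | erule (1) bspec)+)
    have tz: "\<tau> (\<phi> p) = z"
      by (rule inj_onD[OF par_inj[OF P(1)]]) (use W(3)[OF W(2)] Ip P in auto)
    have I: "?I y \<in> U" "\<phi> (?I y) = y" if "y \<in> \<phi> ` U" for y
      using that by (auto intro: inv_into_into f_inv_into_f)
    have cvt: "cdv \<tau> (\<phi> p)" "cdv \<tau>' (\<tau> (\<phi> p))" using W(3)[OF W(2)] W'(3)[OF W'(2)] tz by auto
    obtain D where D: "(\<tau> has_derivative D) (at (\<phi> p))" by (rule cdv_has_derivative[OF cvt(1)])
    obtain E where E: "(\<tau>' has_derivative E) (at (\<tau> (\<phi> p)))" by (rule cdv_has_derivative[OF cvt(2)])
    let ?X = "{y \<in> W. \<tau> y \<in> W'} \<inter> \<phi> ` U"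
    have opU: "open (\<phi> ` U)" using A U by (auto simp: is_atlas_def)
    have opX: "open ?X" by (intro open_Int opU cdv_open_vimage[OF W(1) _ W'(1)]) (use W(3) in auto)
    have X: "\<phi> p \<in> ?X" using W(2) W'(2) tz Ip by auto
    \<comment> \<open>Since \<tau>' inverts \<tau> near the point, the derivative D of \<tau> is
      injective, and it remains to show that D v = 0.\<close>
    have "\<tau>' (\<tau> y) = y" if "y \<in> ?X" for y
    proof -
      have "?I (\<tau>' (\<tau> y)) = ?I y" using that W(3)[of y] W'(3)[of "\<tau> y"] by auto
      then show ?thesis using I(2) that W'(3)[of "\<tau> y"] by (metis (no_types, lifting) Int_iff mem_Collect_eq)
    qed
    with has_derivative_compose[OF D E] have "((\<lambda>y. y) has_derivative (\<lambda>v. E (D v))) (at (\<phi> p))"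
      by (rule has_derivative_transform_within_open[OF _ opX X])
    then have ED: "E (D v) = v" for v
      using has_derivative_unique[OF _ has_derivative_ident] by (metis (no_types))
    have E0: "E 0 = 0" using has_derivative_bounded_linear[OF E] by (simp add: linear_simps)
    \<comment> \<open>The coordinate y $ m is given relative to an index j, whereas the kernel
      condition controls ratios relative to an index i' supplied by the product. The quotient rule
      leads from one to the other.\<close>
    have "D v $ m = 0" for m
    proof -
      obtain M G j k b where MG: "(M, G) \<in> set fs" "j \<le> M" "k \<le> M"
        and G: "\<And>y. y \<in> V ==> G (P y) j \<noteq> 0 \<and> G (P y) k / G (P y) j = b + y $ m"
        using im by metis
      obtain i' where i': "i' \<le> M" "G p i' \<noteq> 0"
        "\<forall>k\<le>M. \<exists>l\<le>N. \<forall>q. F q i \<noteq> 0 \<longrightarrow> F q l / F q i = G q k / G q i'"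
        using F2[rule_format, OF pA i MG(1)] unfolding prod.case by (elim exE conjE) (rule that)
      have gs: "psec A M G" using fs MG(1) by auto
      have der: "((\<lambda>y. G (?I y) k / G (?I y) i') has_derivative f') (at (\<phi> p)) ==> f' v = 0" if k: "k \<le> M" for k f'
      proof -
        assume f': "((\<lambda>y. G (?I y) k / G (?I y) i') has_derivative f') (at (\<phi> p))"
        obtain l where l: "l \<le> N" "\<And>q. F q i \<noteq> 0 ==> F q l / F q i = G q k / G q i'" using i'(3) k by metis
        let ?Y = "{y \<in> \<phi> ` U. ?I y \<in> {q \<in> pts A. F q i \<noteq> 0}}"
        have "open ?Y"
          by (rule open_par_vimage[OF A chart_par[OF A U] holo_fun_openin[OF psecD(2)[OF F i(1) i(1)]]])
        moreover have "\<phi> p \<in> ?Y" using Ip i pA by auto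
        ultimately have "((\<lambda>y. F (?I y) l / F (?I y) i) has_derivative f') (at (\<phi> p))"
          by (rule has_derivative_transform_within_open[OF f']) (use l(2) in auto)
        from frechet_derivative_at[OF this] ker[OF l(1)] show "f' v = 0" by simp
      qed
      have hf: "cdiff (\<lambda>y. G (?I y) k / G (?I y) i') (\<phi> p)" if "k \<le> M" for k
        using holo_fun_cdiff[OF A psecD(2)[OF gs i'(1) that] chart_par[OF A U], of "\<phi> p"] Ip i'(2) pA by simp
      obtain f1 where f1: "((\<lambda>y. G (?I y) k / G (?I y) i') has_derivative f1) (at (\<phi> p))"
        using hf[OF MG(3)] unfolding cdiff_def by blast
      obtain f2 where f2: "((\<lambda>y. G (?I y) j / G (?I y) i') has_derivative f2) (at (\<phi> p))"
        using hf[OF MG(2)] unfolding cdiff_def by blast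
      have z12: "f1 v = 0" "f2 v = 0" using der[OF MG(3) f1] der[OF MG(2) f2] by auto
      have "G (?I (\<phi> p)) j / G (?I (\<phi> p)) i' \<noteq> 0" using G[OF P(2)] P(3) Ip i'(2) by simp
      from has_derivative_divide[OF f1 f2 this]
      have "((\<lambda>y. (G (?I y) k / G (?I y) i') / (G (?I y) j / G (?I y) i')) has_derivative
         (\<lambda>h. - (G (?I (\<phi> p)) k / G (?I (\<phi> p)) i') * (inverse (G (?I (\<phi> p)) j / G (?I (\<phi> p)) i') * f2 h *
            inverse (G (?I (\<phi> p)) j / G (?I (\<phi> p)) i')) + f1 h / (G (?I (\<phi> p)) j / G (?I (\<phi> p)) i'))) (at (\<phi> p))"
        (is "(_ has_derivative ?R) _") .
      then have 1: "((\<lambda>y. b + \<tau> y $ m) has_derivative ?R) (at (\<phi> p))"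
      proof (rule has_derivative_transform_within_open)
        let ?Y = "{y \<in> \<phi> ` U. ?I y \<in> {q \<in> pts A. G q i' \<noteq> 0}} \<inter> W"
        show "open ?Y"
          by (intro open_Int W(1) open_par_vimage[OF A chart_par[OF A U]] holo_fun_openin[OF psecD(2)[OF gs i'(1) i'(1)]])
        show "\<phi> p \<in> ?Y" using Ip i' pA W by auto
        fix y assume y: "y \<in> ?Y"
        then have "?I y = P (\<tau> y)" "\<tau> y \<in> V" "G (?I y) i' \<noteq> 0" using W(3) by auto
        then show "G (?I y) k / G (?I y) i' / (G (?I y) j / G (?I y) i') = b + \<tau> y $ m"
          using G[of "\<tau> y"] by simp
      qed
      have 2: "((\<lambda>y. b + \<tau> y $ m) has_derivative (\<lambda>h. D h $ m)) (at (\<phi> p))"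
        using has_derivative_add[OF has_derivative_const[of b]
            bounded_linear.has_derivative[OF bounded_linear_vec_nth D, of m]] by simp
      have "D v $ m = ?R v" using has_derivative_unique[OF 1 2] by metis
      then show ?thesis using z12 by simp
    qed
    then have "D v = 0" by (simp add: vec_eq_iff)
    then show "v = 0" using ED[of v] E0 by simp
  qed
  note main = this
  have "projective_embedding A N F"
    unfolding projective_embedding_def
  proof (intro conjI ballI allI impI)
    fix p q assume pq: "p \<in> pts A" "q \<in> pts A" "\<exists>c. \<forall>i\<le>N. F q i = c * F p i"
    show "p = q"
    proof (rule sep[OF pq(1,2)])
      fix M G assume "(M, G) \<in> set fs"
      moreover have "\<forall>(M, G)\<in>set fs. prop_at M G p q"
        using F1[rule_format, OF pq(1,2)] pq(3) unfolding prop_at_def by blast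
      ultimately show "prop_at M G p q" by auto
    qed
  next
    fix x assume x: "x \<in> A"
    obtain U \<phi> where "x = (U, \<phi>)" by force
    with x main[of U \<phi>] show "case x of (U, \<phi>) \<Rightarrow> \<forall>p\<in>U. \<forall>i\<le>N. F p i \<noteq> 0 \<longrightarrow>
        (\<forall>v. (\<forall>k\<le>N. frechet_derivative (\<lambda>z. F (inv_into U \<phi> z) k / F (inv_into U \<phi> z) i) (at (\<phi> p)) v = 0)
          \<longrightarrow> v = 0)"
      by simp
  qed (use psecD[OF F] in auto)
  then show ?thesis by blast
qed

section \<open>Blowing up a point of a surface\<close>

lemma fac_cong:
  assumes "fac P z Q V" "open X" "z \<in> X" "\<And>y. y \<in> X ==> P' y = P y"
  shows "fac P' z Q V"
proof -
  obtain W \<tau> where W: "open W" "z \<in> W" "\<And>y. y \<in> W ==> \<tau> y \<in> V \<and> P y = Q (\<tau> y) \<and> cdv \<tau> y"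
    using assms(1) unfolding fac_def by (elim exE conjE) (rule that, (assumption | erule (1) bspec)+)
  show ?thesis
    by (rule facI[of "W \<inter> X" _ \<tau>]) (use W assms in auto)
qed

lemma fac_cong_right:
  assumes "fac P z Q V" "\<And>y. y \<in> V ==> Q' y = Q y"
  shows "fac P z Q' V"
proof -
  obtain W \<tau> where W: "open W" "z \<in> W" "\<And>y. y \<in> W ==> \<tau> y \<in> V \<and> P y = Q (\<tau> y) \<and> cdv \<tau> y"
    using assms(1) unfolding fac_def by (elim exE conjE) (rule that, (assumption | erule (1) bspec)+)
  show ?thesis
    by (rule facI[of W _ \<tau>]) (use W assms in auto)
qed

lemma par_cong:
  assumes P: "par A V P" and eq: "\<And>y. y \<in> V ==> P' y = P y"
  shows "par A V P'"
  unfolding par_def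
proof (intro conjI ballI)
  show "open V" by (rule par_open[OF P])
  show "inj_on P' V" using par_inj[OF P] eq by (simp add: inj_on_def)
  fix z assume z: "z \<in> V"
  obtain V' Q z' where 1: "lpar A V' Q" "z' \<in> V'" "Q z' = P z" "fac P z Q V'" "fac Q z' P V"
    using P z unfolding par_def by meson
  show "\<exists>V' Q z'. lpar A V' Q \<and> z' \<in> V' \<and> Q z' = P' z \<and> fac P' z Q V' \<and> fac Q z' P' V"
    using 1 fac_cong[OF 1(4) par_open[OF P] z eq] fac_cong_right[OF 1(5) eq] eq[OF z]
    by (intro exI[of _ V'] exI[of _ Q] exI[of _ z']) simp
qed

lemma vec2_eqI: "x $ 1 = y $ 1 ==> x $ 2 = y $ 2 ==> x = (y :: complex^2)"
  by (simp add: vec_eq_iff forall_2)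

text \<open>
  The two standard charts of the blow-up of the origin. In each of them, \<^term>\<open>bexc b\<close> is an equation of
  the exceptional curve, and \<^term>\<open>bdir b z\<close> spans the line belonging to the point \<^term>\<open>z\<close>.
\<close>

definition bmap :: "bool \<Rightarrow> complex^2 \<Rightarrow> complex^2" where
  "bmap b z = (if b then vector [z $ 1, z $ 1 * z $ 2] else vector [z $ 1 * z $ 2, z $ 2])"
definition bexc :: "bool \<Rightarrow> complex^2 \<Rightarrow> complex" where
  "bexc b z = (if b then z $ 1 else z $ 2)"
definition bdir :: "bool \<Rightarrow> complex^2 \<Rightarrow> complex^2" where
  "bdir b z = (if b then vector [1, z $ 2] else vector [z $ 1, 1])"
definition binv :: "bool \<Rightarrow> complex^2 \<Rightarrow> complex^2" where
  "binv b x = (if b then vector [x $ 1, x $ 2 / x $ 1] else vector [x $ 1 / x $ 2, x $ 2])"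
text \<open>The change from chart b to the other chart, valid where the slope coordinate is
  nonzero.\<close>

definition bflip :: "bool \<Rightarrow> complex^2 \<Rightarrow> complex^2" where
  "bflip b z = (if b then vector [1 / z $ 2, z $ 1 * z $ 2] else vector [z $ 1 * z $ 2, 1 / z $ 1])"

lemmas bdefs = bmap_def bexc_def bdir_def binv_def

lemma bmap_eq: "bmap b z = bexc b z *s bdir b z"
  by (rule vec2_eqI) (auto simp: bdefs)

lemma bexc_bmap: "bexc b (bmap b z) = bexc b z"
  and bexc_binv: "bexc b (binv b x) = bexc b x"
  and binv_bmap: "bexc b z \<noteq> 0 ==> binv b (bmap b z) = z"
  and bmap_binv: "bexc b x \<noteq> 0 ==> bmap b (binv b x) = x"
  and bdir_nz: "bdir b z \<noteq> 0"
  by (auto simp: bdefs vec_eq_iff forall_2 split: if_splits)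

lemma bmap_0_iff: "bmap b z = 0 \<longleftrightarrow> bexc b z = 0"
  using bdir_nz by (auto simp: bmap_eq)

lemma bdir_inj:
  assumes "bexc b z = bexc b z'" "pline (bdir b z) = pline (bdir b z')"
  shows "z = z'"
proof -
  obtain c where "bdir b z = c *s bdir b z'" using pline_eqD[OF assms(2)] by blast
  then show ?thesis using assms(1) by (auto simp: bdefs vec_eq_iff forall_2 split: if_splits)
qed

lemma bexc_exists: "x \<noteq> 0 ==> \<exists>b. bexc b x \<noteq> 0"
  by (auto simp: bexc_def vec_eq_iff forall_2 intro: exI[of _ True] exI[of _ False])

lemma cdiff_bexc: "cdiff (bexc b) z"
proof -
  have "bexc b = (\<lambda>z. z $ (if b then 1 else 2))" by (auto simp: bexc_def)
  then show ?thesis by (simp add: cdiff_nth)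
qed

lemma cdv_bmap: "cdv (bmap b) z"
  unfolding bmap_def by (cases b) (auto intro!: cd)

lemma cdv_binv: "bexc b x \<noteq> 0 ==> cdv (binv b) x"
  unfolding binv_def bexc_def by (cases b) (auto intro!: cd cdiff_divide)

definition blV :: "(complex^2) set \<Rightarrow> bool \<Rightarrow> (complex^2) set" where
  "blV V b = {z. bmap b z \<in> V}"

text \<open>The map e names the points of the exceptional curve by lines. All other points keep
  their old names, so the blow-down moves exceptional points only.\<close>

definition blP :: "(complex^2 \<Rightarrow> 'a) \<Rightarrow> ((complex^2) set \<Rightarrow> 'a) \<Rightarrow> bool \<Rightarrow> complex^2 \<Rightarrow> 'a" where
  "blP P e b z = (if bexc b z = 0 then e (pline (bdir b z)) else P (bmap b z))"

abbreviation plines :: "(complex^2) set set" where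
  "plines \<equiv> {pline v | v. v \<noteq> 0}"

definition pch :: "(complex^('n::finite)) set \<Rightarrow> (complex^'n \<Rightarrow> 'a) \<Rightarrow> 'a set \<times> ('a \<Rightarrow> complex^'n)" where
  "pch V P = (P ` V, inv_into V P)"

lemma pts_insert_pch: "pts (insert (pch V P) A) = P ` V \<union> pts A"
  by (auto simp: pts_def pch_def)

text \<open>The chart P around the centre is replaced by the two charts of its blow-up. The
  remaining charts \<open>A0\<close> are meant to avoid the centre and are kept unchanged.\<close>

definition blow :: "(complex^2) set \<Rightarrow> (complex^2 \<Rightarrow> 'a) \<Rightarrow> ((complex^2) set \<Rightarrow> 'a) \<Rightarrow> ('a, 2) atlas \<Rightarrow> ('a, 2) atlas" where
  "blow V P e A0 = insert (pch (blV V True) (blP P e True)) (insert (pch (blV V False) (blP P e False)) A0)"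

definition contr :: "'a \<Rightarrow> ((complex^2) set \<Rightarrow> 'a) \<Rightarrow> 'a \<Rightarrow> 'a" where
  "contr p e q = (if q \<in> e ` plines then p else q)"

lemma open_blV: "open V ==> open (blV V b)"
  using cdv_open_vimage[of UNIV "bmap b" V] cdv_bmap by (simp add: blV_def)

lemma bdir_plines: "pline (bdir b z) \<in> plines"
  using bdir_nz by blast

lemma plines_bdir:
  assumes "l \<in> plines"
  obtains b z where "l = pline (bdir b z)" "bexc b z = 0"
proof -
  obtain v where v: "l = pline v" "v \<noteq> 0" using assms by blast
  show thesis
  proof (cases "v $ 1 = 0")
    case True
    then have "v $ 2 \<noteq> 0" using v(2) by (auto simp: vec_eq_iff forall_2)
    then have "l = pline (bdir False (vector [v $ 1 / v $ 2, 0]))"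
      unfolding v(1) by (intro pline_eqI[of "v $ 2"]) (auto simp: bdir_def vec_eq_iff forall_2)
    then show thesis using that by (auto simp: bexc_def)
  next
    case False
    then have "l = pline (bdir True (vector [0, v $ 2 / v $ 1]))"
      unfolding v(1) by (intro pline_eqI[of "v $ 1"]) (auto simp: bdir_def vec_eq_iff forall_2)
    then show thesis using that by (auto simp: bexc_def)
  qed
qed

text \<open>A point of the blow-up is a point of the plane together with a line, and
  \<open>blP\<close> determines both: off the exceptional curve the line is spanned by the point
  itself. There the value P 0 does not occur, which is why e may share it with P.\<close>

lemma blP_inj:
  assumes "inj_on P V" "inj_on e plines" "e ` plines \<inter> P ` V \<subseteq> {P 0}" "0 \<in> V"
    "z \<in> blV V b" "z' \<in> blV V b'" "blP P e b z = blP P e b' z'"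
  shows "bmap b z = bmap b' z'" "pline (bdir b z) = pline (bdir b' z')"
proof -
  have V: "bmap b z \<in> V" "bmap b' z' \<in> V" using assms by (auto simp: blV_def)
  have no: "e (pline (bdir c x)) \<noteq> P (bmap d y)" if "bmap d y \<in> V" "bexc d y \<noteq> 0" for c x d y
  proof
    assume eq: "e (pline (bdir c x)) = P (bmap d y)"
    have "e (pline (bdir c x)) \<in> e ` plines" by (rule imageI[OF bdir_plines])
    then have "P (bmap d y) \<in> e ` plines \<inter> P ` V" using that(1) eq by simp
    then have "P (bmap d y) = P 0" using subsetD[OF assms(3)] by blast
    then have "bmap d y = 0" by (rule inj_onD[OF assms(1) _ that(1) assms(4)])
    then show False using that(2) bmap_0_iff by blast
  qed
  have "bmap b z = bmap b' z' \<and> pline (bdir b z) = pline (bdir b' z')"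
  proof (cases "bexc b z = 0")
    case True
    have 0: "bexc b' z' = 0"
    proof (rule ccontr)
      assume "bexc b' z' \<noteq> 0"
      with no[OF V(2) this, of b z] True assms(7) show False by (simp add: blP_def)
    qed
    have "e (pline (bdir b z)) = e (pline (bdir b' z'))" using True 0 assms(7) unfolding blP_def by simp
    then have "pline (bdir b z) = pline (bdir b' z')"
      by (rule inj_onD[OF assms(2) _ bdir_plines bdir_plines])
    moreover have "bmap b z = 0" "bmap b' z' = 0" using True 0 by (simp_all only: bmap_0_iff)
    ultimately show ?thesis by simp
  next
    case False
    have nz: "bexc b' z' \<noteq> 0"
    proof
      assume "bexc b' z' = 0"
      with no[OF V(1) False, of b' z'] False assms(7) show False unfolding blP_def by simp
    qed
    then have "P (bmap b z) = P (bmap b' z')" using False assms(7) by (simp add: blP_def)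
    then have eq: "bmap b z = bmap b' z'" using inj_onD[OF assms(1)] V by blast
    have "pline (bdir b z) = pline (bmap b z)" "pline (bdir b' z') = pline (bmap b' z')"
      using False nz pline_scale by (auto simp: bmap_eq)
    then show ?thesis using eq by simp
  qed
  then show "bmap b z = bmap b' z'" "pline (bdir b z) = pline (bdir b' z')" by auto
qed

lemma blP_inj_on:
  assumes "inj_on P V" "inj_on e plines" "e ` plines \<inter> P ` V \<subseteq> {P 0}" "0 \<in> V"
  shows "inj_on (blP P e b) (blV V b)"
proof (rule inj_onI)
  fix x y assume xy: "x \<in> blV V b" "y \<in> blV V b" "blP P e b x = blP P e b y"
  note i = blP_inj[OF assms xy]
  show "x = y" by (rule bdir_inj[OF _ i(2)]) (metis i(1) bexc_bmap)
qed

lemma blP_fac: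
  assumes V: "inj_on P V" "inj_on e plines" "e ` plines \<inter> P ` V \<subseteq> {P 0}" "0 \<in> V"
    and op: "open V" and z: "z \<in> blV V b" "z' \<in> blV V b'" "blP P e b z = blP P e b' z'"
  shows "fac (blP P e b) z (blP P e b') (blV V b')"
proof (cases "b = b'")
  case True
  then have "z = z'" using inj_onD[OF blP_inj_on[OF V]] z by blast
  then show ?thesis using True fac_refl[OF open_blV[OF op]] z by blast
next
  case False
  let ?f = "\<lambda>z::complex^2. if b then z $ 2 else z $ 1"
  obtain c where c: "bdir b z = c *s bdir b' z'" using pline_eqD[OF blP_inj(2)[OF V z]] by blast
  \<comment> \<open>The common line is spanned, in the other chart, by a vector whose corresponding
    entry is 1; hence the slope is nonzero.\<close>
  have nz: "?f z \<noteq> 0"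
    using c False by (auto simp: bdir_def vec_eq_iff forall_2 split: if_splits)
  have fl: "bmap b' (bflip b y) = bmap b y" "bexc b' (bflip b y) = 0 \<longleftrightarrow> bexc b y = 0"
    "pline (bdir b y) = pline (bdir b' (bflip b y))" if "?f y \<noteq> 0" for y
  proof -
    show "bmap b' (bflip b y) = bmap b y" "bexc b' (bflip b y) = 0 \<longleftrightarrow> bexc b y = 0"
      using that False by (auto simp: bmap_def bexc_def bflip_def vec_eq_iff forall_2)
    show "pline (bdir b y) = pline (bdir b' (bflip b y))"
      by (rule pline_eqI[of "?f y"]) (use that False in "auto simp: bdir_def bflip_def vec_eq_iff forall_2")
  qed
  have cdf: "cdiff ?f y" for y by (cases b) (auto intro: cd)
  show ?thesis
  proof (rule facI[of "{y \<in> blV V b. ?f y \<noteq> 0}" _ "bflip b"])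
    show "open {y \<in> blV V b. ?f y \<noteq> 0}" by (rule open_cdiff_nz[OF open_blV[OF op] cdf])
    show "z \<in> {y \<in> blV V b. ?f y \<noteq> 0}" using z nz by simp
    fix y assume y: "y \<in> {y \<in> blV V b. ?f y \<noteq> 0}"
    then have fy: "?f y \<noteq> 0" by simp
    show "bflip b y \<in> blV V b'" using y fl(1)[OF fy] by (simp add: blV_def)
    show "blP P e b y = blP P e b' (bflip b y)"
      using fl[OF fy] by (simp add: blP_def)
    show "cdv (bflip b) y" using fy unfolding bflip_def by (cases b) (auto intro!: cd cdiff_divide)
  qed
qed

definition oP :: "bool \<Rightarrow> complex^2 \<Rightarrow> (complex^2) \<times> (complex^2) set" where
  "oP b z = (bmap b z, pline (bdir b z))"

text \<open>The blow-up of the statement is an instance of the general construction, with P z = (z,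
  pline z) and e l = (0, l), so injectivity and compatibility of charts carry over.\<close>

lemma oP_blP: "oP b = blP (\<lambda>z. (z, pline z)) (\<lambda>l. (0, l)) b"
proof
  fix z show "oP b z = blP (\<lambda>z. (z, pline z)) (\<lambda>l. (0, l)) b z"
    using pline_scale[of "bexc b z" "bdir b z"] by (auto simp: oP_def blP_def bmap_0_iff bmap_eq)
qed

lemma oP_fac: "oP b z = oP b' z' ==> fac (oP b) z (oP b') UNIV"
proof -
  assume "oP b z = oP b' z'"
  then have "fac (blP (\<lambda>z. (z, pline z)) (\<lambda>l. (0, l)) b) z (blP (\<lambda>z. (z, pline z)) (\<lambda>l. (0, l)) b') (blV UNIV b')"
    by (intro blP_fac[of _ _ _ _ _ z']) (auto simp: inj_on_def oP_blP blV_def)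
  then show ?thesis by (simp add: oP_blP blV_def)
qed

lemma oP_inj: "inj_on (oP b) X"
proof -
  have "inj_on (blP (\<lambda>z. (z, pline z)) (\<lambda>l. (0, l)) b) (blV UNIV b)"
    by (rule blP_inj_on) (auto simp: inj_on_def)
  then show ?thesis by (auto simp: oP_blP blV_def intro: inj_on_subset)
qed

text \<open>In \<open>blowup_origin\<close> both charts list the exceptional coordinate first,
  whereas \<open>bmap\<close> leaves it in its original place; for b = False the entries have to be
  exchanged.\<close>

definition oS :: "bool \<Rightarrow> complex^2 \<Rightarrow> complex^2" where
  "oS b z = (if b then z else vector [z $ 2, z $ 1])"

lemma oS: "cdv (oS b) z" "oS b (oS b z) = z"
proof -
  show "cdv (oS b) z" unfolding oS_def by (cases b) (auto intro!: cd)
  show "oS b (oS b z) = z" by (cases b) (simp_all add: oS_def vec_eq_iff forall_2)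
qed

lemma blowup_origin_chart:
  assumes "(U, \<phi>) \<in> blowup_origin"
  obtains b where "U = range (oP b)" "\<And>z. \<phi> (oP b z) = oS b z"
proof -
  obtain i j :: 2 where ij: "i \<noteq> j" "U = {(z, pline v) | z v. v $ i \<noteq> 0 \<and> z \<in> pline v}"
    "\<phi> = (\<lambda>(z, l). vector [z $ i, unit_rep i l $ j])"
    using assms unfolding blowup_origin_def by blast
  define b where "b = (i = 1)"
  have ij': "i = (if b then 1 else 2)" "j = (if b then 2 else 1)"
    using ij(1) exhaust_2[of i] exhaust_2[of j] by (auto simp: b_def)
  have d1: "bdir b z $ i = 1" for z by (auto simp: ij' bdir_def)
  have "(z, pline v) \<in> range (oP b)" if v: "v $ i \<noteq> 0" "z \<in> pline v" for z v
  proof -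
    obtain c where c: "z = c *s v" using v(2) by (auto simp: pline_def)
    define w where "w = (if b then vector [z $ 1, v $ 2 / v $ 1] else vector [v $ 1 / v $ 2, z $ 2] :: complex^2)"
    have "pline v = pline (bdir b w)"
    proof (cases b)
      case True
      then show ?thesis
        by (intro pline_eqI[of "v $ 1"]) (use v in "auto simp: ij' bdir_def w_def vec_eq_iff forall_2")
    next
      case False
      then show ?thesis
        by (intro pline_eqI[of "v $ 2"]) (use v in "auto simp: ij' bdir_def w_def vec_eq_iff forall_2")
    qed
    moreover have "z = bmap b w"
      by (rule vec2_eqI) (use v c in "auto simp: ij' bmap_def w_def")
    ultimately show ?thesis by (auto simp: oP_def)
  qed
  moreover have "oP b z \<in> U" for z
    unfolding ij(2) oP_def using d1[of z] by (auto simp: bmap_eq pline_def intro!: exI[of _ "bdir b z"])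
  ultimately have "U = range (oP b)" unfolding ij(2) by blast
  moreover have "\<phi> (oP b z) = oS b z" for z
    using d1[of z] by (auto simp: ij(3) oP_def unit_rep_pline ij' oS_def bmap_def bdir_def vec_eq_iff forall_2)
  ultimately show thesis using that by blast
qed

lemma is_atlas_blowup_origin: "is_atlas blowup_origin"
proof (rule is_atlasI[where F="{(UNIV, \<lambda>z. oP b (oS b z)) | b. True}"])
  fix U :: "((complex^2) \<times> (complex^2) set) set" and \<phi> :: "(complex^2) \<times> (complex^2) set \<Rightarrow> complex^2" assume "(U, \<phi>) \<in> blowup_origin"
  then obtain b where b: "U = range (oP b)" "\<And>z. \<phi> (oP b z) = oS b z" by (rule blowup_origin_chart) blast
  have "oP b z \<in> range (\<lambda>z. oP b (oS b z))" for z by (rule range_eqI[of _ _ "oS b z"]) (simp add: oS)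
  then have "range (\<lambda>z. oP b (oS b z)) = range (oP b)" by blast
  then show "\<exists>V P. (V, P) \<in> {(UNIV, \<lambda>z. oP b (oS b z)) | b. True} \<and> open V \<and> P ` V = U \<and> (\<forall>z\<in>V. \<phi> (P z) = z)"
    using b oS by (intro exI[of _ UNIV] exI[of _ "\<lambda>z. oP b (oS b z)"]) auto
next
  fix V V' :: "(complex^2) set" and P Q :: "complex^2 \<Rightarrow> _" and z z'
  assume "(V, P) \<in> {(UNIV, \<lambda>z. oP b (oS b z)) | b. True}"
    "(V', Q) \<in> {(UNIV, \<lambda>z. oP b (oS b z)) | b. True}" "P z = Q z'"
  then obtain b b' where b: "P = (\<lambda>z. oP b (oS b z))" "Q = (\<lambda>z. oP b' (oS b' z))" "V' = UNIV"
    "oP b (oS b z) = oP b' (oS b' z')" by blast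
  have 1: "fac P z (oP b) UNIV" unfolding b by (rule facI[of UNIV _ "oS b"]) (auto simp: oS)
  have 2: "fac (oP b') (oS b' z') Q UNIV" unfolding b by (rule facI[of UNIV _ "oS b'"]) (auto simp: oS)
  have 3: "fac (oP b) (oS b z) Q UNIV"
    by (rule fac_trans_id[OF oP_fac[OF b(4)] oP_inj UNIV_I b(4)[symmetric] 2])
  show "fac P z Q V'" unfolding b(3)
    by (rule fac_trans_id[OF 1 oP_inj UNIV_I _ 3]) (simp add: b)
qed

lemma par_oP: "open V ==> par blowup_origin V (oP b)"
proof -
  assume V: "open V"
  obtain i j :: 2 where ij: "i = (if b then 1 else 2)" "j = (if b then 2 else 1)" "i \<noteq> j" by auto
  have "({(z, pline v) | z v. v $ i \<noteq> 0 \<and> z \<in> pline v}, \<lambda>(z, l). vector [z $ i, unit_rep i l $ j]) \<in> blowup_origin"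
    (is "(?U, ?\<phi>) \<in> _") unfolding blowup_origin_def using ij by blast
  moreover have d1: "bdir b z $ i = 1" for z by (auto simp: ij bdir_def)
  moreover have "oP b z \<in> ?U" for z
    unfolding oP_def using d1[of z] by (auto simp: bmap_eq pline_def intro!: exI[of _ "bdir b z"])
  moreover have "?\<phi> (oP b (oS b z)) = z" for z
    using d1[of "oS b z"] by (auto simp: oP_def unit_rep_pline ij oS_def bmap_def bdir_def vec_eq_iff forall_2)
  ultimately have "lpar blowup_origin UNIV (\<lambda>z. oP b (oS b z))"
    unfolding lpar_def by (intro conjI open_UNIV bexI[of _ "(?U, ?\<phi>)"]) auto
  from par_reparam[OF lpar_par[OF this] V, of "oS b" "oS b"]
  show ?thesis by (simp add: oS)
qed

lemma pts_blowup_origin: "pts blowup_origin = range (oP True) \<union> range (oP False)"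
proof
  show "pts blowup_origin \<subseteq> range (oP True) \<union> range (oP False)"
  proof
    fix x :: "(complex^2) \<times> (complex^2) set" assume "x \<in> pts blowup_origin"
    then obtain U \<phi> where U: "(U, \<phi>) \<in> blowup_origin" "x \<in> U" by (auto simp: pts_def)
    obtain b where "U = range (oP b)" by (rule blowup_origin_chart[OF U(1)])
    then show "x \<in> range (oP True) \<union> range (oP False)" using U(2) by (cases b) auto
  qed
  show "range (oP True) \<union> range (oP False) \<subseteq> pts blowup_origin"
    using par_pts[OF par_oP[OF open_UNIV]] by blast
qed

lemma is_atlas_affine_space: "is_atlas affine_space"
  by (rule is_atlasI[where F="{(UNIV, id)}"]) (auto simp: affine_space_def intro: fac_refl)

lemma par_affine_space: "open V ==> par affine_space V (\<lambda>z. z)"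
  by (rule lpar_par) (auto simp: lpar_def affine_space_def)

lemma openin_affine_space: "open V ==> openin (mtop affine_space) V"
  using openin_par_image[OF is_atlas_affine_space par_affine_space] by fastforce

lemma open_restrict_Int_pts: "open_restrict A (pts A \<inter> W) = open_restrict A W"
  unfolding open_restrict_def
proof (rule image_cong[OF refl])
  fix x assume x: "x \<in> A"
  obtain U \<phi> where "x = (U, \<phi>)" by force
  moreover from this have "U \<subseteq> pts A" using x by (auto simp: pts_def)
  ultimately show "(\<lambda>(U, \<phi>). (U \<inter> (pts A \<inter> W), \<phi>)) x = (\<lambda>(U, \<phi>). (U \<inter> W, \<phi>)) x" by auto
qed

text \<open>The centre lies in the chart P and in no other one, so the blow-up is a local
  replacement of that chart. The names given by e to the exceptional points must be fresh.\<close>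

locale blowup =
  fixes V :: "(complex^2) set" and P :: "complex^2 \<Rightarrow> 'a" and e :: "(complex^2) set \<Rightarrow> 'a"
    and A0 :: "('a, 2) atlas"
  assumes A: "is_atlas (insert (pch V P) A0)"
    and V: "open V" "0 \<in> V" and P: "inj_on P V" "P 0 \<notin> pts A0"
    and e: "inj_on e plines" "e ` plines \<inter> pts (insert (pch V P) A0) = {}"
begin

abbreviation "B \<equiv> insert (pch V P) A0"
abbreviation "B' \<equiv> blow V P e A0"

lemma pts_B: "pts B = P ` V \<union> pts A0"
  by (rule pts_insert_pch)

lemma parP: "par B V P"
  by (rule lpar_par) (use V P in "auto simp: lpar_def pch_def")

lemma e_P: "e ` plines \<inter> P ` V \<subseteq> {P 0}"
  using e(2) pts_B by auto

lemmas bl_inj = blP_inj_on[OF P(1) e(1) e_P V(2)]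

lemma fac_down: "z \<in> blV V b ==> bexc b z \<noteq> 0 ==> fac (blP P e b) z P V"
  by (rule facI[OF open_cdiff_nz[OF open_blV[OF V(1), of b] cdiff_bexc], where \<tau>="bmap b"])
    (auto simp: blP_def blV_def[of V b] cdv_bmap)

lemma fac_up: "y \<in> V ==> bexc b y \<noteq> 0 ==> fac P y (blP P e b) (blV V b)"
  by (rule facI[of "{y \<in> V. bexc b y \<noteq> 0}" _ "binv b"])
    (auto simp: blP_def blV_def bmap_binv bexc_binv cdv_binv intro: open_cdiff_nz V(1) cdiff_bexc)

lemma blP_old:
  assumes "z \<in> blV V b" "blP P e b z \<in> pts B"
  shows "bexc b z \<noteq> 0" "blP P e b z = P (bmap b z)" "bmap b z \<in> V"
proof -
  show nz: "bexc b z \<noteq> 0"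
  proof
    assume "bexc b z = 0"
    then have "blP P e b z \<in> e ` plines" unfolding blP_def using imageI[OF bdir_plines] by simp
    then show False using assms(2) e(2) by blast
  qed
  show "blP P e b z = P (bmap b z)" "bmap b z \<in> V" using nz assms(1) by (auto simp: blP_def blV_def)
qed

text \<open>An old point in a new chart lies off the exceptional curve, because e takes fresh
  values. There \<open>bmap\<close> is invertible and the comparison runs through P.\<close>

lemma fac_blP_par:
  assumes z: "z \<in> blV V b" "x \<in> W" "blP P e b z = Q x" and Q: "par B W Q"
  shows "fac (blP P e b) z Q W" "fac Q x (blP P e b) (blV V b)"
proof -
  have "blP P e b z \<in> pts B" using par_pts[OF Q z(2)] z(3) by simp
  note o = blP_old[OF z(1) this]
  have 1: "fac P (bmap b z) Q W" by (rule par_fac[OF A parP Q o(3) z(2)]) (use o z in simp)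
  show "fac (blP P e b) z Q W"
    by (rule fac_trans_id[OF fac_down[OF z(1) o(1)] P(1) o(3) _ 1]) (use o in simp)
  have 2: "fac Q x P V" by (rule par_fac[OF A Q parP z(2) o(3)]) (use o z in simp)
  show "fac Q x (blP P e b) (blV V b)"
    by (rule fac_trans_id[OF 2 P(1) o(3) _ fac_up[OF o(3)]]) (use o z bexc_bmap in auto)
qed

lemma A0_par: "(U, \<phi>) \<in> A0 ==> par B (\<phi> ` U) (inv_into U \<phi>)"
  by (rule chart_par[OF A]) simp

lemma is_atlas_blow: "is_atlas B'"
proof -
  let ?F1 = "{(blV V b, blP P e b) | b. True}" and ?F2 = "{(\<phi> ` U, inv_into U \<phi>) | U \<phi>. (U, \<phi>) \<in> A0}"
  show ?thesis
proof (rule is_atlasI[where F="?F1 \<union> ?F2"])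
  fix U \<phi> assume "(U, \<phi>) \<in> B'"
  then consider b where "(U, \<phi>) = pch (blV V b) (blP P e b)" | "(U, \<phi>) \<in> A0"
    unfolding blow_def by blast
  then show "\<exists>V' Q. (V', Q) \<in> ?F1 \<union> ?F2 \<and> open V' \<and> Q ` V' = U \<and> (\<forall>z\<in>V'. \<phi> (Q z) = z)"
  proof cases
    case 1
    then show ?thesis using open_blV[OF V(1)] bl_inj
      by (intro exI[of _ "blV V b"] exI[of _ "blP P e b"]) (auto simp: pch_def)
  next
    case 2
    have "inj_on \<phi> U" by (rule is_atlas_inj[OF A]) (use 2 in simp)
    then show ?thesis using 2 par_open[OF A0_par[OF 2]]
      by (intro exI[of _ "\<phi> ` U"] exI[of _ "inv_into U \<phi>"]) (auto simp: inv_into_image_cancel)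
  qed
next
  fix W Q W' R z z'
  assume W: "(W, Q) \<in> ?F1 \<union> ?F2" "(W', R) \<in> ?F1 \<union> ?F2" and z: "z \<in> W" "z' \<in> W'" "Q z = R z'"
  consider (11) b b' where "W = blV V b" "Q = blP P e b" "W' = blV V b'" "R = blP P e b'"
    | (12) b where "W = blV V b" "Q = blP P e b" "par B W' R"
    | (21) b where "W' = blV V b" "R = blP P e b" "par B W Q"
    | (22) "par B W Q" "par B W' R"
    using W A0_par by blast
  then show "fac Q z R W'"
  proof cases
    case 11
    then show ?thesis using blP_fac[OF P(1) e(1) e_P V(2,1)] z by blast
  next
    case 12
    then show ?thesis using fac_blP_par(1)[OF _ z(2) _ 12(3)] z by blast
  next
    case 21
    then show ?thesis using fac_blP_par(2)[OF _ z(1) _ 21(3)] z by metis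
  next
    case 22
    then show ?thesis using par_fac[OF A 22 z] by blast
  qed
qed
qed

lemma par_blP: "par B' (blV V b) (blP P e b)"
proof (rule lpar_par)
  have "pch (blV V b) (blP P e b) \<in> B'" by (cases b) (auto simp: blow_def)
  then show "lpar B' (blV V b) (blP P e b)"
    unfolding lpar_def using open_blV[OF V(1)] bl_inj[of b]
    by (intro conjI bexI[of _ "pch (blV V b) (blP P e b)"]) (auto simp: pch_def)
qed

lemma pts_blow: "pts B' = (pts B - {P 0}) \<union> e ` plines"
proof
  have "blP P e b z \<in> (pts B - {P 0}) \<union> e ` plines" if "z \<in> blV V b" for b z
  proof (cases "bexc b z = 0")
    case True
    then show ?thesis using bdir_plines[of b z] by (auto simp: blP_def)
  next
    case False
    then have "bmap b z \<noteq> 0" "bmap b z \<in> V" using that bmap_0_iff by (auto simp: blV_def)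
    then have "P (bmap b z) \<noteq> P 0" using inj_onD[OF P(1)] V(2) by blast
    then show ?thesis using False \<open>bmap b z \<in> V\<close> pts_B by (auto simp: blP_def)
  qed
  moreover have "pts A0 \<subseteq> (pts B - {P 0})" using P(2) pts_B by auto
  ultimately show "pts B' \<subseteq> (pts B - {P 0}) \<union> e ` plines"
    unfolding blow_def pts_insert_pch by (intro Un_least image_subsetI) blast+
next
  have 1: "e l \<in> pts B'" if l: "l \<in> plines" for l
  proof -
    obtain b z where b: "l = pline (bdir b z)" "bexc b z = 0" by (rule plines_bdir[OF l])
    then have "z \<in> blV V b" using bmap_0_iff V(2) by (metis blV_def mem_Collect_eq)
    from par_pts[OF par_blP this] show ?thesis using b by (simp add: blP_def)
  qed
  have 2: "P y \<in> pts B'" if y: "y \<in> V" "y \<noteq> 0" for y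
  proof -
    obtain b where b: "bexc b y \<noteq> 0" using bexc_exists[OF y(2)] by blast
    have "binv b y \<in> blV V b" using y b by (simp add: blV_def bmap_binv)
    from par_pts[OF par_blP this] show ?thesis using b by (simp add: blP_def bexc_binv bmap_binv)
  qed
  have 3: "pts A0 \<subseteq> pts B'" by (auto simp: pts_def blow_def)
  show "(pts B - {P 0}) \<union> e ` plines \<subseteq> pts B'"
    using 1 2 3 unfolding pts_B by blast
qed

text \<open>A point of the chart P other than the centre has a nonzero coordinate, so one of the two
  new charts takes it over; the other charts are still present.\<close>

lemma par_old:
  assumes Q: "par B W Q" and no: "P 0 \<notin> Q ` W"
  shows "par B' W Q"
  unfolding par_def
proof (intro conjI ballI)
  show "open W" "inj_on Q W" using Q by (auto simp: par_def)
  fix z assume z: "z \<in> W"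
  then have "Q z \<in> pts B" by (rule par_pts[OF Q])
  then consider U \<phi> where "(U, \<phi>) \<in> A0" "Q z \<in> U" | y where "y \<in> V" "Q z = P y"
    unfolding pts_B by (auto simp: pts_def)
  then show "\<exists>V' R z'. lpar B' V' R \<and> z' \<in> V' \<and> R z' = Q z \<and> fac Q z R V' \<and> fac R z' Q W"
  proof cases
    case 1
    have "(U, \<phi>) \<in> B'" using 1 by (simp add: blow_def)
    note l = chart_lpar[OF is_atlas_blow this]
    have i: "inj_on \<phi> U" by (rule is_atlas_inj[OF A]) (use 1 in simp)
    show ?thesis
      by (intro exI conjI, rule l, rule imageI, rule 1(2))
        (use i 1(2) par_fac[OF A Q A0_par[OF 1(1)] z, of "\<phi> (Q z)"]
          par_fac[OF A A0_par[OF 1(1)] Q _ z, of "\<phi> (Q z)"] in auto)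
  next
    case 2
    have "y \<noteq> 0"
    proof
      assume "y = 0"
      then have "Q z = P 0" using 2 by simp
      then show False using no z by (metis imageI)
    qed
    then obtain b where b: "bexc b y \<noteq> 0" using bexc_exists by blast
    have y: "binv b y \<in> blV V b" "blP P e b (binv b y) = Q z"
      using 2 b by (auto simp: blV_def bmap_binv blP_def bexc_binv)
    have "pch (blV V b) (blP P e b) \<in> B'" by (cases b) (auto simp: blow_def)
    then have l: "lpar B' (blV V b) (blP P e b)"
      unfolding lpar_def using open_blV[OF V(1)] bl_inj[of b]
      by (intro conjI bexI[of _ "pch (blV V b) (blP P e b)"]) (auto simp: pch_def)
    show ?thesis
      by (intro exI conjI, rule l, rule y(1), rule y(2))
        (use fac_blP_par[OF y(1) z y(2) Q] in auto)
  qed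
qed

lemma par_old':
  assumes Q: "par B W Q" and op: "openin (mtop B) (pts B - {P 0})"
  shows "par B {z \<in> W. Q z \<in> pts B - {P 0}} Q" "par B' {z \<in> W. Q z \<in> pts B - {P 0}} Q"
proof -
  show 1: "par B {z \<in> W. Q z \<in> pts B - {P 0}} Q"
    by (rule par_subset[OF Q open_par_vimage[OF A Q op]]) auto
  show "par B' {z \<in> W. Q z \<in> pts B - {P 0}} Q" by (rule par_old[OF 1]) auto
qed

lemma openin_minus: "Hausdorff_space (mtop B) ==> openin (mtop B) (pts B - {P 0})"
  using closedin_Hausdorff_singleton[of "mtop B" "P 0"] par_pts[OF parP V(2)]
  by (simp add: closedin_def topspace_mtop[OF A])

text \<open>Both biholomorphisms are identities in suitable coordinates: away from the centre in the
  old charts, and over the chart P because \<open>blP P e b\<close> and \<open>oP b\<close> are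
  built from the same formulas.\<close>

lemma is_blowup:
  assumes m: "complex_manifold B" "complex_manifold B'"
  shows "is_blowup B (P 0) B' (contr (P 0) e)"
proof -
  let ?\<pi> = "contr (P 0) e" and ?X = "pts B - {P 0}"
  have op: "openin (mtop B) ?X" using m openin_minus by (auto simp: complex_manifold_def)
  have p0: "P 0 \<in> pts B" by (rule par_pts[OF parP V(2)])
  have \<pi>X: "?\<pi> q = q" if "q \<in> pts B" for q
  proof -
    have "q \<notin> e ` plines" using that e(2) by blast
    then show ?thesis unfolding contr_def by (rule if_not_P)
  qed
  have \<pi>e: "?\<pi> (e l) = P 0" if "l \<in> plines" for l
    unfolding contr_def using imageI[OF that, of e] by (rule if_P)
  have X': "pts B' - ?\<pi> -` {P 0} = ?X"
  proof (intro set_eqI)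
    fix q
    show "q \<in> pts B' - ?\<pi> -` {P 0} \<longleftrightarrow> q \<in> ?X"
    proof (cases "q \<in> e ` plines")
      case True
      then have "?\<pi> q = P 0" unfolding contr_def by (rule if_P)
      moreover have "q \<notin> pts B" using e(2) True by blast
      ultimately show ?thesis by simp
    next
      case False
      then have "?\<pi> q = q" unfolding contr_def by (rule if_not_P)
      moreover have "q \<in> pts B' \<longleftrightarrow> q \<in> ?X" unfolding pts_blow using False by blast
      ultimately show ?thesis by auto
    qed
  qed
  have op': "openin (mtop B') ?X"
  proof (rule openinI[OF is_atlas_blow])
    fix q assume q: "q \<in> ?X"
    then have "q \<in> pts B" by simp
    then obtain W Q z where W: "par B W Q" "z \<in> W" "Q z = q" by (rule pts_par[OF A])
    show "\<exists>V P'. par B' V P' \<and> q \<in> P' ` V \<and> P' ` V \<subseteq> ?X"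
      by (intro exI conjI, rule par_old'(2)[OF W(1) op]) (use W q in auto)
  qed
  have "biholo (open_restrict B' ?X) (open_restrict B ?X) ?\<pi>"
  proof (rule biholoI[OF is_atlas_open_restrict[OF is_atlas_blow op'] is_atlas_open_restrict[OF A op]])
    have "pts (open_restrict B' ?X) = ?X" "pts (open_restrict B ?X) = ?X"
      unfolding pts_open_restrict pts_blow by auto
    moreover have "bij_betw ?\<pi> ?X ?X" using \<pi>X by (auto simp: bij_betw_def inj_on_def image_iff)
    ultimately show "bij_betw ?\<pi> (pts (open_restrict B' ?X)) (pts (open_restrict B ?X))" by simp
    fix q assume "q \<in> pts (open_restrict B' ?X)"
    then have q: "q \<in> pts B" "q \<in> ?X" unfolding pts_open_restrict by auto
    obtain W Q z where W: "par B W Q" "z \<in> W" "Q z = q" by (rule pts_par[OF A q(1)])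
    note o = par_old'[OF W(1) op]
    show "\<exists>V P'. par (open_restrict B' ?X) V P' \<and> q \<in> P' ` V \<and> par (open_restrict B ?X) V (\<lambda>z. ?\<pi> (P' z))"
    proof (intro exI conjI)
      show "par (open_restrict B' ?X) {z \<in> W. Q z \<in> ?X} Q"
        by (rule par_open_restrict[OF is_atlas_blow o(2) op']) auto
      show "q \<in> Q ` {z \<in> W. Q z \<in> ?X}" using W q by auto
      have "par (open_restrict B ?X) {z \<in> W. Q z \<in> ?X} Q"
        by (rule par_open_restrict[OF A o(1) op]) auto
      then show "par (open_restrict B ?X) {z \<in> W. Q z \<in> ?X} (\<lambda>z. ?\<pi> (Q z))"
        by (rule par_cong) (use \<pi>X in auto)
    qed
  qed
  then have 1: "biholo (open_restrict B' (pts B' - ?\<pi> -` {P 0})) (open_restrict B (pts B - {P 0})) ?\<pi>"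
    unfolding X' .
  let ?U = "P ` V" and ?\<phi> = "inv_into V P"
  \<comment> \<open>A new point carries its line; for an old point P y with y nonzero, the line is
    the one spanned by y.\<close>
  let ?\<Theta> = "\<lambda>q. if q \<in> e ` plines then (0, inv_into plines e q) else (?\<phi> q, pline (?\<phi> q))"
  have opU: "openin (mtop B) ?U" by (rule openin_par_image[OF A parP])
  have \<phi>P: "?\<phi> (P z) = z" if "z \<in> V" for z using that P(1) by simp
  have \<phi>U: "?\<phi> ` ?U = V" using P(1) by simp
  have opV: "openin (mtop affine_space) V" by (rule openin_affine_space[OF V(1)])
  have 2: "biholo (open_restrict B ?U) (open_restrict affine_space (?\<phi> ` ?U)) ?\<phi>"
    unfolding \<phi>U
  proof (rule biholoI[OF is_atlas_open_restrict[OF A opU] is_atlas_open_restrict[OF is_atlas_affine_space opV]])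
    have e1: "pts (open_restrict B ?U) = P ` V" "pts (open_restrict affine_space V) = V"
      unfolding pts_open_restrict pts_B by (auto simp: pts_def affine_space_def)
    show "bij_betw ?\<phi> (pts (open_restrict B ?U)) (pts (open_restrict affine_space V))"
      unfolding e1 using P(1) by (simp add: bij_betw_inv_into inj_on_imp_bij_betw)
    fix q assume "q \<in> pts (open_restrict B ?U)"
    then have q: "q \<in> P ` V" unfolding e1 .
    have "par (open_restrict affine_space V) V (\<lambda>z. z)"
      by (rule par_open_restrict[OF is_atlas_affine_space par_affine_space[OF V(1)] opV]) auto
    then have "par (open_restrict affine_space V) V (\<lambda>z. ?\<phi> (P z))"
      by (rule par_cong) (use \<phi>P in auto)
    then show "\<exists>V' P'. par (open_restrict B ?U) V' P' \<and> q \<in> P' ` V' \<and> par (open_restrict affine_space V) V' (\<lambda>z. ?\<phi> (P' z))"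
      using par_open_restrict[OF A parP opU] q by blast
  qed
  have \<Theta>e: "?\<Theta> (e l) = (0, l)" if "l \<in> plines" for l
    using that e(1) by simp
  have \<Theta>P: "?\<Theta> (P y) = (y, pline y)" if "y \<in> V" for y
    using that e(2) \<phi>P pts_B by auto
  have \<Theta>bl: "?\<Theta> (blP P e b z) = oP b z" if z: "z \<in> blV V b" for b z
  proof (cases "bexc b z = 0")
    case True
    then have eq: "blP P e b z = e (pline (bdir b z))" "oP b z = (0, pline (bdir b z))"
      by (simp_all add: blP_def oP_def bmap_0_iff)
    show ?thesis unfolding eq by (rule \<Theta>e[OF bdir_plines])
  next
    case False
    then have eq: "blP P e b z = P (bmap b z)" "oP b z = (bmap b z, pline (bmap b z))"
      using pline_scale[OF False, of "bdir b z"] by (simp_all add: blP_def oP_def bmap_eq[symmetric])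
    show ?thesis unfolding eq by (rule \<Theta>P) (use z in "simp add: blV_def")
  qed
  let ?Y = "?\<pi> -` ?U" and ?Z = "{(z, l). z \<in> V} :: ((complex^2) \<times> (complex^2) set) set"
  have bl\<pi>: "?\<pi> (blP P e b z) = P (bmap b z)" if "z \<in> blV V b" for b z
  proof (cases "bexc b z = 0")
    case True
    then show ?thesis using \<pi>e[OF bdir_plines[of b z]] bmap_0_iff[of b z] by (simp add: blP_def)
  next
    case False
    then show ?thesis using \<pi>X[of "P (bmap b z)"] that pts_B by (auto simp: blP_def blV_def)
  qed
  have Y: "pts B' \<inter> ?Y = (\<Union>b. blP P e b ` blV V b)"
  proof
    show "(\<Union>b. blP P e b ` blV V b) \<subseteq> pts B' \<inter> ?Y"
      using par_pts[OF par_blP] bl\<pi> by (auto simp: blV_def)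
    show "pts B' \<inter> ?Y \<subseteq> (\<Union>b. blP P e b ` blV V b)"
    proof
      fix q assume q: "q \<in> pts B' \<inter> ?Y"
      show "q \<in> (\<Union>b. blP P e b ` blV V b)"
      proof (cases "q \<in> e ` plines")
        case True
        then obtain l where l: "q = e l" "l \<in> plines" by blast
        obtain b z where b: "l = pline (bdir b z)" "bexc b z = 0" by (rule plines_bdir[OF l(2)])
        then have "z \<in> blV V b" using bmap_0_iff V(2) by (metis blV_def mem_Collect_eq)
        then show ?thesis using b l by (intro UN_I[of b] image_eqI[of _ _ z]) (auto simp: blP_def)
      next
        case False
        then have "q \<in> ?X" "q \<in> P ` V" using q \<pi>X unfolding pts_blow by auto
        then obtain y where y: "y \<in> V" "q = P y" "y \<noteq> 0" by auto
        then obtain b where b: "bexc b y \<noteq> 0" using bexc_exists by blast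
        have "binv b y \<in> blV V b" "blP P e b (binv b y) = q"
          using y b by (auto simp: blV_def bmap_binv blP_def bexc_binv)
        then show ?thesis by (metis UNIV_I UN_iff imageI)
      qed
    qed
  qed
  have opY: "openin (mtop B') (pts B' \<inter> ?Y)"
    unfolding Y using openin_par_image[OF is_atlas_blow par_blP] by blast
  note rY = open_restrict_Int_pts[of "B'" "?Y", symmetric]
  have oPZ: "pts blowup_origin \<inter> ?Z = (\<Union>b. oP b ` blV V b)"
    unfolding pts_blowup_origin by (auto simp: oP_def blV_def UN_bool_eq)
  have opZ: "openin (mtop blowup_origin) (pts blowup_origin \<inter> ?Z)"
    unfolding oPZ using openin_par_image[OF is_atlas_blowup_origin par_oP[OF open_blV[OF V(1)]]] by blast
  note rZ = open_restrict_Int_pts[of "blowup_origin" "?Z", symmetric]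
  have 3: "biholo (open_restrict B' ?Y) (open_restrict blowup_origin ?Z) ?\<Theta>"
    unfolding rY rZ
  proof (rule biholoI[OF is_atlas_open_restrict[OF is_atlas_blow opY] is_atlas_open_restrict[OF is_atlas_blowup_origin opZ]])
    have e1: "pts (open_restrict B' (pts B' \<inter> ?Y)) = (\<Union>b. blP P e b ` blV V b)"
      "pts (open_restrict blowup_origin (pts blowup_origin \<inter> ?Z)) = (\<Union>b. oP b ` blV V b)"
      by (rule trans[OF pts_open_restrict], rule trans[OF Int_left_absorb Y],
          rule trans[OF pts_open_restrict], rule trans[OF Int_left_absorb oPZ])
    have "inj_on ?\<Theta> (\<Union>b. blP P e b ` blV V b)"
    proof (rule inj_onI)
      fix q q' assume "q \<in> (\<Union>b. blP P e b ` blV V b)" "q' \<in> (\<Union>b. blP P e b ` blV V b)" and eq: "?\<Theta> q = ?\<Theta> q'"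
      then obtain b z b' z' where q: "q = blP P e b z" "z \<in> blV V b" "q' = blP P e b' z'" "z' \<in> blV V b'" by blast
      have "oP b z = oP b' z'" using eq unfolding q(1,3) \<Theta>bl[OF q(2)] \<Theta>bl[OF q(4)] .
      then have 4: "bmap b z = bmap b' z'" "pline (bdir b z) = pline (bdir b' z')" by (auto simp: oP_def)
      then have "bexc b z = 0 \<longleftrightarrow> bexc b' z' = 0" using bmap_0_iff by metis
      then show "q = q'" unfolding q using 4 by (simp add: blP_def)
    qed
    moreover have "?\<Theta> ` (\<Union>b. blP P e b ` blV V b) = (\<Union>b. oP b ` blV V b)"
    proof -
      have "?\<Theta> ` blP P e b ` blV V b = oP b ` blV V b" for b
        unfolding image_image by (rule image_cong[OF refl \<Theta>bl])
      then show ?thesis unfolding image_UN by (rule SUP_cong[OF refl])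
    qed
    ultimately show "bij_betw ?\<Theta> (pts (open_restrict B' (pts B' \<inter> ?Y)))
        (pts (open_restrict blowup_origin (pts blowup_origin \<inter> ?Z)))"
      unfolding e1 bij_betw_def by blast
    fix q assume "q \<in> pts (open_restrict B' (pts B' \<inter> ?Y))"
    then obtain b where b: "q \<in> blP P e b ` blV V b" unfolding e1 by blast
    have 1: "par (open_restrict B' (pts B' \<inter> ?Y)) (blV V b) (blP P e b)"
      by (rule par_open_restrict[OF is_atlas_blow par_blP opY]) (unfold Y, blast)
    have "par (open_restrict blowup_origin (pts blowup_origin \<inter> ?Z)) (blV V b) (oP b)"
      by (rule par_open_restrict[OF is_atlas_blowup_origin par_oP[OF open_blV[OF V(1)]] opZ]) (unfold oPZ, blast)
    then have 2: "par (open_restrict blowup_origin (pts blowup_origin \<inter> ?Z)) (blV V b) (\<lambda>z. ?\<Theta> (blP P e b z))"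
      by (rule par_cong) (rule \<Theta>bl)
    show "\<exists>V' P'. par (open_restrict B' (pts B' \<inter> ?Y)) V' P' \<and> q \<in> P' ` V' \<and>
        par (open_restrict blowup_origin (pts blowup_origin \<inter> ?Z)) V' (\<lambda>z. ?\<Theta> (P' z))"
      by (intro exI conjI, rule 1, rule b, rule 2)
  qed
  have 4: "fst (?\<Theta> q) = ?\<phi> (?\<pi> q)" if "q \<in> pts B'" "?\<pi> q \<in> ?U" for q
  proof -
    have "q \<in> (\<Union>b. blP P e b ` blV V b)" using that unfolding Y[symmetric] by simp
    then obtain b z where q: "q = blP P e b z" "z \<in> blV V b" by blast
    have "bmap b z \<in> V" using q(2) by (simp add: blV_def)
    then show ?thesis unfolding q(1) \<Theta>bl[OF q(2)] bl\<pi>[OF q(2)] by (simp add: oP_def \<phi>P)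
  qed
  show ?thesis unfolding is_blowup_def
  proof (intro conjI m p0 1)
    show "\<exists>U \<phi> \<Theta>. openin (mtop B) U \<and> P 0 \<in> U \<and> \<phi> (P 0) = 0 \<and>
        biholo (open_restrict B U) (open_restrict affine_space (\<phi> ` U)) \<phi> \<and>
        biholo (open_restrict B' (?\<pi> -` U)) (open_restrict blowup_origin {(z, l). z \<in> \<phi> ` U}) \<Theta> \<and>
        (\<forall>q\<in>pts B'. ?\<pi> q \<in> U \<longrightarrow> fst (\<Theta> q) = \<phi> (?\<pi> q))"
    proof (rule exI[of _ ?U], rule exI[of _ ?\<phi>], rule exI[of _ ?\<Theta>], unfold \<phi>U, intro conjI ballI impI)
      show "openin (mtop B) ?U" by (rule opU)
      show "P 0 \<in> ?U" using V(2) by (rule imageI)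
      show "?\<phi> (P 0) = 0" by (rule \<phi>P[OF V(2)])
      show "biholo (open_restrict B ?U) (open_restrict affine_space V) ?\<phi>" using 2 unfolding \<phi>U .
      show "biholo (open_restrict B' ?Y) (open_restrict blowup_origin ?Z) ?\<Theta>" by (rule 3)
      show "fst (?\<Theta> q) = ?\<phi> (?\<pi> q)" if "q \<in> pts B'" "?\<pi> q \<in> ?U" for q by (rule 4[OF that])
    qed
  qed
qed

text \<open>Two closed bidiscs, on which the slope has norm at most 1, cover the preimage of a small
  open polydisc around the centre. What remains is the complement of that polydisc in the compact
  surface, and it keeps its compactness because the blow-up changes nothing there.\<close>

lemma compact_blow:
  assumes c: "compact_space (mtop B)"
  shows "compact_space (mtop B')"
proof -
  let ?D = "\<lambda>r s. {z::complex^2. norm (z $ 1) \<le> r \<and> norm (z $ 2) \<le> s}"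
  have l1: "norm z \<le> norm (z $ 1) + norm (z $ 2)" for z :: "complex^2"
    using L2_set_le_sum[of UNIV "\<lambda>i. norm (z $ i)"] by (simp add: norm_vec_def sum_2)
  have cD: "compact (?D r s)" for r s
  proof -
    have "closed (?D r s)" by (intro closed_Collect_conj closed_Collect_le continuous_intros)
    moreover have "bounded (?D r s)"
      by (rule boundedI[of _ "r + s"]) (rule order_trans[OF l1 add_mono], auto)
    ultimately show ?thesis using compact_eq_bounded_closed by blast
  qed
  obtain \<epsilon> where eps: "\<epsilon> > 0" "ball 0 \<epsilon> \<subseteq> V" using V open_contains_ball by blast
  \<comment> \<open>The norm is at most the sum of the norms of the two entries, so two entries of
    size at most \<epsilon> / 3 stay inside the ball.\<close>
  define r where "r = \<epsilon> / 3"
  have r: "r > 0" using eps by (simp add: r_def)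
  have DV: "?D r r \<subseteq> V"
  proof
    fix z assume "z \<in> ?D r r"
    then have "norm z < \<epsilon>" using l1[of z] eps(1) by (auto simp: r_def)
    then show "z \<in> V" using eps(2) by auto
  qed
  have bD: "?D r 1 \<subseteq> blV V True" "?D 1 r \<subseteq> blV V False"
  proof -
    have "norm (z $ 1 * z $ 2) \<le> r" if "norm (z $ 1) \<le> r \<and> norm (z $ 2) \<le> 1 \<or> norm (z $ 1) \<le> 1 \<and> norm (z $ 2) \<le> r" for z :: "complex^2"
      using that mult_mono[of "norm (z $ 1)" r "norm (z $ 2)" 1] mult_mono[of "norm (z $ 1)" 1 "norm (z $ 2)" r] r
      by (auto simp: norm_mult)
    then show "?D r 1 \<subseteq> blV V True" "?D 1 r \<subseteq> blV V False"
      using DV by (auto simp: blV_def bmap_def subset_iff)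
  qed
  let ?K1 = "blP P e True ` ?D r 1" and ?K2 = "blP P e False ` ?D 1 r"
  let ?W = "{z. norm (z $ 1) < r \<and> norm (z $ 2) < r}"
  let ?K3 = "pts B - P ` ?W" and ?X = "pts B - {P 0}"
  have cK: "compactin (mtop B') (blP P e b ` D)" if "compact D" "D \<subseteq> blV V b" for b D
    by (rule image_compactin[OF _ continuous_map_par[OF is_atlas_blow par_blP]])
      (use that in "auto simp: compactin_subtopology")
  have "open ?W" by (intro open_Collect_conj open_Collect_less continuous_intros)
  moreover have "?W \<subseteq> V" using DV by force
  ultimately have parW: "par B ?W P" by (rule par_subset[OF parP])
  have K3X: "?K3 \<subseteq> ?X" using r by force
  have "closedin (mtop B) ?K3"
    using closedin_diff[OF closedin_topspace openin_par_image[OF A parW]] unfolding topspace_mtop[OF A] .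
  then have "compactin (mtop B) ?K3" using c closedin_compact_space by blast
  then have c3: "compactin (subtopology (mtop B) ?X) ?K3" using K3X by (simp add: compactin_subtopology)
  \<comment> \<open>Off the centre the identity is continuous from the old topology to the new one;
    this transports compactness of the remainder.\<close>
  have "continuous_map (subtopology (mtop B) ?X) (mtop B') (\<lambda>q. q)"
    unfolding continuous_map_def
  proof (intro conjI allI impI)
    show "(\<lambda>q. q) \<in> topspace (subtopology (mtop B) ?X) \<rightarrow> topspace (mtop B')"
      by (auto simp: topspace_mtop[OF A] topspace_mtop[OF is_atlas_blow] pts_blow)
    fix W assume W: "openin (mtop B') W"
    have "openin (mtop B) (W \<inter> ?X)"
    proof (rule openinI[OF A])
      fix q assume q: "q \<in> W \<inter> ?X"
      then have "q \<in> pts B" by simp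
      then obtain T Q z where T: "par B T Q" "z \<in> T" "Q z = q" by (rule pts_par[OF A])
      \<comment> \<open>Q is injective, so at most one parameter value is removed. Openness is
        obtained without a separation axiom.\<close>
      have op: "open {z \<in> T. Q z \<in> ?X}"
      proof (cases "P 0 \<in> Q ` T")
        case True
        then obtain t where t: "t \<in> T" "Q t = P 0" by auto
        have "{z \<in> T. Q z \<in> ?X} = T - {t}"
        proof (intro set_eqI)
          fix z
          have "Q z = P 0 \<longleftrightarrow> z = t" if "z \<in> T"
            using inj_onD[OF par_inj[OF T(1)], of z t] that t by auto
          then show "z \<in> {z \<in> T. Q z \<in> ?X} \<longleftrightarrow> z \<in> T - {t}"
            using par_pts[OF T(1), of z] by auto
        qed
        then show ?thesis using par_open[OF T(1)] by (simp add: open_delete)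
      next
        case False
        then have "Q z \<noteq> P 0" if "z \<in> T" for z using that by (metis imageI)
        then have "{z \<in> T. Q z \<in> ?X} = T" using par_pts[OF T(1)] by auto
        then show ?thesis using par_open[OF T(1)] by simp
      qed
      have T1: "par B {z \<in> T. Q z \<in> ?X} Q" by (rule par_subset[OF T(1) op]) auto
      have T2: "par B' {z \<in> T. Q z \<in> ?X} Q" by (rule par_old[OF T1]) auto
      have "par B {y \<in> {z \<in> T. Q z \<in> ?X}. Q y \<in> W} Q"
        by (rule par_subset[OF T1 open_par_vimage[OF is_atlas_blow T2 W]]) auto
      then show "\<exists>V P'. par B V P' \<and> q \<in> P' ` V \<and> P' ` V \<subseteq> W \<inter> ?X"
        by (rule_tac exI[of _ "{y \<in> {z \<in> T. Q z \<in> ?X}. Q y \<in> W}"], rule_tac exI[of _ Q]) (use T q in auto)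
    qed
    moreover have "{x \<in> topspace (subtopology (mtop B) ?X). x \<in> W} = (W \<inter> ?X) \<inter> ?X"
      by (auto simp: topspace_mtop[OF A])
    ultimately show "openin (subtopology (mtop B) ?X) {x \<in> topspace (subtopology (mtop B) ?X). x \<in> W}"
      unfolding openin_subtopology by blast
  qed
  from image_compactin[OF c3 this] have c3': "compactin (mtop B') ?K3" by simp
  have "pts B' \<subseteq> ?K1 \<union> ?K2 \<union> ?K3"
  proof
    fix q assume q: "q \<in> pts B'"
    show "q \<in> ?K1 \<union> ?K2 \<union> ?K3"
    proof (cases "q \<in> ?K3")
      case False
      have "\<exists>b z. q = blP P e b z \<and> z \<in> (if b then ?D r 1 else ?D 1 r)"
      proof (cases "q \<in> e ` plines")
        case True
        then obtain v where v: "q = e (pline v)" "v \<noteq> 0" by blast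
        then have nz: "v $ 1 \<noteq> 0 \<or> v $ 2 \<noteq> 0" by (auto simp: vec_eq_iff forall_2)
        show ?thesis
        proof (cases "norm (v $ 2) \<le> norm (v $ 1)")
          case True
          then have n1: "v $ 1 \<noteq> 0" using nz by auto
          then have "pline v = pline (bdir True (vector [0, v $ 2 / v $ 1]))"
            by (intro pline_eqI[of "v $ 1"]) (auto simp: bdir_def vec_eq_iff forall_2)
          then show ?thesis using v True n1 r
            by (intro exI[of _ True] exI[of _ "vector [0, v $ 2 / v $ 1]"])
              (auto simp: blP_def bexc_def norm_divide)
        next
          case False
          then have n1: "v $ 2 \<noteq> 0" by auto
          then have "pline v = pline (bdir False (vector [v $ 1 / v $ 2, 0]))"
            by (intro pline_eqI[of "v $ 2"]) (auto simp: bdir_def vec_eq_iff forall_2)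
          then show ?thesis using v False n1 r
            by (intro exI[of _ False] exI[of _ "vector [v $ 1 / v $ 2, 0]"])
              (auto simp: blP_def bexc_def norm_divide)
        qed
      next
        case False
        then have "q \<in> P ` ?W" "q \<noteq> P 0" using q \<open>q \<notin> ?K3\<close> unfolding pts_blow by auto
        then obtain y where y: "y \<in> ?W" "q = P y" "y \<noteq> 0" by auto
        then have nz: "y $ 1 \<noteq> 0 \<or> y $ 2 \<noteq> 0" by (auto simp: vec_eq_iff forall_2)
        \<comment> \<open>The chart is chosen by the larger coordinate, which makes the slope at
          most 1 in norm.\<close>
        define b where "b = (norm (y $ 2) \<le> norm (y $ 1))"
        have b: "bexc b y \<noteq> 0" using nz by (auto simp: b_def bexc_def)
        then have "blP P e b (binv b y) = q" using y by (simp add: blP_def bexc_binv bmap_binv)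
        moreover have "binv b y \<in> (if b then ?D r 1 else ?D 1 r)"
          using y b by (auto simp: b_def binv_def bexc_def norm_divide)
        ultimately show ?thesis by (intro exI[of _ b] exI[of _ "binv b y"] conjI) (rule sym)
      qed
      then obtain b z where bz: "q = blP P e b z" "z \<in> (if b then ?D r 1 else ?D 1 r)"
        by (elim exE conjE) (rule that)
      show ?thesis
      proof (cases b)
        case True
        then have "q \<in> ?K1" using bz by (intro image_eqI[of _ _ z]) simp_all
        then show ?thesis by blast
      next
        case False
        then have "q \<in> ?K2" using bz by (intro image_eqI[of _ _ z]) simp_all
        then show ?thesis by blast
      qed
    qed simp
  qed
  moreover have "compactin (mtop B') (?K1 \<union> ?K2 \<union> ?K3)"
    by (intro compactin_Un cK cD bD c3')
  moreover from compactin_subset_topspace[OF this] have "?K1 \<union> ?K2 \<union> ?K3 \<subseteq> pts B'"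
    unfolding topspace_mtop[OF is_atlas_blow] .
  ultimately have "compactin (mtop B') (pts B')"
    using subset_antisym[of "pts B'" "?K1 \<union> ?K2 \<union> ?K3"] by simp
  then show ?thesis by (simp add: compact_space_def topspace_mtop[OF is_atlas_blow])
qed

end

section \<open>The blown-up planes\<close>

text \<open>
  In the coordinates \<open>u = x/y\<close>, \<open>v = 1/y\<close> near the line at infinity \<open>v = 0\<close>, the points to blow up lie
  over \<open>(a, 0)\<close> with \<open>a = 0, 1, -1\<close>. The chart \<^term>\<open>Cp a k\<close> has the coordinates \<open>((u - a)/v\<^sup>k, v)\<close>, and
  \<^term>\<open>Bp a k\<close> the coordinates \<open>((u - a)/v\<^sup>k, v\<^sup>k\<^sup>+\<^sup>1/(u - a))\<close>. The points of the \<open>m\<close>-th exceptional curve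
  over \<open>(a, 0)\<close> are the \<^term>\<open>exc a m d\<close>, for lines \<^term>\<open>d\<close>.
\<close>

definition Br :: "complex set" where "Br = {0, 1, -1}"

definition ctr :: "complex \<Rightarrow> (complex^3) set" where "ctr a = pline (vector [a, 1, 0])"

text \<open>Repeating the line d makes the level of the curve readable as the length of the list, so
  one carrier type serves all levels; level 0 is the centre itself.\<close>

definition exc :: "complex \<Rightarrow> nat \<Rightarrow> (complex^2) set \<Rightarrow> surface_point" where
  "exc a m d = (ctr a, replicate m d)"

primrec Cp :: "complex \<Rightarrow> nat \<Rightarrow> complex^2 \<Rightarrow> surface_point" where
  "Cp a 0 = (\<lambda>z. (pline (vector [a + z $ 1, 1, z $ 2]), []))"
| "Cp a (Suc k) = blP (Cp a k) (exc a (Suc k)) False"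

text \<open>At level 0 the other centres are removed, so that each centre lies in only one chart. At
  higher levels all points with v = 0 lie over (a, 0), and nothing has to be removed any
  more.\<close>

primrec CV :: "complex \<Rightarrow> nat \<Rightarrow> (complex^2) set" where
  "CV a 0 = {z. z $ 2 = 0 \<longrightarrow> a + z $ 1 \<in> Br \<longrightarrow> z $ 1 = 0}"
| "CV a (Suc k) = blV (CV a k) False"

definition Bp :: "complex \<Rightarrow> nat \<Rightarrow> complex^2 \<Rightarrow> surface_point" where
  "Bp a k = blP (Cp a k) (exc a (Suc k)) True"

definition BV :: "complex \<Rightarrow> nat \<Rightarrow> (complex^2) set" where
  "BV a k = blV (CV a k) True"

definition Zp :: "complex^2 \<Rightarrow> surface_point" where
  "Zp z = (pline (vector [z $ 1, z $ 2, 1]), [])"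

definition Xp :: "complex^2 \<Rightarrow> surface_point" where
  "Xp z = (pline (vector [1, z $ 1, z $ 2]), [])"

text \<open>The points removed are the centres [1 : 1 : 0] and [1 : -1 : 0]; the centre [0 : 1 : 0]
  is outside this chart anyway.\<close>

definition XV :: "(complex^2) set" where
  "XV = {z. z $ 2 = 0 \<longrightarrow> z $ 1 \<noteq> 1 \<and> z $ 1 \<noteq> -1}"

definition BC :: "(complex \<Rightarrow> nat) \<Rightarrow> complex \<Rightarrow> (surface_point, 2) atlas" where
  "BC n a = (\<lambda>k. pch (BV a k) (Bp a k)) ` {..<n a}"

text \<open>The plane after n a successive blow-ups over each (a, 0). Every blow-up leaves one chart
  \<open>Bp\<close> behind for good; the other new chart is \<open>Cp\<close>, and only the latest
  one is kept, since its origin is the next centre.\<close>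

definition Surf :: "(complex \<Rightarrow> nat) \<Rightarrow> (surface_point, 2) atlas" where
  "Surf n = {pch UNIV Zp, pch XV Xp} \<union> (\<Union>a\<in>Br. insert (pch (CV a (n a)) (Cp a (n a))) (BC n a))"

definition Rest :: "(complex \<Rightarrow> nat) \<Rightarrow> complex \<Rightarrow> (surface_point, 2) atlas" where
  "Rest n a = {pch UNIV Zp, pch XV Xp} \<union> BC n a \<union>
     (\<Union>b\<in>Br - {a}. insert (pch (CV b (n b)) (Cp b (n b))) (BC n b))"

lemma Surf_Rest: "a \<in> Br ==> Surf n = insert (pch (CV a (n a)) (Cp a (n a))) (Rest n a)"
  unfolding Surf_def Rest_def by blast

lemma Surf_blow:
  assumes "a \<in> Br"
  shows "Surf (n(a := Suc (n a))) = blow (CV a (n a)) (Cp a (n a)) (exc a (Suc (n a))) (Rest n a)"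
proof -
  let ?n = "n(a := Suc (n a))"
  have 1: "BC ?n a = insert (pch (BV a (n a)) (Bp a (n a))) (BC n a)"
    unfolding BC_def by (simp add: lessThan_Suc)
  have 2: "BC ?n b = BC n b" if "b \<noteq> a" for b using that by (simp add: BC_def)
  have "Rest ?n a = insert (pch (BV a (n a)) (Bp a (n a))) (Rest n a)"
    unfolding Rest_def using 1 2 by auto
  then show ?thesis
    unfolding Surf_Rest[OF assms] blow_def by (simp add: BV_def Bp_def insert_commute)
qed

lemma finite_Surf: "finite (Surf n)"
  by (auto simp: Surf_def BC_def Br_def)

lemma CV_Suc: "CV a (Suc k) = UNIV"
proof -
  have "bmap False z \<in> CV a 0" for z by (simp add: bmap_def)
  then have "CV a (Suc 0) = UNIV" by (auto simp: blV_def)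
  then show ?thesis by (induction k) (auto simp: blV_def)
qed

lemma BV_Suc: "BV a (Suc k) = UNIV"
  unfolding BV_def CV_Suc by (simp add: blV_def)

lemma BV_0: "BV a 0 = CV a 0"
  by (auto simp: BV_def blV_def bmap_def)

lemma open_CV: "open (CV a k)"
proof (cases k)
  case 0
  have "finite ((\<lambda>b. vector [b - a, 0] :: complex^2) ` (Br - {a}))" by (simp add: Br_def)
  then have "open (- ((\<lambda>b. vector [b - a, 0] :: complex^2) ` (Br - {a})))"
    by (intro open_Compl finite_imp_closed)
  moreover have "CV a 0 = - ((\<lambda>b. vector [b - a, 0]) ` (Br - {a}))"
  proof (intro set_eqI iffI)
    fix z :: "complex^2" assume "z \<in> CV a 0"
    then show "z \<in> - ((\<lambda>b. vector [b - a, 0]) ` (Br - {a}))" by auto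
  next
    fix z :: "complex^2" assume z: "z \<in> - ((\<lambda>b. vector [b - a, 0]) ` (Br - {a}))"
    show "z \<in> CV a 0"
    proof (rule ccontr)
      assume "z \<notin> CV a 0"
      then have 1: "z $ 2 = 0" "a + z $ 1 \<in> Br" "z $ 1 \<noteq> 0" by auto
      then have "z = vector [(a + z $ 1) - a, 0]" by (simp add: vec_eq_iff forall_2)
      moreover have "a + z $ 1 \<in> Br - {a}" using 1 by auto
      ultimately show False using z by blast
    qed
  qed
  ultimately show ?thesis using 0 by simp
next
  case (Suc j)
  then show ?thesis by (simp only: CV_Suc open_UNIV)
qed

lemma open_BV: "open (BV a k)"
  unfolding BV_def by (rule open_blV[OF open_CV])

lemma open_XV: "open XV"
proof -
  have "XV = - {vector [1, 0], vector [-1, 0]}" by (auto simp: XV_def vec_eq_iff forall_2)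
  then show ?thesis
    using open_Compl[OF finite_imp_closed[of "{vector [1, 0], vector [-1, 0]} :: (complex^2) set"]] by simp
qed

lemma zero_CV: "0 \<in> CV a k"
  by (cases k) (simp, simp only: CV_Suc UNIV_I)

lemma Cp_eq: "Cp a k z = (if k = 0 \<or> z $ 2 \<noteq> 0
    then (pline (vector [a + z $ 1 * z $ 2 ^ k, 1, z $ 2]), []) else exc a k (pline (vector [z $ 1, 1])))"
proof (induction k arbitrary: z)
  case (Suc k)
  show ?case
    by (simp add: blP_def bexc_def bdir_def bmap_def Suc mult.assoc)
qed simp

lemma Bp_eq: "Bp a k z = (if z $ 1 = 0 then exc a (Suc k) (pline (vector [1, z $ 2]))
    else if k = 0 \<or> z $ 2 \<noteq> 0 then (pline (vector [a + z $ 1 * (z $ 1 * z $ 2) ^ k, 1, z $ 1 * z $ 2]), [])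
    else exc a k (pline (vector [z $ 1, 1])))"
  by (simp add: Bp_def blP_def bexc_def bdir_def bmap_def Cp_eq)

lemma pline_Y_eq: "pline (vector [u, 1, v] :: complex^3) = pline (vector [u', 1, v']) \<longleftrightarrow> u = u' \<and> v = v'"
proof
  assume "pline (vector [u, 1, v] :: complex^3) = pline (vector [u', 1, v'])"
  then obtain c where "(vector [u, 1, v] :: complex^3) = c *s vector [u', 1, v']" using pline_eqD by blast
  then show "u = u' \<and> v = v'" by (simp add: vec_eq_iff forall_3)
qed simp

lemma ctr_eq: "ctr a = ctr b \<longleftrightarrow> a = b"
  by (simp add: ctr_def pline_Y_eq)

lemma exc_eq: "exc a m d = exc b k l \<longleftrightarrow> a = b \<and> m = k \<and> (m = 0 \<or> d = l)"
  by (cases m; cases k) (auto simp: exc_def ctr_eq dest: arg_cong[where f=length])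

lemma pline_Z_eq: "pline (vector [u, 1, v] :: complex^3) = pline (vector [x, y, 1]) \<longleftrightarrow>
    v \<noteq> 0 \<and> x = u / v \<and> y = 1 / v"
proof
  assume "pline (vector [u, 1, v] :: complex^3) = pline (vector [x, y, 1])"
  then obtain c where "(vector [u, 1, v] :: complex^3) = c *s vector [x, y, 1]" using pline_eqD by blast
  then show "v \<noteq> 0 \<and> x = u / v \<and> y = 1 / v" by (auto simp: vec_eq_iff forall_3 field_simps)
next
  assume "v \<noteq> 0 \<and> x = u / v \<and> y = 1 / v"
  then show "pline (vector [u, 1, v] :: complex^3) = pline (vector [x, y, 1])"
    by (intro pline_eqI[of v]) (auto simp: vec_eq_iff forall_3)
qed

lemma pline_X_eq: "pline (vector [u, 1, v] :: complex^3) = pline (vector [1, x, y]) \<longleftrightarrow>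
    u \<noteq> 0 \<and> x = 1 / u \<and> y = v / u"
proof
  assume "pline (vector [u, 1, v] :: complex^3) = pline (vector [1, x, y])"
  then obtain c where "(vector [u, 1, v] :: complex^3) = c *s vector [1, x, y]" using pline_eqD by blast
  then show "u \<noteq> 0 \<and> x = 1 / u \<and> y = v / u" by (auto simp: vec_eq_iff forall_3 field_simps)
next
  assume "u \<noteq> 0 \<and> x = 1 / u \<and> y = v / u"
  then show "pline (vector [u, 1, v] :: complex^3) = pline (vector [1, x, y])"
    by (intro pline_eqI[of u]) (auto simp: vec_eq_iff forall_3)
qed

lemma vector_Y_nz: "(vector [u, 1, v] :: complex^3) \<noteq> 0"
  by (simp add: vec_eq_iff forall_3)

lemma pline2_ne: "pline (vector [1, w] :: complex^2) \<noteq> pline (vector [0, 1])"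
proof
  assume "pline (vector [1, w] :: complex^2) = pline (vector [0, 1])"
  then obtain c where "(vector [1, w] :: complex^2) = c *s vector [0, 1]" using pline_eqD by blast
  then show False by (simp add: vec_eq_iff forall_2)
qed

lemma pts_BC: "pts (BC n a) = (\<Union>k<n a. Bp a k ` BV a k)"
  by (auto simp: BC_def pts_def pch_def)

lemma pts_Surf: "pts (Surf n) = range Zp \<union> Xp ` XV \<union>
    (\<Union>a\<in>Br. Cp a (n a) ` CV a (n a) \<union> (\<Union>k<n a. Bp a k ` BV a k))"
proof -
  have "pts (Surf n) = range Zp \<union> Xp ` XV \<union> (\<Union>a\<in>Br. Cp a (n a) ` CV a (n a) \<union> pts (BC n a))"
    by (auto simp: Surf_def pts_def pch_def)
  then show ?thesis by (simp only: pts_BC)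
qed

lemma Surf_cases:
  assumes "p \<in> pts (Surf n)"
  obtains (Z) z where "p = Zp z"
    | (X) z where "z \<in> XV" "p = Xp z"
    | (C) a z where "a \<in> Br" "z \<in> CV a (n a)" "p = Cp a (n a) z"
    | (B) a k z where "a \<in> Br" "k < n a" "z \<in> BV a k" "p = Bp a k z"
  using assms unfolding pts_Surf by blast

text \<open>No centre of a later blow-up is covered by another chart.\<close>

lemma Surf_points:
  assumes "p \<in> pts (Surf n)"
  shows "(\<exists>v. v \<noteq> 0 \<and> p = (pline v, []) \<and> (\<forall>a\<in>Br. pline v = ctr a \<longrightarrow> n a = 0)) \<or>
    (\<exists>a m d. a \<in> Br \<and> p = exc a m (pline d) \<and> 1 \<le> m \<and> m \<le> n a \<and> d \<noteq> 0 \<and> (d $ 1 = 0 \<longrightarrow> m = n a))"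
  using assms
proof (cases rule: Surf_cases)
  case (Z z)
  have "pline (vector [z $ 1, z $ 2, 1]) \<noteq> ctr a" for a
    using pline_Z_eq[of a 0 "z $ 1" "z $ 2"] unfolding ctr_def by metis
  moreover have "(vector [z $ 1, z $ 2, 1] :: complex^3) \<noteq> 0" by (simp add: vec_eq_iff forall_3)
  ultimately show ?thesis unfolding Z Zp_def
    by (intro disjI1 exI[of _ "vector [z $ 1, z $ 2, 1]"]) simp
next
  case (X z)
  have "pline (vector [1, z $ 1, z $ 2]) \<noteq> ctr a" if "a \<in> Br" for a
  proof
    assume "pline (vector [1, z $ 1, z $ 2]) = ctr a"
    then have "a \<noteq> 0 \<and> z $ 1 = 1 / a \<and> z $ 2 = 0"
      using pline_X_eq[of a 0 "z $ 1" "z $ 2"] unfolding ctr_def by simp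
    then show False using X(1) that by (auto simp: XV_def Br_def)
  qed
  moreover have "(vector [1, z $ 1, z $ 2] :: complex^3) \<noteq> 0" by (simp add: vec_eq_iff forall_3)
  ultimately show ?thesis unfolding X Xp_def
    by (intro disjI1 exI[of _ "vector [1, z $ 1, z $ 2]"]) simp
next
  case (C a z)
  show ?thesis
  proof (cases "n a = 0 \<or> z $ 2 \<noteq> 0")
    case True
    have "n b = 0" if "b \<in> Br" "pline (vector [a + z $ 1 * z $ 2 ^ n a, 1, z $ 2]) = ctr b" for b
    proof -
      have 1: "z $ 2 = 0" "a + z $ 1 * z $ 2 ^ n a = b" using that(2) by (auto simp: ctr_def pline_Y_eq)
      then have 2: "n a = 0" using True by simp
      then have "z $ 1 = 0" using C(2) 1 that(1) by simp
      then show ?thesis using 1 2 by simp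
    qed
    then show ?thesis using True unfolding C(3) Cp_eq
      by (intro disjI1 exI[of _ "vector [a + z $ 1 * z $ 2 ^ n a, 1, z $ 2]"]) (simp add: vector_Y_nz)
  next
    case False
    then show ?thesis unfolding C(3) Cp_eq
      by (intro disjI2 exI[of _ a] exI[of _ "n a"] exI[of _ "vector [z $ 1, 1]"])
        (use C in "auto simp: vec_eq_iff forall_2")
  qed
next
  case (B a k z)
  consider (1) "z $ 1 = 0" | (2) "z $ 1 \<noteq> 0" "k = 0 \<or> z $ 2 \<noteq> 0" | (3) "z $ 1 \<noteq> 0" "k \<noteq> 0" "z $ 2 = 0" by blast
  then show ?thesis
  proof cases
    case 1
    then show ?thesis unfolding B(4) Bp_eq
      by (intro disjI2 exI[of _ a] exI[of _ "Suc k"] exI[of _ "vector [1, z $ 2]"])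
        (use B in "auto simp: vec_eq_iff forall_2")
  next
    case 2
    have "n b = 0" if "b \<in> Br" "pline (vector [a + z $ 1 * (z $ 1 * z $ 2) ^ k, 1, z $ 1 * z $ 2]) = ctr b" for b
    proof -
      have 3: "z $ 2 = 0" "a + z $ 1 * (z $ 1 * z $ 2) ^ k = b" using that(2) 2 by (auto simp: ctr_def pline_Y_eq)
      then have 4: "k = 0" using 2 by simp
      then have "z $ 1 = 0" using B(3) 3 that(1) by (simp add: BV_0)
      then show ?thesis using 2 by simp
    qed
    then show ?thesis using 2 unfolding B(4) Bp_eq
      by (intro disjI1 exI[of _ "vector [a + z $ 1 * (z $ 1 * z $ 2) ^ k, 1, z $ 1 * z $ 2]"])
        (simp add: vector_Y_nz)
  next
    case 3
    then show ?thesis unfolding B(4) Bp_eq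
      by (intro disjI2 exI[of _ a] exI[of _ k] exI[of _ "vector [z $ 1, 1]"])
        (use B in "auto simp: vec_eq_iff forall_2")
  qed
qed

lemma exc_new:
  assumes "exc a m l \<in> pts (Surf n)" "m \<noteq> 0"
  shows "m \<le> n a"
  using Surf_points[OF assms(1)] assms(2)
  by (auto simp: exc_eq) (auto simp: exc_def)

lemma Rest_cases:
  assumes "p \<in> pts (Rest n a)" "a \<in> Br"
  obtains (Z) z where "p = Zp z" | (X) z where "z \<in> XV" "p = Xp z"
    | (C) b z where "b \<in> Br" "b \<noteq> a" "z \<in> CV b (n b)" "p = Cp b (n b) z"
    | (B) b k z where "b \<in> Br" "k < n b" "z \<in> BV b k" "p = Bp b k z"
proof -
  have "p \<in> range Zp \<union> Xp ` XV \<union> pts (BC n a) \<union>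
      (\<Union>b\<in>Br - {a}. Cp b (n b) ` CV b (n b) \<union> pts (BC n b))"
    using assms(1) by (auto simp: Rest_def pts_def pch_def)
  then show thesis unfolding pts_BC using assms(2) Z X C B by blast
qed

text \<open>On the latest exceptional curve the centre is the line (0, 1), the only one that the
  chart \<open>Bp\<close> of that blow-up misses. Before the first blow-up over a, the point is
  removed from the other charts by \<open>CV\<close> and \<open>XV\<close> or lies outside
  them.\<close>

lemma centre_Rest:
  assumes a: "a \<in> Br"
  shows "Cp a (n a) 0 \<notin> pts (Rest n a)"
proof
  let ?p = "Cp a (n a) 0"
  have p: "?p = (if n a = 0 then (ctr a, []) else exc a (n a) (pline (vector [0, 1])))"
    by (simp add: Cp_eq ctr_def)
  assume "?p \<in> pts (Rest n a)"
  from this a show False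
  proof (cases rule: Rest_cases)
    case (Z z)
    then show ?thesis using pline_Z_eq[of a 0 "z $ 1" "z $ 2"]
      by (auto simp: p Zp_def exc_def ctr_def split: if_splits)
  next
    case (X z)
    then show ?thesis using pline_X_eq[of a 0 "z $ 1" "z $ 2"] a
      by (auto simp: p Xp_def exc_def ctr_def XV_def Br_def split: if_splits)
  next
    case (C b z)
    show ?thesis
    proof (cases "n b = 0 \<or> z $ 2 \<noteq> 0")
      case True
      then have "Cp b (n b) z = (pline (vector [b + z $ 1 * z $ 2 ^ n b, 1, z $ 2]), [])"
        by (subst Cp_eq) simp
      then have "ctr a = pline (vector [b + z $ 1 * z $ 2 ^ n b, 1, z $ 2])"
        using C(4) by (auto simp: p exc_def split: if_splits)
      then have 1: "z $ 2 = 0" "a = b + z $ 1 * z $ 2 ^ n b" by (auto simp: ctr_def pline_Y_eq)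
      then have "n b = 0" using True by simp
      then show ?thesis using 1 C a by auto
    next
      case False
      then have "Cp b (n b) z = exc b (n b) (pline (vector [z $ 1, 1]))" by (subst Cp_eq) simp
      then show ?thesis using C False by (auto simp: p exc_def ctr_eq split: if_splits)
    qed
  next
    case (B b k z)
    consider (1) "z $ 1 = 0" | (2) "z $ 1 \<noteq> 0" "k = 0 \<or> z $ 2 \<noteq> 0" | (3) "z $ 1 \<noteq> 0" "k \<noteq> 0" "z $ 2 = 0" by blast
    then show ?thesis
    proof cases
      case 1
      then have "?p = exc b (Suc k) (pline (vector [1, z $ 2]))" using B(4) by (simp add: Bp_eq)
      then have "n a \<noteq> 0 \<and> exc a (n a) (pline (vector [0, 1])) = exc b (Suc k) (pline (vector [1, z $ 2]))"
        unfolding p by (auto simp: exc_def split: if_splits)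
      then show ?thesis using pline2_ne by (metis exc_eq)
    next
      case 2
      then have "Bp b k z = (pline (vector [b + z $ 1 * (z $ 1 * z $ 2) ^ k, 1, z $ 1 * z $ 2]), [])"
        by (subst Bp_eq) simp
      then have e: "ctr a = pline (vector [b + z $ 1 * (z $ 1 * z $ 2) ^ k, 1, z $ 1 * z $ 2])"
        using B(4) by (auto simp: p exc_def split: if_splits)
      then have 3: "z $ 2 = 0" "a = b + z $ 1 * (z $ 1 * z $ 2) ^ k" using 2 by (auto simp: ctr_def pline_Y_eq)
      then have "k = 0" using 2 by simp
      then show ?thesis using 2 3 B(3) a by (simp add: BV_0)
    next
      case 3
      then have "?p = exc b k (pline (vector [z $ 1, 1]))" using B(4) by (simp add: Bp_eq)
      then have "n a \<noteq> 0 \<and> exc a (n a) (pline (vector [0, 1])) = exc b k (pline (vector [z $ 1, 1]))"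
        unfolding p using 3 by (auto simp: exc_def split: if_splits)
      then show ?thesis using B(2) by (auto simp: exc_eq)
    qed
  qed
qed

lemma is_atlas_Surf_0: "is_atlas (Surf (\<lambda>_. 0))"
proof -
  define F where "F = {(UNIV, Zp), (XV, Xp)} \<union> (\<lambda>a. (CV a 0, Cp a 0)) ` Br"
  have op: "open V" if "(V, P) \<in> F" for V P
    using that open_CV[of _ 0] open_XV by (auto simp: F_def simp del: CV.simps Cp.simps)
  have l: "\<exists>\<alpha> \<tau> l. lins \<alpha> \<tau> l \<and> P = (\<lambda>z. (pline (\<alpha> z), []))" if "(V, P) \<in> F" for V P
    using that lins_Z lins_X lins_Y unfolding F_def Zp_def[abs_def] Xp_def[abs_def] by fastforce
  have inj: "inj_on P V" if VP: "(V, P) \<in> F" for V P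
  proof -
    obtain \<alpha> \<tau> l where "lins \<alpha> \<tau> l" "P = (\<lambda>z. (pline (\<alpha> z), []))"
      using l[OF VP] by (elim exE conjE) (rule that)
    then show ?thesis using lins_inj[of \<alpha> \<tau> l V] by (simp add: inj_on_def)
  qed
  show ?thesis
  proof (rule is_atlasI[where F=F])
    fix U \<phi> assume "(U, \<phi>) \<in> Surf (\<lambda>_. 0)"
    then obtain V P where VP: "(V, P) \<in> F" "(U, \<phi>) = pch V P"
      by (auto simp: Surf_def BC_def F_def simp del: CV.simps Cp.simps)
    then show "\<exists>V P. (V, P) \<in> F \<and> open V \<and> P ` V = U \<and> (\<forall>z\<in>V. \<phi> (P z) = z)"
      using op[OF VP(1)] inj[OF VP(1)] by (intro exI[of _ V] exI[of _ P]) (auto simp: pch_def)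
  next
    fix V P V' Q z z' assume VP: "(V, P) \<in> F" "(V', Q) \<in> F" and z: "z \<in> V" "z' \<in> V'" "P z = Q z'"
    obtain \<alpha> \<tau> l where 1: "lins \<alpha> \<tau> l" "P = (\<lambda>z. (pline (\<alpha> z), []))"
      using l[OF VP(1)] by (elim exE conjE) (rule that)
    obtain \<alpha>' \<tau>' l' where 2: "lins \<alpha>' \<tau>' l'" "Q = (\<lambda>z. (pline (\<alpha>' z), []))"
      using l[OF VP(2)] by (elim exE conjE) (rule that)
    have "fac (\<lambda>y. pline (\<alpha> y)) z (\<lambda>y. pline (\<alpha>' y)) V'"
      by (rule lins_fac[OF 1(1) 2(1) op[OF VP(2)] z(2)]) (use z 1 2 in simp)
    from fac_map[OF this, of "\<lambda>l. (l, [])"] show "fac P z Q V'" unfolding 1 2 .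
  qed
qed

text \<open>Finitely many points over each centre are blown up.\<close>

lemma Surf_induct [consumes 1, case_names zero step]:
  assumes n: "\<And>a. a \<notin> Br ==> n a = (0::nat)"
    and "R (\<lambda>_. 0)" "\<And>n a. R n ==> a \<in> Br ==> R (n(a := Suc (n a)))"
  shows "R n"
proof -
  have up: "R m ==> a \<in> Br ==> R (m(a := m a + k))" for m a k
  proof (induction k)
    case (Suc k)
    have "(m(a := m a + k))(a := Suc ((m(a := m a + k)) a)) = m(a := m a + Suc k)" by (rule ext) simp
    then show ?case using assms(3)[OF Suc.IH[OF Suc.prems] Suc.prems(2)] by (simp only:)
  qed simp
  have 1: "R ((\<lambda>_. 0)(0 := n 0))" using up[OF assms(2), of 0 "n 0"] by (simp add: Br_def)
  have 2: "R ((\<lambda>_. 0)(0 := n 0, 1 := n 1))" using up[OF 1, of 1 "n 1"] by (simp add: Br_def)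
  have 3: "R ((\<lambda>_. 0)(0 := n 0, 1 := n 1, - 1 := n (- 1)))" using up[OF 2, of "-1" "n (-1)"] by (simp add: Br_def)
  moreover have "(\<lambda>_. 0)(0 := n 0, 1 := n 1, - 1 := n (- 1)) = n"
    using n by (auto simp: fun_eq_iff Br_def)
  ultimately show ?thesis by simp
qed

lemma Cp_blowup:
  assumes at: "is_atlas (Surf n)" and a: "a \<in> Br" and inj: "inj_on (Cp a (n a)) (CV a (n a))"
  shows "blowup (CV a (n a)) (Cp a (n a)) (exc a (Suc (n a))) (Rest n a)"
proof
  show "is_atlas (insert (pch (CV a (n a)) (Cp a (n a))) (Rest n a))"
    using at unfolding Surf_Rest[OF a, of n] .
  show "inj_on (exc a (Suc (n a))) plines" by (simp add: inj_on_def exc_eq)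
  show "exc a (Suc (n a)) ` plines \<inter> pts (insert (pch (CV a (n a)) (Cp a (n a))) (Rest n a)) = {}"
    unfolding Surf_Rest[OF a, of n, symmetric] using exc_new[of a "Suc (n a)"] by fastforce
qed (use open_CV zero_CV inj centre_Rest[OF a] in auto)

lemma exc_Cp_disjoint: "exc a (Suc k) ` X \<inter> Cp a k ` Y = {}"
proof -
  have "exc a (Suc k) l \<noteq> Cp a k z" for l z
    by (simp add: Cp_eq exc_eq) (simp add: exc_def)
  note ne = this
  show ?thesis
  proof (rule equals0I)
    fix x assume "x \<in> exc a (Suc k) ` X \<inter> Cp a k ` Y"
    then obtain l z where "x = exc a (Suc k) l" "x = Cp a k z" by blast
    then show False using ne[of l z] by simp
  qed
qed

lemma Cp_inj: "inj_on (Cp a k) (CV a k)"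
proof (induction k)
  case 0
  show ?case using lins_inj[OF lins_Y, of a "CV a 0"] by (simp add: inj_on_def)
next
  case (Suc k)
  show ?case unfolding CV.simps Cp.simps
    by (rule blP_inj_on[OF Suc _ _ zero_CV]) (simp_all add: exc_Cp_disjoint inj_on_def exc_eq del: CV.simps Cp.simps)
qed

lemma Bp_inj: "inj_on (Bp a k) (BV a k)"
  unfolding BV_def Bp_def
  by (rule blP_inj_on[OF Cp_inj _ _ zero_CV]) (simp_all add: exc_Cp_disjoint inj_on_def exc_eq del: CV.simps Cp.simps)

text \<open>Blow-ups over the three centres only; this is what makes \<open>Surf_induct\<close>
  applicable.\<close>

locale brn =
  fixes n :: "complex \<Rightarrow> nat"
  assumes n0: "\<And>a. a \<notin> Br ==> n a = 0"
begin

lemma is_atlas_Surf: "is_atlas (Surf n)"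
proof (rule Surf_induct[where R="\<lambda>n. is_atlas (Surf n)" and n=n])
  fix n :: "complex \<Rightarrow> nat" and a assume step: "is_atlas (Surf n)" "a \<in> Br"
  interpret blowup "CV a (n a)" "Cp a (n a)" "exc a (Suc (n a))" "Rest n a"
    by (rule Cp_blowup[OF step Cp_inj])
  show "is_atlas (Surf (n(a := Suc (n a))))" unfolding Surf_blow[OF step(2)] by (rule is_atlas_blow)
qed (use n0 is_atlas_Surf_0 in auto)

lemma lpar_Surf: "pch V P \<in> Surf n ==> open V ==> inj_on P V ==> lpar (Surf n) V P"
  unfolding lpar_def by (intro conjI bexI[of _ "pch V P"]) (auto simp: pch_def)

lemma par_Z: "par (Surf n) UNIV Zp"
  by (rule lpar_par[OF lpar_Surf]) (use lins_inj[OF lins_Z] in "auto simp: Surf_def inj_on_def Zp_def")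

lemma par_X: "par (Surf n) XV Xp"
  by (rule lpar_par[OF lpar_Surf]) (use lins_inj[OF lins_X] open_XV in "auto simp: Surf_def inj_on_def Xp_def")

lemma par_C: "a \<in> Br ==> par (Surf n) (CV a (n a)) (Cp a (n a))"
  by (rule lpar_par[OF lpar_Surf[OF _ open_CV Cp_inj]]) (auto simp: Surf_def)

lemma par_B: "a \<in> Br ==> k < n a ==> par (Surf n) (BV a k) (Bp a k)"
  by (rule lpar_par[OF lpar_Surf[OF _ open_BV Bp_inj]]) (auto simp: Surf_def BC_def)

end

section \<open>Maps of the surfaces to the projective plane\<close>

definition rep :: "(complex^('n::finite)) set \<Rightarrow> complex^'n" where
  "rep l = (SOME v. v \<noteq> 0 \<and> l = pline v)"

lemma rep_pline:
  assumes "v \<noteq> 0"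
  shows "\<exists>c. c \<noteq> 0 \<and> rep (pline v) = c *s v" "rep (pline v) \<noteq> 0" "pline (rep (pline v)) = pline v"
proof -
  have 1: "rep (pline v) \<noteq> 0 \<and> pline v = pline (rep (pline v))"
    unfolding rep_def by (rule someI[of _ v]) (use assms in simp)
  then show "rep (pline v) \<noteq> 0" "pline (rep (pline v)) = pline v" by auto
  from 1 pline_eqD[of "rep (pline v)" v] show "\<exists>c. c \<noteq> 0 \<and> rep (pline v) = c *s v" by auto
qed

definition tri :: "complex \<Rightarrow> complex \<Rightarrow> complex \<Rightarrow> nat \<Rightarrow> complex" where
  "tri x y w i = (if i = 0 then x else if i = 1 then y else w)"

definition F0 :: "surface_point \<Rightarrow> nat \<Rightarrow> complex" where
  "F0 p = tri (rep (fst p) $ 1) (rep (fst p) $ 2) (rep (fst p) $ 3)"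

text \<open>
  The map \<open>[(X - aY) Y\<^sup>j\<^sup>-\<^sup>1 : (X - aY) X\<^sup>j\<^sup>-\<^sup>1 : Z\<^sup>j]\<close>, resolved by \<open>j\<close> blow-ups over \<open>(a, 0)\<close>. Without its second
  component, it would be indeterminate at \<open>[1 : 0 : 0]\<close>, too.
\<close>

definition FG :: "complex \<Rightarrow> nat \<Rightarrow> surface_point \<Rightarrow> nat \<Rightarrow> complex" where
  "FG a j p = (let v = rep (fst p); d = rep (last (snd p)); m = length (snd p) in
     if m = 0 \<or> fst p \<noteq> ctr a
     then tri ((v $ 1 - a * v $ 2) * v $ 2 ^ (j - 1)) ((v $ 1 - a * v $ 2) * v $ 1 ^ (j - 1)) (v $ 3 ^ j)
     else if m < j then tri 1 (a ^ (j - 1)) 0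
     else if m = j then tri (d $ 1) (a ^ (j - 1) * d $ 1) (d $ 2)
     else tri 0 0 1)"

lemma tri_mult: "c * tri x y w i = tri (c * x) (c * y) (c * w) i"
  by (simp add: tri_def)

lemma tri_cong: "x = x' ==> y = y' ==> w = w' ==> tri x y w i = tri x' y' w' i"
  by simp

lemma cdiff_tri: "cdiff f x ==> cdiff g x ==> cdiff h x ==> cdiff (\<lambda>y. tri (f y) (g y) (h y) i) x"
  by (cases "i = 0"; cases "i = 1") (simp_all add: tri_def)

lemma F0_line: "v \<noteq> 0 ==> fst p = pline v ==> \<exists>c. c \<noteq> 0 \<and> (\<forall>k\<le>2. F0 p k = c * tri (v $ 1) (v $ 2) (v $ 3) k)"
  using rep_pline(1)[of v] by (auto simp: F0_def tri_def)

lemma FG_line: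
  assumes "v \<noteq> 0" "fst p = pline v" "snd p = [] \<or> fst p \<noteq> ctr a" "j \<ge> 1"
  shows "\<exists>c. c \<noteq> 0 \<and> (\<forall>k\<le>2. FG a j p k = c *
    tri ((v $ 1 - a * v $ 2) * v $ 2 ^ (j - 1)) ((v $ 1 - a * v $ 2) * v $ 1 ^ (j - 1)) (v $ 3 ^ j) k)"
proof -
  obtain c where c: "c \<noteq> 0" "rep (pline v) = c *s v" using rep_pline(1)[OF assms(1)] by blast
  obtain i where j: "j = Suc i" using assms(4) by (cases j) auto
  \<comment> \<open>All three components are homogeneous of degree j, so a change of representative
    multiplies them by c^j.\<close>
  have "FG a j p k = c ^ j * tri ((v $ 1 - a * v $ 2) * v $ 2 ^ (j - 1)) ((v $ 1 - a * v $ 2) * v $ 1 ^ (j - 1)) (v $ 3 ^ j) k" for k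
    using assms(2,3) c unfolding tri_mult
    by (auto simp: FG_def Let_def j power_mult_distrib algebra_simps intro!: tri_cong)
  then show ?thesis using c(1) by (intro exI[of _ "c ^ j"]) simp
qed

lemma FG_exc:
  assumes "m \<ge> 1" "d \<noteq> 0"
  shows "\<exists>c. c \<noteq> 0 \<and> (\<forall>k\<le>2. FG a j (exc a m (pline d)) k = c *
    (if m < j then tri 1 (a ^ (j - 1)) 0 else if m = j then tri (d $ 1) (a ^ (j - 1) * d $ 1) (d $ 2) else tri 0 0 1) k)"
proof -
  obtain c where c: "c \<noteq> 0" "rep (pline d) = c *s d" using rep_pline(1)[OF assms(2)] by blast
  have "last (replicate m (pline d)) = pline d" using assms(1) by simp
  then show ?thesis using c assms(1)
    by (intro exI[of _ "if m = j then c else 1"])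
      (auto simp: FG_def Let_def exc_def tri_mult algebra_simps intro!: tri_cong)
qed

lemma CV_Br: "z \<in> CV b m ==> a \<in> Br ==> a \<noteq> b ==> z $ 2 = 0 ==> b + z $ 1 * z $ 2 ^ m \<noteq> a"
  by (cases m) auto

lemma BV_Br: "z \<in> BV b m ==> a \<in> Br ==> a \<noteq> b ==> z $ 1 * z $ 2 = 0 ==>
    b + z $ 1 * (z $ 1 * z $ 2) ^ m \<noteq> a"
  by (cases m) (auto simp: BV_0)

lemma fst_Cp: "fst (Cp a k z) = pline (vector [a + z $ 1 * z $ 2 ^ k, 1, z $ 2])"
  by (auto simp: Cp_eq exc_def ctr_def power_0_left)

lemma fst_Bp: "fst (Bp a k z) = pline (vector [a + z $ 1 * (z $ 1 * z $ 2) ^ k, 1, z $ 1 * z $ 2])"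
  by (auto simp: Bp_eq exc_def ctr_def power_0_left)

lemma snd_Cp_other: "snd (Cp b k z) = [] \<or> fst (Cp b k z) = ctr b"
  by (auto simp: Cp_eq exc_def)

lemma snd_Bp_other: "snd (Bp b k z) = [] \<or> fst (Bp b k z) = ctr b"
  by (auto simp: Bp_eq exc_def)

text \<open>The same map in the affine coordinates u = X/Y and v = Z/Y, as used away from the
  exceptional curves over (a, 0).\<close>

definition Fpoly :: "complex \<Rightarrow> nat \<Rightarrow> complex \<Rightarrow> complex \<Rightarrow> nat \<Rightarrow> complex" where
  "Fpoly a j u v = tri (u - a) ((u - a) * u ^ (j - 1)) (v ^ j)"

lemma FG_Y:
  assumes "fst p = pline (vector [u, 1, v])" "snd p = [] \<or> fst p \<noteq> ctr a" "j \<ge> 1"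
  shows "\<exists>c. c \<noteq> 0 \<and> (\<forall>k\<le>2. FG a j p k = c * Fpoly a j u v k)"
  using FG_line[OF vector_Y_nz assms] by (simp add: Fpoly_def)

text \<open>Here u - a = z1 z2^m and v = z2, so for j \<le> m the factor z2^j is common to all
  components. Cancelling it extends the map across the exceptional curve.\<close>

lemma FG_Cp:
  assumes j: "1 \<le> j" "j \<le> m"
  shows "\<exists>c. c \<noteq> 0 \<and> (\<forall>k\<le>2. FG a j (Cp a m z) k = c * tri (z $ 1 * z $ 2 ^ (m - j))
    ((a + z $ 1 * z $ 2 ^ m) ^ (j - 1) * (z $ 1 * z $ 2 ^ (m - j))) 1 k)"
proof (cases "z $ 2 = 0")
  case False
  then have "snd (Cp a m z) = []" by (simp add: Cp_eq)
  then obtain c where c: "c \<noteq> 0" "\<forall>k\<le>2. FG a j (Cp a m z) k = c * Fpoly a j (a + z $ 1 * z $ 2 ^ m) (z $ 2) k"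
    using FG_Y[OF fst_Cp _ j(1)] by blast
  have "z $ 2 ^ m = z $ 2 ^ j * z $ 2 ^ (m - j)" using j(2) by (simp flip: power_add)
  then show ?thesis using c False
    by (intro exI[of _ "c * z $ 2 ^ j"]) (auto simp: Fpoly_def tri_def algebra_simps)
next
  case True
  then have e: "Cp a m z = exc a m (pline (vector [z $ 1, 1]))" using j by (simp add: Cp_eq)
  have "(vector [z $ 1, 1] :: complex^2) \<noteq> 0" by (simp add: vec_eq_iff forall_2)
  then show ?thesis unfolding e using FG_exc[of m "vector [z $ 1, 1]" a j] j True
    by (cases "m = j") (auto simp: power_0_left)
qed

lemma FG_Bp:
  assumes j: "1 \<le> j" "j \<le> m"
  shows "\<exists>c. c \<noteq> 0 \<and> (\<forall>k\<le>2. FG a j (Bp a m z) k = c * tri (z $ 1 * (z $ 1 * z $ 2) ^ (m - j))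
    ((a + z $ 1 * (z $ 1 * z $ 2) ^ m) ^ (j - 1) * (z $ 1 * (z $ 1 * z $ 2) ^ (m - j))) 1 k)"
proof (cases "z $ 1 = 0")
  case False
  then have "Bp a m z = Cp a m (vector [z $ 1, z $ 1 * z $ 2])" by (simp add: Bp_eq Cp_eq)
  then show ?thesis using FG_Cp[OF j, of a "vector [z $ 1, z $ 1 * z $ 2]"] by simp
next
  case True
  then have e: "Bp a m z = exc a (Suc m) (pline (vector [1, z $ 2]))" by (simp add: Bp_eq)
  have "(vector [1, z $ 2] :: complex^2) \<noteq> 0" by (simp add: vec_eq_iff forall_2)
  then show ?thesis unfolding e using FG_exc[of "Suc m" "vector [1, z $ 2]" a j] j True by auto
qed

text \<open>Now the common factor is u - a = z1 v^m itself, where v = z1 z2: for j > m one has v^j =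
  (u - a) v^(j - m - 1) z2.\<close>

lemma FG_Bp_less:
  assumes j: "m < j"
  shows "\<exists>c. c \<noteq> 0 \<and> (\<forall>k\<le>2. FG a j (Bp a m z) k = c * tri 1
    ((a + z $ 1 * (z $ 1 * z $ 2) ^ m) ^ (j - 1)) ((z $ 1 * z $ 2) ^ (j - m - 1) * z $ 2) k)"
proof -
  consider (1) "z $ 1 = 0" | (2) "z $ 1 \<noteq> 0" "m = 0 \<or> z $ 2 \<noteq> 0" | (3) "z $ 1 \<noteq> 0" "m \<noteq> 0" "z $ 2 = 0" by blast
  then show ?thesis
  proof cases
    case 1
    then have e: "Bp a m z = exc a (Suc m) (pline (vector [1, z $ 2]))" by (simp add: Bp_eq)
    have "(vector [1, z $ 2] :: complex^2) \<noteq> 0" by (simp add: vec_eq_iff forall_2)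
    then obtain c where c: "c \<noteq> 0" "\<forall>k\<le>2. FG a j (Bp a m z) k = c *
        (if Suc m < j then tri 1 (a ^ (j - 1)) 0 else tri 1 (a ^ (j - 1)) (z $ 2)) k"
      using FG_exc[of "Suc m" "vector [1, z $ 2]" a j] j unfolding e by auto
    then show ?thesis using 1 j
      by (intro exI[of _ c]) (cases "Suc m < j"; simp add: power_0_left)
  next
    case 2
    then have "snd (Bp a m z) = []" by (simp add: Bp_eq)
    then obtain c where c: "c \<noteq> 0" "\<forall>k\<le>2. FG a j (Bp a m z) k =
        c * Fpoly a j (a + z $ 1 * (z $ 1 * z $ 2) ^ m) (z $ 1 * z $ 2) k"
      using FG_Y[OF fst_Bp, of a m z a j] j by auto
    let ?v = "z $ 1 * z $ 2"
    have "?v ^ j = ?v ^ (m + (j - m - 1) + 1)" using j by simp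
    then have "?v ^ j = ?v ^ m * ?v ^ (j - m - 1) * ?v" by (simp only: power_add power_one_right)
    then have "?v ^ j = (z $ 1 * ?v ^ m) * (?v ^ (j - m - 1) * z $ 2)" by (simp only: mult_ac)
    then show ?thesis using c 2
      by (intro exI[of _ "c * (z $ 1 * ?v ^ m)"]) (auto simp: Fpoly_def tri_def)
  next
    case 3
    then have e: "Bp a m z = exc a m (pline (vector [z $ 1, 1]))" by (simp add: Bp_eq)
    have "(vector [z $ 1, 1] :: complex^2) \<noteq> 0" by (simp add: vec_eq_iff forall_2)
    then show ?thesis unfolding e using FG_exc[of m "vector [z $ 1, 1]" a j] j 3 by (auto simp: power_0_left)
  qed
qed

context brn
begin

lemmas at = is_atlas_Surf

lemma psec_F0: "psec (Surf n) 2 F0"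
proof (rule psecI[OF at])
  fix p assume "p \<in> pts (Surf n)"
  then show "\<exists>V P G z. par (Surf n) V P \<and> z \<in> V \<and> P z = p \<and> (\<forall>y\<in>V. \<forall>k\<le>2. cdiff (\<lambda>y. G y k) y) \<and>
      (\<forall>y\<in>V. \<exists>c. c \<noteq> 0 \<and> (\<forall>k\<le>2. F0 (P y) k = c * G y k)) \<and> (\<exists>k\<le>2. G z k \<noteq> 0)"
  proof (cases rule: Surf_cases)
    case (Z z)
    let ?G = "\<lambda>z. tri (z $ 1) (z $ 2) 1"
    have "\<exists>c. c \<noteq> 0 \<and> (\<forall>k\<le>2. F0 (Zp y) k = c * ?G y k)" for y
      using F0_line[of "vector [y $ 1, y $ 2, 1]" "Zp y"] by (simp add: Zp_def vec_eq_iff forall_3)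
    moreover have "\<exists>k\<le>2. ?G z k \<noteq> 0" by (rule exI[of _ 2]) (simp add: tri_def)
    ultimately show ?thesis using Z par_Z
      by (intro exI[of _ UNIV] exI[of _ Zp] exI[of _ ?G] exI[of _ z]) (auto intro!: cd cdiff_tri)
  next
    case (X z)
    let ?G = "\<lambda>z. tri 1 (z $ 1) (z $ 2)"
    have "\<exists>c. c \<noteq> 0 \<and> (\<forall>k\<le>2. F0 (Xp y) k = c * ?G y k)" for y
      using F0_line[of "vector [1, y $ 1, y $ 2]" "Xp y"] by (simp add: Xp_def vec_eq_iff forall_3)
    moreover have "\<exists>k\<le>2. ?G z k \<noteq> 0" by (rule exI[of _ 0]) (simp add: tri_def)
    ultimately show ?thesis using X par_X
      by (intro exI[of _ XV] exI[of _ Xp] exI[of _ ?G] exI[of _ z]) (auto intro!: cd cdiff_tri)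
  next
    case (C a z)
    let ?G = "\<lambda>z. tri (a + z $ 1 * z $ 2 ^ n a) 1 (z $ 2)"
    have "\<exists>k\<le>2. ?G z k \<noteq> 0" by (rule exI[of _ 1]) (simp add: tri_def)
    then show ?thesis using C par_C[OF C(1)] F0_line[OF vector_Y_nz fst_Cp, of a "n a"]
      by (intro exI[of _ "CV a (n a)"] exI[of _ "Cp a (n a)"] exI[of _ ?G] exI[of _ z])
        (auto intro!: cd cdiff_tri)
  next
    case (B a m z)
    let ?G = "\<lambda>z. tri (a + z $ 1 * (z $ 1 * z $ 2) ^ m) 1 (z $ 1 * z $ 2)"
    have "\<exists>k\<le>2. ?G z k \<noteq> 0" by (rule exI[of _ 1]) (simp add: tri_def)
    then show ?thesis using B par_B[OF B(1)] F0_line[OF vector_Y_nz fst_Bp, of a m]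
      by (intro exI[of _ "BV a m"] exI[of _ "Bp a m"] exI[of _ ?G] exI[of _ z])
        (auto intro!: cd cdiff_tri)
  qed
qed

lemma Fpoly_nz: "j \<ge> 1 ==> (v = 0 ==> u \<noteq> a) ==> \<exists>k\<le>2. Fpoly a j u v k \<noteq> 0"
proof (cases "v = 0")
  case True
  assume "v = 0 ==> u \<noteq> a"
  with True show ?thesis by (intro exI[of _ 0]) (simp add: Fpoly_def tri_def)
next
  case False
  then show ?thesis by (intro exI[of _ 2]) (simp add: Fpoly_def tri_def)
qed

lemma psec_FG:
  assumes a: "a \<in> Br" and j: "1 \<le> j" "j \<le> n a"
  shows "psec (Surf n) 2 (FG a j)"
proof (rule psecI[OF at])
  fix p assume "p \<in> pts (Surf n)"
  then show "\<exists>V P G z. par (Surf n) V P \<and> z \<in> V \<and> P z = p \<and> (\<forall>y\<in>V. \<forall>k\<le>2. cdiff (\<lambda>y. G y k) y) \<and>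
      (\<forall>y\<in>V. \<exists>c. c \<noteq> 0 \<and> (\<forall>k\<le>2. FG a j (P y) k = c * G y k)) \<and> (\<exists>k\<le>2. G z k \<noteq> 0)"
  proof (cases rule: Surf_cases)
    case (Z z)
    let ?G = "\<lambda>z. tri ((z $ 1 - a * z $ 2) * z $ 2 ^ (j - 1)) ((z $ 1 - a * z $ 2) * z $ 1 ^ (j - 1)) 1"
    have "\<exists>c. c \<noteq> 0 \<and> (\<forall>k\<le>2. FG a j (Zp y) k = c * ?G y k)" for y
      using FG_line[of "vector [y $ 1, y $ 2, 1]" "Zp y" a j] j by (simp add: Zp_def vec_eq_iff forall_3)
    moreover have "\<exists>k\<le>2. ?G z k \<noteq> 0" by (rule exI[of _ 2]) (simp add: tri_def)
    ultimately show ?thesis using Z par_Z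
      by (intro exI[of _ UNIV] exI[of _ Zp] exI[of _ ?G] exI[of _ z]) (auto intro!: cd cdiff_tri)
  next
    case (X z)
    let ?G = "\<lambda>z. tri ((1 - a * z $ 1) * z $ 1 ^ (j - 1)) (1 - a * z $ 1) (z $ 2 ^ j)"
    have "\<exists>c. c \<noteq> 0 \<and> (\<forall>k\<le>2. FG a j (Xp y) k = c * ?G y k)" for y
      using FG_line[of "vector [1, y $ 1, y $ 2]" "Xp y" a j] j by (simp add: Xp_def vec_eq_iff forall_3)
    moreover have "\<exists>k\<le>2. ?G z k \<noteq> 0"
    proof (cases "z $ 2 = 0")
      case True
      \<comment> \<open>On the line at infinity this expression vanishes only at the centre
        [a : 1 : 0] with a = 1 or -1, which \<open>XV\<close> leaves out.\<close>
      then have "1 - a * z $ 1 \<noteq> 0" using X(1) a True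
        by (auto simp: XV_def Br_def add_eq_0_iff) (metis add.inverse_inverse)
      then show ?thesis by (intro exI[of _ 1]) (simp add: tri_def)
    next
      case False
      then show ?thesis by (intro exI[of _ 2]) (simp add: tri_def)
    qed
    ultimately show ?thesis using X par_X
      by (intro exI[of _ XV] exI[of _ Xp] exI[of _ ?G] exI[of _ z]) (auto intro!: cd cdiff_tri)
  next
    case (C b z)
    show ?thesis
    proof (cases "b = a")
      case True
      let ?G = "\<lambda>z. tri (z $ 1 * z $ 2 ^ (n a - j)) ((a + z $ 1 * z $ 2 ^ n a) ^ (j - 1) * (z $ 1 * z $ 2 ^ (n a - j))) 1"
      have "\<exists>k\<le>2. ?G z k \<noteq> 0" by (rule exI[of _ 2]) (simp add: tri_def)
      then show ?thesis using C True par_C[OF a] FG_Cp[OF j, of a]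
        by (intro exI[of _ "CV a (n a)"] exI[of _ "Cp a (n a)"] exI[of _ ?G] exI[of _ z])
          (auto intro!: cd cdiff_tri)
    next
      case False
      let ?G = "\<lambda>z. Fpoly a j (b + z $ 1 * z $ 2 ^ n b) (z $ 2)"
      have "snd (Cp b (n b) y) = [] \<or> fst (Cp b (n b) y) \<noteq> ctr a" for y
        using snd_Cp_other[of b "n b" y] False ctr_eq by metis
      then have "\<exists>c. c \<noteq> 0 \<and> (\<forall>k\<le>2. FG a j (Cp b (n b) y) k = c * ?G y k)" for y
        by (rule FG_Y[OF fst_Cp _ j(1)])
      moreover have "\<exists>k\<le>2. ?G z k \<noteq> 0"
        by (rule Fpoly_nz[OF j(1)], rule CV_Br[OF C(2) a]) (use False in simp_all)
      ultimately show ?thesis using C par_C[OF C(1)]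
        by (intro exI[of _ "CV b (n b)"] exI[of _ "Cp b (n b)"] exI[of _ ?G] exI[of _ z])
          (auto simp: Fpoly_def intro!: cd cdiff_tri)
    qed
  next
    case (B b m z)
    show ?thesis
    proof (cases "b = a")
      case True
      show ?thesis
      proof (cases "j \<le> m")
        case jm: True
        let ?G = "\<lambda>z. tri (z $ 1 * (z $ 1 * z $ 2) ^ (m - j))
          ((a + z $ 1 * (z $ 1 * z $ 2) ^ m) ^ (j - 1) * (z $ 1 * (z $ 1 * z $ 2) ^ (m - j))) 1"
        have "\<exists>k\<le>2. ?G z k \<noteq> 0" by (rule exI[of _ 2]) (simp add: tri_def)
        then show ?thesis using B True par_B[OF a] FG_Bp[OF j(1) jm, of a]
          by (intro exI[of _ "BV a m"] exI[of _ "Bp a m"] exI[of _ ?G] exI[of _ z])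
            (auto intro!: cd cdiff_tri)
      next
        case jm: False
        let ?G = "\<lambda>z. tri 1 ((a + z $ 1 * (z $ 1 * z $ 2) ^ m) ^ (j - 1)) ((z $ 1 * z $ 2) ^ (j - m - 1) * z $ 2)"
        have "\<exists>k\<le>2. ?G z k \<noteq> 0" by (rule exI[of _ 0]) (simp add: tri_def)
        then show ?thesis using B True par_B[OF a] FG_Bp_less[of m j a] jm
          by (intro exI[of _ "BV a m"] exI[of _ "Bp a m"] exI[of _ ?G] exI[of _ z])
            (auto intro!: cd cdiff_tri)
      qed
    next
      case False
      let ?G = "\<lambda>z. Fpoly a j (b + z $ 1 * (z $ 1 * z $ 2) ^ m) (z $ 1 * z $ 2)"
      have "snd (Bp b m y) = [] \<or> fst (Bp b m y) \<noteq> ctr a" for y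
        using snd_Bp_other[of b m y] False ctr_eq by metis
      then have "\<exists>c. c \<noteq> 0 \<and> (\<forall>k\<le>2. FG a j (Bp b m y) k = c * ?G y k)" for y
        by (rule FG_Y[OF fst_Bp _ j(1)])
      moreover have "\<exists>k\<le>2. ?G z k \<noteq> 0"
        by (rule Fpoly_nz[OF j(1)], rule BV_Br[OF B(3) a]) (use False in simp_all)
      ultimately show ?thesis using B par_B[OF B(1)]
        by (intro exI[of _ "BV b m"] exI[of _ "Bp b m"] exI[of _ ?G] exI[of _ z])
          (auto simp: Fpoly_def intro!: cd cdiff_tri)
    qed
  qed
qed

text \<open>\<open>F0\<close> recovers the point of the plane. Over a centre, \<open>FG a m\<close>
  has third entry 0 on levels below m, is [0 : 0 : 1] on levels above m, and separates the lines on
  level m. The only line on level m that it sends to [0 : 0 : 1] as well is (0, 1), and below the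
  top level that point has been blown up.\<close>

lemma Surf_separated:
  assumes p: "p \<in> pts (Surf n)" and q: "q \<in> pts (Surf n)"
    and 0: "prop_at 2 F0 p q" and G: "\<And>a j. a \<in> Br ==> 1 \<le> j ==> j \<le> n a ==> prop_at 2 (FG a j) p q"
  shows "p = q"
proof -
  have line: "\<exists>v. v \<noteq> 0 \<and> fst p = pline v" if "p \<in> pts (Surf n)" for p
    using Surf_points[OF that]
  proof (elim disjE exE conjE)
    fix v assume "v \<noteq> 0" "p = (pline v, [])"
    then show ?thesis by (intro exI[of _ v]) simp
  next
    fix a m d assume "p = exc a m (pline d)"
    then show ?thesis using vector_Y_nz[of a 0] by (intro exI[of _ "vector [a, 1, 0]"]) (simp add: exc_def ctr_def)
  qed
  obtain v where v: "v \<noteq> 0" "fst p = pline v" using line[OF p] by blast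
  obtain w where w: "w \<noteq> 0" "fst q = pline w" using line[OF q] by blast
  have fst: "fst p = fst q"
  proof -
    obtain c where c: "\<forall>i\<le>2. F0 q i = c * F0 p i" using 0 by (auto simp: prop_at_def)
    have "rep (fst q) = c *s rep (fst p)"
      using c[rule_format, of 0] c[rule_format, of 1] c[rule_format, of 2]
      by (simp add: F0_def tri_def vec_eq_iff forall_3)
    moreover from this have "c \<noteq> 0" using rep_pline(2)[OF w(1)] w(2) by auto
    ultimately have "pline (rep (fst q)) = pline (rep (fst p))" by (simp add: pline_scale)
    then show ?thesis using rep_pline(3)[OF v(1)] rep_pline(3)[OF w(1)] v w by simp
  qed
  show ?thesis
  proof (cases "snd p = [] \<or> snd q = []")
    case True
    then show ?thesis using Surf_points[OF p] Surf_points[OF q] fst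
      by (cases "snd p = []"; cases "snd q = []") (auto simp: exc_def prod_eq_iff)
  next
    case False
    then obtain a m d where 1: "a \<in> Br" "p = exc a m (pline d)" "1 \<le> m" "m \<le> n a" "d \<noteq> 0" "d $ 1 = 0 \<longrightarrow> m = n a"
      using Surf_points[OF p] by auto
    obtain b k l where 2: "b \<in> Br" "q = exc b k (pline l)" "1 \<le> k" "k \<le> n b" "l \<noteq> 0" "l $ 1 = 0 \<longrightarrow> k = n b"
      using False Surf_points[OF q] by auto
    have ab: "b = a" using fst 1 2 ctr_eq by (auto simp: exc_def)
    note E = FG_exc[OF 1(3,5), of a, folded 1(2)] FG_exc[OF 2(3,5), of a, folded 2(2)[unfolded ab]]
    consider "m < k" | "k < m" | "m = k" by linarith
    then show ?thesis
    proof cases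
      case 1
      obtain c where c: "FG a m q 0 = c * FG a m p 0" "FG a m q 2 = c * FG a m p 2"
        using G[OF \<open>a \<in> Br\<close> \<open>1 \<le> m\<close> \<open>m \<le> n a\<close>] by (auto simp: prop_at_def)
      obtain c1 where c1: "c1 \<noteq> 0" "FG a m p 0 = c1 * d $ 1" using E(1)[of m] by (auto simp: tri_def)
      obtain c2 where c2: "c2 \<noteq> 0" "FG a m q 0 = 0" "FG a m q 2 = c2" using E(2)[of m] 1 by (auto simp: tri_def)
      have "d $ 1 \<noteq> 0" using \<open>d $ 1 = 0 \<longrightarrow> m = n a\<close> 1 2(4) ab by auto
      then show ?thesis using c c1 c2 by simp
    next
      case 2
      obtain c where c: "FG a k q 0 = c * FG a k p 0"
        using G[OF \<open>a \<in> Br\<close> \<open>1 \<le> k\<close>] \<open>k \<le> n b\<close> ab by (auto simp: prop_at_def)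
      have c1: "FG a k p 0 = 0" using E(1)[of k] 2 by (auto simp: tri_def)
      obtain c2 where c2: "c2 \<noteq> 0" "FG a k q 0 = c2 * l $ 1" using E(2)[of k] by (auto simp: tri_def)
      have "l $ 1 \<noteq> 0" using \<open>l $ 1 = 0 \<longrightarrow> k = n b\<close> 2 \<open>m \<le> n a\<close> ab by auto
      then show ?thesis using c c1 c2 by simp
    next
      case 3
      obtain c where c: "FG a m q 0 = c * FG a m p 0" "FG a m q 2 = c * FG a m p 2"
        using G[OF \<open>a \<in> Br\<close> \<open>1 \<le> m\<close> \<open>m \<le> n a\<close>] by (auto simp: prop_at_def)
      obtain c1 where c1: "c1 \<noteq> 0" "FG a m p 0 = c1 * d $ 1" "FG a m p 2 = c1 * d $ 2"
        using E(1)[of m] by (auto simp: tri_def)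
      obtain c2 where c2: "c2 \<noteq> 0" "FG a m q 0 = c2 * l $ 1" "FG a m q 2 = c2 * l $ 2"
        using E(2)[of m] 3 by (auto simp: tri_def)
      have l: "l = (c * c1 / c2) *s d"
        using c c1 c2 by (simp add: vec_eq_iff forall_2 field_simps)
      then have "c * c1 / c2 \<noteq> 0" using 2(5) by auto
      then have "pline l = pline d" using l pline_scale by metis
      then show ?thesis using 1 2 3 ab \<open>p = exc a m (pline d)\<close> by simp
    qed
  qed
qed

lemma complex_manifold_Surf: "complex_manifold (Surf n)"
  unfolding complex_manifold_def
proof (intro conjI at second_countable_mtop finite_Surf)
  show "Hausdorff_space (mtop (Surf n))"
    unfolding Hausdorff_space_def topspace_mtop[OF at]
  proof (intro allI impI, elim conjE)
    fix p q assume pq: "p \<in> pts (Surf n)" "q \<in> pts (Surf n)" "p \<noteq> q"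
    then consider "\<not> prop_at 2 F0 p q" | a j where "a \<in> Br" "1 \<le> j" "j \<le> n a" "\<not> prop_at 2 (FG a j) p q"
      using Surf_separated by blast
    then show "\<exists>U V. openin (mtop (Surf n)) U \<and> openin (mtop (Surf n)) V \<and> p \<in> U \<and> q \<in> V \<and> disjnt U V"
      unfolding prop_at_def using separated_by_psec[OF at psec_F0 pq(1,2)] separated_by_psec[OF at psec_FG pq(1,2)]
      by cases blast+
  qed
qed

end

section \<open>Products and bimeromorphic maps\<close>

definition jl :: "complex^('m::finite + 'n::finite) \<Rightarrow> complex^'m" where "jl z = (\<chi> i. z $ Inl i)"
definition jr :: "complex^('m::finite + 'n::finite) \<Rightarrow> complex^'n" where "jr z = (\<chi> i. z $ Inr i)"
definition jn :: "complex^('m::finite) \<Rightarrow> complex^('n::finite) \<Rightarrow> complex^('m + 'n)" where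
  "jn x y = (\<chi> k. case k of Inl i \<Rightarrow> x $ i | Inr j \<Rightarrow> y $ j)"

lemma jn_simps [simp]: "jl (jn x y) = x" "jr (jn x y) = y" "jn (jl z) (jr z) = z"
  by (auto simp: jl_def jr_def jn_def vec_eq_iff split: sum.split)

lemma cdv_jl: "cdv jl z" and cdv_jr: "cdv jr z"
  by (simp_all add: cdv_def jl_def jr_def cdiff_nth)

lemma cdv_jn:
  assumes "cdv f z" "cdv g z"
  shows "cdv (\<lambda>y. jn (f y) (g y)) z"
  unfolding cdv_def
proof
  fix k show "cdiff (\<lambda>y. jn (f y) (g y) $ k) z"
    using cdv_nth[OF assms(1)] cdv_nth[OF assms(2)] by (cases k) (simp_all add: jn_def)
qed

definition jV :: "(complex^('m::finite)) set \<Rightarrow> (complex^('n::finite)) set \<Rightarrow> (complex^('m + 'n)) set" where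
  "jV V W = {z. jl z \<in> V \<and> jr z \<in> W}"

definition jP :: "(complex^('m::finite) \<Rightarrow> 'a) \<Rightarrow> (complex^('n::finite) \<Rightarrow> 'b) \<Rightarrow> complex^('m + 'n) \<Rightarrow> 'a \<times> 'b" where
  "jP P Q z = (P (jl z), Q (jr z))"

lemma open_jV: "open V ==> open W ==> open (jV V W)"
proof -
  assume "open V" "open W"
  then have "open ({z \<in> UNIV. jl z \<in> V} \<inter> {z \<in> UNIV. jr z \<in> W})"
    by (intro open_Int cdv_open_vimage open_UNIV cdv_jl cdv_jr)
  then show ?thesis by (simp add: jV_def Int_def)
qed

lemma jP_image: "jP P Q ` jV V W = P ` V \<times> Q ` W"
proof (intro set_eqI iffI)
  fix x assume "x \<in> P ` V \<times> Q ` W"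
  then obtain a b where "a \<in> V" "b \<in> W" "x = (P a, Q b)" by blast
  then show "x \<in> jP P Q ` jV V W"
    by (intro image_eqI[of _ _ "jn a b"]) (auto simp: jP_def jV_def)
qed (auto simp: jP_def jV_def)

lemma fac_jP:
  assumes P: "fac P (jl z) P' V'" and Q: "fac Q (jr z) Q' W'"
  shows "fac (jP P Q) z (jP P' Q') (jV V' W')"
proof -
  obtain X \<tau> where X: "open X" "jl z \<in> X" "\<And>y. y \<in> X ==> \<tau> y \<in> V' \<and> P y = P' (\<tau> y) \<and> cdv \<tau> y"
    using P unfolding fac_def by (elim exE conjE) (rule that, (assumption | erule (1) bspec)+)
  obtain Y \<sigma> where Y: "open Y" "jr z \<in> Y" "\<And>y. y \<in> Y ==> \<sigma> y \<in> W' \<and> Q y = Q' (\<sigma> y) \<and> cdv \<sigma> y"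
    using Q unfolding fac_def by (elim exE conjE) (rule that, (assumption | erule (1) bspec)+)
  show ?thesis
  proof (rule facI[OF open_jV[OF X(1) Y(1)], where \<tau>="\<lambda>y. jn (\<tau> (jl y)) (\<sigma> (jr y))"])
    show "z \<in> jV X Y" using X Y by (simp add: jV_def)
    fix y assume "y \<in> jV X Y"
    then have y: "jl y \<in> X" "jr y \<in> Y" by (auto simp: jV_def)
    show "jn (\<tau> (jl y)) (\<sigma> (jr y)) \<in> jV V' W'" using X(3)[OF y(1)] Y(3)[OF y(2)] by (simp add: jV_def)
    show "jP P Q y = jP P' Q' (jn (\<tau> (jl y)) (\<sigma> (jr y)))" using X(3)[OF y(1)] Y(3)[OF y(2)] by (simp add: jP_def)
    show "cdv (\<lambda>y. jn (\<tau> (jl y)) (\<sigma> (jr y))) y"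
      by (intro cdv_jn cdv_compose[OF cdv_jl] cdv_compose[OF cdv_jr]) (use X(3)[OF y(1)] Y(3)[OF y(2)] in auto)
  qed
qed

lemma product_chart:
  assumes "x \<in> product_atlas A B"
  obtains U \<phi> V \<psi> where "(U, \<phi>) \<in> A" "(V, \<psi>) \<in> B" "x = (U \<times> V, \<lambda>(p, q). jn (\<phi> p) (\<psi> q))"
  using assms unfolding product_atlas_def jn_def by blast

lemma product_chartI: "(U, \<phi>) \<in> A ==> (V, \<psi>) \<in> B ==> (U \<times> V, \<lambda>(p, q). jn (\<phi> p) (\<psi> q)) \<in> product_atlas A B"
  unfolding product_atlas_def jn_def by blast

lemma is_atlas_product:
  assumes A: "is_atlas A" and B: "is_atlas B"
  shows "is_atlas (product_atlas A B)"
proof (rule is_atlasI[where F="{(jV (\<phi> ` U) (\<psi> ` V), jP (inv_into U \<phi>) (inv_into V \<psi>)) | U \<phi> V \<psi>. (U, \<phi>) \<in> A \<and> (V, \<psi>) \<in> B}"])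
  fix X \<xi> assume "(X, \<xi>) \<in> product_atlas A B"
  then obtain U \<phi> V \<psi> where 1: "(U, \<phi>) \<in> A" "(V, \<psi>) \<in> B" and "(X, \<xi>) = (U \<times> V, \<lambda>(p, q). jn (\<phi> p) (\<psi> q))"
    by (rule product_chart)
  then have X: "X = U \<times> V" "\<xi> = (\<lambda>(p, q). jn (\<phi> p) (\<psi> q))" by auto
  have inj: "inj_on \<phi> U" "inj_on \<psi> V" using A B 1 is_atlas_inj by blast+
  have "jP (inv_into U \<phi>) (inv_into V \<psi>) ` jV (\<phi> ` U) (\<psi> ` V) = X"
    unfolding jP_image X using inj by simp
  moreover have "\<xi> (jP (inv_into U \<phi>) (inv_into V \<psi>) z) = z" if "z \<in> jV (\<phi> ` U) (\<psi> ` V)" for z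
    using that by (simp add: X jP_def jV_def f_inv_into_f)
  moreover have "open (jV (\<phi> ` U) (\<psi> ` V))"
    using A B 1 by (intro open_jV) (auto simp: is_atlas_def)
  ultimately show "\<exists>V' P. (V', P) \<in> {(jV (\<phi> ` U) (\<psi> ` V), jP (inv_into U \<phi>) (inv_into V \<psi>)) | U \<phi> V \<psi>.
      (U, \<phi>) \<in> A \<and> (V, \<psi>) \<in> B} \<and> open V' \<and> P ` V' = X \<and> (\<forall>z\<in>V'. \<xi> (P z) = z)"
    using 1 by (intro exI[of _ "jV (\<phi> ` U) (\<psi> ` V)"] exI[of _ "jP (inv_into U \<phi>) (inv_into V \<psi>)"]) blast
next
  fix W P W' Q z z'
  assume "(W, P) \<in> {(jV (\<phi> ` U) (\<psi> ` V), jP (inv_into U \<phi>) (inv_into V \<psi>)) | U \<phi> V \<psi>. (U, \<phi>) \<in> A \<and> (V, \<psi>) \<in> B}"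
    and "(W', Q) \<in> {(jV (\<phi> ` U) (\<psi> ` V), jP (inv_into U \<phi>) (inv_into V \<psi>)) | U \<phi> V \<psi>. (U, \<phi>) \<in> A \<and> (V, \<psi>) \<in> B}"
    and z: "z \<in> W" "z' \<in> W'" "P z = Q z'"
  then obtain U \<phi> V \<psi> U' \<phi>' V' \<psi>' where 1: "(U, \<phi>) \<in> A" "(V, \<psi>) \<in> B" "(U', \<phi>') \<in> A" "(V', \<psi>') \<in> B"
    "W = jV (\<phi> ` U) (\<psi> ` V)" "P = jP (inv_into U \<phi>) (inv_into V \<psi>)"
    "W' = jV (\<phi>' ` U') (\<psi>' ` V')" "Q = jP (inv_into U' \<phi>') (inv_into V' \<psi>')" by blast
  show "fac P z Q W'" unfolding 1(6-8)
    by (rule fac_jP[OF par_fac[OF A chart_par[OF A 1(1)] chart_par[OF A 1(3)]]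
          par_fac[OF B chart_par[OF B 1(2)] chart_par[OF B 1(4)]]])
      (use z 1(5-8) in "auto simp: jP_def jV_def")
qed

lemma lparD:
  assumes "lpar A V P"
  shows "\<exists>U \<phi>. (U, \<phi>) \<in> A \<and> P ` V \<subseteq> U \<and> (\<forall>z\<in>V. \<phi> (P z) = z) \<and> open V"
proof -
  obtain c where c: "c \<in> A" "case c of (U, \<phi>) \<Rightarrow> P ` V \<subseteq> U \<and> (\<forall>z\<in>V. \<phi> (P z) = z)" "open V"
    using assms unfolding lpar_def by (elim conjE bexE) (rule that)
  then show ?thesis by (intro exI[of _ "fst c"] exI[of _ "snd c"]) (simp add: case_prod_beta)
qed

lemma lpar_product:
  assumes P: "lpar A V P" and Q: "lpar B W Q"
  shows "lpar (product_atlas A B) (jV V W) (jP P Q)"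
proof -
  obtain U \<phi> where U: "(U, \<phi>) \<in> A" "P ` V \<subseteq> U" "\<forall>z\<in>V. \<phi> (P z) = z" "open V"
    using lparD[OF P] by (elim exE conjE) (rule that)
  obtain U' \<psi> where U': "(U', \<psi>) \<in> B" "Q ` W \<subseteq> U'" "\<forall>z\<in>W. \<psi> (Q z) = z" "open W"
    using lparD[OF Q] by (elim exE conjE) (rule that)
  show ?thesis unfolding lpar_def
    by (intro conjI open_jV U(4) U'(4) bexI[OF _ product_chartI[OF U(1) U'(1)]])
      (use U U' in "auto simp: jP_def jV_def image_subset_iff")
qed

lemma par_product:
  assumes P: "par A V P" and Q: "par B W Q"
  shows "par (product_atlas A B) (jV V W) (jP P Q)"
  unfolding par_def
proof (intro conjI ballI)
  show "open (jV V W)" by (rule open_jV[OF par_open[OF P] par_open[OF Q]])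
  show "inj_on (jP P Q) (jV V W)"
  proof (rule inj_onI)
    fix x y assume xy: "x \<in> jV V W" "y \<in> jV V W" "jP P Q x = jP P Q y"
    have "jl x = jl y" by (rule inj_onD[OF par_inj[OF P]]) (use xy in "auto simp: jP_def jV_def")
    moreover have "jr x = jr y" by (rule inj_onD[OF par_inj[OF Q]]) (use xy in "auto simp: jP_def jV_def")
    ultimately show "x = y" by (metis jn_simps(3))
  qed
  fix z assume "z \<in> jV V W"
  then have z: "jl z \<in> V" "jr z \<in> W" by (auto simp: jV_def)
  obtain V' P' x where 1: "lpar A V' P'" "x \<in> V'" "P' x = P (jl z)" "fac P (jl z) P' V'" "fac P' x P V"
    using P z(1) unfolding par_def by meson
  obtain W' Q' y where 2: "lpar B W' Q'" "y \<in> W'" "Q' y = Q (jr z)" "fac Q (jr z) Q' W'" "fac Q' y Q W"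
    using Q z(2) unfolding par_def by meson
  show "\<exists>V' R z'. lpar (product_atlas A B) V' R \<and> z' \<in> V' \<and> R z' = jP P Q z \<and>
      fac (jP P Q) z R V' \<and> fac R z' (jP P Q) (jV V W)"
    by (intro exI[of _ "jV V' W'"] exI[of _ "jP P' Q'"] exI[of _ "jn x y"] conjI lpar_product[OF 1(1) 2(1)]
        fac_jP 1(4) 2(4))
      (use 1 2 in "auto simp: jP_def jV_def")
qed

lemma pts_product: "pts (product_atlas A B) = pts A \<times> pts B"
proof (intro set_eqI iffI)
  fix x assume "x \<in> pts (product_atlas A B)"
  then obtain c where c: "c \<in> product_atlas A B" "x \<in> fst c" by (auto simp: pts_def)
  obtain U \<phi> V \<psi> where "(U, \<phi>) \<in> A" "(V, \<psi>) \<in> B" "c = (U \<times> V, \<lambda>(p, q). jn (\<phi> p) (\<psi> q))"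
    by (rule product_chart[OF c(1)])
  then show "x \<in> pts A \<times> pts B" using c(2) by (auto simp: pts_def)
next
  fix x assume "x \<in> pts A \<times> pts B"
  then obtain U \<phi> V \<psi> where 1: "(U, \<phi>) \<in> A" "(V, \<psi>) \<in> B" "x \<in> U \<times> V" by (auto simp: pts_def)
  show "x \<in> pts (product_atlas A B)"
    unfolding pts_def by (rule UN_I[OF product_chartI[OF 1(1,2)]]) (use 1(3) in simp)
qed

lemma openin_product:
  assumes A: "is_atlas A" and B: "is_atlas B" and W: "openin (mtop A) W" "openin (mtop B) W'"
  shows "openin (mtop (product_atlas A B)) (W \<times> W')"
proof (rule openinI[OF is_atlas_product[OF A B]])
  fix x assume x: "x \<in> W \<times> W'"
  then have "fst x \<in> pts A" "snd x \<in> pts B"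
    using W unfolding openin_mtop[OF A] openin_mtop[OF B] by auto
  then obtain V P z V' Q z' where P: "par A V P" "z \<in> V" "P z = fst x" and Q: "par B V' Q" "z' \<in> V'" "Q z' = snd x"
    by (meson pts_par[OF A] pts_par[OF B])
  have 1: "par A {z \<in> V. P z \<in> W} P" by (rule par_subset[OF P(1) open_par_vimage[OF A P(1) W(1)]]) auto
  have 2: "par B {z \<in> V'. Q z \<in> W'} Q" by (rule par_subset[OF Q(1) open_par_vimage[OF B Q(1) W(2)]]) auto
  show "\<exists>V P. par (product_atlas A B) V P \<and> x \<in> P ` V \<and> P ` V \<subseteq> W \<times> W'"
    by (intro exI conjI, rule par_product[OF 1 2], unfold jP_image)
      (use x P Q in "auto simp: image_iff intro!: rev_image_eqI simp: mem_Times_iff")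
qed

lemma holo_fun_const: "is_atlas A ==> openin (mtop A) W ==> holo_fun A W (\<lambda>_. c)"
proof (rule holo_funI)
  fix p assume A: "is_atlas A" and "openin (mtop A) W" "p \<in> W"
  then have "p \<in> pts A" by (auto simp: openin_mtop)
  then obtain V P z where "par A V P" "z \<in> V" "P z = p" by (rule pts_par[OF A])
  then show "\<exists>V P z. par A V P \<and> z \<in> V \<and> P z = p \<and> cdiff (\<lambda>y. c) z" using cdiff_const by blast
qed

text \<open>A monomial equation covers the three situations that occur: the set misses the chart (i
  = j = 0), is one axis, or is both axes at a crossing of curves.\<close>

lemma nowhere_dense_analyticI:
  fixes A :: "('a, 2) atlas"
  assumes A: "is_atlas A" and Z: "Z \<subseteq> pts A"
    and loc: "\<And>p. p \<in> pts A ==> \<exists>V P z i j. par A V P \<and> z \<in> V \<and> P z = p \<and>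
      (\<forall>y\<in>V. P y \<in> Z \<longleftrightarrow> y $ 1 ^ i * y $ 2 ^ j = (0 :: complex))"
  shows "nowhere_dense_analytic A Z"
  unfolding nowhere_dense_analytic_def analytic_subset_def
proof (intro conjI Z ballI)
  fix p assume "p \<in> pts A"
  from loc[OF this] obtain V P z i j where P: "par A V P" "z \<in> V" "P z = p"
    "\<forall>y\<in>V. P y \<in> Z \<longleftrightarrow> y $ 1 ^ i * y $ 2 ^ j = (0 :: complex)" by (elim exE conjE) (rule that)
  let ?g = "\<lambda>q. (inv_into V P q) $ 1 ^ i * (inv_into V P q) $ 2 ^ j"
  have inv: "inv_into V P (P y) = y" if "y \<in> V" for y using that par_inj[OF P(1)] by simp
  have op: "openin (mtop A) (P ` V)" by (rule openin_par_image[OF A P(1)])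
  have "holo_fun A (P ` V) ?g"
  proof (rule holo_funI[OF A op])
    fix q assume "q \<in> P ` V"
    then obtain y where y: "y \<in> V" "q = P y" by blast
    have "cdiff (\<lambda>y. y $ 1 ^ i * y $ 2 ^ j) y" by (intro cd)
    then have "cdiff (\<lambda>y. ?g (P y)) y"
      by (rule cdiff_cong[OF _ par_open[OF P(1)] y(1)]) (simp add: inv)
    then show "\<exists>V' P' z. par A V' P' \<and> z \<in> V' \<and> P' z = q \<and> cdiff (\<lambda>y. ?g (P' y)) z"
      using P(1) y by (intro exI[of _ V] exI[of _ P] exI[of _ y]) simp
  qed
  moreover have "Z \<inter> P ` V = {q \<in> P ` V. \<forall>g\<in>{?g}. g q = 0}"
    using P(4) inv by auto
  ultimately show "\<exists>W F. openin (mtop A) W \<and> p \<in> W \<and> finite F \<and> (\<forall>g\<in>F. holo_fun A W g) \<and>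
      Z \<inter> W = {q \<in> W. \<forall>g\<in>F. g q = 0}"
    using op P(2,3) by (intro exI[of _ "P ` V"] exI[of _ "{?g}"]) auto
next
  show "mtop A closure_of (pts A - Z) = pts A"
  proof
    show "mtop A closure_of (pts A - Z) \<subseteq> pts A"
      using closure_of_subset_topspace[of "mtop A"] by (simp add: topspace_mtop[OF A])
    show "pts A \<subseteq> mtop A closure_of (pts A - Z)"
    proof
      fix p assume p: "p \<in> pts A"
      from loc[OF this] obtain V P z i j where P: "par A V P" "z \<in> V" "P z = p"
        "\<forall>y\<in>V. P y \<in> Z \<longleftrightarrow> y $ 1 ^ i * y $ 2 ^ j = (0 :: complex)" by (elim exE conjE) (rule that)
      have "\<exists>q. q \<in> pts A - Z \<and> q \<in> T" if T: "p \<in> T" "openin (mtop A) T" for T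
      proof -
        have z: "z \<in> {y \<in> V. P y \<in> T}" using P T by simp
        obtain y where "y \<in> {y \<in> V. P y \<in> T}" "y $ 1 \<noteq> 0" "y $ 2 \<noteq> 0"
          by (rule open_generic[OF open_par_vimage[OF A P(1) T(2)] z])
        then show ?thesis using P(4) par_pts[OF P(1)] by (intro exI[of _ "P y"]) auto
      qed
      then show "p \<in> mtop A closure_of (pts A - Z)"
        using p by (auto simp: in_closure_of topspace_mtop[OF A])
    qed
  qed
qed

text \<open>A holomorphic map has a closed graph, locally given by equations between coordinates.\<close>

lemma bimeromorphicI:
  fixes A :: "('a, 'm::finite) atlas" and B :: "('b, 'n::finite) atlas"
  assumes A: "is_atlas A" and B: "is_atlas B" and H: "Hausdorff_space (mtop B)"
    and f: "holo_map A B f" and Z: "nowhere_dense_analytic A Z" "nowhere_dense_analytic B E"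
    and bi: "biholo (open_restrict A (pts A - Z)) (open_restrict B (pts B - E)) f"
  shows "bimeromorphic A B"
proof -
  let ?X = "product_atlas A B" and ?G = "{(p, f p) | p. p \<in> pts A}"
  note X = is_atlas_product[OF A B]
  have fB: "f p \<in> pts B" if "p \<in> pts A" for p using f that by (auto simp: holo_map_def)
  have cf: "continuous_map (mtop A) (mtop B) f" by (rule holo_map_continuous[OF A B f])
  have sub: "?G \<subseteq> pts ?X" using fB by (auto simp: pts_product)
  have "openin (mtop ?X) (pts ?X - ?G)"
  proof (subst openin_subopen, intro ballI)
    fix x assume "x \<in> pts ?X - ?G"
    then obtain p q where x: "x = (p, q)" "p \<in> pts A" "q \<in> pts B" "q \<noteq> f p" by (auto simp: pts_product)
    then obtain U V where U: "openin (mtop B) U" "openin (mtop B) V" "q \<in> U" "f p \<in> V" "disjnt U V"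
      using H fB[OF x(2)] unfolding Hausdorff_space_def topspace_mtop[OF B] by metis
    have "openin (mtop A) {y \<in> topspace (mtop A). f y \<in> V}"
      using cf U(2) by (simp add: continuous_map_def)
    then have "openin (mtop A) {y \<in> pts A. f y \<in> V}" by (simp add: topspace_mtop[OF A])
    from openin_product[OF A B this U(1)]
    show "\<exists>T. openin (mtop ?X) T \<and> x \<in> T \<and> T \<subseteq> pts ?X - ?G"
      by (rule_tac exI[of _ "{y \<in> pts A. f y \<in> V} \<times> U"])
        (use x U openin_subset[OF U(1)] in "auto simp: pts_product disjnt_iff topspace_mtop[OF B]")
  qed
  then have clG: "closedin (mtop ?X) ?G" using sub by (simp add: closedin_def topspace_mtop[OF X])
  have loc: "\<exists>V P z V' Q \<tau>. par A V P \<and> z \<in> V \<and> P z = p \<and> par B V' Q \<and>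
      (\<forall>y\<in>V. \<tau> y \<in> V' \<and> f (P y) = Q (\<tau> y) \<and> cdv \<tau> y)" if p: "p \<in> pts A"
    for p and w :: "complex^'m" and w' :: "complex^'n"
  proof -
    obtain V P z where P: "par A V P" "z \<in> V" "P z = p" by (rule pts_par[OF A p])
    obtain V' Q z' where Q: "par B V' Q" "z' \<in> V'" "Q z' = f p" by (rule pts_par[OF B fB[OF p]])
    have "fac (\<lambda>y. f (P y)) z Q V'" by (rule holo_map_fac[OF A B f P(1) Q(1) P(2) Q(2)]) (use P Q in simp)
    then obtain O' \<tau> where O': "open O'" "z \<in> O'" "\<And>y. y \<in> O' ==> \<tau> y \<in> V' \<and> f (P y) = Q (\<tau> y) \<and> cdv \<tau> y"
      unfolding fac_def by (elim exE conjE) (rule that, (assumption | erule (1) bspec)+)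
    have "par A (V \<inter> O') P" by (rule par_subset[OF P(1)]) (use O' par_open[OF P(1)] in auto)
    then show ?thesis using P Q O' by (intro exI[of _ "V \<inter> O'"] exI[of _ P] exI[of _ z] exI[of _ V'] exI[of _ Q] exI[of _ \<tau>]) auto
  qed
  \<comment> \<open>The full graph of f is closed, and the part over the complement of Z is dense in
    it because Z is nowhere dense.\<close>
  have cl: "mtop ?X closure_of {(p, f p) | p. p \<in> pts A - Z} = ?G"
  proof
    show "mtop ?X closure_of {(p, f p) | p. p \<in> pts A - Z} \<subseteq> ?G"
      by (rule closure_of_minimal[OF _ clG]) auto
    show "?G \<subseteq> mtop ?X closure_of {(p, f p) | p. p \<in> pts A - Z}"
    proof
      fix x assume "x \<in> ?G"
      then obtain p where p: "x = (p, f p)" "p \<in> pts A" by blast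
      from loc[OF p(2)] obtain V P z V' Q \<tau> where P: "par A V P" "z \<in> V" "P z = p" and Q: "par B V' Q"
        and t: "\<forall>y\<in>V. \<tau> y \<in> V' \<and> f (P y) = Q (\<tau> y) \<and> cdv \<tau> y" by (elim exE conjE) (rule that)
      have "\<exists>y. y \<in> {(p, f p) | p. p \<in> pts A - Z} \<and> y \<in> T" if T: "x \<in> T" "openin (mtop ?X) T" for T
      proof -
        let ?W = "{y \<in> V. jn y (\<tau> y) \<in> {w \<in> jV V V'. jP P Q w \<in> T}}"
        have op: "open ?W"
          by (rule cdv_open_vimage[OF par_open[OF P(1)] cdv_jn[OF cdv_ident] open_par_vimage[OF X par_product[OF P(1) Q] T(2)]])
            (use t in auto)
        have W: "?W = {y \<in> V. (P y, f (P y)) \<in> T}" using t by (auto simp: jV_def jP_def)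
        have "par A ?W P" by (rule par_subset[OF P(1) op]) auto
        from openin_par_image[OF A this] have "openin (mtop A) (P ` ?W)" .
        moreover have "p \<in> P ` ?W" unfolding W using P p T by auto
        moreover have "p \<in> mtop A closure_of (pts A - Z)"
          using Z(1) p(2) by (simp add: nowhere_dense_analytic_def)
        then have "\<forall>T. p \<in> T \<and> openin (mtop A) T \<longrightarrow> (\<exists>y. y \<in> pts A - Z \<and> y \<in> T)"
          unfolding in_closure_of by (rule conjunct2)
        ultimately have "\<exists>y. y \<in> pts A - Z \<and> y \<in> P ` ?W" by (elim allE[of _ "P ` ?W"] impE) (rule conjI)
        then obtain q where "q \<in> pts A - Z" "q \<in> P ` ?W" by (elim exE conjE) (rule that)
        then show ?thesis unfolding W by (intro exI[of _ "(q, f q)"]) auto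
      qed
      then show "x \<in> mtop ?X closure_of {(p, f p) | p. p \<in> pts A - Z}"
        using p fB[OF p(2)] unfolding in_closure_of topspace_mtop[OF X] pts_product by auto
    qed
  qed
  have "analytic_subset ?X ?G"
    unfolding analytic_subset_def
  proof (intro conjI sub ballI)
    fix x assume x: "x \<in> pts ?X"
    show "\<exists>W F. openin (mtop ?X) W \<and> x \<in> W \<and> finite F \<and> (\<forall>g\<in>F. holo_fun ?X W g) \<and>
      ?G \<inter> W = {q \<in> W. \<forall>g\<in>F. g q = 0}"
    proof (cases "x \<in> ?G")
      case False
      have "openin (mtop ?X) (pts ?X - ?G)" using clG by (simp add: closedin_def topspace_mtop[OF X])
      then show ?thesis using False x holo_fun_const[OF X]
        by (intro exI[of _ "pts ?X - ?G"] exI[of _ "{\<lambda>_. 1}"]) auto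
    next
      case True
      then obtain p where p: "x = (p, f p)" "p \<in> pts A" by blast
      from loc[OF p(2)] obtain V P z V' Q \<tau> where P: "par A V P" "z \<in> V" "P z = p" and Q: "par B V' Q"
        and t: "\<forall>y\<in>V. \<tau> y \<in> V' \<and> f (P y) = Q (\<tau> y) \<and> cdv \<tau> y" by (elim exE conjE) (rule that)
      let ?W = "jP P Q ` jV V V'"
      let ?g = "\<lambda>j (a, b). \<tau> (inv_into V P a) $ j - inv_into V' Q b $ j"
      have inv: "inv_into V P (P y) = y" if "y \<in> V" for y using that par_inj[OF P(1)] by simp
      have inv': "inv_into V' Q (Q y) = y" if "y \<in> V'" for y using that par_inj[OF Q] by simp
      note pp = par_product[OF P(1) Q]
      have op: "openin (mtop ?X) ?W" by (rule openin_par_image[OF X pp])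
      have "holo_fun ?X ?W (?g j)" for j
      proof (rule holo_funI[OF X op])
        fix q assume "q \<in> ?W"
        then obtain w where w: "w \<in> jV V V'" "q = jP P Q w" by blast
        have "cdv \<tau> (jl w)" using t w(1) by (simp add: jV_def)
        then have "cdiff (\<lambda>w. \<tau> (jl w) $ j - jr w $ j) w"
          by (intro cdiff_diff cdiff_compose[OF cdv_jr cdiff_nth] cdiff_compose[OF cdv_jl cdv_nth])
        then have "cdiff (\<lambda>w. ?g j (jP P Q w)) w"
          by (rule cdiff_cong[OF _ par_open[OF pp] w(1)]) (simp add: jP_def jV_def inv inv')
        then show "\<exists>V P z. par ?X V P \<and> z \<in> V \<and> P z = q \<and> cdiff (\<lambda>w. ?g j (P w)) z"
          using pp w by (intro exI[of _ "jV V V'"] exI[of _ "jP P Q"] exI[of _ w]) simp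
      qed
      moreover have "?G \<inter> ?W = {q \<in> ?W. \<forall>g\<in>range ?g. g q = 0}"
      proof (intro set_eqI)
        fix q
        have "q \<in> ?G \<longleftrightarrow> (\<forall>j. ?g j q = 0)" if q: "q \<in> ?W"
        proof -
          obtain a b where ab: "a \<in> V" "b \<in> V'" "q = (P a, Q b)" using q unfolding jP_image by blast
          have "q \<in> ?G \<longleftrightarrow> Q b = Q (\<tau> a)" using ab t par_pts[OF P(1) ab(1)] by auto
          also have "\<dots> \<longleftrightarrow> b = \<tau> a" using inj_onD[OF par_inj[OF Q]] ab t by blast
          also have "\<dots> \<longleftrightarrow> (\<forall>j. \<tau> a $ j - b $ j = 0)" by (auto simp: vec_eq_iff)
          also have "\<dots> \<longleftrightarrow> (\<forall>j. ?g j q = 0)" unfolding ab(3) using inv[OF ab(1)] inv'[OF ab(2)] by simp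
          finally show ?thesis .
        qed
        then show "q \<in> ?G \<inter> ?W \<longleftrightarrow> q \<in> {q \<in> ?W. \<forall>g\<in>range ?g. g q = 0}" by blast
      qed
      moreover have "x \<in> ?W" unfolding jP_image p using P t Q by force
      ultimately show ?thesis using op by (intro exI[of _ ?W] exI[of _ "range ?g"]) auto
    qed
  qed
  then show ?thesis unfolding bimeromorphic_def
    using Z bi cl by (intro exI[of _ Z] exI[of _ E] exI[of _ f]) simp
qed

section \<open>Rationality of the surfaces\<close>

lemma par_P2:
  "par P2 UNIV (\<lambda>z. pline (vector [z $ 1, z $ 2, 1]))"
  "open V ==> par P2 V (\<lambda>z. pline (vector [1, z $ 1, z $ 2]))"
  "open V ==> par P2 V (\<lambda>z. pline (vector [a + z $ 1, 1, z $ 2]))"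
  using par_lins[OF lins_Z, of UNIV] par_lins[OF lins_X] par_lins[OF lins_Y] by simp_all

lemma pts_P2: "pts P2 = {pline v | v. v \<noteq> 0}"
  by (rule pts_projective_space) simp

lemma P2_cases:
  fixes v :: "complex^3"
  assumes "v \<noteq> 0"
  obtains (Z) z :: "complex^2" where "pline v = pline (vector [z $ 1, z $ 2, 1])"
    | (X) "pline v = pline (vector [1, 0, 0])"
    | (Y) a z where "a \<in> Br" "z \<in> CV a 0" "z $ 2 = 0" "pline v = pline (vector [a + z $ 1, 1, z $ 2])"
proof -
  consider "v $ 3 \<noteq> 0" | "v $ 3 = 0" "v $ 2 \<noteq> 0" | "v $ 3 = 0" "v $ 2 = 0" "v $ 1 \<noteq> 0"
    using assms by (auto simp: vec_eq_iff forall_3)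
  then show thesis
  proof cases
    case 1
    have "pline v = pline (vector [(vector [v $ 1 / v $ 3, v $ 2 / v $ 3] :: complex^2) $ 1,
        (vector [v $ 1 / v $ 3, v $ 2 / v $ 3] :: complex^2) $ 2, 1])"
      by (rule pline_eqI[OF 1]) (use 1 in "simp add: vec_eq_iff forall_3")
    then show thesis by (rule Z)
  next
    case 2
    define a where "a = (if v $ 1 / v $ 2 \<in> Br then v $ 1 / v $ 2 else 0)"
    define z :: "complex^2" where "z = vector [v $ 1 / v $ 2 - a, 0]"
    have "pline v = pline (vector [a + z $ 1, 1, z $ 2])"
      by (rule pline_eqI[OF 2(2)]) (use 2 in "simp add: vec_eq_iff forall_3 z_def")
    moreover have "a \<in> Br" "z \<in> CV a 0" "z $ 2 = 0" by (auto simp: a_def z_def Br_def)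
    ultimately show thesis by (intro Y)
  next
    case 3
    have "pline v = pline (vector [1, 0, 0])"
      by (rule pline_eqI[OF 3(3)]) (use 3 in "simp add: vec_eq_iff forall_3")
    then show thesis by (rule X)
  qed
qed

lemma biholo_Surf_0: "biholo (Surf (\<lambda>_. 0)) P2 fst"
proof (rule biholoI[OF is_atlas_Surf_0 is_atlas_proj])
  interpret brn "\<lambda>_. 0" by unfold_locales simp
  have snd: "snd p = []" if "p \<in> pts (Surf (\<lambda>_. 0))" for p
    using Surf_points[OF that] by auto
  show "bij_betw fst (pts (Surf (\<lambda>_. 0))) (pts P2)"
    unfolding bij_betw_def
  proof (intro conjI inj_onI)
    fix p q assume "p \<in> pts (Surf (\<lambda>_. 0))" "q \<in> pts (Surf (\<lambda>_. 0))" "fst p = fst q"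
    then show "p = q" using snd by (simp add: prod_eq_iff)
  next
    show "fst ` pts (Surf (\<lambda>_. 0)) = pts P2"
    proof
      show "fst ` pts (Surf (\<lambda>_. 0)) \<subseteq> pts P2" unfolding pts_P2 using Surf_points by fastforce
      show "pts P2 \<subseteq> fst ` pts (Surf (\<lambda>_. 0))"
      proof
        fix l assume "l \<in> pts P2"
        then obtain v :: "complex^3" where v: "v \<noteq> 0" "l = pline v" unfolding pts_P2 by blast
        from v(1) have "(l, []) \<in> pts (Surf (\<lambda>_. 0))"
        proof (cases rule: P2_cases)
          case (Z z)
          then show ?thesis using par_pts[OF par_Z, of z] v by (simp add: Zp_def)
        next
          case X
          then show ?thesis using par_pts[OF par_X, of 0] v by (simp add: Xp_def XV_def)
        next
          case (Y a z)
          then show ?thesis using par_pts[OF par_C[OF Y(1)] Y(2)] v by simp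
        qed
        then show "l \<in> fst ` pts (Surf (\<lambda>_. 0))" by force
      qed
    qed
  qed
  fix p assume "p \<in> pts (Surf (\<lambda>_. 0))"
  then show "\<exists>V P. par (Surf (\<lambda>_. 0)) V P \<and> p \<in> P ` V \<and> par P2 V (\<lambda>z. fst (P z))"
  proof (cases rule: Surf_cases)
    case (Z z)
    then show ?thesis using par_Z par_P2(1) by (intro exI[of _ UNIV] exI[of _ Zp]) (simp add: Zp_def)
  next
    case (X z)
    then show ?thesis using par_X par_P2(2)[OF open_XV]
      by (intro exI[of _ XV] exI[of _ Xp]) (auto simp: Xp_def)
  next
    case (C a z)
    then show ?thesis using par_C[OF C(1)] par_P2(3)[OF open_CV[of a 0], of a]
      by (intro exI[of _ "CV a 0"] exI[of _ "Cp a 0"]) (auto simp del: CV.simps)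
  next
    case (B a k z)
    then show ?thesis by simp
  qed
qed

lemma compact_Surf_0: "compact_space (mtop (Surf (\<lambda>_. 0)))"
proof -
  let ?g = "inv_into (pts (Surf (\<lambda>_. 0))) fst"
  have "holo_map P2 (Surf (\<lambda>_. 0)) ?g" and bij: "bij_betw fst (pts (Surf (\<lambda>_. 0))) (pts P2)"
    using biholo_Surf_0 by (auto simp: biholo_def)
  from holo_map_continuous[OF is_atlas_proj is_atlas_Surf_0 this(1)]
  have "continuous_map (mtop P2) (mtop (Surf (\<lambda>_. 0))) ?g" .
  moreover have "compactin (mtop P2) (pts P2)"
    using compact_projective_space[where 'm=2 and 'n=3]
    by (simp add: compact_space_def topspace_mtop[OF is_atlas_proj])
  ultimately have "compactin (mtop (Surf (\<lambda>_. 0))) (?g ` pts P2)" by (rule image_compactin[rotated])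
  moreover have "?g ` pts P2 = pts (Surf (\<lambda>_. 0))"
    using bij_betw_inv_into[OF bij] by (simp add: bij_betw_def)
  ultimately show ?thesis by (simp add: compact_space_def topspace_mtop[OF is_atlas_Surf_0])
qed

definition Linf :: "(complex^3) set set" where "Linf = {pline v | v. v \<noteq> 0 \<and> v $ 3 = 0}"

lemma Linf_iff: "v \<noteq> 0 ==> pline v \<in> Linf \<longleftrightarrow> v $ 3 = 0"
proof
  assume "v \<noteq> 0" "pline v \<in> Linf"
  then obtain w where w: "pline v = pline w" "w $ 3 = 0" by (auto simp: Linf_def)
  from pline_eqD[OF w(1)] w(2) show "v $ 3 = 0" by auto
qed (auto simp: Linf_def)

lemma Linf_Y: "pline (vector [u, 1, v]) \<in> Linf \<longleftrightarrow> v = 0"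
  using Linf_iff[OF vector_Y_nz] by simp

lemma Linf_X: "pline (vector [1, u, v]) \<in> Linf \<longleftrightarrow> v = 0"
  using Linf_iff[of "vector [1, u, v]"] by (simp add: vec_eq_iff forall_3)

lemma Linf_Z: "pline (vector [x, y, 1]) \<notin> Linf"
  using Linf_iff[of "vector [x, y, 1]"] by (simp add: vec_eq_iff forall_3)

lemma nowhere_dense_Linf: "nowhere_dense_analytic P2 Linf"
proof (rule nowhere_dense_analyticI[OF is_atlas_proj])
  show "Linf \<subseteq> pts P2" by (auto simp: Linf_def pts_P2)
  fix p assume "p \<in> pts P2"
  then obtain v :: "complex^3" where v: "v \<noteq> 0" "p = pline v" unfolding pts_P2 by blast
  from v(1) show "\<exists>V P z i j. par P2 V P \<and> z \<in> V \<and> P z = p \<and> (\<forall>y\<in>V. P y \<in> Linf \<longleftrightarrow> y $ 1 ^ i * y $ 2 ^ j = (0 :: complex))"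
  proof (cases rule: P2_cases)
    case (Z z)
    show ?thesis
      by (rule exI[of _ UNIV], rule exI[of _ "\<lambda>z. pline (vector [z $ 1, z $ 2, 1])"], rule exI[of _ z],
          rule exI[of _ 0], rule exI[of _ 0])
        (use Z v par_P2(1) Linf_Z in simp)
  next
    case X
    show ?thesis
      by (rule exI[of _ UNIV], rule exI[of _ "\<lambda>z. pline (vector [1, z $ 1, z $ 2])"], rule exI[of _ 0],
          rule exI[of _ 0], rule exI[of _ 1])
        (use X v par_P2(2) Linf_X in simp)
  next
    case (Y a z)
    show ?thesis
      by (rule exI[of _ UNIV], rule exI[of _ "\<lambda>z. pline (vector [a + z $ 1, 1, z $ 2])"], rule exI[of _ z],
          rule exI[of _ 0], rule exI[of _ 1])
        (use Y v par_P2(3) Linf_Y in simp)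
  qed
qed

text \<open>The tautological map, given by a representative of each line, separates the
  points.\<close>

lemma Hausdorff_P2: "Hausdorff_space (mtop P2)"
  unfolding Hausdorff_space_def topspace_mtop[OF is_atlas_proj]
proof (intro allI impI, elim conjE)
  let ?F = "\<lambda>l. tri (rep l $ 1) (rep l $ 2) (rep l $ 3) :: nat \<Rightarrow> complex"
  have line: "\<exists>c. c \<noteq> 0 \<and> (\<forall>k\<le>2. ?F (pline v) k = c * tri (v $ 1) (v $ 2) (v $ 3) k)" if "v \<noteq> 0" for v :: "complex^3"
    using rep_pline(1)[OF that] by (auto simp: tri_def)
  have ps: "psec P2 2 ?F"
  proof (rule psecI[OF is_atlas_proj])
    fix p assume "p \<in> pts P2"
    then obtain v :: "complex^3" where v: "v \<noteq> 0" "p = pline v" unfolding pts_P2 by blast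
    from v(1) show "\<exists>V P G z. par P2 V P \<and> z \<in> V \<and> P z = p \<and> (\<forall>y\<in>V. \<forall>k\<le>2. cdiff (\<lambda>y. G y k) y) \<and>
      (\<forall>y\<in>V. \<exists>c. c \<noteq> 0 \<and> (\<forall>k\<le>2. ?F (P y) k = c * G y k)) \<and> (\<exists>k\<le>2. G z k \<noteq> 0)"
    proof (cases rule: P2_cases)
      case (Z z)
      let ?G = "\<lambda>z::complex^2. tri (z $ 1) (z $ 2) 1" and ?P = "\<lambda>z::complex^2. pline (vector [z $ 1, z $ 2, 1]) :: (complex^3) set"
      have "\<exists>c. c \<noteq> 0 \<and> (\<forall>k\<le>2. ?F (?P y) k = c * ?G y k)" for y
        using line[of "vector [y $ 1, y $ 2, 1]"] by (simp add: vec_eq_iff forall_3)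
      moreover have "\<exists>k\<le>2. ?G z k \<noteq> 0" by (rule exI[of _ 2]) (simp add: tri_def)
      ultimately show ?thesis using Z v par_P2(1)
        by (intro exI[of _ UNIV] exI[of _ ?P] exI[of _ ?G] exI[of _ z]) (auto intro!: cd cdiff_tri)
    next
      case X
      let ?G = "\<lambda>z::complex^2. tri 1 (z $ 1) (z $ 2)" and ?P = "\<lambda>z::complex^2. pline (vector [1, z $ 1, z $ 2]) :: (complex^3) set"
      have "\<exists>c. c \<noteq> 0 \<and> (\<forall>k\<le>2. ?F (?P y) k = c * ?G y k)" for y
        using line[of "vector [1, y $ 1, y $ 2]"] by (simp add: vec_eq_iff forall_3)
      moreover have "\<exists>k\<le>2. ?G 0 k \<noteq> 0" by (rule exI[of _ 0]) (simp add: tri_def)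
      ultimately show ?thesis using X v par_P2(2)[of UNIV]
        by (intro exI[of _ UNIV] exI[of _ ?P] exI[of _ ?G] exI[of _ 0]) (auto intro!: cd cdiff_tri)
    next
      case (Y a z)
      let ?G = "\<lambda>z::complex^2. tri (a + z $ 1) 1 (z $ 2)" and ?P = "\<lambda>z::complex^2. pline (vector [a + z $ 1, 1, z $ 2]) :: (complex^3) set"
      have "\<exists>c. c \<noteq> 0 \<and> (\<forall>k\<le>2. ?F (?P y) k = c * ?G y k)" for y
        using line[OF vector_Y_nz, of "a + y $ 1" "y $ 2"] by simp
      moreover have "\<exists>k\<le>2. ?G z k \<noteq> 0" by (rule exI[of _ 1]) (simp add: tri_def)
      ultimately show ?thesis using Y v par_P2(3)[of UNIV a]
        by (intro exI[of _ UNIV] exI[of _ ?P] exI[of _ ?G] exI[of _ z]) (auto intro!: cd cdiff_tri)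
    qed
  qed
  fix p q assume pq: "p \<in> pts P2" "q \<in> pts P2" "p \<noteq> q"
  have "\<not> (\<exists>c. \<forall>i\<le>2. ?F q i = c * ?F p i)"
  proof
    assume "\<exists>c. \<forall>i\<le>2. ?F q i = c * ?F p i"
    then obtain c where c: "\<forall>i\<le>2. ?F q i = c * ?F p i" by blast
    obtain v w :: "complex^3" where v: "v \<noteq> 0" "p = pline v" "w \<noteq> 0" "q = pline w" using pq unfolding pts_P2 by blast
    have e: "rep q = c *s rep p"
      using c[rule_format, of 0] c[rule_format, of 1] c[rule_format, of 2] by (simp add: tri_def vec_eq_iff forall_3)
    then have "c \<noteq> 0" using rep_pline(2)[OF v(3)] v(4) by auto
    then have "pline (rep q) = pline (rep p)" using e by (simp add: pline_scale)
    then show False using rep_pline(3)[OF v(1)] rep_pline(3)[OF v(3)] v pq by simp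
  qed
  then show "\<exists>U V. openin (mtop P2) U \<and> openin (mtop P2) V \<and> p \<in> U \<and> q \<in> V \<and> disjnt U V"
    by (rule separated_by_psec[OF is_atlas_proj ps pq(1,2)])
qed

lemma pline_fac_exists:
  fixes G :: "complex^('k::finite) \<Rightarrow> complex^('n::finite)"
  assumes card: "CARD('n) = Suc CARD('m::finite)" and V: "open V" "z \<in> V" "\<And>y. y \<in> V ==> cdv G y" "G z \<noteq> 0"
  shows "\<exists>V' Q. par (projective_space :: ((complex^'n) set, 'm) atlas) V' Q \<and> fac (\<lambda>y. pline (G y)) z Q V'"
proof -
  obtain i where i: "G z $ i \<noteq> 0" using V(4) by (auto simp: vec_eq_iff)
  obtain \<sigma> :: "'m \<Rightarrow> 'n" where s: "bij_betw \<sigma> UNIV (- {i})" by (rule exists_pchart[OF card])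
  have "fac (\<lambda>y. pline (G y)) z (\<lambda>y. pline (pchart i \<sigma> y)) UNIV"
    by (rule pline_fac[OF pchart_lins[OF s] V(1,2,3) i open_UNIV UNIV_I])
  then show ?thesis using lpar_par[OF lpar_projective_space[OF s]] by blast
qed

context brn
begin

lemma compact_Surf: "compact_space (mtop (Surf n))"
proof -
  have "is_atlas (Surf n) \<and> compact_space (mtop (Surf n))"
  proof (rule Surf_induct[where R="\<lambda>n. is_atlas (Surf n) \<and> compact_space (mtop (Surf n))" and n=n])
    fix n :: "complex \<Rightarrow> nat" and a assume s: "is_atlas (Surf n) \<and> compact_space (mtop (Surf n))" "a \<in> Br"
    interpret blowup "CV a (n a)" "Cp a (n a)" "exc a (Suc (n a))" "Rest n a"
      by (rule Cp_blowup[OF _ s(2) Cp_inj]) (use s in simp)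
    show "is_atlas (Surf (n(a := Suc (n a)))) \<and> compact_space (mtop (Surf (n(a := Suc (n a)))))"
      unfolding Surf_blow[OF s(2)] using is_atlas_blow compact_blow s(1) unfolding Surf_Rest[OF s(2), of n] by blast
  qed (use n0 is_atlas_Surf_0 compact_Surf_0 in auto)
  then show ?thesis by simp
qed

text \<open>An exceptional point stores its centre in the first component, so \<open>fst\<close> is
  the contraction of all exceptional curves onto the plane.\<close>

lemma holo_fst: "holo_map (Surf n) P2 fst"
proof (rule holo_mapI[OF at is_atlas_proj])
  fix p assume "p \<in> pts (Surf n)"
  then show "\<exists>V P z V' Q. par (Surf n) V P \<and> z \<in> V \<and> P z = p \<and> par P2 V' Q \<and> fac (\<lambda>y. fst (P y)) z Q V'"
  proof (cases rule: Surf_cases)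
    case (Z z)
    have "fac (\<lambda>y. fst (Zp y)) z (\<lambda>z::complex^2. pline (vector [z $ 1, z $ 2, 1])) UNIV"
      unfolding Zp_def fst_conv by (rule fac_refl) auto
    then show ?thesis using Z par_Z par_P2(1) by blast
  next
    case (X z)
    have "fac (\<lambda>y. fst (Xp y)) z (\<lambda>z::complex^2. pline (vector [1, z $ 1, z $ 2])) XV"
      unfolding Xp_def fst_conv by (rule fac_refl[OF open_XV X(1)])
    then show ?thesis using X par_X par_P2(2)[OF open_XV] by blast
  next
    case (C a z)
    have "\<exists>V' Q. par P2 V' Q \<and> fac (\<lambda>y. fst (Cp a (n a) y)) z Q V'"
      unfolding fst_Cp
      by (rule pline_fac_exists[OF _ open_CV C(2)]) (auto intro!: cd simp: vector_Y_nz simp del: CV.simps)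
    then show ?thesis using C par_C[OF C(1)] by blast
  next
    case (B a k z)
    have "\<exists>V' Q. par P2 V' Q \<and> fac (\<lambda>y. fst (Bp a k y)) z Q V'"
      unfolding fst_Bp
      by (rule pline_fac_exists[OF _ open_BV B(3)]) (auto intro!: cd simp: vector_Y_nz)
    then show ?thesis using B par_B[OF B(1,2)] by blast
  qed
qed

abbreviation "Dinf \<equiv> {p \<in> pts (Surf n). fst p \<in> Linf}"

lemma nowhere_dense_Dinf: "nowhere_dense_analytic (Surf n) Dinf"
proof (rule nowhere_dense_analyticI[OF at])
  fix p assume "p \<in> pts (Surf n)"
  then show "\<exists>V P z i j. par (Surf n) V P \<and> z \<in> V \<and> P z = p \<and>
      (\<forall>y\<in>V. P y \<in> Dinf \<longleftrightarrow> y $ 1 ^ i * y $ 2 ^ j = (0 :: complex))"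
  proof (cases rule: Surf_cases)
    case (Z z)
    show ?thesis
      by (rule exI[of _ UNIV], rule exI[of _ Zp], rule exI[of _ z], rule exI[of _ 0], rule exI[of _ 0])
        (use Z par_Z Linf_Z in "simp add: Zp_def")
  next
    case (X z)
    show ?thesis
      by (rule exI[of _ XV], rule exI[of _ Xp], rule exI[of _ z], rule exI[of _ 0], rule exI[of _ 1])
        (use X par_X par_pts[OF par_X] Linf_X in "simp add: Xp_def")
  next
    case (C a z)
    show ?thesis
      by (rule exI[of _ "CV a (n a)"], rule exI[of _ "Cp a (n a)"], rule exI[of _ z], rule exI[of _ 0], rule exI[of _ 1])
        (use C par_C par_pts[OF par_C] Linf_Y in "simp add: fst_Cp")
  next
    case (B a k z)
    show ?thesis
      by (rule exI[of _ "BV a k"], rule exI[of _ "Bp a k"], rule exI[of _ z], rule exI[of _ 1], rule exI[of _ 1])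
        (use B par_B par_pts[OF par_B] Linf_Y in "simp add: fst_Bp")
  qed
qed simp

lemma Dinf_compl: "pts (Surf n) - Dinf = range Zp"
proof (intro set_eqI iffI)
  fix p assume "p \<in> range Zp"
  then show "p \<in> pts (Surf n) - Dinf" using par_pts[OF par_Z] Linf_Z by (auto simp: Zp_def)
next
  fix p assume p: "p \<in> pts (Surf n) - Dinf"
  then have "fst p \<notin> Linf" "p \<in> pts (Surf n)" by auto
  from Surf_points[OF this(2)] show "p \<in> range Zp"
  proof (elim disjE exE conjE)
    fix v assume v: "v \<noteq> 0" "p = (pline v, [])"
    from v(1) show ?thesis
    proof (cases rule: P2_cases)
      case (Z z)
      then show ?thesis using v by (simp add: Zp_def)
    next
      case X
      then show ?thesis using \<open>fst p \<notin> Linf\<close> v Linf_X by simp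
    next
      case (Y a z)
      then show ?thesis using \<open>fst p \<notin> Linf\<close> v Linf_Y by simp
    qed
  next
    fix a m d assume "p = exc a m (pline d)"
    then show ?thesis using \<open>fst p \<notin> Linf\<close> Linf_Y[of a 0] by (simp add: exc_def ctr_def)
  qed
qed

lemma bimeromorphic_Surf: "bimeromorphic (Surf n) P2"
proof (rule bimeromorphicI[OF at is_atlas_proj Hausdorff_P2 holo_fst nowhere_dense_Dinf nowhere_dense_Linf])
  let ?P = "\<lambda>z::complex^2. pline (vector [z $ 1, z $ 2, 1]) :: (complex^3) set"
  have c: "pts P2 - Linf = range ?P"
  proof (intro set_eqI iffI)
    fix l assume "l \<in> pts P2 - Linf"
    then obtain v :: "complex^3" where v: "v \<noteq> 0" "l = pline v" "l \<notin> Linf" unfolding pts_P2 by blast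
    from v(1) show "l \<in> range ?P"
      by (cases rule: P2_cases) (use v Linf_X[of 0 0] Linf_Y in auto)
  next
    fix l assume "l \<in> range ?P"
    then show "l \<in> pts P2 - Linf" using par_pts[OF par_P2(1)] Linf_Z by auto
  qed
  have o: "openin (mtop (Surf n)) (range Zp)" "openin (mtop P2) (range ?P)"
    by (rule openin_par_image[OF at par_Z], rule openin_par_image[OF is_atlas_proj par_P2(1)])
  show "biholo (open_restrict (Surf n) (pts (Surf n) - Dinf)) (open_restrict P2 (pts P2 - Linf)) fst"
    unfolding Dinf_compl c
  proof (rule biholoI[OF is_atlas_open_restrict[OF at o(1)] is_atlas_open_restrict[OF is_atlas_proj o(2)]])
    have e: "pts (open_restrict (Surf n) (range Zp)) = range Zp" "pts (open_restrict P2 (range ?P)) = range ?P"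
      using par_pts[OF par_Z] par_pts[OF par_P2(1)] by (auto simp: pts_open_restrict)
    show "bij_betw fst (pts (open_restrict (Surf n) (range Zp))) (pts (open_restrict P2 (range ?P)))"
      unfolding e by (auto simp: bij_betw_def inj_on_def Zp_def image_iff)
    fix p assume "p \<in> pts (open_restrict (Surf n) (range Zp))"
    then have p: "p \<in> range Zp" unfolding e .
    have "par (open_restrict P2 (range ?P)) UNIV ?P"
      by (rule par_open_restrict[OF is_atlas_proj par_P2(1) o(2)]) auto
    then have "par (open_restrict P2 (range ?P)) UNIV (\<lambda>z. fst (Zp z))" by (simp add: Zp_def)
    moreover have "par (open_restrict (Surf n) (range Zp)) UNIV Zp"
      by (rule par_open_restrict[OF at par_Z o(1)]) auto
    ultimately show "\<exists>V P. par (open_restrict (Surf n) (range Zp)) V P \<and> p \<in> P ` V \<and>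
        par (open_restrict P2 (range ?P)) V (\<lambda>z. fst (P z))"
      using p by blast
  qed
qed

text \<open>The affine plane is connected, and its image is dense.\<close>

lemma connected_Surf: "connected_space (mtop (Surf n))"
proof -
  have "connectedin (mtop (Surf n)) (Zp ` UNIV)"
    using connectedin_continuous_map_image[OF continuous_map_par[OF at par_Z], of UNIV]
    by (simp add: connected_UNIV)
  then have "connectedin (mtop (Surf n)) (mtop (Surf n) closure_of (range Zp))"
    by (rule connectedin_closure_of)
  moreover have "mtop (Surf n) closure_of (range Zp) = topspace (mtop (Surf n))"
    using nowhere_dense_Dinf unfolding nowhere_dense_analytic_def Dinf_compl topspace_mtop[OF at] by simp
  ultimately show ?thesis by (simp add: connectedin_topspace)
qed

text \<open>Local coordinates occur among the ratios of the maps. In \<open>Cp a (n a)\<close>, z1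
  comes from \<open>FG a (n a)\<close> and z2 from \<open>F0\<close>. In \<open>Bp a m\<close>, z2
  comes from \<open>FG a (Suc m)\<close> and z1 from \<open>FG a m\<close>, or from
  \<open>F0\<close> up to the constant a when m = 0.\<close>

lemma projective_Surf:
  assumes pos: "\<And>a. a \<in> Br ==> 1 \<le> n a"
  shows "\<exists>N F. projective_embedding (Surf n) N F"
proof -
  have "finite (insert (2, F0) ((\<lambda>(a, j). (2, FG a j)) ` (SIGMA a:Br. {1..n a})))"
    by (simp add: Br_def)
  then obtain fs :: "(nat \<times> (surface_point \<Rightarrow> nat \<Rightarrow> complex)) list"
    where "set fs = insert (2, F0) ((\<lambda>(a, j). (2, FG a j)) ` (SIGMA a:Br. {1..n a}))"
    using finite_list by blast
  then have fs: "set fs = insert (2, F0) {(2, FG a j) | a j. a \<in> Br \<and> 1 \<le> j \<and> j \<le> n a}"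
    by (simp only: set_eq_iff) (fastforce simp: image_iff)
  have m0: "(2, F0) \<in> set fs" and m1: "\<And>a j. a \<in> Br ==> 1 \<le> j ==> j \<le> n a ==> (2, FG a j) \<in> set fs"
    unfolding fs by blast+
  show ?thesis
  proof (rule projective_embeddingI[OF at, of fs])
    show "\<forall>(N, F)\<in>set fs. psec (Surf n) N F" using psec_F0 psec_FG by (auto simp: fs)
    fix p q assume pq: "p \<in> pts (Surf n)" "q \<in> pts (Surf n)" "\<And>N F. (N, F) \<in> set fs ==> prop_at N F p q"
    show "p = q" by (rule Surf_separated[OF pq(1,2)]) (auto intro!: pq(3) simp: fs)
  next
    fix p assume p: "p \<in> pts (Surf n)"
    have crit: "\<exists>V P z. par (Surf n) V P \<and> z \<in> V \<and> P z = p \<and> (\<forall>m. \<exists>N F i k b. (N, F) \<in> set fs \<and> i \<le> N \<and> k \<le> N \<and>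
        (\<forall>y\<in>V. F (P y) i \<noteq> 0 \<and> F (P y) k / F (P y) i = b + y $ m))"
      if P: "par (Surf n) V P" "z \<in> V" "P z = p" and F: "(2, F1) \<in> set fs" "(2, F2) \<in> set fs" "i1 \<le> 2" "k1 \<le> 2" "i2 \<le> 2" "k2 \<le> 2"
        and 1: "\<And>y. y \<in> V ==> \<exists>c. c \<noteq> 0 \<and> (\<forall>k\<le>2. F1 (P y) k = c * G1 y k)" "\<And>y. G1 y i1 = 1" "\<And>y. G1 y k1 = b + y $ 1"
        and 2: "\<And>y. y \<in> V ==> \<exists>c. c \<noteq> 0 \<and> (\<forall>k\<le>2. F2 (P y) k = c * G2 y k)" "\<And>y. G2 y i2 = 1" "\<And>y. G2 y k2 = y $ 2"
      for V P z F1 F2 i1 k1 i2 k2 b and G1 G2 :: "complex^2 \<Rightarrow> nat \<Rightarrow> complex"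
    proof -
      have r1: "F1 (P y) i1 \<noteq> 0 \<and> F1 (P y) k1 / F1 (P y) i1 = b + y $ 1" if y: "y \<in> V" for y
      proof -
        obtain c where "c \<noteq> 0" "\<forall>k\<le>2. F1 (P y) k = c * G1 y k" using 1(1)[OF y] by blast
        then show ?thesis using 1(2,3)[of y] F(3,4) by simp
      qed
      have r2: "F2 (P y) i2 \<noteq> 0 \<and> F2 (P y) k2 / F2 (P y) i2 = 0 + y $ 2" if y: "y \<in> V" for y
      proof -
        obtain c where "c \<noteq> 0" "\<forall>k\<le>2. F2 (P y) k = c * G2 y k" using 2(1)[OF y] by blast
        then show ?thesis using 2(2,3)[of y] F(5,6) by simp
      qed
      have "\<exists>N F i k b. (N, F) \<in> set fs \<and> i \<le> N \<and> k \<le> N \<and> (\<forall>y\<in>V. F (P y) i \<noteq> 0 \<and> F (P y) k / F (P y) i = b + y $ m)" for m :: 2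
      proof (cases "m = 1")
        case True
        then show ?thesis using F r1 by (intro exI[of _ 2] exI[of _ F1] exI[of _ i1] exI[of _ k1] exI[of _ b]) simp
      next
        case False
        then have "m = 2" using exhaust_2[of m] by simp
        then show ?thesis using F r2 by (intro exI[of _ 2] exI[of _ F2] exI[of _ i2] exI[of _ k2] exI[of _ 0]) simp
      qed
      then show ?thesis using P by (intro exI[of _ V] exI[of _ P] exI[of _ z]) simp
    qed
    from p show "\<exists>V P z. par (Surf n) V P \<and> z \<in> V \<and> P z = p \<and> (\<forall>m. \<exists>N F i k b. (N, F) \<in> set fs \<and> i \<le> N \<and> k \<le> N \<and>
        (\<forall>y\<in>V. F (P y) i \<noteq> 0 \<and> F (P y) k / F (P y) i = b + y $ m))"
    proof (cases rule: Surf_cases)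
      case (Z z)
      have l: "\<exists>c. c \<noteq> 0 \<and> (\<forall>k\<le>2. F0 (Zp y) k = c * tri (y $ 1) (y $ 2) 1 k)" for y
        using F0_line[of "vector [y $ 1, y $ 2, 1]" "Zp y"] by (simp add: Zp_def vec_eq_iff forall_3)
      show ?thesis
        by (rule crit[OF par_Z UNIV_I, of z F0 F0 2 0 2 1 _ 0, OF _ _ _ _ _ _ _ l _ _ l]) (use Z m0 in "auto simp: tri_def")
    next
      case (X z)
      have l: "\<exists>c. c \<noteq> 0 \<and> (\<forall>k\<le>2. F0 (Xp y) k = c * tri 1 (y $ 1) (y $ 2) k)" for y
        using F0_line[of "vector [1, y $ 1, y $ 2]" "Xp y"] by (simp add: Xp_def vec_eq_iff forall_3)
      show ?thesis
        by (rule crit[OF par_X X(1), of F0 F0 0 1 0 2 _ 0, OF _ _ _ _ _ _ _ l _ _ l]) (use X m0 in "auto simp: tri_def")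
    next
      case (C a z)
      have l1: "\<exists>c. c \<noteq> 0 \<and> (\<forall>k\<le>2. FG a (n a) (Cp a (n a) y) k = c * tri (y $ 1) ((a + y $ 1 * y $ 2 ^ n a) ^ (n a - 1) * y $ 1) 1 k)" for y
        using FG_Cp[OF pos[OF C(1)] order_refl, of a y] by simp
      have l2: "\<exists>c. c \<noteq> 0 \<and> (\<forall>k\<le>2. F0 (Cp a (n a) y) k = c * tri (a + y $ 1 * y $ 2 ^ n a) 1 (y $ 2) k)" for y
        using F0_line[OF vector_Y_nz fst_Cp, of a "n a" y] by simp
      show ?thesis
        by (rule crit[OF par_C[OF C(1)] C(2), of "FG a (n a)" F0 2 0 1 2 _ 0, OF _ _ _ _ _ _ _ l1 _ _ l2])
          (use C m0 m1[OF C(1) pos[OF C(1)] order_refl] in "auto simp: tri_def")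
    next
      case (B a m z)
      have l2: "\<exists>c. c \<noteq> 0 \<and> (\<forall>k\<le>2. FG a (Suc m) (Bp a m y) k = c * tri 1 ((a + y $ 1 * (y $ 1 * y $ 2) ^ m) ^ m) (y $ 2) k)" for y
        using FG_Bp_less[of m "Suc m" a y] by simp
      show ?thesis
      proof (cases "m = 0")
        case True
        have l1: "\<exists>c. c \<noteq> 0 \<and> (\<forall>k\<le>2. F0 (Bp a m y) k = c * tri (a + y $ 1) 1 (y $ 1 * y $ 2) k)" for y
          using F0_line[OF vector_Y_nz fst_Bp, of a m y] True by simp
        show ?thesis
          by (rule crit[OF par_B[OF B(1,2)] B(3), of F0 "FG a (Suc m)" 1 0 0 2 _ a, OF _ _ _ _ _ _ _ l1 _ _ l2])
            (use B m0 m1[of a "Suc m"] in "auto simp: tri_def")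
      next
        case False
        have l1: "\<exists>c. c \<noteq> 0 \<and> (\<forall>k\<le>2. FG a m (Bp a m y) k = c * tri (y $ 1) ((a + y $ 1 * (y $ 1 * y $ 2) ^ m) ^ (m - 1) * y $ 1) 1 k)" for y
          using FG_Bp[of m m a y] False by simp
        show ?thesis
          by (rule crit[OF par_B[OF B(1,2)] B(3), of "FG a m" "FG a (Suc m)" 2 0 0 2 _ 0, OF _ _ _ _ _ _ _ l1 _ _ l2])
            (use B False m1[of a m] m1[of a "Suc m"] in "auto simp: tri_def")
      qed
    qed
  qed
qed

lemma rational_Surf:
  assumes "\<And>a. a \<in> Br ==> 1 \<le> n a"
  shows "smooth_projective_rational_surface (Surf n)"
  unfolding smooth_projective_rational_surface_def
  by (intro conjI complex_manifold_Surf compact_Surf connected_Surf projective_Surf bimeromorphic_Surf assms)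

end

section \<open>Smooth rational curves in a surface\<close>

definition pl :: "bool \<Rightarrow> complex \<Rightarrow> (complex^2) set" where
  "pl b w = pline (if b then vector [1, w] else vector [w, 1])"

lemma par_pl: "open W ==> par P1 W (\<lambda>z. pl b (z $ 1))"
  by (cases b) (simp_all add: pl_def par_lins[OF lins_1] par_lins[OF lins_2])

lemma pts_P1: "pts P1 = plines"
  by (rule pts_projective_space) simp

lemma plines_pl: "l \<in> plines ==> \<exists>b w. l = pl b w"
proof -
  assume "l \<in> plines"
  then obtain b z where "l = pline (bdir b z)"
    by (rule plines_bdir)
  then have "l = pl b (if b then z $ 2 else z $ 1)"
    by (simp add: pl_def bdir_def)
  then show ?thesis by blast
qed

lemma open_nth_vimage: "open W ==> open {z :: complex^1. z $ 1 \<in> W}"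
  using open_vimage_vec_nth[of W 1] by (simp add: vimage_def)

lemma open_axis_vimage:
  fixes z :: "complex^2"
  assumes "open V"
  shows "open ((\<lambda>t. z + t *s axis i 1) -` V)"
proof (rule open_vimage[OF assms])
  have "(\<lambda>t. z + t *s axis i 1) = (\<lambda>t. \<chi> k. z $ k + t * axis i 1 $ k)"
    by (simp add: fun_eq_iff vec_eq_iff)
  then show "continuous_on UNIV (\<lambda>t. z + t *s axis i 1)"
    by (simp only:) (intro continuous_intros)
qed

lemma cdv_axis: "cdiff f x ==> cdv (\<lambda>y. A + f y *s axis i (1::complex)) x"
  unfolding cdv_def by (auto simp: axis_def intro!: cd)

text \<open>Locally the curve runs along a coordinate axis of some parametrisation at unit speed.
  The parameter is then a holomorphic function of the point of the surface, so the map has a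
  holomorphic left inverse and its derivative is injective.\<close>

lemma rational_curveI:
  fixes \<gamma> :: "(complex^2) set \<Rightarrow> 'a" and S :: "('a, 2) atlas"
  assumes S: "is_atlas S" and inj: "inj_on \<gamma> plines"
    and loc: "\<And>p. p \<in> plines ==> \<exists>V P A i b w W. par S V P \<and> p = pl b w \<and> open W \<and> w \<in> W \<and>
      (\<forall>w'\<in>W. A + (w' - w) *s axis i 1 \<in> V \<and> \<gamma> (pl b w') = P (A + (w' - w) *s axis (i::2) 1))"
  shows "smooth_rational_curve S (\<gamma> ` plines)"
proof -
  have P1: "is_atlas P1" by (rule is_atlas_proj)
  have h: "holo_map P1 S \<gamma>"
  proof (rule holo_mapI[OF P1 S], unfold pts_P1)
    fix p :: "(complex^2) set"
    assume "p \<in> plines"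
    from loc[OF this] obtain V P A i b w W where P: "par S V P" and p: "p = pl b w" and W: "open W" "w \<in> W"
      and g: "\<forall>w'\<in>W. A + (w' - w) *s axis i 1 \<in> V \<and> \<gamma> (pl b w') = P (A + (w' - w) *s axis (i::2) 1)"
      by (elim exE conjE) (rule that)
    let ?V = "{z :: complex^1. z $ 1 \<in> W}"
    have 1: "fac (\<lambda>y. \<gamma> (pl b (y $ 1))) (vec w :: complex^1) P V"
      by (rule facI[where W="?V" and \<tau>="\<lambda>y. A + (y $ 1 - w) *s axis i 1"];
          (rule open_nth_vimage[OF W(1)] | (rule cdv_axis, intro cd) | use g W in simp))
    show "\<exists>V P z V' Q. par P1 V P \<and> z \<in> V \<and> P z = p \<and> par S V' Q \<and> fac (\<lambda>y. \<gamma> (P y)) z Q V'"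
      by (rule exI[of _ ?V], rule exI[of _ "\<lambda>z. pl b (z $ 1)"], rule exI[of _ "vec w"], rule exI[of _ V],
          rule exI[of _ P], intro conjI par_pl P 1 open_nth_vimage W(1)) (use W p in simp_all)
  qed
  have imm: "inj (frechet_derivative (\<psi> \<circ> \<gamma> \<circ> inv_into U \<phi>) (at (\<phi> p)))"
    if ch: "(U, \<phi>) \<in> P1" "(V0, \<psi>) \<in> S" and p: "p \<in> U" "\<gamma> p \<in> V0" for U \<phi> V0 \<psi> p
  proof -
    let ?f = "\<psi> \<circ> \<gamma> \<circ> inv_into U \<phi>" and ?i = "inv_into U \<phi>" and ?x = "\<phi> p"
    have pp: "p \<in> plines" using ch(1) p(1) by (auto simp: pts_P1[symmetric] pts_def)
    from loc[OF pp] obtain V P A i b w W where P: "par S V P" and pb: "p = pl b w" and W: "open W" "w \<in> W"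
      and g: "\<forall>w'\<in>W. A + (w' - w) *s axis i 1 \<in> V \<and> \<gamma> (pl b w') = P (A + (w' - w) *s axis (i::2) 1)"
      by (elim exE conjE) (rule that)
    have AV: "A \<in> V" and PA: "P A = \<gamma> p" using g[rule_format, OF W(2)] pb by simp_all
    have ix: "?i ?x = p" using is_atlas_inj[OF P1 ch(1)] p(1) by simp
    have U: "par P1 (\<phi> ` U) ?i" by (rule chart_par[OF P1 ch(1)])
    have V0: "par S (\<psi> ` V0) (inv_into V0 \<psi>)" by (rule chart_par[OF S ch(2)])
    let ?o = "\<phi> ` (U \<inter> \<gamma> -` V0)"
    have "hol_map_on ?o ?f"
      using bspec[OF bspec[OF conjunct2[OF h[unfolded holo_map_def]] ch(1), unfolded prod.case] ch(2), unfolded prod.case] .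
    then have hf: "open ?o" "\<And>y. y \<in> ?o ==> cdv ?f y"
      unfolding hol_map_on_iff by blast+
    have xo: "?x \<in> ?o" using p by blast
    have xU: "?x \<in> \<phi> ` U" using p by blast
    have ip: "?i ?x = pl b w" using ix pb by simp
    have pw: "par P1 {z. z $ 1 \<in> W} (\<lambda>z. pl b (z $ 1))"
      by (rule par_pl[OF open_nth_vimage[OF W(1)]])
    have vw: "(vec w :: complex^1) \<in> {z. z $ 1 \<in> W}" using W(2) by simp
    have ip': "?i ?x = pl b ((vec w :: complex^1) $ 1)" unfolding vec_component by (rule ip)
    have "fac ?i ?x (\<lambda>z. pl b (z $ 1)) {z :: complex^1. z $ 1 \<in> W}"
      by (rule par_fac[OF P1 U pw xU vw ip'])
    then obtain W1 \<tau>1 where 1: "open W1" "?x \<in> W1"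
      "\<forall>y\<in>W1. \<tau>1 y \<in> {z :: complex^1. z $ 1 \<in> W} \<and> ?i y = pl b (\<tau>1 y $ 1) \<and> cdv \<tau>1 y"
      unfolding fac_def by (elim exE conjE) (rule that)
    have "fac (\<lambda>z :: complex^1. pl b (z $ 1)) (vec w) ?i (\<phi> ` U)"
      by (rule par_fac[OF P1 par_pl[OF open_UNIV] U UNIV_I xU ip'[symmetric]])
    then obtain W3 \<tau>3 where 3: "open W3" "(vec w :: complex^1) \<in> W3"
      "\<forall>y\<in>W3. \<tau>3 y \<in> \<phi> ` U \<and> pl b (y $ 1) = ?i (\<tau>3 y) \<and> cdv \<tau>3 y"
      unfolding fac_def by (elim exE conjE) (rule that)
    have fx: "?f ?x \<in> \<psi> ` V0" "inv_into V0 \<psi> (?f ?x) = \<gamma> p"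
      using p ix is_atlas_inj[OF S ch(2)] by simp_all
    have "fac (inv_into V0 \<psi>) (?f ?x) P V"
      by (rule par_fac[OF S V0 P fx(1) AV]) (use fx PA in simp)
    then obtain W4 \<tau>4 where 4: "open W4" "?f ?x \<in> W4"
      "\<forall>y\<in>W4. \<tau>4 y \<in> V \<and> inv_into V0 \<psi> y = P (\<tau>4 y) \<and> cdv \<tau>4 y"
      unfolding fac_def by (elim exE conjE) (rule that)
    \<comment> \<open>H reads the curve parameter back from the coordinates of the target chart:
      \<open>\<tau>4\<close> passes to the parametrisation P, in which entry i is the parameter up
      to a shift.\<close>
    define H where "H v = (vec (w + (\<tau>4 v - A) $ i) :: complex^1)" for v
    have key: "\<tau>4 (?f y) = A + (\<tau>1 y $ 1 - w) *s axis i 1"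
      if y: "y \<in> W1" "y \<in> ?o" "?f y \<in> W4" for y
    proof (rule inj_onD[OF par_inj[OF P]])
      have "P (\<tau>4 (?f y)) = inv_into V0 \<psi> (\<psi> (\<gamma> (?i y)))" using 4(3) y(3) by simp
      also have "\<dots> = \<gamma> (?i y)"
        using y(2) is_atlas_inj[OF S ch(2)] is_atlas_inj[OF P1 ch(1)] by auto
      also have "\<dots> = P (A + (\<tau>1 y $ 1 - w) *s axis i 1)" using 1(3) g y(1) by simp
      finally show "P (\<tau>4 (?f y)) = P (A + (\<tau>1 y $ 1 - w) *s axis i 1)" .
      show "\<tau>4 (?f y) \<in> V" "A + (\<tau>1 y $ 1 - w) *s axis i 1 \<in> V" using 4(3) 1(3) g y by simp_all
    qed
    have v1: "vec (v $ 1) = v" for v :: "complex^1" by (simp add: vec_eq_iff)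
    have H: "H (?f y) = \<tau>1 y" if "y \<in> W1" "y \<in> ?o" "?f y \<in> W4" for y
      unfolding H_def key[OF that] by (simp add: vec_eq_iff)
    have t1x: "\<tau>1 ?x = vec w"
    proof (rule inj_onD[OF par_inj[OF par_pl[OF open_UNIV]]])
      show "pl b (\<tau>1 ?x $ 1) = pl b ((vec w :: complex^1) $ 1)" using 1 ix pb by auto
    qed simp_all
    have Hx: "H (?f ?x) = vec w" using H[OF 1(2) xo 4(2)] t1x by simp
    have cH: "cdv H (?f ?x)"
      unfolding H_def cdv_def using 4 by (auto intro!: cd cdv_nth)
    let ?W = "{y \<in> W1 \<inter> ?o. ?f y \<in> W4} \<inter> {y \<in> W1. \<tau>1 y \<in> W3}"
    have oW: "open ?W"
      by (intro open_Int cdv_open_vimage 1(1) hf 4(1) 3(1)) (use 1(3) hf in auto)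
    have xW: "?x \<in> ?W" using 1 4 xo 3 t1x by auto
    have c3: "cdv (\<lambda>v. \<tau>3 (H v)) (?f ?x)"
      by (rule cdv_compose[OF cH]) (use 3 Hx in auto)
    have eq: "y $ 1 = \<tau>3 (H (?f y)) $ 1" if y: "y \<in> ?W" for y
    proof -
      have "?i (\<tau>3 (\<tau>1 y)) = ?i y" using 1(3) 3(3) y by auto
      moreover have "y \<in> \<phi> ` U" "\<tau>3 (\<tau>1 y) \<in> \<phi> ` U" using y 3(3) by auto
      ultimately have "\<tau>3 (\<tau>1 y) = y" by (metis f_inv_into_f)
      then show ?thesis using H[of y] y by simp
    qed
    \<comment> \<open>The coordinate of the projective line factors through the map in charts; since
      its own derivative is injective, so is the derivative of the map.\<close>
    have "frechet_derivative (\<lambda>y::complex^1. y $ 1) (at ?x) =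
        frechet_derivative (\<lambda>v. \<tau>3 (H v) $ 1) (at (?f ?x)) \<circ> frechet_derivative ?f (at ?x)"
      by (rule frechet_cdiff_compose[OF hf(2)[OF xo] cdv_nth[OF c3] oW xW eq])
    moreover have "frechet_derivative (\<lambda>y::complex^1. y $ 1) (at ?x) = (\<lambda>y. y $ 1)"
      by (rule frechet_derivative_at[symmetric]) (auto intro!: derivative_eq_intros bounded_linear_vec_nth bounded_linear_imp_has_derivative)
    moreover have "inj (\<lambda>y::complex^1. y $ 1)" by (auto simp: inj_def vec_eq_iff)
    ultimately show ?thesis by (metis inj_on_imageI2)
  qed
  have "inj_immersion P1 S \<gamma>"
    unfolding inj_immersion_def using h inj imm by (auto simp: pts_P1)
  then show ?thesis unfolding smooth_rational_curve_def pts_P1 by blast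
qed

section \<open>Intersection numbers computed from transition functions\<close>

definition coord_or_one :: "(complex^2 \<Rightarrow> complex) \<Rightarrow> bool" where
  "coord_or_one s \<longleftrightarrow> (\<exists>d. s = (\<lambda>z. z $ d)) \<or> s = (\<lambda>_. 1)"

text \<open>g is the transition function of O(D): the equations of D obey s = g s', and on the curve
  C, which is the axis z $ e = 0 with coordinate z $ a, the powers serving as a meromorphic section
  obey the same rule.\<close>

definition cocycle :: "(complex^2 \<Rightarrow> complex) \<Rightarrow> (complex^2 \<Rightarrow> complex) \<Rightarrow> (complex^2 \<Rightarrow> complex) \<Rightarrow>
    2 \<Rightarrow> 2 \<Rightarrow> 2 \<Rightarrow> int \<Rightarrow> int \<Rightarrow> complex^2 \<Rightarrow> complex^2 \<Rightarrow> bool" where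
  "cocycle g s s' e a a' m m' z z' \<longleftrightarrow> cdiff g z \<and> s z = g z * s' z' \<and>
     (z $ e = 0 \<longrightarrow> (z $ a) powi m = g z * (z' $ a') powi m')"

text \<open>A coordinate function is linear and equals its own derivative, hence has nonzero
  derivative everywhere; by the chain rule this persists in every other chart.\<close>

lemma local_equation_chart:
  fixes S :: "('a, 2) atlas"
  assumes S: "is_atlas S" and P: "par S V P" and D: "\<And>z. z \<in> V ==> P z \<in> D \<longleftrightarrow> s z = 0"
    and s: "coord_or_one s"
  shows "local_equation S D (P ` V) (\<lambda>q. s (inv_into V P q))"
proof -
  have inv: "inv_into V P (P z) = z" if "z \<in> V" for z using par_inj[OF P] that by simp
  have h: "holo_fun S (P ` V) (\<lambda>q. s (inv_into V P q))"
  proof (rule holo_funI[OF S openin_par_image[OF S P]])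
    fix p assume "p \<in> P ` V"
    then obtain z where z: "z \<in> V" "p = P z" by blast
    have "cdiff s z" using s by (auto simp: coord_or_one_def intro: cd)
    then have "cdiff (\<lambda>y. s (inv_into V P (P y))) z"
      by (rule cdiff_cong[OF _ par_open[OF P] z(1)]) (simp add: inv)
    then show "\<exists>V' P' z. par S V' P' \<and> z \<in> V' \<and> P' z = p \<and> cdiff (\<lambda>y. s (inv_into V P (P' y))) z"
      using P z by blast
  qed
  have fr: "frechet_derivative ((\<lambda>q. s (inv_into V P q)) \<circ> inv_into U \<phi>) (at (\<phi> q)) \<noteq> (\<lambda>_. 0)"
    if ch: "(U, \<phi>) \<in> S" and q: "q \<in> U" "q \<in> P ` V" "q \<in> D" for U \<phi> q
  proof
    assume 0: "frechet_derivative ((\<lambda>q. s (inv_into V P q)) \<circ> inv_into U \<phi>) (at (\<phi> q)) = (\<lambda>_. 0)"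
    obtain z where z: "z \<in> V" "q = P z" using q by blast
    have "s z = 0" using D q z by simp
    then obtain d where d: "s = (\<lambda>z. z $ d)" using s by (auto simp: coord_or_one_def)
    have U: "par S (\<phi> ` U) (inv_into U \<phi>)" by (rule chart_par[OF S ch])
    have iq: "inv_into U \<phi> (\<phi> q) = q" using is_atlas_inj[OF S ch] q by simp
    have "fac P z (inv_into U \<phi>) (\<phi> ` U)"
      by (rule par_fac[OF S P U z(1), where z'="\<phi> q"]) (use q iq z in auto)
    then obtain W \<tau> where W: "open W" "z \<in> W" "\<forall>y\<in>W. \<tau> y \<in> \<phi> ` U \<and> P y = inv_into U \<phi> (\<tau> y) \<and> cdv \<tau> y"
      unfolding fac_def by (elim exE conjE) (rule that)
    have tz: "\<tau> z = \<phi> q" using W z iq is_atlas_inj[OF S ch] by (metis f_inv_into_f)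
    let ?g = "(\<lambda>q. s (inv_into V P q)) \<circ> inv_into U \<phi>"
    have g: "cdiff ?g (\<tau> z)"
      using holo_fun_cdiff[OF S h U, of "\<phi> q"] q iq tz by (simp add: comp_def)
    have "frechet_derivative s (at z) = frechet_derivative ?g (at (\<tau> z)) \<circ> frechet_derivative \<tau> (at z)"
    proof (rule frechet_cdiff_compose[where W="W \<inter> V" and \<tau>=\<tau> and g="?g" and x=z, OF _ g])
      show "cdv \<tau> z" using W by blast
      show "open (W \<inter> V)" "z \<in> W \<inter> V" using W par_open[OF P] z by auto
      fix y assume y: "y \<in> W \<inter> V"
      then have "inv_into U \<phi> (\<tau> y) = P y" using W(3) by simp
      then show "s y = ?g (\<tau> y)" using inv y by simp
    qed
    then have "frechet_derivative s (at z) = (\<lambda>_. 0)" using 0 tz by (simp add: comp_def)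
    moreover have "frechet_derivative s (at z) = s"
      unfolding d by (rule frechet_derivative_at[symmetric]) (auto intro!: bounded_linear_vec_nth bounded_linear_imp_has_derivative)
    ultimately have "(axis d 1 :: complex^2) $ d = 0" using d by metis
    then show False by simp
  qed
  show ?thesis unfolding local_equation_def using h D inv fr by auto
qed

lemma local_parameter_chart:
  fixes z :: "complex^2"
  assumes P: "lpar S V P" and z: "z \<in> V" "z $ e = 0" and C: "\<And>z. z \<in> V ==> z $ e = 0 ==> P z \<in> C" and oe: "ax \<noteq> e"
  shows "local_parameter S C (P z) (\<lambda>t. P (z + t *s axis ax 1))"
proof -
  from lparD[OF P] obtain U \<phi> where U: "(U, \<phi>) \<in> S" "P ` V \<subseteq> U" "\<forall>z\<in>V. \<phi> (P z) = z" "open V"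
    by (elim exE conjE) (rule that)
  let ?k = "\<lambda>t::complex. z + t *s axis ax 1"
  let ?T = "?k -` V"
  have T: "open ?T" by (rule open_axis_vimage[OF U(4)])
  have nth: "?k t $ i = z $ i + t * (if i = ax then 1 else 0)" for t i by (auto simp: axis_def)
  have C': "P (?k t) \<in> C" if "t \<in> ?T" for t
    using C[of "?k t"] that z(2) oe nth[of t e] by auto
  have h: "(\<lambda>t. \<phi> (P (?k t)) $ i) holomorphic_on ?T" for i
    by (rule holomorphic_transform[of "\<lambda>t. z $ i + t * (if i = ax then 1 else 0)"])
      (use U(3) in "auto intro!: holomorphic_intros simp: axis_def")
  have 0: "0 \<in> ?T" using z by simp
  have ev: "\<forall>\<^sub>F t in nhds 0. \<phi> (P (?k t)) $ ax = z $ ax + t"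
    using T 0 U(3) nth by (auto simp: eventually_nhds intro!: exI[of _ ?T])
  have "deriv (\<lambda>t. \<phi> (P (?k t)) $ ax) 0 = deriv (\<lambda>t. z $ ax + t) 0"
    by (rule deriv_cong_ev[OF ev]) simp
  also have "\<dots> = 1" by (rule DERIV_imp_deriv) (auto intro!: derivative_eq_intros)
  finally have d: "deriv (\<lambda>t. \<phi> (P (?k t)) $ ax) 0 \<noteq> 0" by simp
  show ?thesis unfolding local_parameter_def
    by (intro conjI, simp, rule bexI[OF _ U(1)], unfold prod.case, rule exI[of _ ?T], intro conjI allI T 0 h exI[of _ ax] d)
      (use C' U(2) in auto)
qed

text \<open>The charts \<open>P j\<close> cover \<open>C\<close>, which is a coordinate axis in each of them; the section of \<open>O(D)\<close> is
  the power \<open>m j\<close> of the coordinate along that axis.\<close>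

lemma intersection_numberI:
  fixes S :: "('a, 2) atlas" and P :: "'j \<Rightarrow> complex^2 \<Rightarrow> 'a" and m :: "'j \<Rightarrow> int" and e ax :: "'j \<Rightarrow> 2"
  assumes S: "is_atlas S" and fin: "finite J" and P: "\<And>j. j \<in> J ==> lpar S (V j) (P j)"
    and cov: "C \<subseteq> (\<Union>j\<in>J. P j ` V j)"
    and C: "\<And>j z. j \<in> J ==> z \<in> V j ==> P j z \<in> C \<longleftrightarrow> z $ e j = 0"
    and oe: "\<And>j. j \<in> J ==> ax j \<noteq> e j"
    and D: "\<And>j z. j \<in> J ==> z \<in> V j ==> P j z \<in> D \<longleftrightarrow> s j z = 0"
    and s: "\<And>j. j \<in> J ==> coord_or_one (s j)"
    and m0: "\<And>j. j \<in> J ==> m j \<noteq> 0 ==> 0 \<in> V j \<and> (\<forall>i\<in>J. P j 0 \<in> P i ` V i \<longrightarrow> i = j)"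
    and g: "\<And>i j z z'. i \<in> J ==> j \<in> J ==> i \<noteq> j ==> z \<in> V i ==> z' \<in> V j ==> P i z = P j z' ==>
      cocycle (g i j) (s i) (s j) (e i) (ax i) (ax j) (m i) (m j) z z'"
  shows "has_intersection_number S C D (\<Sum>j\<in>J. m j)"
proof -
  have inv: "inv_into (V j) (P j) (P j z) = z" if "j \<in> J" "z \<in> V j" for j z
    using lpar_inj[OF P[OF that(1)]] that by simp
  note par = lpar_par[OF P]
  \<comment> \<open>Each point of C is assigned one chart containing it, so the family indexed by
    points is a finite family of charts in disguise.\<close>
  define ix where "ix p = (SOME j. j \<in> J \<and> p \<in> P j ` V j)" for p
  have ix: "ix p \<in> J \<and> p \<in> P (ix p) ` V (ix p)" if "p \<in> C" for p
    unfolding ix_def by (rule someI_ex) (use cov that in blast)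
  define c where "c j = inv_into (V j) (P j)" for j
  have c: "c j (P j z) = z" if "j \<in> J" "z \<in> V j" for j z using inv[OF that] by (simp add: c_def)
  have ixc: "c (ix p) p \<in> V (ix p)" "P (ix p) (c (ix p) p) = p" if "p \<in> C" for p
    using ix[OF that] unfolding c_def by (auto intro: inv_into_into f_inv_into_f)
  define Vp where "Vp p = P (ix p) ` V (ix p)" for p
  define sp where "sp p q = s (ix p) (c (ix p) q)" for p q
  define \<sigma> where "\<sigma> p q = (c (ix p) q $ ax (ix p)) powi m (ix p)" for p q
  define \<kappa> where "\<kappa> p t = P (ix p) (c (ix p) p + t *s axis (ax (ix p)) 1)" for p t
  \<comment> \<open>Zeros and poles of the section can lie only at the origins of charts with m j
    \<noteq> 0. By \<open>m0\<close> such an origin lies in no other chart of the family, so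
    \<open>ix\<close> returns j there and each order is counted once.\<close>
  define J' where "J' = {j \<in> J. m j \<noteq> 0}"
  define Q where "Q = (\<lambda>j. P j 0) ` J'"
  have Q0: "P j 0 \<in> C" "ix (P j 0) = j" "c j (P j 0) = 0" if "j \<in> J'" for j
  proof -
    have j: "j \<in> J" "0 \<in> V j" "\<And>i. i \<in> J ==> P j 0 \<in> P i ` V i ==> i = j"
      using m0[of j] that by (auto simp: J'_def)
    show C0: "P j 0 \<in> C" using C[OF j(1,2)] by simp
    show "ix (P j 0) = j" using ix[OF C0] j(3) by blast
    show "c j (P j 0) = 0" using c j by simp
  qed
  have ce: "c (ix p) p $ e (ix p) = 0" if "p \<in> C" for p
    using C[of "ix p" "c (ix p) p"] ix[OF that] ixc[OF that] that by simp
  have sk: "\<forall>\<^sub>F t in nhds 0. (\<sigma> p \<circ> \<kappa> p) t = (c (ix p) p $ ax (ix p) + t) powi m (ix p)" if p: "p \<in> C" for p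
  proof -
    let ?k = "\<lambda>t::complex. c (ix p) p + t *s axis (ax (ix p)) 1"
    have o: "open (V (ix p))" using par_open[OF par] ix[OF p] by blast
    have T: "open (?k -` V (ix p))" by (rule open_axis_vimage[OF o])
    show ?thesis
      unfolding eventually_nhds
      by (rule exI[of _ "?k -` V (ix p)"], intro conjI T)
        (use ixc[OF p] ix[OF p] in "auto simp: \<sigma>_def \<kappa>_def c")
  qed
  \<comment> \<open>On C the transversal coordinate is 0; if the coordinate along C vanished too,
    the point would be the origin of its chart.\<close>
  have pQ: "m (ix p) = 0 \<or> c (ix p) p $ ax (ix p) \<noteq> 0" if p: "p \<in> C" "p \<notin> Q" for p
  proof (rule ccontr)
    assume a: "\<not> ?thesis"
    have "c (ix p) p $ k = 0" for k
      using a ce[OF p(1)] oe[of "ix p"] ix[OF p(1)] exhaust_2[of k] exhaust_2[of "e (ix p)"] exhaust_2[of "ax (ix p)"] by auto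
    then have "c (ix p) p = 0" by (simp add: vec_eq_iff)
    then have "p = P (ix p) 0" using ixc[OF p(1)] by simp
    then show False using p(2) a ix[OF p(1)] unfolding Q_def J'_def by blast
  qed
  have mer: "(\<sigma> p \<circ> \<kappa> p) meromorphic_on {0}" if p: "p \<in> C" for p
  proof -
    have "(\<lambda>t. (c (ix p) p $ ax (ix p) + t) powi m (ix p)) meromorphic_on {0}"
      by (intro meromorphic_intros)
    then show ?thesis
      by (rule meromorphic_on_cong[THEN iffD1, rotated 2])
        (use sk[OF p] in "auto simp: eventually_at_filter elim: eventually_mono")
  qed
  have ana: "(\<sigma> p \<circ> \<kappa> p) analytic_on {0}" if p: "p \<in> C" "p \<notin> Q" for p
  proof -
    have "(\<lambda>t. (c (ix p) p $ ax (ix p) + t) powi m (ix p)) analytic_on {0}"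
      using pQ[OF p] by (auto intro!: analytic_intros)
    then show ?thesis
      using analytic_at_cong[OF sk[OF p(1)] refl] by blast
  qed
  have nz: "\<sigma> p q \<noteq> 0" if p: "p \<in> C" and q: "q \<in> Vp p" "q \<in> C" "q \<notin> Q" for p q
  proof -
    obtain z where z: "z \<in> V (ix p)" "q = P (ix p) z" using q by (auto simp: Vp_def)
    have i: "ix p \<in> J" using ix[OF p] by simp
    have e0: "z $ e (ix p) = 0" using C[OF i z(1)] q z by simp
    have "m (ix p) = 0 \<or> z $ ax (ix p) \<noteq> 0"
    proof (rule ccontr)
      assume a: "\<not> ?thesis"
      have "z $ k = 0" for k
        using a e0 oe[OF i] exhaust_2[of k] exhaust_2[of "e (ix p)"] exhaust_2[of "ax (ix p)"] by auto
      then have "z = 0" by (simp add: vec_eq_iff)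
      then show False using q(3) a i z(2) unfolding Q_def J'_def by blast
    qed
    then show ?thesis using c[OF i z(1)] z(2) by (auto simp: \<sigma>_def)
  qed
  have glue: "\<exists>g. holo_fun S (Vp p \<inter> Vp p') g \<and> (\<forall>q\<in>Vp p \<inter> Vp p'. sp p q = g q * sp p' q) \<and>
     (\<forall>q\<in>Vp p \<inter> Vp p' \<inter> C - Q. \<sigma> p q = g q * \<sigma> p' q)" if p: "p \<in> C" "p' \<in> C" for p p'
  proof -
    let ?i = "ix p" and ?j = "ix p'"
    have ij: "?i \<in> J" "?j \<in> J" using ix p by auto
    have op: "openin (mtop S) (Vp p \<inter> Vp p')"
      unfolding Vp_def by (intro openin_Int openin_par_image[OF S] par ij)
    show ?thesis
    proof (cases "?i = ?j")
      case True
      show ?thesis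
        by (rule exI[of _ "\<lambda>_. 1"]) (use op True in "auto simp: holo_fun_const[OF S] sp_def \<sigma>_def")
    next
      case False
      let ?g = "\<lambda>q. g ?i ?j (c ?i q)"
      have gg: "cdiff (g ?i ?j) z \<and> s ?i z = g ?i ?j z * s ?j (c ?j (P ?i z)) \<and>
          (z $ e ?i = 0 \<longrightarrow> (z $ ax ?i) powi m ?i = g ?i ?j z * (c ?j (P ?i z) $ ax ?j) powi m ?j)"
        if z: "z \<in> V ?i" "P ?i z \<in> Vp p'" for z
      proof -
        obtain z' where z': "z' \<in> V ?j" "P ?i z = P ?j z'" using z(2) by (auto simp: Vp_def)
        show ?thesis using g[OF ij False z(1) z'] z' c[OF ij(2) z'(1)] by (simp add: cocycle_def)
      qed
      show ?thesis
      proof (rule exI[of _ ?g], intro conjI ballI)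
        show "holo_fun S (Vp p \<inter> Vp p') ?g"
        proof (rule holo_funI[OF S op])
          fix q assume q: "q \<in> Vp p \<inter> Vp p'"
          then obtain z where z: "z \<in> V ?i" "q = P ?i z" by (auto simp: Vp_def)
          have "cdiff (g ?i ?j) z" using gg z q by blast
          then have "cdiff (\<lambda>y. g ?i ?j (c ?i (P ?i y))) z"
            by (rule cdiff_cong[OF _ par_open[OF par[OF ij(1)]] z(1)]) (simp add: c ij)
          then show "\<exists>V' P' z. par S V' P' \<and> z \<in> V' \<and> P' z = q \<and> cdiff (\<lambda>y. ?g (P' y)) z"
            using par[OF ij(1)] z by blast
        qed
      next
        fix q assume q: "q \<in> Vp p \<inter> Vp p'"
        then obtain z where z: "z \<in> V ?i" "q = P ?i z" by (auto simp: Vp_def)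
        show "sp p q = ?g q * sp p' q"
          using gg[OF z(1)] z q c[OF ij(1) z(1)] by (simp add: sp_def)
      next
        fix q assume q: "q \<in> Vp p \<inter> Vp p' \<inter> C - Q"
        then obtain z where z: "z \<in> V ?i" "q = P ?i z" by (auto simp: Vp_def)
        have "z $ e ?i = 0" using C[OF ij(1) z(1)] q z by simp
        then show "\<sigma> p q = ?g q * \<sigma> p' q"
          using gg[OF z(1)] z q c[OF ij(1) z(1)] by (simp add: \<sigma>_def)
      qed
    qed
  qed
  have injQ: "inj_on (\<lambda>j. P j 0) J'"
    by (rule inj_onI) (metis Q0(2))
  have ord: "zorder (\<sigma> (P j 0) \<circ> \<kappa> (P j 0)) 0 = m j" if j: "j \<in> J'" for j
  proof -
    have j': "P j 0 \<in> C" "ix (P j 0) = j" "c j (P j 0) = 0" using Q0[OF j] by simp_all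
    have "zorder (\<sigma> (P j 0) \<circ> \<kappa> (P j 0)) 0 = zorder (\<lambda>t. (t :: complex) powi m j) 0"
      by (rule zorder_cong) (use sk[OF j'(1)] j' in "auto simp: eventually_at_filter elim: eventually_mono")
    also have "\<dots> = m j"
      by (rule zorder_eqI[where S=UNIV and g="\<lambda>_. 1"]) auto
    finally show ?thesis .
  qed
  have sum: "(\<Sum>j\<in>J. m j) = (\<Sum>p\<in>Q. zorder (\<sigma> p \<circ> \<kappa> p) 0)"
  proof -
    have "(\<Sum>p\<in>Q. zorder (\<sigma> p \<circ> \<kappa> p) 0) = (\<Sum>j\<in>J'. m j)"
      unfolding Q_def by (subst sum.reindex[OF injQ]) (simp add: ord)
    also have "\<dots> = (\<Sum>j\<in>J. m j)"
      by (rule sum.mono_neutral_left) (use fin in "auto simp: J'_def")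
    finally show ?thesis by simp
  qed
  have le: "local_equation S D (Vp p) (sp p)" if p: "p \<in> C" for p
  proof -
    have "sp p = (\<lambda>q. s (ix p) (inv_into (V (ix p)) (P (ix p)) q))" by (simp add: fun_eq_iff sp_def c_def)
    then show ?thesis using local_equation_chart[OF S par D s, of "ix p"] ix[OF p] by (simp add: Vp_def)
  qed
  have lp: "local_parameter S C p (\<kappa> p)" if p: "p \<in> C" for p
  proof -
    have "\<kappa> p = (\<lambda>t. P (ix p) (c (ix p) p + t *s axis (ax (ix p)) 1))" by (simp add: fun_eq_iff \<kappa>_def)
    then show ?thesis
      using local_parameter_chart[OF P ixc(1)[OF p] ce[OF p] _ oe, of C] ix[OF p] C ixc(2)[OF p] by simp
  qed
  show ?thesis unfolding has_intersection_number_def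
  proof (rule exI[of _ Q], rule exI[of _ Vp], rule exI[of _ sp], rule exI[of _ \<kappa>], rule exI[of _ \<sigma>], intro conjI ballI impI)
    show "finite Q" "Q \<subseteq> C" using fin Q0 by (auto simp: Q_def J'_def)
    show "p \<in> Vp p" if "p \<in> C" for p using ix that by (simp add: Vp_def)
  qed (use le lp mer ana nz glue sum in "simp_all")
qed

section \<open>The boundary curves: the line at infinity and the exceptional curves\<close>

definition Lc :: "surface_point set" where
  "Lc = {p. fst p \<in> Linf \<and> snd p = (if fst p \<in> ctr ` Br then [pline (vector [1, 0])] else [])}"

text \<open>The k-th exceptional curve over (a, 0) after the next blow-up: its point (0, 1), the
  next centre, is replaced by the point in direction (1, 0) of the following curve.\<close>

definition Ec :: "complex \<Rightarrow> nat \<Rightarrow> surface_point set" where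
  "Ec a k = insert (exc a (Suc k) (pline (vector [1, 0])))
     (exc a k ` (plines - {pline (vector [0, 1])}))"

lemma pline2_eq: "pline (vector [1, w] :: complex^2) = pline (vector [u, v]) \<longleftrightarrow> u \<noteq> 0 \<and> v = w * u"
proof
  assume "pline (vector [1, w] :: complex^2) = pline (vector [u, v])"
  from pline_eqD[OF this] obtain c where "vector [1, w] = c *s (vector [u, v] :: complex^2)" by blast
  then show "u \<noteq> 0 \<and> v = w * u" by (auto simp: vec_eq_iff forall_2)
next
  assume "u \<noteq> 0 \<and> v = w * u"
  then show "pline (vector [1, w] :: complex^2) = pline (vector [u, v])"
    by (intro pline_eqI[of "1 / u"]) (auto simp: vec_eq_iff forall_2)
qed

lemma pline2_False: "pline (vector [u, 1] :: complex^2) = pline (vector [1, 0]) \<longleftrightarrow> False"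
  "pline (vector [u, 1] :: complex^2) = pline (vector [0, 1]) \<longleftrightarrow> u = 0"
proof -
  show "pline (vector [u, 1] :: complex^2) = pline (vector [1, 0]) \<longleftrightarrow> False"
    using pline2_eq[of 0 u 1] by (metis mult_zero_left zero_neq_one)
  show "pline (vector [u, 1] :: complex^2) = pline (vector [0, 1]) \<longleftrightarrow> u = 0"
    using pline2_eq[of "1 / u" u 1] pline2_eq[of "1 / u" 0 1] by (cases "u = 0") auto
qed

lemma pline_vec2_plines: "pline (vector [1, w]) \<in> plines" "pline (vector [w, 1]) \<in> plines"
  using bdir_plines[of True "vector [0, w]"] bdir_plines[of False "vector [w, 0]"] by (simp_all add: bdir_def)

text \<open>The line v = 0 leaves a centre in the direction (1, 0). Hence it meets only the charts
  of the first blow-ups, there along z $ 2 = 0.\<close>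

lemma mem_Lc_Bp:
  assumes b: "b \<in> Br" and z: "z \<in> BV b m"
  shows "Bp b m z \<in> Lc \<longleftrightarrow> m = 0 \<and> z $ 2 = 0"
proof (cases "z $ 1 = 0")
  case True
  have "ctr b \<in> Linf" unfolding ctr_def Linf_Y by simp
  then show ?thesis using True b by (cases m) (auto simp: Bp_eq Lc_def exc_def pline2_eq)
next
  case False
  show ?thesis
  proof (cases "m = 0 \<or> z $ 2 \<noteq> 0")
    case True
    let ?p = "pline (vector [b + z $ 1 * (z $ 1 * z $ 2) ^ m, 1, z $ 1 * z $ 2]) :: (complex^3) set"
    have p: "Bp b m z = (?p, [])" using True False by (simp add: Bp_eq)
    have "?p \<notin> ctr ` Br" if "z $ 2 = 0"
    proof -
      have "m = 0" "b + z $ 1 \<notin> Br" using that True z False by (auto simp: BV_0 CV.simps)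
      then show ?thesis using that by (auto simp: ctr_def pline_Y_eq)
    qed
    then show ?thesis unfolding p Lc_def using True False by (auto simp: Linf_Y)
  next
    case F: False
    have "Bp b m z = exc b m (pline (vector [z $ 1, 1]))" using F False by (simp add: Bp_eq)
    then show ?thesis using F b by (cases m) (auto simp: Lc_def exc_def pline2_False)
  qed
qed

text \<open>The curve is visible in two charts: as the exceptional axis z $ 1 = 0 of the blow-up
  that creates it, and as the axis z $ 2 = 0, its proper transform, in the chart of the next
  blow-up.\<close>

lemma mem_Ec_Bp:
  assumes k: "1 \<le> k"
  shows "Bp b m z \<in> Ec a k \<longleftrightarrow> b = a \<and> (Suc m = k \<and> z $ 1 = 0 \<or> m = k \<and> z $ 2 = 0)"
proof (cases "z $ 1 = 0")
  case True
  have "pline (vector [1, z $ 2]) \<in> plines - {pline (vector [0, 1] :: complex^2)}"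
    using pline_vec2_plines pline2_ne by blast
  then show ?thesis using True k by (auto simp: Bp_eq Ec_def exc_eq pline2_eq image_iff)
next
  case False
  show ?thesis
  proof (cases "m = 0 \<or> z $ 2 \<noteq> 0")
    case True
    then show ?thesis using True False k by (auto simp: Bp_eq Ec_def exc_def)
  next
    case F: False
    have "pline (vector [z $ 1, 1]) \<in> plines - {pline (vector [0, 1] :: complex^2)}"
      using pline_vec2_plines False by (auto simp: pline2_False)
    moreover have "Bp b m z = exc b m (pline (vector [z $ 1, 1]))" using F False by (simp add: Bp_eq)
    ultimately show ?thesis using F False k by (auto simp: Ec_def exc_eq pline2_False image_iff)
  qed
qed

lemma mem_Lc_Xp:
  assumes "z \<in> XV"
  shows "Xp z \<in> Lc \<longleftrightarrow> z $ 2 = 0"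
proof -
  have "pline (vector [1, z $ 1, z $ 2]) \<notin> ctr ` Br" if "z $ 2 = 0"
  proof
    assume "pline (vector [1, z $ 1, z $ 2] :: complex^3) \<in> ctr ` Br"
    then obtain b where b: "b \<in> Br" "pline (vector [b, 1, 0] :: complex^3) = pline (vector [1, z $ 1, z $ 2])"
      by (auto simp: ctr_def)
    then show False using assms that by (auto simp: pline_X_eq Br_def XV_def)
  qed
  then show ?thesis by (auto simp: Xp_def Lc_def Linf_X)
qed

lemma mem_Ec_Xp: "1 \<le> k ==> Xp z \<notin> Ec a k"
  by (auto simp: Xp_def Ec_def exc_def)

lemma mem_Zp: "Zp z \<notin> Lc" "1 \<le> k ==> Zp z \<notin> Ec a k"
  by (auto simp: Zp_def Ec_def Lc_def exc_def Linf_Z)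

text \<open>The chart \<open>Cp\<close> of level m meets only the m-th exceptional curve of its
  tower, and of this curve just the part away from the direction (1, 0).\<close>

lemma mem_Cp:
  assumes b: "b \<in> Br" and m: "1 \<le> m" "k < m \<or> b \<noteq> a" "1 \<le> k"
  shows "Cp b m z \<notin> Lc" "Cp b m z \<notin> Ec a k"
proof -
  show "Cp b m z \<notin> Lc"
  proof (cases "z $ 2 = 0")
    case True
    then show ?thesis using m by (cases m) (auto simp: Cp_eq Lc_def exc_def pline2_False simp del: Cp.simps)
  next
    case False
    then show ?thesis using m by (auto simp: Cp_eq Lc_def Linf_Y)
  qed
  show "Cp b m z \<notin> Ec a k"
  proof (cases "z $ 2 = 0")
    case True
    then show ?thesis using m by (auto simp: Cp_eq Ec_def exc_eq pline2_False)
  next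
    case False
    then show ?thesis using m by (auto simp: Cp_eq Ec_def exc_def)
  qed
qed

lemma Lc_cases:
  assumes "p \<in> Lc"
  obtains (X) z where "z \<in> XV" "p = Xp z" | (B) b z where "b \<in> Br" "z \<in> BV b 0" "p = Bp b 0 z" "z $ 2 = 0"
proof -
  from assms obtain v where v: "v \<noteq> 0" "v $ 3 = 0" "fst p = pline v" by (auto simp: Lc_def Linf_def)
  from v(1) show ?thesis
  proof (cases rule: P2_cases)
    case (Z z)
    then show ?thesis using v Linf_iff[OF v(1)] Linf_Z by metis
  next
    case X
    have "ctr b \<noteq> pline (vector [1, 0, 0])" for b
      unfolding ctr_def by (auto simp: pline_X_eq)
    then have "p = Xp 0" using X v assms by (intro prod_eqI) (auto simp: Xp_def Lc_def)
    then show ?thesis using that(1)[of 0] by (simp add: XV_def)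
  next
    case (Y a z)
    have p: "fst p = pline (vector [a + z $ 1, 1, 0])" using v Y by simp
    show ?thesis
    proof (cases "a + z $ 1 \<in> Br")
      case True
      then have "p = Bp (a + z $ 1) 0 0" using p assms
        by (intro prod_eqI) (auto simp: Lc_def Bp_eq exc_def ctr_def)
      then show ?thesis using that(2)[of "a + z $ 1" 0] True zero_CV by (simp add: BV_0)
    next
      case False
      have "pline (vector [a + z $ 1, 1, 0]) \<notin> ctr ` Br" using False by (auto simp: ctr_def pline_Y_eq)
      moreover have "z $ 1 \<noteq> 0" using False Y(1) by auto
      ultimately have "p = Bp a 0 z" using p assms Y
        by (intro prod_eqI) (auto simp: Lc_def Bp_eq)
      then show ?thesis using that(2)[of a z] Y by (simp add: BV_0)
    qed
  qed
qed

lemma Ec_cases: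
  assumes "p \<in> Ec a k" "1 \<le> k"
  obtains (A) w where "p = Bp a (k - 1) (vector [0, w])" | (B) s where "p = Bp a k (vector [s, 0])"
proof -
  from assms(1) consider "p = exc a (Suc k) (pline (vector [1, 0]))" |
    l where "l \<in> plines" "l \<noteq> pline (vector [0, 1])" "p = exc a k l" by (auto simp: Ec_def)
  then show ?thesis
  proof cases
    case 1
    then show ?thesis using that(2)[of 0] by (simp add: Bp_eq)
  next
    case 2
    then obtain b w where l: "l = pl b w" using plines_pl by blast
    show ?thesis
    proof (cases b)
      case True
      then show ?thesis using that(1)[of w] 2 l assms(2) by (simp add: Bp_eq pl_def)
    next
      case False
      then have "w \<noteq> 0" using 2 l by (auto simp: pl_def)
      then show ?thesis using that(2)[of w] 2 l assms(2) False by (simp add: Bp_eq pl_def)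
    qed
  qed
qed

context brn begin

lemma lpar_B: "a \<in> Br ==> k < n a ==> lpar (Surf n) (BV a k) (Bp a k)"
  by (rule lpar_Surf) (auto simp: Surf_def BC_def open_BV Bp_inj)

lemma lpar_X: "lpar (Surf n) XV Xp"
  by (rule lpar_Surf) (auto simp: Surf_def open_XV par_inj[OF par_X])

lemma rational_Ec:
  assumes a: "a \<in> Br" and k: "1 \<le> k" "k < n a"
  shows "smooth_rational_curve (Surf n) (Ec a k)"
proof -
  \<comment> \<open>The line (0, 1) is the next centre; the next blow-up moves this point of the
    curve to the following level.\<close>
  define \<gamma> where "\<gamma> l = (if l = pline (vector [0, 1]) then exc a (Suc k) (pline (vector [1, 0])) else exc a k l)"
    for l :: "(complex^2) set"
  have im: "\<gamma> ` plines = Ec a k"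
    using pline_vec2_plines(2)[of 0] by (auto simp: \<gamma>_def Ec_def)
  have inj: "inj_on \<gamma> plines"
    using k by (auto simp: inj_on_def \<gamma>_def exc_eq split: if_splits)
  have T: "\<gamma> (pl True w) = Bp a (k - 1) (vector [0, w])" for w
    using k pline2_ne by (simp add: \<gamma>_def pl_def Bp_eq)
  have F: "\<gamma> (pl False w) = Bp a k (vector [w, 0])" for w
    using k by (simp add: \<gamma>_def pl_def Bp_eq pline2_False)
  have v: "vector [0, w] + (w' - w) *s axis 2 1 = (vector [0, w'] :: complex^2)"
    "vector [w, 0] + (w' - w) *s axis 1 1 = (vector [w', 0] :: complex^2)" for w w'
    by (simp_all add: vec_eq_iff forall_2 axis_def)
  have BV: "vector [0, w] \<in> BV a (k - 1)" "BV a k = UNIV" for w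
    using BV_Suc[of a "k - 1"] BV_Suc[of a "k - 2"] k
    by (cases "k = 1"; simp add: BV_0 CV.simps numeral_2_eq_2 Suc_diff_Suc)+
  have "smooth_rational_curve (Surf n) (\<gamma> ` plines)"
  proof (rule rational_curveI[OF at inj])
    fix p :: "(complex^2) set"
    assume "p \<in> plines"
    then obtain b w where p: "p = pl b w" using plines_pl by blast
    show "\<exists>V P A i b w W. par (Surf n) V P \<and> p = pl b w \<and> open W \<and> w \<in> W \<and>
      (\<forall>w'\<in>W. A + (w' - w) *s axis i 1 \<in> V \<and> \<gamma> (pl b w') = P (A + (w' - w) *s axis (i::2) 1))"
    proof (cases b)
      case True
      show ?thesis
        by (rule exI[of _ "BV a (k - 1)"], rule exI[of _ "Bp a (k - 1)"], rule exI[of _ "vector [0, w]"], rule exI[of _ 2],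
            rule exI[of _ True], rule exI[of _ w], rule exI[of _ UNIV], unfold v T)
          (use par_B[OF a, of "k - 1"] k p True BV in auto)
    next
      case False
      show ?thesis
        by (rule exI[of _ "BV a k"], rule exI[of _ "Bp a k"], rule exI[of _ "vector [w, 0]"], rule exI[of _ 1],
            rule exI[of _ False], rule exI[of _ w], rule exI[of _ UNIV], unfold v F)
          (use par_B[OF a, of k] k p False BV in auto)
    qed
  qed
  then show ?thesis by (simp add: im)
qed

lemma rational_Lc:
  assumes pos: "\<And>a. a \<in> Br ==> 1 \<le> n a"
  shows "smooth_rational_curve (Surf n) Lc"
proof -
  define em where "em l = pline (vector [rep l $ 1, rep l $ 2, 0] :: complex^3)" for l :: "(complex^2) set"
  define \<gamma> where "\<gamma> l = (em l, if em l \<in> ctr ` Br then [pline (vector [1, 0] :: complex^2)] else [])" for l :: "(complex^2) set"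
  have em: "em (pline v) = pline (vector [v $ 1, v $ 2, 0])" if v: "v \<noteq> 0" for v :: "complex^2"
  proof -
    from rep_pline(1)[OF v] obtain c where c: "c \<noteq> 0" "rep (pline v) = c *s v" by blast
    have "vector [rep (pline v) $ 1, rep (pline v) $ 2, 0] = c *s (vector [v $ 1, v $ 2, 0] :: complex^3)"
      by (simp add: c vec_eq_iff forall_3)
    then show ?thesis unfolding em_def using c(1) by (simp add: pline_scale)
  qed
  have vnz: "(vector [v $ 1, v $ 2, 0] :: complex^3) \<noteq> 0" if "v \<noteq> 0" for v :: "complex^2"
    using that by (auto simp: vec_eq_iff forall_2 forall_3)
  have Lem: "em (pline v) \<in> Linf" if "v \<noteq> 0" for v
    unfolding em[OF that] Linf_iff[OF vnz[OF that]] by simp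
  have im: "\<gamma> ` plines = Lc"
  proof
    show "\<gamma> ` plines \<subseteq> Lc" using Lem by (auto simp: \<gamma>_def Lc_def)
    show "Lc \<subseteq> \<gamma> ` plines"
    proof
      fix p assume p: "p \<in> Lc"
      then obtain v where v: "v \<noteq> 0" "v $ 3 = 0" "fst p = pline v" by (auto simp: Lc_def Linf_def)
      let ?v = "vector [v $ 1, v $ 2] :: complex^2"
      have v0: "?v \<noteq> 0" using v by (auto simp: vec_eq_iff forall_2 forall_3)
      have "v = vector [v $ 1, v $ 2, 0]" using v by (simp add: vec_eq_iff forall_3)
      then have "em (pline ?v) = fst p" using em[OF v0] v by simp
      then have "p = \<gamma> (pline ?v)" using p by (intro prod_eqI) (auto simp: \<gamma>_def Lc_def)
      then show "p \<in> \<gamma> ` plines" using v0 by blast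
    qed
  qed
  have inj: "inj_on \<gamma> plines"
  proof (rule inj_onI)
    fix l l' :: "(complex^2) set" assume l: "l \<in> plines" "l' \<in> plines" "\<gamma> l = \<gamma> l'"
    then obtain v v' where v: "v \<noteq> 0" "l = pline v" "v' \<noteq> 0" "l' = pline v'" by blast
    then have "pline (vector [v $ 1, v $ 2, 0] :: complex^3) = pline (vector [v' $ 1, v' $ 2, 0])"
      using l(3) em by (simp add: \<gamma>_def)
    from pline_eqD[OF this] obtain c where c: "vector [v $ 1, v $ 2, 0] = c *s (vector [v' $ 1, v' $ 2, 0] :: complex^3)"
      by blast
    then have vv: "v = c *s v'" by (auto simp: vec_eq_iff forall_2 forall_3)
    then have "c \<noteq> 0" using v by auto
    then show "l = l'" using v vv by (metis pline_scale)
  qed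
  have nz: "(vector [1, w] :: complex^2) \<noteq> 0" "(vector [w, 1] :: complex^2) \<noteq> 0" for w
    by (auto simp: vec_eq_iff forall_2)
  have T: "\<gamma> (pl True w) = Xp (vector [w, 0]) \<and> vector [w, 0] \<in> XV" if "w \<noteq> 1" "w \<noteq> -1" for w
  proof -
    have V: "vector [w, 0] \<in> XV" using that by (simp add: XV_def)
    have L: "Xp (vector [w, 0]) \<in> Lc" using mem_Lc_Xp[OF V] by simp
    have "fst (Xp (vector [w, 0])) = em (pl True w)" unfolding pl_def using em[OF nz(1)] by (simp add: Xp_def)
    then show ?thesis using L V by (auto simp: \<gamma>_def Lc_def Xp_def)
  qed
  have F: "\<gamma> (pl False w) = Bp b 0 (vector [w - b, 0]) \<and> vector [w - b, 0] \<in> BV b 0"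
    if "b \<in> Br" "w \<notin> Br \<or> w = b" for w b
  proof -
    have V: "vector [w - b, 0] \<in> BV b 0" using that by (auto simp: BV_0 CV.simps)
    have L: "Bp b 0 (vector [w - b, 0]) \<in> Lc" using mem_Lc_Bp[OF that(1) V] by simp
    have "fst (Bp b 0 (vector [w - b, 0])) = em (pl False w)" unfolding pl_def using em[OF nz(2)] by (simp add: fst_Bp)
    then have "Bp b 0 (vector [w - b, 0]) = \<gamma> (pl False w)"
      using L by (intro prod_eqI) (auto simp: \<gamma>_def Lc_def)
    then show ?thesis using V by simp
  qed
  have v: "vector [w - b, 0] + (w' - w) *s axis 1 1 = (vector [w' - b, 0] :: complex^2)"
    "vector [w, 0] + (w' - w) *s axis 1 1 = (vector [w', 0] :: complex^2)" for w w' b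
    by (simp_all add: vec_eq_iff forall_2 axis_def)
  have "smooth_rational_curve (Surf n) (\<gamma> ` plines)"
  proof (rule rational_curveI[OF at inj])
    fix p :: "(complex^2) set"
    assume "p \<in> plines"
    then obtain b w where p: "p = pl b w" using plines_pl by blast
    show "\<exists>V P A i b w W. par (Surf n) V P \<and> p = pl b w \<and> open W \<and> w \<in> W \<and>
      (\<forall>w'\<in>W. A + (w' - w) *s axis i 1 \<in> V \<and> \<gamma> (pl b w') = P (A + (w' - w) *s axis (i::2) 1))"
    proof (cases "b \<and> w \<noteq> 1 \<and> w \<noteq> -1")
      case True
      have o: "open (- {1, -1 :: complex})" by (intro open_Compl finite_imp_closed) simp
      show ?thesis
        by (rule exI[of _ XV], rule exI[of _ Xp], rule exI[of _ "vector [w, 0]"], rule exI[of _ 1],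
            rule exI[of _ True], rule exI[of _ w], rule exI[of _ "- {1, -1}"], unfold v)
          (use par_X p True T o in auto)
    next
      case False
      define u where "u = (if b then 1 / w else w)"
      have pu: "p = pl False u"
      proof (cases b)
        case True
        then have "w = 1 \<or> w = -1" using False by simp
        then show ?thesis using True p by (auto simp: u_def pl_def pline2_eq)
      qed (use p in "simp add: u_def")
      \<comment> \<open>At a centre its own chart must be used; elsewhere any of the three serves,
        and the one at 0 is taken.\<close>
      define d where "d = (if u \<in> Br then u else 0)"
      have d: "d \<in> Br" "u \<in> Br \<longrightarrow> u = d" by (auto simp: d_def Br_def)
      have o: "open (- (Br - {d}))" by (intro open_Compl finite_imp_closed) (simp add: Br_def)
      show ?thesis
        by (rule exI[of _ "BV d 0"], rule exI[of _ "Bp d 0"], rule exI[of _ "vector [u - d, 0]"], rule exI[of _ 1],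
            rule exI[of _ False], rule exI[of _ u], rule exI[of _ "- (Br - {d})"], unfold v)
          (use par_B[OF d(1), of 0] pos[OF d(1)] pu d F[OF d(1)] F[OF d(1), of d] o in auto)
    qed
  qed
  then show ?thesis by (simp add: im)
qed

end

section \<open>Intersection numbers of the boundary curves\<close>

lemma L_B_overlap:
  assumes b: "b \<in> Br" "c \<in> Br" "b \<noteq> c" and z: "z \<in> BV b 0" "z' \<in> BV c 0" and eq: "Bp b 0 z = Bp c 0 z'"
  shows "z $ 1 \<noteq> 0 \<and> z' $ 1 \<noteq> 0 \<and> b + z $ 1 = c + z' $ 1 \<and> z $ 1 * z $ 2 = z' $ 1 * z' $ 2"
proof -
  have "z $ 1 \<noteq> 0" using eq b by (auto simp: Bp_eq exc_def ctr_eq split: if_splits)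
  moreover have "z' $ 1 \<noteq> 0" using eq b by (auto simp: Bp_eq exc_def ctr_eq split: if_splits)
  ultimately show ?thesis using eq by (simp add: Bp_eq pline_Y_eq)
qed

lemma L_X_overlap:
  assumes eq: "Bp b 0 z = Xp z'"
  shows "z $ 1 \<noteq> 0 \<and> b + z $ 1 \<noteq> 0 \<and> z' $ 1 = 1 / (b + z $ 1) \<and> z' $ 2 = z $ 1 * z $ 2 / (b + z $ 1)"
proof -
  have "z $ 1 \<noteq> 0" using eq by (auto simp: Bp_eq Xp_def exc_def)
  then show ?thesis using eq by (simp add: Bp_eq Xp_def pline_X_eq)
qed

text \<open>Off infinity the two points are compared through u and v = z $ 1 * z $ 2, on the curve
  itself through the lines (1, z $ 2) and (z' $ 1, 1). The exponent 2 is what produces the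
  self-intersection -2.\<close>

lemma E_overlap:
  assumes k: "1 \<le> k" and eq: "Bp a (k - 1) z = Bp a k z'" and z: "z \<in> BV a (k - 1)" "z' \<in> BV a k"
  shows "z' $ 1 \<noteq> 0 \<and> z $ 1 = (z' $ 1)\<^sup>2 * z' $ 2 \<and> z $ 2 = 1 / z' $ 1"
proof -
  obtain m where m: "k = Suc m" using k by (cases k) auto
  have z1: "z' $ 1 \<noteq> 0"
  proof
    assume "z' $ 1 = 0"
    then have "Bp a m z = exc a (Suc k) (pline (vector [1, z' $ 2]))" using eq m by (simp add: Bp_eq)
    then show False using m by (auto simp: Bp_eq exc_eq split: if_splits) (auto simp: exc_def)
  qed
  have fs: "fst (Bp a m z) = fst (Bp a k z')" using eq m by simp
  have "a + z $ 1 * (z $ 1 * z $ 2) ^ m = a + z' $ 1 * (z' $ 1 * z' $ 2) ^ k" and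
    p: "z $ 1 * z $ 2 = z' $ 1 * z' $ 2"
    using fs unfolding fst_Bp pline_Y_eq by auto
  have sn: "Bp a m z = Bp a k z'" using eq m by simp
  show ?thesis
  proof (cases "z' $ 2 = 0")
    case True
    then have B: "Bp a k z' = exc a k (pline (vector [z' $ 1, 1]))" using z1 m by (simp add: Bp_eq)
    have "z $ 1 = 0"
      using sn unfolding B using m by (auto simp: Bp_eq exc_eq split: if_splits) (auto simp: exc_def)
    moreover have "pline (vector [1, z $ 2] :: complex^2) = pline (vector [z' $ 1, 1])"
      using sn unfolding B using \<open>z $ 1 = 0\<close> m by (simp add: Bp_eq exc_eq)
    ultimately show ?thesis using True z1 by (auto simp: pline2_eq field_simps)
  next
    case False
    have nz: "z $ 1 * z $ 2 \<noteq> 0" using p False z1 by simp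
    have "z $ 1 * (z $ 1 * z $ 2) ^ m = z' $ 1 * (z' $ 1 * z' $ 2) * (z $ 1 * z $ 2) ^ m"
      using \<open>a + _ = _\<close> p m by simp
    then have "z $ 1 = z' $ 1 * (z' $ 1 * z' $ 2)" using nz by simp
    moreover from this have "z $ 2 = 1 / z' $ 1" using p z1 False by (simp add: field_simps)
    ultimately show ?thesis using z1 by (simp add: power2_eq_square)
  qed
qed

lemma zero_BV: "0 \<in> BV a k"
  by (cases k) (simp_all add: BV_0 BV_Suc zero_CV)

context brn begin

text \<open>The line is covered by \<open>Xp\<close>, with index None, and by the charts
  \<open>Bp b 0\<close> of the three centres, with index Some b. The coordinate changes in the
  hypotheses are those of \<open>L_B_overlap\<close> and \<open>L_X_overlap\<close>.\<close>

lemma intersection_LcI: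
  assumes pos: "\<And>a. a \<in> Br ==> 1 \<le> n a"
    and D: "\<And>b z. b \<in> Br ==> z \<in> BV b 0 ==> Bp b 0 z \<in> D \<longleftrightarrow> s (Some b) z = 0"
      "\<And>z. z \<in> XV ==> Xp z \<in> D \<longleftrightarrow> s None z = 0"
    and s: "\<And>j. coord_or_one (s j)"
    and g: "\<And>b c z z'. b \<in> Br ==> c \<in> Br ==> b \<noteq> c ==> z $ 1 \<noteq> 0 ==> z' $ 1 \<noteq> 0 ==> b + z $ 1 = c + z' $ 1 ==>
        z $ 1 * z $ 2 = z' $ 1 * z' $ 2 ==> cocycle (g (Some b) (Some c)) (s (Some b)) (s (Some c)) 2 1 1 (m (Some b)) (m (Some c)) z z'"
      "\<And>b z z'. b \<in> Br ==> z $ 1 \<noteq> 0 ==> b + z $ 1 \<noteq> 0 ==> z' $ 1 = 1 / (b + z $ 1) ==> z' $ 2 = z $ 1 * z $ 2 / (b + z $ 1) ==>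
        cocycle (g (Some b) None) (s (Some b)) (s None) 2 1 1 (m (Some b)) (m None) z z' \<and>
        cocycle (g None (Some b)) (s None) (s (Some b)) 2 1 1 (m None) (m (Some b)) z' z"
  shows "has_intersection_number (Surf n) Lc D (m None + (\<Sum>b\<in>Br. m (Some b)))"
proof -
  let ?J = "insert None (Some ` Br)"
  let ?V = "\<lambda>j. case j of None \<Rightarrow> XV | Some b \<Rightarrow> BV b 0"
  let ?P = "\<lambda>j. case j of None \<Rightarrow> Xp | Some b \<Rightarrow> Bp b 0"
  have "has_intersection_number (Surf n) Lc D (\<Sum>j\<in>?J. m j)"
  proof (rule intersection_numberI[where V="?V" and P="?P" and e="\<lambda>_. 2" and ax="\<lambda>_. 1" and s=s and g=g, OF at])
    show "finite ?J" by (simp add: Br_def)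
    show "lpar (Surf n) (?V j) (?P j)" if "j \<in> ?J" for j
      using that lpar_X lpar_B pos by (auto simp: Suc_le_eq)
    show "Lc \<subseteq> (\<Union>j\<in>?J. ?P j ` ?V j)"
      by (rule subsetI, erule Lc_cases) auto
    show "?P j z \<in> Lc \<longleftrightarrow> z $ 2 = 0" if "j \<in> ?J" "z \<in> ?V j" for j z
      using that mem_Lc_Xp mem_Lc_Bp by auto
    show "?P j z \<in> D \<longleftrightarrow> s j z = 0" if "j \<in> ?J" "z \<in> ?V j" for j z
      using that D by auto
    show "coord_or_one (s j)" for j by (rule s)
    show "0 \<in> ?V j \<and> (\<forall>i\<in>?J. ?P j 0 \<in> ?P i ` ?V i \<longrightarrow> i = j)" if j: "j \<in> ?J" for j
    proof (intro conjI ballI impI)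
      show "0 \<in> ?V j" using zero_BV by (cases j) (simp_all add: XV_def)
      fix i assume i: "i \<in> ?J" "?P j 0 \<in> ?P i ` ?V i"
      show "i = j"
      proof (cases i; cases j)
        fix b assume b: "i = None" "j = Some b"
        then obtain z where "Bp b 0 0 = Xp z" using i by auto
        from L_X_overlap[OF this] show ?thesis by simp
      next
        fix b assume b: "i = Some b" "j = None"
        then obtain z where "Bp b 0 z = Xp 0" using i by (auto dest: sym)
        from L_X_overlap[OF this] show ?thesis by auto
      next
        fix b c assume b: "i = Some b" "j = Some c"
        then obtain z where z: "z \<in> BV b 0" "Bp c 0 0 = Bp b 0 z" using i by auto
        show ?thesis
        proof (rule ccontr)
          assume "i \<noteq> j"
          then show False using L_B_overlap[OF _ _ _ zero_BV z] b i j by auto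
        qed
      qed simp
    qed
    fix i j z z'
    assume ij: "i \<in> ?J" "j \<in> ?J" "i \<noteq> j" and z: "z \<in> ?V i" "z' \<in> ?V j" and eq: "?P i z = ?P j z'"
    show "cocycle (g i j) (s i) (s j) 2 1 1 (m i) (m j) z z'"
    proof (cases i; cases j)
      fix b assume b: "i = None" "j = Some b"
      then have "Bp b 0 z' = Xp z" using eq by simp
      from L_X_overlap[OF this] show ?thesis using g(2)[of b z' z] b ij by auto
    next
      fix b assume b: "i = Some b" "j = None"
      then have "Bp b 0 z = Xp z'" using eq by simp
      from L_X_overlap[OF this] show ?thesis using g(2)[of b z z'] b ij by auto
    next
      fix b c assume b: "i = Some b" "j = Some c"
      then have "Bp b 0 z = Bp c 0 z'" "b \<in> Br" "c \<in> Br" "b \<noteq> c" "z \<in> BV b 0" "z' \<in> BV c 0"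
        using eq ij z by auto
      then show ?thesis using L_B_overlap[of b c z z'] g(1)[of b c z z'] b by auto
    qed (use ij in simp)
  qed simp_all
  moreover have "(\<Sum>j\<in>?J. m j) = m None + (\<Sum>b\<in>Br. m (Some b))"
    by (subst sum.insert) (auto simp: sum.reindex Br_def)
  ultimately show ?thesis by simp
qed

lemma Lc_Lc:
  assumes pos: "\<And>a. a \<in> Br ==> 1 \<le> n a"
  shows "has_intersection_number (Surf n) Lc Lc (- 2)"
proof -
  \<comment> \<open>The chosen section has a simple zero at [1 : 0 : 0] and a simple pole over each
    of the three centres: 1 - 3 = -2, the degree of a line in the plane less one for each first
    blow-up.\<close>
  define m where "m j = (case j of None \<Rightarrow> 1 | Some b \<Rightarrow> (- 1 :: int))" for j :: "complex option"
  define g where "g i j z = (case i of None \<Rightarrow> (case j of None \<Rightarrow> 1 | Some b \<Rightarrow> 1 - b * z $ 1)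
      | Some b \<Rightarrow> (case j of None \<Rightarrow> (b + z $ 1) / z $ 1 | Some c \<Rightarrow> (b - c + z $ 1) / z $ 1))"
    for i j :: "complex option" and z :: "complex^2"
  have g': "g (Some b) (Some c) = (\<lambda>z. (b - c + z $ 1) / z $ 1)" "g (Some b) None = (\<lambda>z. (b + z $ 1) / z $ 1)"
    "g None (Some b) = (\<lambda>z. 1 - b * z $ 1)" for b c
    by (auto simp: g_def)
  have "has_intersection_number (Surf n) Lc Lc (m None + (\<Sum>b\<in>Br. m (Some b)))"
  proof (rule intersection_LcI[where s="\<lambda>_ z. z $ 2" and g=g])
    fix b c and z z' :: "complex^2"
    assume h: "b \<noteq> c" "z $ 1 \<noteq> 0" "z' $ 1 \<noteq> 0" "b + z $ 1 = c + z' $ 1" "z $ 1 * z $ 2 = z' $ 1 * z' $ 2"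
    have *: "b - c + z $ 1 = z' $ 1" using h(4) by (simp add: algebra_simps)
    have "z $ 2 = z' $ 1 / z $ 1 * z' $ 2" using h by (simp add: field_simps)
    then show "cocycle (g (Some b) (Some c)) (\<lambda>z. z $ 2) (\<lambda>z. z $ 2) 2 1 1 (m (Some b)) (m (Some c)) z z'"
      using h unfolding cocycle_def g' * by (auto intro!: cd cdiff_divide simp: m_def power_int_minus field_simps)
  next
    fix b and z z' :: "complex^2"
    assume h: "z $ 1 \<noteq> 0" "b + z $ 1 \<noteq> 0" "z' $ 1 = 1 / (b + z $ 1)" "z' $ 2 = z $ 1 * z $ 2 / (b + z $ 1)"
    have *: "1 - b * z' $ 1 = z $ 1 / (b + z $ 1)" using h by (simp add: field_simps)
    show "cocycle (g (Some b) None) (\<lambda>z. z $ 2) (\<lambda>z. z $ 2) 2 1 1 (m (Some b)) (m None) z z' \<and>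
        cocycle (g None (Some b)) (\<lambda>z. z $ 2) (\<lambda>z. z $ 2) 2 1 1 (m None) (m (Some b)) z' z"
      using h(1,2) unfolding cocycle_def g' * unfolding h(3,4)
      by (auto intro!: cd cdiff_divide simp: m_def power_int_minus inverse_eq_divide)
  qed (use pos mem_Lc_Bp mem_Lc_Xp in "auto simp: coord_or_one_def")
  moreover have "m None + (\<Sum>b\<in>Br. m (Some b)) = - 2" by (simp add: m_def Br_def)
  ultimately show ?thesis by simp
qed

lemma Lc_Ec:
  assumes pos: "\<And>a. a \<in> Br ==> 1 \<le> n a" and a: "a \<in> Br" and k: "1 \<le> k"
  shows "has_intersection_number (Surf n) Lc (Ec a k) (if k = 1 then 1 else 0)"
proof -
  \<comment> \<open>For k = 1 the equation z $ 1 of the exceptional curve in the chart at a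
    restricts to the coordinate along the line. It serves as its own section, with one simple zero;
    for k > 1 the curves are disjoint and everything is 1.\<close>
  define m where "m j = (if j = Some a \<and> k = 1 then 1 else 0 :: int)" for j
  define s where "s j = (if j = Some a \<and> k = 1 then \<lambda>z :: complex^2. z $ 1 else (\<lambda>_. 1))" for j
  define g where "g i j z = (if k = 1 \<and> i = Some a then z $ 1
     else if k = 1 \<and> j = Some a then (case i of None \<Rightarrow> z $ 1 / (1 - a * z $ 1) | Some b \<Rightarrow> 1 / (b - a + z $ 1)) else 1)"
    for i j and z :: "complex^2"
  have "has_intersection_number (Surf n) Lc (Ec a k) (m None + (\<Sum>b\<in>Br. m (Some b)))"
  proof (rule intersection_LcI[where s=s and g=g])
    fix b c and z z' :: "complex^2"
    assume h: "b \<noteq> c" "z $ 1 \<noteq> 0" "z' $ 1 \<noteq> 0" "b + z $ 1 = c + z' $ 1" "z $ 1 * z $ 2 = z' $ 1 * z' $ 2"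
    have *: "b - c + z $ 1 = z' $ 1" using h(4) by (simp add: algebra_simps)
    have 1: "g (Some b) (Some c) z * s (Some c) z' = s (Some b) z"
      using h * by (auto simp: g_def s_def)
    have 2: "g (Some b) (Some c) z * (z' $ 1) powi m (Some c) = (z $ 1) powi m (Some b)"
      using h * by (auto simp: g_def m_def)
    have "cdiff (g (Some b) (Some c)) z"
    proof -
      have "g (Some b) (Some c) = (if k = 1 \<and> b = a then \<lambda>z. z $ 1
          else if k = 1 \<and> c = a then \<lambda>z. 1 / (b - c + z $ 1) else (\<lambda>_. 1))"
        by (auto simp: g_def fun_eq_iff)
      then show ?thesis using h * by (auto intro!: cd cdiff_divide)
    qed
    then show "cocycle (g (Some b) (Some c)) (s (Some b)) (s (Some c)) 2 1 1 (m (Some b)) (m (Some c)) z z'"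
      using 1 2 by (simp add: cocycle_def)
  next
    fix b and z z' :: "complex^2"
    assume h: "z $ 1 \<noteq> 0" "b + z $ 1 \<noteq> 0" "z' $ 1 = 1 / (b + z $ 1)" "z' $ 2 = z $ 1 * z $ 2 / (b + z $ 1)"
    have *: "1 - b * z' $ 1 = z $ 1 / (b + z $ 1)" using h by (simp add: field_simps)
    have c: "cdiff (g (Some b) None) z" "cdiff (g None (Some b)) z'"
    proof -
      have "g (Some b) None = (if k = 1 \<and> b = a then \<lambda>z. z $ 1 else (\<lambda>_. 1))"
        by (auto simp: g_def fun_eq_iff)
      then show "cdiff (g (Some b) None) z" by (auto intro!: cd)
      have "g None (Some b) = (if k = 1 \<and> b = a then \<lambda>z. z $ 1 / (1 - b * z $ 1) else (\<lambda>_. 1))"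
        by (auto simp: g_def fun_eq_iff)
      then show "cdiff (g None (Some b)) z'" using h * by (auto intro!: cd cdiff_divide)
    qed
    have 1: "g (Some b) None z * s None z' = s (Some b) z"
      using h by (auto simp: g_def s_def)
    have 2: "g (Some b) None z * (z' $ 1) powi m None = (z $ 1) powi m (Some b)"
      using h by (auto simp: g_def m_def)
    have 3: "g None (Some b) z' * s (Some b) z = s None z'"
      using h * by (auto simp: g_def s_def)
    have 4: "g None (Some b) z' * (z $ 1) powi m (Some b) = (z' $ 1) powi m None"
      using h * by (auto simp: g_def m_def)
    show "cocycle (g (Some b) None) (s (Some b)) (s None) 2 1 1 (m (Some b)) (m None) z z' \<and>
        cocycle (g None (Some b)) (s None) (s (Some b)) 2 1 1 (m None) (m (Some b)) z' z"
      using c 1 2 3 4 by (simp add: cocycle_def)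
  next
    show "Bp b 0 z \<in> Ec a k \<longleftrightarrow> s (Some b) z = 0" for b z
      using k by (auto simp: mem_Ec_Bp[OF k] s_def)
    show "Xp z \<in> Ec a k \<longleftrightarrow> s None z = 0" for z
      using mem_Ec_Xp[OF k] by (simp add: s_def)
    show "coord_or_one (s j)" for j
      by (auto simp: s_def coord_or_one_def)
  qed (use pos in auto)
  moreover have "m None + (\<Sum>b\<in>Br. m (Some b)) = (if k = 1 then 1 else 0)"
    using a by (auto simp: m_def Br_def)
  ultimately show ?thesis by simp
qed

text \<open>The index True stands for \<open>Bp a (k - 1)\<close>, where the curve is z $ 1 = 0 with
  coordinate z $ 2, and False for \<open>Bp a k\<close>, where the two coordinates exchange their
  roles.\<close>

lemma intersection_EcI:
  assumes a: "a \<in> Br" and k: "1 \<le> k" "k < n a"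
    and D: "\<And>z. z \<in> BV a (k - 1) ==> Bp a (k - 1) z \<in> D \<longleftrightarrow> s True z = 0"
      "\<And>z. z \<in> BV a k ==> Bp a k z \<in> D \<longleftrightarrow> s False z = 0"
    and s: "\<And>j. coord_or_one (s j)"
    and g: "\<And>z z'. z' $ 1 \<noteq> 0 ==> z $ 1 = (z' $ 1)\<^sup>2 * z' $ 2 ==> z $ 2 = 1 / z' $ 1 ==>
        cocycle (g True) (s True) (s False) 1 2 1 (m True) (m False) z z' \<and>
        cocycle (g False) (s False) (s True) 2 1 2 (m False) (m True) z' z"
  shows "has_intersection_number (Surf n) (Ec a k) D (m True + m False)"
proof -
  let ?V = "\<lambda>j. if j then BV a (k - 1) else BV a k"
  let ?P = "\<lambda>j. if j then Bp a (k - 1) else Bp a k"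
  have "has_intersection_number (Surf n) (Ec a k) D (\<Sum>j\<in>{True, False}. m j)"
  proof (rule intersection_numberI[where V="?V" and P="?P" and e="\<lambda>j. if j then 1 else 2"
        and ax="\<lambda>j. if j then 2 else 1" and s=s and g="\<lambda>i j. g i", OF at])
    show "lpar (Surf n) (?V j) (?P j)" for j
      using lpar_B[OF a] k by auto
    show "Ec a k \<subseteq> (\<Union>j\<in>{True, False}. ?P j ` ?V j)"
    proof
      fix p assume "p \<in> Ec a k"
      then show "p \<in> (\<Union>j\<in>{True, False}. ?P j ` ?V j)"
        using k(1)
      proof (cases rule: Ec_cases)
        case (A w)
        have "vector [0, w] \<in> BV a (k - 1)"
          using BV_Suc[of a "k - 2"] k
          by (cases "k = 1"; simp add: BV_0 CV.simps numeral_2_eq_2 Suc_diff_Suc)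
        then show ?thesis using A by auto
      next
        case (B w)
        then show ?thesis using BV_Suc[of a "k - 1"] k by auto
      qed
    qed
    show "?P j z \<in> Ec a k \<longleftrightarrow> z $ (if j then 1 else 2) = 0" for j z
      using k by (auto simp: mem_Ec_Bp)
    show "?P j z \<in> D \<longleftrightarrow> s j z = 0" if "z \<in> ?V j" for j z
      using that D by (cases j) auto
    show "coord_or_one (s j)" for j by (rule s)
    show "0 \<in> ?V j \<and> (\<forall>i\<in>{True, False}. ?P j 0 \<in> ?P i ` ?V i \<longrightarrow> i = j)" for j
    proof (intro conjI ballI impI)
      show "0 \<in> ?V j" using zero_BV by simp
      fix i assume i: "?P j 0 \<in> ?P i ` ?V i"
      then obtain z where z: "z \<in> ?V i" "?P j 0 = ?P i z" by blast
      show "i = j"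
      proof (cases i; cases j)
        assume b: "i" "\<not> j"
        then show ?thesis using E_overlap[OF k(1), of a z 0] z zero_BV by auto
      next
        assume b: "\<not> i" "j"
        then show ?thesis using E_overlap[OF k(1), of a 0 z] z zero_BV by auto
      qed simp_all
    qed
    fix i j z z'
    assume ij: "i \<noteq> j" and z: "z \<in> ?V i" "z' \<in> ?V j" and eq: "?P i z = ?P j z'"
    show "cocycle (g i) (s i) (s j) (if i then 1 else 2) (if i then 2 else 1) (if j then 2 else 1) (m i) (m j) z z'"
    proof (cases i)
      case True
      then have ij': "i = True" "j = False" using ij by auto
      have o: "z' $ 1 \<noteq> 0 \<and> z $ 1 = (z' $ 1)\<^sup>2 * z' $ 2 \<and> z $ 2 = 1 / z' $ 1"
        by (rule E_overlap[OF k(1)]) (use eq z ij' in simp_all)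
      show ?thesis
        using g[OF conjunct1[OF o] conjunct1[OF conjunct2[OF o]] conjunct2[OF conjunct2[OF o]]]
        unfolding ij' if_True if_False by blast
    next
      case False
      then have ij': "i = False" "j = True" using ij by auto
      have o: "z $ 1 \<noteq> 0 \<and> z' $ 1 = (z $ 1)\<^sup>2 * z $ 2 \<and> z' $ 2 = 1 / z $ 1"
        by (rule E_overlap[OF k(1)]) (use eq z ij' in simp_all)
      show ?thesis
        using g[OF conjunct1[OF o] conjunct1[OF conjunct2[OF o]] conjunct2[OF conjunct2[OF o]]]
        unfolding ij' if_True if_False by blast
    qed
  qed auto
  then show ?thesis by (simp add: add.commute)
qed

lemma Ec_Ec:
  assumes a: "a \<in> Br" and k: "1 \<le> k" "k < n a"
  shows "has_intersection_number (Surf n) (Ec a k) (Ec a k) (- 2)"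
proof -
  \<comment> \<open>The equations z $ 1 and z' $ 2 differ by the square of z' $ 1 = 1 / z $ 2. The
    powers -1 of z $ 2 and z' $ 1 differ by the same factor, and their two simple poles add up to
    -2.\<close>
  define g where "g j = (\<lambda>z :: complex^2. if j then 1 / (z $ 2)\<^sup>2 else 1 / (z $ 1)\<^sup>2)" for j
  have "has_intersection_number (Surf n) (Ec a k) (Ec a k) ((\<lambda>_. - 1) True + (\<lambda>_. - 1) False)"
  proof (rule intersection_EcI[OF a k, where s="\<lambda>j z. if j then z $ 1 else z $ 2" and g=g])
    fix z z' :: "complex^2"
    assume h: "z' $ 1 \<noteq> 0" "z $ 1 = (z' $ 1)\<^sup>2 * z' $ 2" "z $ 2 = 1 / z' $ 1"
    have c: "cdiff (g True) z" "cdiff (g False) z'"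
      unfolding g_def using h by (auto intro!: cd cdiff_divide)
    show "cocycle (g True) (\<lambda>z. if True then z $ 1 else z $ 2) (\<lambda>z. if False then z $ 1 else z $ 2) 1 2 1 (- 1) (- 1) z z' \<and>
        cocycle (g False) (\<lambda>z. if False then z $ 1 else z $ 2) (\<lambda>z. if True then z $ 1 else z $ 2) 2 1 2 (- 1) (- 1) z' z"
      using c unfolding cocycle_def h(2,3) by (auto simp: g_def h power_int_minus inverse_eq_divide power2_eq_square)
  next
    show "coord_or_one (\<lambda>z :: complex^2. if j then z $ 1 else z $ 2)" for j
      by (cases j) (auto simp: coord_or_one_def)
  qed (use k in "auto simp: mem_Ec_Bp")
  then show ?thesis by simp
qed

lemma Ec_Lc:
  assumes a: "a \<in> Br" and k: "1 \<le> k" "k < n a"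
  shows "has_intersection_number (Surf n) (Ec a k) Lc (if k = 1 then 1 else 0)"
proof -
  define m where "m j = (if j \<and> k = 1 then 1 else 0 :: int)" for j
  define s where "s j = (if j \<and> k = 1 then \<lambda>z :: complex^2. z $ 2 else (\<lambda>_. 1))" for j
  define g where "g j = (\<lambda>z :: complex^2. if k = 1 then (if j then z $ 2 else z $ 1) else 1)" for j
  have "has_intersection_number (Surf n) (Ec a k) Lc (m True + m False)"
  proof (rule intersection_EcI[OF a k, where s=s and g=g])
    fix z z' :: "complex^2"
    assume h: "z' $ 1 \<noteq> 0" "z $ 1 = (z' $ 1)\<^sup>2 * z' $ 2" "z $ 2 = 1 / z' $ 1"
    have "cdiff (g True) z" "cdiff (g False) z'"
      unfolding g_def by (cases "k = 1"; simp; intro cd)+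
    then show "cocycle (g True) (s True) (s False) 1 2 1 (m True) (m False) z z' \<and>
        cocycle (g False) (s False) (s True) 2 1 2 (m False) (m True) z' z"
      using h by (auto simp: cocycle_def g_def s_def m_def)
  next
    show "Bp a (k - 1) z \<in> Lc \<longleftrightarrow> s True z = 0" if "z \<in> BV a (k - 1)" for z
      using mem_Lc_Bp[OF a that] k by (auto simp: s_def)
    show "Bp a k z \<in> Lc \<longleftrightarrow> s False z = 0" if "z \<in> BV a k" for z
      using mem_Lc_Bp[OF a that] k by (auto simp: s_def)
    show "coord_or_one (s j)" for j
      by (auto simp: s_def coord_or_one_def)
  qed
  moreover have "m True + m False = (if k = 1 then 1 else 0)" by (simp add: m_def)
  ultimately show ?thesis by simp
qed

lemma Ec_Ec':
  assumes a: "a \<in> Br" and k: "1 \<le> k" "k < n a" and l: "1 \<le> l" and ne: "b \<noteq> a \<or> l \<noteq> k"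
  shows "has_intersection_number (Surf n) (Ec a k) (Ec b l) (if b = a \<and> (l = Suc k \<or> k = Suc l) then 1 else 0)"
proof -
  \<comment> \<open>The curve one level lower is crossed at the origin of
    \<open>Bp a (k - 1)\<close>, the curve one level higher at the origin of
    \<open>Bp a k\<close>.\<close>
  let ?A = "b = a \<and> k = Suc l" and ?B = "b = a \<and> l = Suc k"
  define m where "m j = (if (if j then ?A else ?B) then 1 else 0 :: int)" for j
  define s where "s j = (if j then if ?A then \<lambda>z :: complex^2. z $ 2 else (\<lambda>_. 1)
     else if ?B then \<lambda>z. z $ 1 else (\<lambda>_. 1))" for j
  define g where "g j = (\<lambda>z :: complex^2. if ?A \<or> ?B then (if j then z $ 2 else z $ 1) else 1)" for j
  have "has_intersection_number (Surf n) (Ec a k) (Ec b l) (m True + m False)"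
  proof (rule intersection_EcI[OF a k, where s=s and g=g])
    fix z z' :: "complex^2"
    assume h: "z' $ 1 \<noteq> 0" "z $ 1 = (z' $ 1)\<^sup>2 * z' $ 2" "z $ 2 = 1 / z' $ 1"
    have "cdiff (g True) z" "cdiff (g False) z'"
    proof -
      have "g True = (if ?A \<or> ?B then \<lambda>z. z $ 2 else (\<lambda>_. 1))" "g False = (if ?A \<or> ?B then \<lambda>z. z $ 1 else (\<lambda>_. 1))"
        by (auto simp: g_def fun_eq_iff)
      then show "cdiff (g True) z" "cdiff (g False) z'" by (auto intro!: cd)
    qed
    then show "cocycle (g True) (s True) (s False) 1 2 1 (m True) (m False) z z' \<and>
        cocycle (g False) (s False) (s True) 2 1 2 (m False) (m True) z' z"
      using h by (auto simp: cocycle_def g_def s_def m_def)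
  next
    show "Bp a (k - 1) z \<in> Ec b l \<longleftrightarrow> s True z = 0" if "z \<in> BV a (k - 1)" for z
      using k ne by (auto simp: s_def mem_Ec_Bp[OF l])
    show "Bp a k z \<in> Ec b l \<longleftrightarrow> s False z = 0" if "z \<in> BV a k" for z
      using k ne by (auto simp: s_def mem_Ec_Bp[OF l])
    show "coord_or_one (s j)" for j
      by (auto simp: s_def coord_or_one_def)
  qed
  moreover have "m True + m False = (if b = a \<and> (l = Suc k \<or> k = Suc l) then 1 else 0)" by (auto simp: m_def)
  ultimately show ?thesis by simp
qed

end

lemma Lc_Ec_Int: "1 \<le> k ==> a \<in> Br ==> Lc \<inter> Ec a k \<noteq> {} \<longleftrightarrow> k = 1"
proof
  assume k: "1 \<le> k" "a \<in> Br" and "Lc \<inter> Ec a k \<noteq> {}"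
  then obtain p where p: "p \<in> Lc" "p \<in> Ec a k" by blast
  from p(1) show "k = 1"
  proof (cases rule: Lc_cases)
    case (X z)
    then show ?thesis using p mem_Ec_Xp[OF k(1)] by simp
  next
    case (B b z)
    then show ?thesis using p mem_Ec_Bp[OF k(1)] k by auto
  qed
next
  assume k: "1 \<le> k" "a \<in> Br" "k = 1"
  have "Bp a 0 0 \<in> Lc" "Bp a 0 0 \<in> Ec a k"
    using mem_Lc_Bp[OF k(2) zero_BV] mem_Ec_Bp[OF k(1)] k by auto
  then show "Lc \<inter> Ec a k \<noteq> {}" by blast
qed

lemma Ec_Ec_Int:
  assumes k: "1 \<le> k" "1 \<le> l" and ne: "b \<noteq> a \<or> l \<noteq> k"
  shows "Ec a k \<inter> Ec b l \<noteq> {} \<longleftrightarrow> b = a \<and> (l = Suc k \<or> k = Suc l)"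
proof
  assume "Ec a k \<inter> Ec b l \<noteq> {}"
  then obtain p where p: "p \<in> Ec a k" "p \<in> Ec b l" by blast
  from p(1) k(1) show "b = a \<and> (l = Suc k \<or> k = Suc l)"
  proof (cases rule: Ec_cases)
    case (A w)
    then show ?thesis using p(2) mem_Ec_Bp[OF k(2)] k ne by auto
  next
    case (B w)
    then show ?thesis using p(2) mem_Ec_Bp[OF k(2)] k ne by auto
  qed
next
  assume h: "b = a \<and> (l = Suc k \<or> k = Suc l)"
  \<comment> \<open>Consecutive curves are the two axes of the chart indexed by the smaller level,
    so they cross at its origin.\<close>
  have "Bp a (min k l) 0 \<in> Ec a k \<inter> Ec b l"
    using h mem_Ec_Bp[OF k(2)] mem_Ec_Bp[OF k(1)] by auto
  then show "Ec a k \<inter> Ec b l \<noteq> {}" by blast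
qed

context brn begin

text \<open>The last exceptional curve of each tower is not among the curves on the right: apart
  from its point in direction (1, 0), it is covered by \<open>Cp a (n a)\<close>. That point lies on
  the preceding curve, or on the line at infinity if n a = 1.\<close>

lemma curves_compl:
  assumes pos: "\<And>a. a \<in> Br ==> 1 \<le> n a"
  shows "pts (Surf n) - (range Zp \<union> (\<Union>a\<in>Br. range (Cp a (n a)))) = Lc \<union> (\<Union>a\<in>Br. \<Union>k\<in>{1..<n a}. Ec a k)"
proof (intro equalityI subsetI)
  fix p assume "p \<in> pts (Surf n) - (range Zp \<union> (\<Union>a\<in>Br. range (Cp a (n a))))"
  then have p: "p \<in> pts (Surf n)" "p \<notin> range Zp" "\<And>a. a \<in> Br ==> p \<notin> range (Cp a (n a))" by auto
  show "p \<in> Lc \<union> (\<Union>a\<in>Br. \<Union>k\<in>{1..<n a}. Ec a k)"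
    using p(1)
  proof (cases rule: Surf_cases)
    case (X z)
    have "z $ 2 = 0"
    proof (rule ccontr)
      assume z2: "z $ 2 \<noteq> 0"
      have "pline (vector [1, z $ 1, z $ 2] :: complex^3) = pline (vector [1 / z $ 2, z $ 1 / z $ 2, 1])"
        by (rule pline_eqI[of "z $ 2"]) (use z2 in "auto simp: vec_eq_iff forall_3")
      then have "p = Zp (vector [1 / z $ 2, z $ 1 / z $ 2])" using X by (simp add: Xp_def Zp_def)
      then show False using p(2) by blast
    qed
    then show ?thesis using mem_Lc_Xp X by blast
  next
    case (B a k z)
    show ?thesis
    proof (cases "z $ 1 = 0")
      case True
      then have pe: "p = exc a (Suc k) (pline (vector [1, z $ 2]))" using B by (simp add: Bp_eq)
      show ?thesis
      proof (cases "Suc k < n a")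
        case True
        then have "p \<in> Ec a (Suc k)" using B \<open>z $ 1 = 0\<close> mem_Ec_Bp[of "Suc k" a k z a] by simp
        then show ?thesis using B True by auto
      next
        case False
        then have kn: "Suc k = n a" using B by simp
        show ?thesis
        proof (cases "z $ 2 = 0")
          case True
          show ?thesis
          proof (cases "k = 0")
            case True
            then show ?thesis using B mem_Lc_Bp[of a z 0] \<open>z $ 2 = 0\<close> by auto
          next
            case F: False
            then have "p \<in> Ec a k" using B True mem_Ec_Bp[of k a k z a] by simp
            then show ?thesis using B F by auto
          qed
        next
          case False
          have "pline (vector [1, z $ 2] :: complex^2) = pline (vector [1 / z $ 2, 1])"
            using False by (simp add: pline2_eq)
          then have "p = Cp a (n a) (vector [1 / z $ 2, 0])" using pe kn by (simp add: Cp_eq)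
          then show ?thesis using p(3) B by blast
        qed
      qed
    next
      case z1: False
      show ?thesis
      proof (cases "z $ 2 = 0")
        case True
        show ?thesis
        proof (cases "k = 0")
          case True
          then show ?thesis using B mem_Lc_Bp[of a z 0] \<open>z $ 2 = 0\<close> by auto
        next
          case F: False
          then have "p \<in> Ec a k" using B True mem_Ec_Bp[of k a k z a] by simp
          then show ?thesis using B F by auto
        qed
      next
        case False
        let ?u = "a + z $ 1 * (z $ 1 * z $ 2) ^ k" and ?v = "z $ 1 * z $ 2"
        have "p = (pline (vector [?u, 1, ?v]), [])" using B z1 False by (simp add: Bp_eq)
        moreover have "pline (vector [?u, 1, ?v] :: complex^3) = pline (vector [?u / ?v, 1 / ?v, 1])"
          unfolding pline_Z_eq using z1 False by simp
        ultimately have "p = Zp (vector [?u / ?v, 1 / ?v])" by (simp add: Zp_def)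
        then show ?thesis using p(2) by blast
      qed
    qed
  qed (use p in auto)
next
  fix p assume "p \<in> Lc \<union> (\<Union>a\<in>Br. \<Union>k\<in>{1..<n a}. Ec a k)"
  then consider "p \<in> Lc" | a k where "a \<in> Br" "1 \<le> k" "k < n a" "p \<in> Ec a k" by auto
  then show "p \<in> pts (Surf n) - (range Zp \<union> (\<Union>a\<in>Br. range (Cp a (n a))))"
  proof cases
    case 1
    have "p \<in> pts (Surf n)"
      using 1
    proof (cases rule: Lc_cases)
      case (X z)
      then show ?thesis using par_pts[OF par_X] by simp
    next
      case (B b z)
      then show ?thesis using par_pts[OF par_B, of b 0 z] pos[of b] by simp
    qed
    moreover have "p \<notin> range Zp" using 1 mem_Zp by blast
    moreover have "p \<notin> range (Cp a (n a))" if "a \<in> Br" for a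
    proof
      assume "p \<in> range (Cp a (n a))"
      then obtain z where z: "p = Cp a (n a) z" by blast
      then show False using 1 mem_Cp(1)[OF that pos[OF that], of 1 "a + 1" z] by simp
    qed
    ultimately show ?thesis by blast
  next
    case (2 a k)
    have "p \<in> pts (Surf n)"
      using 2(4,2)
    proof (cases rule: Ec_cases)
      case (A w)
      have "vector [0, w] \<in> BV a (k - 1)"
        using BV_Suc[of a "k - 2"] 2
        by (cases "k = 1"; simp add: BV_0 CV.simps numeral_2_eq_2 Suc_diff_Suc)
      then show ?thesis using A par_pts[OF par_B[OF 2(1), of "k - 1"]] 2 by simp
    next
      case (B s)
      then show ?thesis using par_pts[OF par_B[OF 2(1), of k]] 2 BV_Suc[of a "k - 1"] by simp
    qed
    moreover have "p \<notin> range Zp" using 2 mem_Zp by blast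
    moreover have "p \<notin> range (Cp b (n b))" if "b \<in> Br" for b
    proof
      assume "p \<in> range (Cp b (n b))"
      then obtain z where z: "p = Cp b (n b) z" by blast
      then show False using 2 mem_Cp(2)[OF that pos[OF that], of k a z] by auto
    qed
    ultimately show ?thesis by blast
  qed
qed

end

section \<open>Solutions near a singular time\<close>

lemma punctured_const:
  fixes f :: "complex \<Rightarrow> complex"
  assumes "\<And>t. t \<in> ball a r - {a} ==> (f has_field_derivative 0) (at t)"
  shows "\<exists>c. \<forall>t\<in>ball a r - {a}. f t = c"
proof -
  have "connected (ball a r - {a})" "open (ball a r - {a})"
    by (auto intro!: connected_punctured_ball open_delete)
  then have "f constant_on (ball a r - {a})"
    by (intro has_field_derivative_0_imp_constant_on[OF assms])
  then show ?thesis unfolding constant_on_def .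
qed

text \<open>With K a primitive of k on the whole disc, h exp(-K) has derivative 0 on the connected
  punctured disc and is therefore constant. So h extends across the centre, with no multivaluedness
  and no essential singularity.\<close>

lemma punctured_linear_ode:
  fixes h k :: "complex \<Rightarrow> complex"
  assumes k: "k holomorphic_on ball a r"
    and h: "\<And>t. t \<in> ball a r - {a} ==> (h has_field_derivative h t * k t) (at t)"
  shows "\<exists>H. H holomorphic_on ball a r \<and> (\<forall>t\<in>ball a r - {a}. h t = H t)"
proof -
  obtain K where K: "\<And>t. t \<in> ball a r ==> (K has_field_derivative k t) (at t within ball a r)"
    using holomorphic_convex_primitive'[OF convex_ball open_ball k] by blast
  then have K': "(K has_field_derivative k t) (at t)" if "t \<in> ball a r" for t
    using that by (metis at_within_open open_ball)
  have "((\<lambda>t. h t * exp (- K t)) has_field_derivative 0) (at t)" if "t \<in> ball a r - {a}" for t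
    using that by (auto intro!: derivative_eq_intros h K' simp: algebra_simps)
  from punctured_const[OF this] obtain c where c: "\<forall>t\<in>ball a r - {a}. h t * exp (- K t) = c" by (rule exE)
  have "h t = c * exp (K t)" if "t \<in> ball a r - {a}" for t
  proof -
    have "h t * exp (- K t) * exp (K t) = c * exp (K t)" using bspec[OF c that] by simp
    then show ?thesis by (simp add: mult.assoc flip: exp_add)
  qed
  moreover have "K holomorphic_on ball a r"
    unfolding holomorphic_on_def field_differentiable_def by (intro ballI exI, rule K)
  then have "(\<lambda>t. c * exp (K t)) holomorphic_on ball a r" by (intro holomorphic_intros)
  ultimately show ?thesis by blast
qed

lemma ball_limit_eq:
  fixes f g :: "complex \<Rightarrow> complex"
  assumes "f holomorphic_on ball a r" "g holomorphic_on ball a r" "0 < r"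
    and eq: "\<And>t. t \<in> ball a r - {a} ==> f t = g t"
  shows "f a = g a"
proof -
  have "isCont f a" "isCont g a"
    using assms by (auto intro!: continuous_on_interior dest!: holomorphic_on_imp_continuous_on)
  then have f: "(f \<longlongrightarrow> f a) (at a)" and g: "(g \<longlongrightarrow> g a) (at a)" by (simp_all add: isCont_def)
  have "\<forall>\<^sub>F t in at a. f t = g t"
    unfolding eventually_at
    by (rule exI[of _ r], intro conjI ballI impI assms(3), rule eq) (simp add: dist_commute)
  from Lim_transform_eventually[OF f this] show ?thesis by (rule tendsto_unique[OF at_neq_bot _ g])
qed

lemma ball_nonzero:
  fixes f :: "complex \<Rightarrow> complex"
  assumes "f holomorphic_on ball a r" "0 < r" "f a \<noteq> 0"
  shows "\<exists>r'>0. r' \<le> r \<and> (\<forall>t\<in>ball a r'. f t \<noteq> 0)"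
proof -
  have "isCont f a"
    using assms by (auto intro!: continuous_on_interior dest!: holomorphic_on_imp_continuous_on)
  from continuous_at_avoid[OF this assms(3)] obtain e where "e > 0" "\<forall>y. dist a y < e \<longrightarrow> f y \<noteq> 0" by blast
  then show ?thesis using assms(2) by (intro exI[of _ "min e r"]) auto
qed

text \<open>The analytic core of the extension property, without any gluing: in one of the four
  charts the solution becomes holomorphic across a.\<close>

definition resolves :: "complex \<Rightarrow> (complex \<Rightarrow> complex) \<Rightarrow> (complex \<Rightarrow> complex) \<Rightarrow> bool" where
  "resolves a x y \<longleftrightarrow> (\<exists>j\<in>{0, 1, 2, 3}. \<exists>P Q r. 0 < r \<and> P holomorphic_on ball a r \<and> Q holomorphic_on ball a r \<and>
     (\<forall>t\<in>ball a r - {a}. (j = 0 \<or> y t \<noteq> 0) \<and> chart_coord j (vector [x t, y t]) = vector [P t, Q t]))"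

lemma resolvesI:
  assumes "j \<in> {0, 1, 2, 3}" "0 < r" "P holomorphic_on ball a r" "Q holomorphic_on ball a r"
    "\<And>t. t \<in> ball a r - {a} ==> j = 0 \<or> y t \<noteq> 0"
    "\<And>t. t \<in> ball a r - {a} ==> chart_coord j (vector [x t, y t]) = vector [P t, Q t]"
  shows "resolves a x y"
  unfolding resolves_def
  by (rule bexI[OF _ assms(1)], rule exI[of _ P], rule exI[of _ Q], rule exI[of _ r], intro conjI ballI assms(2-6))

lemma eventually_ball:
  assumes "\<forall>\<^sub>F t in at (a :: complex). R t"
  obtains r where "0 < r" "\<And>t. t \<in> ball a r - {a} ==> R t"
proof -
  from assms obtain d where d: "0 < d \<and> (\<forall>t\<in>UNIV. t \<noteq> a \<and> dist t a < d \<longrightarrow> R t)"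
    unfolding eventually_at by (rule exE)
  show ?thesis
  proof (rule that)
    show "0 < d" using d by (rule conjunct1)
    fix t assume "t \<in> ball a d - {a}"
    then have "t \<noteq> a \<and> dist t a < d" by (simp add: dist_commute)
    then show "R t" by (rule mp[OF bspec[OF conjunct2[OF d] UNIV_I]])
  qed
qed

text \<open>What remains is y' = -y^2. Either y vanishes near a, or (1/y)' = 1, so that 1/y = t + c
  is the second coordinate of chart 1.\<close>

lemma resolves_x0:
  assumes r: "0 < r" and x: "\<And>t. t \<in> ball a r - {a} ==> x t = 0"
    and y: "\<And>t. t \<in> ball a r - {a} ==> (y has_field_derivative - (y t)\<^sup>2) (at t)"
    and my: "y meromorphic_on {a}"
  shows "resolves a x y"
proof (cases "\<exists>\<^sub>F t in at a. y t = 0")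
  case True
  then have "\<forall>\<^sub>F t in at a. y t = 0"
    using my by (intro not_essential_frequently_0_imp_eventually_0)
      (auto intro: meromorphic_on_isolated_singularity meromorphic_on_not_essential)
  then obtain e where e: "0 < e" "\<And>t. t \<in> ball a e - {a} ==> y t = 0" by (rule eventually_ball) blast
  show ?thesis
    by (rule resolvesI[of 0 "min r e" "\<lambda>_. 0" a "\<lambda>_. 0"]) (use r e x in "auto simp: chart_coord_def")
next
  case False
  then have "\<forall>\<^sub>F t in at a. y t \<noteq> 0" by (simp add: frequently_def)
  then obtain e where e: "0 < e" "\<And>t. t \<in> ball a e - {a} ==> y t \<noteq> 0" by (rule eventually_ball) blast
  have "((\<lambda>t. 1 / y t - t) has_field_derivative 0) (at t)" if "t \<in> ball a (min r e) - {a}" for t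
    using that e y by (auto intro!: derivative_eq_intros y simp: field_simps power2_eq_square)
  from punctured_const[OF this] obtain c where c: "\<forall>t\<in>ball a (min r e) - {a}. 1 / y t - t = c" by (rule exE)
  then have c': "1 / y t = c + t" if "t \<in> ball a (min r e) - {a}" for t using bspec[OF c that] by (simp add: algebra_simps)
  show ?thesis
    by (rule resolvesI[of 1 "min r e" "\<lambda>_. 0" a "\<lambda>t. c + t"])
      (use r e x c' in "auto simp: chart_coord_def intro!: holomorphic_intros")
qed

text \<open>Here n is the order of x at a and g the nonvanishing factor, so that the first equation
  gives y = x'/x = n / (t - a) + g'/g. Every meromorphic x that does not vanish identically near a
  has this form.\<close>

lemma resolves_factor:
  fixes n :: int
  assumes r: "0 < r" and g: "g holomorphic_on ball a r" "\<And>t. t \<in> ball a r ==> g t \<noteq> 0"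
    and xg: "\<And>t. t \<in> ball a r - {a} ==> x t = g t * (t - a) powi n"
    and x: "\<And>t. t \<in> ball a r - {a} ==> (x has_field_derivative x t * y t) (at t)"
    and y: "\<And>t. t \<in> ball a r - {a} ==> (y has_field_derivative 2 * (x t)\<^sup>2 - (y t)\<^sup>2) (at t)"
  shows "resolves a x y"
proof -
  let ?B = "ball a r" and ?B' = "ball a r - {a}"
  have op: "open ?B'" by (simp add: open_delete)
  have aB: "a \<in> ?B" using r by simp
  define q where "q t = deriv g t / g t" for t
  have q: "q holomorphic_on ?B" unfolding q_def using g by (auto intro!: holomorphic_intros)
  have gd: "(g has_field_derivative deriv g t) (at t)" if "t \<in> ?B" for t
    using g(1) that by (simp add: holomorphic_derivI)
  have qd: "(q has_field_derivative deriv q t) (at t)" if "t \<in> ?B" for t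
    using q that by (simp add: holomorphic_derivI)
  have yq: "y t = of_int n / (t - a) + q t" if t: "t \<in> ?B'" for t
  proof -
    have nz: "t - a \<noteq> 0" "g t \<noteq> 0" "(t - a) powi n \<noteq> 0" using t g(2) by auto
    have alg: "G * S + g * (m * (S / s)) = (g * S) * (m / s + G / g)" if "s \<noteq> 0" "g \<noteq> 0" for g G s S m :: complex
      using that by (simp add: field_simps)
    have "((\<lambda>t. g t * (t - a) powi n) has_field_derivative
        deriv g t * (t - a) powi n + g t * (of_int n * (t - a) powi (n - 1))) (at t)"
      using t nz by (auto intro!: derivative_eq_intros gd)
    moreover have "((\<lambda>t. g t * (t - a) powi n) has_field_derivative x t * y t) (at t)"
      by (rule has_field_derivative_transform_within_open[OF x[OF t] op t]) (simp add: xg)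
    ultimately have "deriv g t * (t - a) powi n + g t * (of_int n * (t - a) powi (n - 1)) = x t * y t"
      by (rule DERIV_unique)
    moreover have "(t - a) powi (n - 1) = (t - a) powi n / (t - a)" using nz by (simp add: power_int_diff)
    ultimately have "(g t * (t - a) powi n) * (of_int n / (t - a) + q t) = (g t * (t - a) powi n) * y t"
      using alg[OF nz(1,2), of "deriv g t" "(t - a) powi n" "of_int n"] xg[OF t] nz by (simp add: q_def)
    then show ?thesis using nz by simp
  qed
  \<comment> \<open>The equation for y' with y = n / (t - a) + q inserted, multiplied by (t - a)^2.
    A comparison of leading terms becomes an evaluation of holomorphic functions at a.\<close>
  have star: "2 * ((t - a) * x t)\<^sup>2 = of_int n * (of_int n - 1) + (t - a) * (2 * of_int n * q t)
      + (t - a)\<^sup>2 * (deriv q t + (q t)\<^sup>2)" if t: "t \<in> ?B'" for t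
  proof -
    have nz: "t - a \<noteq> 0" using t by auto
    have alg: "s\<^sup>2 * (- m / s\<^sup>2 + d + (m / s + e)\<^sup>2) = - m + s\<^sup>2 * d + (m + s * e)\<^sup>2" if "s \<noteq> 0" for s m d e :: complex
      using that by (simp add: field_simps power2_eq_square)
    have "((\<lambda>t. of_int n / (t - a) + q t) has_field_derivative - of_int n / (t - a)\<^sup>2 + deriv q t) (at t)"
      using t nz by (auto intro!: derivative_eq_intros qd simp: power2_eq_square)
    moreover have "((\<lambda>t. of_int n / (t - a) + q t) has_field_derivative 2 * (x t)\<^sup>2 - (y t)\<^sup>2) (at t)"
      by (rule has_field_derivative_transform_within_open[OF y[OF t] op t]) (simp add: yq)
    ultimately have "- of_int n / (t - a)\<^sup>2 + deriv q t = 2 * (x t)\<^sup>2 - (y t)\<^sup>2"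
      by (rule DERIV_unique)
    then have "2 * (x t)\<^sup>2 = - of_int n / (t - a)\<^sup>2 + deriv q t + (of_int n / (t - a) + q t)\<^sup>2"
      by (simp add: yq[OF t])
    then have "2 * ((t - a) * x t)\<^sup>2 = (t - a)\<^sup>2 * (- of_int n / (t - a)\<^sup>2 + deriv q t + (of_int n / (t - a) + q t)\<^sup>2)"
      by (simp add: power_mult_distrib)
    also have "\<dots> = - of_int n + (t - a)\<^sup>2 * deriv q t + (of_int n + (t - a) * q t)\<^sup>2"
      by (rule alg[OF nz])
    finally show ?thesis by (simp add: power2_eq_square algebra_simps)
  qed
  let ?L = "\<lambda>t. of_int n * (of_int n - 1) + (t - a) * (2 * of_int n * q t) + (t - a)\<^sup>2 * (deriv q t + (q t)\<^sup>2)"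
  have L: "?L holomorphic_on ?B" using q by (auto intro!: holomorphic_intros)
  show ?thesis
  proof (cases "n \<ge> 0")
    case True
    define m where "m = nat n"
    have n: "n = int m" using True by (simp add: m_def)
    have sx: "(t - a) * x t = g t * (t - a) ^ Suc m" if "t \<in> ?B'" for t
      using xg[OF that] by (simp add: n)
    \<comment> \<open>The left side vanishes at a because x has no pole there, and n (n - 1) = 0 is
      left.\<close>
    have "2 * (g a * (a - a) ^ Suc m)\<^sup>2 = ?L a"
      by (rule ball_limit_eq[where f="\<lambda>t. 2 * (g t * (t - a) ^ Suc m)\<^sup>2", OF _ L r]) (use g star sx in "auto intro!: holomorphic_intros")
    then have "of_int n * (of_int n - 1) = (0 :: complex)" by simp
    then have "m = 0 \<or> m = 1" by (auto simp: n)
    then show ?thesis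
    proof
      assume m: "m = 0"
      show ?thesis
        by (rule resolvesI[of 0 r g a q])
          (use r g q m in "auto simp: chart_coord_def xg yq n")
    next
      assume m: "m = 1"
      \<comment> \<open>Here x has a simple zero and y = d / (t - a) a simple pole with residue 1,
        so x y and 1/y are holomorphic near a: this is chart 1.\<close>
      let ?d = "\<lambda>t. 1 + (t - a) * q t"
      have "?d holomorphic_on ?B" using q by (auto intro!: holomorphic_intros)
      from ball_nonzero[OF this r] obtain e where e: "e > 0" "e \<le> r" "\<And>t. t \<in> ball a e ==> ?d t \<noteq> 0" by auto
      have sub: "ball a e \<subseteq> ?B" using e by auto
      note h = holomorphic_on_subset[OF _ sub]
      have yd: "y t = ?d t / (t - a)" if "t \<in> ball a e - {a}" for t
        using yq[of t] that sub by (auto simp: n m field_simps)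
      have xd: "x t = g t * (t - a)" if "t \<in> ball a e - {a}" for t
        using xg[of t] that sub by (auto simp: n m)
      show ?thesis
      proof (rule resolvesI[OF _ e(1), of 1 "\<lambda>t. g t * ?d t" a "\<lambda>t. (t - a) / ?d t"])
        show "(\<lambda>t. g t * ?d t) holomorphic_on ball a e"
          by (intro holomorphic_intros h[OF g(1)] h[OF q])
        show "(\<lambda>t. (t - a) / ?d t) holomorphic_on ball a e"
          by (intro holomorphic_intros h[OF q] e(3))
        fix t assume t: "t \<in> ball a e - {a}"
        have d: "?d t \<noteq> 0" by (rule e(3)) (use t in simp)
        have ta: "t - a \<noteq> 0" using t by simp
        have yt: "y t \<noteq> 0" unfolding yd[OF t] using d ta by simp
        then show "1 = (0::nat) \<or> y t \<noteq> 0" by (rule disjI2)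
        have "x t * y t = g t * ?d t" unfolding xd[OF t] yd[OF t] using ta by simp
        moreover have "1 / y t = (t - a) / ?d t" unfolding yd[OF t] by simp
        ultimately show "chart_coord 1 (vector [x t, y t]) = vector [g t * ?d t, (t - a) / ?d t]"
          by (simp add: chart_coord_def)
      qed simp
    qed
  next
    case False
    define m where "m = nat (- n - 1)"
    have n: "n = - int (Suc m)" using False by (simp add: m_def)
    have sx: "(t - a) ^ m * ((t - a) * x t) = g t" if t: "t \<in> ?B'" for t
    proof -
      have "x t = g t / (t - a) ^ Suc m"
        using xg[OF t] unfolding n power_int_minus power_int_of_nat by (simp add: divide_inverse)
      then show ?thesis using t by simp
    qed
    \<comment> \<open>If m > 0, the right side vanishes at a while g a is nonzero; so the pole of x
      is simple.\<close>
    have "2 * (g a)\<^sup>2 = ?L a * ((a - a) ^ m)\<^sup>2"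
    proof (rule ball_limit_eq[where f="\<lambda>t. 2 * (g t)\<^sup>2" and g="\<lambda>t. ?L t * ((t - a) ^ m)\<^sup>2", OF _ _ r])
      fix t assume t: "t \<in> ?B'"
      have "2 * (g t)\<^sup>2 = 2 * ((t - a) * x t)\<^sup>2 * ((t - a) ^ m)\<^sup>2"
        unfolding sx[OF t, symmetric] by (simp add: power_mult_distrib)
      then show "2 * (g t)\<^sup>2 = ?L t * ((t - a) ^ m)\<^sup>2" unfolding star[OF t] .
    qed (use g L in "auto intro!: holomorphic_intros")
    moreover have "g a \<noteq> 0" using g(2) aB by blast
    ultimately have m: "m = 0" by (cases m) simp_all
    \<comment> \<open>For n = -1 the right side at a is n (n - 1) = 2.\<close>
    have g1: "(g a)\<^sup>2 = 1" using \<open>2 * (g a)\<^sup>2 = _\<close> by (simp add: n m)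
    let ?d = "\<lambda>t. - 1 + (t - a) * q t"
    \<comment> \<open>The residues of x and y are g a and -1, so b is the limit of x/y, one of the
      centres 1 and -1.\<close>
    define b where "b = - g a"
    have b2: "b * b = 1" using g1 by (simp add: b_def power2_eq_square)
    \<comment> \<open>With w = x - b y and b^2 = 1, the system gives w' = w (-2 b x - y), and e is
      (t - a) times this logarithmic derivative. Its value 3 at a is the order to which w vanishes
      there.\<close>
    define e where "e t = 1 - 2 * b * g t - (t - a) * q t" for t
    have ea: "e a = 3" using b2 by (simp add: e_def b_def)
    define k where "k t = (if t = a then deriv e a else (e t - e a) / (t - a))" for t
    have "e holomorphic_on ?B" unfolding e_def using g q by (auto intro!: holomorphic_intros)
    then have k: "k holomorphic_on ?B" unfolding k_def by (rule pole_lemma_open) simp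
    have yd: "y t = ?d t / (t - a)" "x t = g t / (t - a)" if "t \<in> ?B'" for t
      using yq[OF that] xg[OF that] that by (auto simp: n m field_simps power_int_minus)
    \<comment> \<open>Since e = 3 + (t - a) k, dividing w by (t - a)^3 removes the singular part of
      the linear equation and leaves h' = h k with k holomorphic.\<close>
    define h where "h t = (x t - b * y t) / (t - a) ^ 3" for t
    have "(h has_field_derivative h t * k t) (at t)" if t: "t \<in> ?B'" for t
    proof -
      have nz: "t - a \<noteq> 0" using t by auto
      have alg: "s * (- 2 * b * (c / s) - (- 1 + s * d) / s) = 1 - 2 * b * c - s * d" if "s \<noteq> 0" for s c d :: complex
        using that by (simp add: field_simps)
      have alg2: "W * X * s ^ 3 - W * (3 * s ^ 2) = W * s ^ 2 * (s * X - 3)" for s W X :: complex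
        by (simp add: algebra_simps power2_eq_square power3_eq_cube)
      have alg3: "W * s ^ 2 * E / (s ^ 3 * s ^ 3) = W / s ^ 3 * (E / s)" if "s \<noteq> 0" for s W E :: complex
        using that by (simp add: power2_eq_square power3_eq_cube)
      have s: "(t - a) * (- 2 * b * x t - y t) = e t"
        unfolding yd[OF t] e_def by (rule alg[OF nz])
      let ?w = "x t - b * y t"
      have "x t * y t - b * (2 * (x t)\<^sup>2 - (y t)\<^sup>2) = ?w * (- 2 * b * x t - y t) + 2 * (1 - b * b) * x t * y t"
        by (simp add: algebra_simps power2_eq_square)
      then have w: "x t * y t - b * (2 * (x t)\<^sup>2 - (y t)\<^sup>2) = ?w * (- 2 * b * x t - y t)" using b2 by simp
      have d3: "((\<lambda>t. (t - a) ^ 3) has_field_derivative 3 * (t - a) ^ 2) (at t)"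
        by (auto intro!: derivative_eq_intros)
      have dw: "((\<lambda>t. x t - b * y t) has_field_derivative ?w * (- 2 * b * x t - y t)) (at t)"
        unfolding w[symmetric] by (intro DERIV_diff DERIV_cmult x[OF t] y[OF t])
      have "(?w * (- 2 * b * x t - y t) * (t - a) ^ 3 - ?w * (3 * (t - a) ^ 2)) / ((t - a) ^ 3 * (t - a) ^ 3)
          = ?w * (t - a) ^ 2 * (e t - 3) / ((t - a) ^ 3 * (t - a) ^ 3)"
        unfolding alg2 s by (rule refl)
      also have "\<dots> = ?w / (t - a) ^ 3 * ((e t - 3) / (t - a))"
        by (rule alg3[OF nz])
      also have "\<dots> = h t * k t" using nz by (simp add: h_def k_def ea)
      finally have eq: "(?w * (- 2 * b * x t - y t) * (t - a) ^ 3 - ?w * (3 * (t - a) ^ 2)) / ((t - a) ^ 3 * (t - a) ^ 3)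
          = h t * k t" .
      have "(h has_field_derivative (?w * (- 2 * b * x t - y t) * (t - a) ^ 3 - ?w * (3 * (t - a) ^ 2)) /
          ((t - a) ^ 3 * (t - a) ^ 3)) (at t)"
        unfolding h_def[abs_def] by (rule DERIV_divide[OF dw d3]) (use nz in simp)
      then show ?thesis unfolding eq .
    qed
    from punctured_linear_ode[OF k this] obtain H where H: "H holomorphic_on ?B" "\<And>t. t \<in> ?B' ==> h t = H t" by blast
    have "?d holomorphic_on ?B" using q by (auto intro!: holomorphic_intros)
    from ball_nonzero[OF this r] obtain c where c: "c > 0" "c \<le> r" "\<And>t. t \<in> ball a c ==> ?d t \<noteq> 0" by fastforce
    have sub: "ball a c \<subseteq> ?B" using c by auto
    note hs = holomorphic_on_subset[OF _ sub]
    have y0: "y t \<noteq> 0" "1 / y t = (t - a) / ?d t" and P: "y t ^ 3 * (x t - b * y t) = ?d t ^ 3 * H t"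
      if "t \<in> ball a c - {a}" for t
    proof -
      have t: "t \<in> ?B'" "t - a \<noteq> 0" using that sub by auto
      have d0: "?d t \<noteq> 0" by (rule c(3)) (use that in simp)
      note t = t d0
      show "y t \<noteq> 0" "1 / y t = (t - a) / ?d t" using t unfolding yd(1)[OF t(1)] by auto
      have "x t - b * y t = h t * (t - a) ^ 3" using t by (simp add: h_def)
      then show "y t ^ 3 * (x t - b * y t) = ?d t ^ 3 * H t"
        using t H(2)[OF t(1)] unfolding yd(1)[OF t(1)] by (simp add: power_divide)
    qed
    have "(b - 1) * (b + 1) = 0" using b2 by (simp add: algebra_simps)
    then have "b = 1 \<or> b = - 1" by (simp add: eq_neg_iff_add_eq_0)
    then consider "b = 1" | "b = - 1" by blast
    then obtain j :: nat where j: "j \<in> {0, 1, 2, 3}"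
      "\<And>x y. chart_coord j (vector [x, y]) = vector [y ^ 3 * (x - b * y), 1 / y]"
    proof cases
      case 1
      show ?thesis
        by (rule that[of 2]) (simp_all add: 1 chart_coord_def algebra_simps power3_eq_cube power4_eq_xxxx)
    next
      case 2
      show ?thesis
        by (rule that[of 3]) (simp_all add: 2 chart_coord_def algebra_simps power3_eq_cube power4_eq_xxxx)
    qed
    show ?thesis
    proof (rule resolvesI[OF j(1) c(1), of "\<lambda>t. ?d t ^ 3 * H t" a "\<lambda>t. (t - a) / ?d t"])
      show "(\<lambda>t. ?d t ^ 3 * H t) holomorphic_on ball a c"
        by (intro holomorphic_intros hs[OF H(1)] hs[OF q])
      show "(\<lambda>t. (t - a) / ?d t) holomorphic_on ball a c"
        by (intro holomorphic_intros hs[OF q] c(3))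
      fix t assume t: "t \<in> ball a c - {a}"
      show "j = 0 \<or> y t \<noteq> 0" by (rule disjI2, rule y0(1)[OF t])
      show "chart_coord j (vector [x t, y t]) = vector [?d t ^ 3 * H t, (t - a) / ?d t]"
        unfolding j(2) y0(2)[OF t] P[OF t] by (rule refl)
    qed
  qed
qed

lemma resolves_solution:
  assumes mx: "x meromorphic_on {a}" and my: "y meromorphic_on {a}"
    and r: "0 < r" and x: "\<And>t. t \<in> ball a r - {a} ==> (x has_field_derivative x t * y t) (at t)"
    and y: "\<And>t. t \<in> ball a r - {a} ==> (y has_field_derivative 2 * (x t)\<^sup>2 - (y t)\<^sup>2) (at t)"
  shows "resolves a x y"
proof -
  have mx': "isolated_singularity_at x a" "not_essential x a"
    using mx by (auto intro: meromorphic_on_isolated_singularity meromorphic_on_not_essential)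
  show ?thesis
  proof (cases "\<exists>\<^sub>F t in at a. x t \<noteq> 0")
    case True
    note zz = zorder_exist[OF mx' True]
    have z: "zor_poly x a a \<noteq> 0" by (rule conjunct1[OF zz])
    have "\<exists>r. 0 < r \<and> zor_poly x a holomorphic_on cball a r \<and>
        (\<forall>w\<in>cball a r - {a}. x w = zor_poly x a w * (w - a) powi zorder x a \<and> zor_poly x a w \<noteq> 0)"
      by (rule conjunct2[OF zz])
    then obtain e where e: "e > 0" "zor_poly x a holomorphic_on cball a e"
      "\<forall>w\<in>cball a e - {a}. x w = zor_poly x a w * (w - a) powi zorder x a \<and> zor_poly x a w \<noteq> 0"
      by (elim exE conjE) (rule that)
    show ?thesis
    proof (rule resolves_factor)
      show "0 < min e r" using e r by simp
      show "zor_poly x a holomorphic_on ball a (min e r)"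
        by (rule holomorphic_on_subset[OF e(2)]) auto
      fix t assume t: "t \<in> ball a (min e r) - {a}"
      then have t': "t \<in> cball a e - {a}" "t \<in> ball a r - {a}" by auto
      show "x t = zor_poly x a t * (t - a) powi zorder x a" using bspec[OF e(3) t'(1)] by (rule conjunct1)
      show "(x has_field_derivative x t * y t) (at t)"
        "(y has_field_derivative 2 * (x t)\<^sup>2 - (y t)\<^sup>2) (at t)"
        by (rule x[OF t'(2)] y[OF t'(2)])+
    next
      fix t assume "t \<in> ball a (min e r)"
      then show "zor_poly x a t \<noteq> 0" using z e(3) by (cases "t = a") auto
    qed
  next
    case False
    then have "\<forall>\<^sub>F t in at a. x t = 0" by (simp add: frequently_def)
    then obtain e where e: "0 < e" "\<And>t. t \<in> ball a e - {a} ==> x t = 0" by (rule eventually_ball) blast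
    show ?thesis
    proof (rule resolves_x0[OF _ _ _ my])
      show "0 < min e r" using e r by simp
      fix t assume t: "t \<in> ball a (min e r) - {a}"
      show "x t = 0" using e t by auto
      then show "(y has_field_derivative - (y t)\<^sup>2) (at t)" using y[of t] t by auto
    qed
  qed
qed

section \<open>The four charts inside one compact surface\<close>

abbreviation "JJ \<equiv> {0, 1, 2, 3 :: nat}"

definition ca :: "nat \<Rightarrow> complex" where "ca j = (if j = 2 then 1 else if j = 3 then - 1 else 0)"
text \<open>In the charts 1, 2, 3 one has x_j = (x/y - a) / (1/y)^n with a = \<open>ca j\<close> and
  n = \<open>nj j\<close>. This n is the number of blow-ups over a, so these charts are the last
  charts \<open>Cp\<close> of the three towers.\<close>

definition nj :: "nat \<Rightarrow> nat" where "nj j = (if j = 1 then 2 else 4)"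
definition nf :: "complex \<Rightarrow> nat" where "nf a = (if a = 0 then 2 else if a = 1 \<or> a = - 1 then 4 else 0)"

interpretation nf: brn nf
  by unfold_locales (auto simp: nf_def Br_def)

abbreviation "SS \<equiv> Surf nf"

definition Qp :: "nat \<Rightarrow> complex^2 \<Rightarrow> surface_point" where
  "Qp j = (if j = 0 then Zp else Cp (ca j) (nj j))"

lemma Qp_0: "Qp 0 = Zp"
  by (simp add: Qp_def)

lemma ca_nj: "j \<in> JJ ==> j \<noteq> 0 ==> ca j \<in> Br \<and> nf (ca j) = nj j"
  by (auto simp: ca_def nj_def nf_def Br_def)

lemma ca_inj: "j \<in> JJ ==> k \<in> JJ ==> j \<noteq> 0 ==> k \<noteq> 0 ==> j \<noteq> k ==> ca j \<noteq> ca k"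
  by (auto simp: ca_def)

lemma nj_pos: "1 \<le> nj j" "nj j = Suc (nj j - 1)"
  by (auto simp: nj_def)

lemma par_Qp:
  assumes "j \<in> JJ"
  shows "par SS UNIV (Qp j)"
proof (cases "j = 0")
  case True
  then show ?thesis using nf.par_Z by (simp add: Qp_def)
next
  case False
  have "CV (ca j) (nj j) = UNIV" using CV_Suc nj_pos(2) by metis
  then show ?thesis using nf.par_C[of "ca j"] ca_nj[OF assms False] False by (simp add: Qp_def)
qed

lemma Qp_inj: "j \<in> JJ ==> Qp j z = Qp j w ==> z = w"
  using par_inj[OF par_Qp] by (auto dest: injD)

lemma vec2_nth: "vector [v $ 1, v $ 2] = (v :: complex^2)"
  by (simp add: vec_eq_iff forall_2)

lemma chart_coord_eq:
  assumes "j \<in> JJ" "j \<noteq> 0"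
  shows "chart_coord j v = vector [v $ 2 ^ (nj j - 1) * (v $ 1 - ca j * v $ 2), 1 / v $ 2]"
  using assms by (auto simp: chart_coord_def ca_def nj_def Let_def algebra_simps power3_eq_cube power4_eq_xxxx)

lemma chart_coord_0: "chart_coord 0 v = v"
  by (simp add: chart_coord_def Let_def vec2_nth)

lemma Zp_Cp:
  assumes j: "j \<in> JJ" "j \<noteq> 0"
  shows "Zp z = Qp j w \<longleftrightarrow> w $ 2 \<noteq> 0 \<and> z = vector [(ca j + w $ 1 * w $ 2 ^ nj j) / w $ 2, 1 / w $ 2]"
proof (cases "w $ 2 = 0")
  case True
  then show ?thesis using nj_pos(1)[of j] j by (auto simp: Qp_def Cp_eq Zp_def exc_def)
next
  case False
  then show ?thesis using j
    by (auto simp: Qp_def Cp_eq Zp_def pline_Z_eq eq_commute[of "pline (vector [z $ 1, _, _])"] vec_eq_iff forall_2)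
qed

text \<open>Solving the formulas of chart j for (x, y) shows that all charts place a point of the
  plane at the same point of the surface. This is why gluing can be read as equality in the
  surface.\<close>

lemma Qp_chart:
  assumes j: "j \<in> JJ" and u: "u \<in> chart_dom j"
  shows "Qp j (chart_coord j u) = Zp u"
proof (cases "j = 0")
  case False
  have u2: "u $ 2 \<noteq> 0" using u False by (simp add: chart_dom_def)
  have alg: "(a + y ^ m * (x - a * y) * (1 / y) ^ Suc m) / (1 / y) = x" if "y \<noteq> 0" for a x y :: complex and m
    using that by (simp add: power_divide field_simps)
  have "Zp u = Qp j (chart_coord j u)"
    unfolding Zp_Cp[OF j False] chart_coord_eq[OF j False]
    using u2 alg[OF u2, where m="nj j - 1" and a="ca j" and x="u $ 1"] nj_pos(2)[of j]
    by (simp add: vec2_nth)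
  then show ?thesis by simp
qed (simp add: Qp_def chart_coord_0)

text \<open>The images share u and v. Since the centres differ, u can agree only where v is nonzero,
  that is, off the exceptional curves.\<close>

lemma Qp_Qp:
  assumes j: "j \<in> JJ" "k \<in> JJ" "j \<noteq> 0" "k \<noteq> 0" "j \<noteq> k" and eq: "Qp j z = Qp k w"
  shows "z $ 2 \<noteq> 0" "z $ 2 = w $ 2" "ca j + z $ 1 * z $ 2 ^ nj j = ca k + w $ 1 * w $ 2 ^ nj k"
proof -
  have n: "nj j \<noteq> 0" "nj k \<noteq> 0" using nj_pos(1)[of j] nj_pos(1)[of k] by auto
  have ne: "ca j \<noteq> ca k" using ca_inj j by blast
  have fs: "fst (Qp j z) = fst (Qp k w)" using eq by simp
  show z: "z $ 2 = w $ 2" and s: "ca j + z $ 1 * z $ 2 ^ nj j = ca k + w $ 1 * w $ 2 ^ nj k"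
    using fs j(3,4) by (auto simp: Qp_def fst_Cp pline_Y_eq)
  show "z $ 2 \<noteq> 0" using s z ne n by (auto simp: power_0_left)
qed

section \<open>Biregularity of the transitions expressed in the surface\<close>

lemma poly_fun_mono: "poly_fun (\<lambda>v. k * v $ 1 ^ a * v $ 2 ^ b)"
proof -
  have "(\<Sum>i\<le>max a b. \<Sum>j\<le>max a b. (if i = a \<and> j = b then k else 0) * v $ 1 ^ i * v $ 2 ^ j)
     = k * v $ 1 ^ a * v $ 2 ^ b" for v :: "complex^2"
  proof -
    have "(\<Sum>i\<le>max a b. \<Sum>j\<le>max a b. (if i = a \<and> j = b then k else 0) * v $ 1 ^ i * v $ 2 ^ j)
       = (\<Sum>i\<in>{a}. \<Sum>j\<le>max a b. (if i = a \<and> j = b then k else 0) * v $ 1 ^ i * v $ 2 ^ j)"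
      by (intro sum.mono_neutral_right) auto
    also have "\<dots> = (\<Sum>j\<le>max a b. (if a = a \<and> j = b then k else 0) * v $ 1 ^ a * v $ 2 ^ j)"
      by simp
    also have "\<dots> = (\<Sum>j\<in>{b}. (if a = a \<and> j = b then k else 0) * v $ 1 ^ a * v $ 2 ^ j)"
      by (intro sum.mono_neutral_right) auto
    also have "\<dots> = k * v $ 1 ^ a * v $ 2 ^ b" by simp
    finally show ?thesis .
  qed
  then show ?thesis unfolding poly_fun_def
    by (intro exI[of _ "max a b"] exI[of _ "\<lambda>i j. if i = a \<and> j = b then k else 0"]) simp
qed

lemma poly_fun_add:
  assumes "poly_fun P" "poly_fun R"
  shows "poly_fun (\<lambda>v. P v + R v)"
proof -
  obtain n c where c: "\<And>v. P v = (\<Sum>a\<le>n. \<Sum>b\<le>n. c a b * v $ 1 ^ a * v $ 2 ^ b)"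
    using assms(1) by (auto simp: poly_fun_def)
  obtain m d where d: "\<And>v. R v = (\<Sum>a\<le>m. \<Sum>b\<le>m. d a b * v $ 1 ^ a * v $ 2 ^ b)"
    using assms(2) by (auto simp: poly_fun_def)
  \<comment> \<open>Zero coefficients bring both double sums to the common range up to n +
    m.\<close>
  have pad: "(\<Sum>a\<le>n. \<Sum>b\<le>n. c a b * x ^ a * y ^ b) =
      (\<Sum>a\<le>n + m. \<Sum>b\<le>n + m. (if a \<le> n \<and> b \<le> n then c a b else 0) * x ^ a * y ^ b)"
    for n m and c :: "nat \<Rightarrow> nat \<Rightarrow> complex" and x y :: complex
  proof -
    have "(\<Sum>a\<le>n. \<Sum>b\<le>n. c a b * x ^ a * y ^ b) =
        (\<Sum>a\<le>n. \<Sum>b\<le>n + m. (if a \<le> n \<and> b \<le> n then c a b else 0) * x ^ a * y ^ b)"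
      by (intro sum.cong refl sum.mono_neutral_cong_left) auto
    also have "\<dots> = (\<Sum>a\<le>n + m. \<Sum>b\<le>n + m. (if a \<le> n \<and> b \<le> n then c a b else 0) * x ^ a * y ^ b)"
      by (intro sum.mono_neutral_left) auto
    finally show ?thesis .
  qed
  have "P v + R v = (\<Sum>a\<le>n + m. \<Sum>b\<le>n + m. ((if a \<le> n \<and> b \<le> n then c a b else 0) +
      (if a \<le> m \<and> b \<le> m then d a b else 0)) * v $ 1 ^ a * v $ 2 ^ b)" for v
    unfolding c d pad[of c _ _ n m] pad[of d _ _ m n] add.commute[of m n]
    by (simp only: sum.distrib[symmetric] distrib_right)
  then show ?thesis unfolding poly_fun_def
    by (intro exI[of _ "n + m"] exI[of _ "\<lambda>a b. (if a \<le> n \<and> b \<le> n then c a b else 0) +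
      (if a \<le> m \<and> b \<le> m then d a b else 0)"] allI)
qed

lemma poly_fun_nth: "poly_fun (\<lambda>v. v $ 1)" "poly_fun (\<lambda>v. v $ 2)" "poly_fun (\<lambda>_. c)" "poly_fun (\<lambda>v. v $ 2 ^ m)"
  using poly_fun_mono[of 1 1 0] poly_fun_mono[of 1 0 1] poly_fun_mono[of c 0 0] poly_fun_mono[of 1 0 m] by simp_all

lemma poly_fun_isCont:
  assumes "poly_fun P"
  shows "isCont P v"
proof -
  obtain n c where "P = (\<lambda>v. \<Sum>a\<le>n. \<Sum>b\<le>n. c a b * v $ 1 ^ a * v $ 2 ^ b)"
    using assms by (auto simp: poly_fun_def fun_eq_iff)
  then show ?thesis by (simp only:) (intro continuous_intros)
qed

lemma regularI:
  assumes "poly_fun N1" "poly_fun D1" "poly_fun N2" "poly_fun D2" "D1 v \<noteq> 0" "D2 v \<noteq> 0"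
    "w = vector [N1 v / D1 v, N2 v / D2 v]"
    "\<And>a b. (a, b) \<in> R ==> (D1 a \<noteq> 0 \<longrightarrow> b $ 1 = N1 a / D1 a) \<and> (D2 a \<noteq> 0 \<longrightarrow> b $ 2 = N2 a / D2 a)"
  shows "regular_with_value R v w"
  unfolding regular_with_value_def
  by (rule exI[of _ "\<lambda>i. if i = 1 then N1 else N2"], rule exI[of _ "\<lambda>i. if i = 1 then D1 else D2"])
    (use assms in "auto simp: forall_2")

abbreviation "TG \<equiv> transition_graph chart_dom chart_coord"

lemma Qp_graph:
  assumes "j \<in> JJ" "k \<in> JJ" "(a, b) \<in> TG j k"
  shows "Qp j a = Qp k b"
  using assms Qp_chart by (auto simp: transition_graph_def)

text \<open>For j \<noteq> k the transition has powers of the second coordinate as its only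
  denominators, and equal images in the surface force that coordinate to be nonzero.\<close>

lemma regular_of_eq:
  assumes j: "j \<in> JJ" "k \<in> JJ" and eq: "Qp j z = Qp k w"
  shows "regular_with_value (TG j k) z w"
proof -
  consider "j = k" | "j = 0" "k \<noteq> 0" | "j \<noteq> 0" "k = 0" | "j \<noteq> 0" "k \<noteq> 0" "j \<noteq> k"
    by (cases "j = k"; cases "j = 0"; cases "k = 0") auto
  then show ?thesis
  proof cases
    case 1
    then have w: "w = z" using Qp_inj[OF j(1)] eq by auto
    show ?thesis
    proof (rule regularI[of "\<lambda>v. v $ 1" "\<lambda>_. 1" "\<lambda>v. v $ 2" "\<lambda>_. 1"])
      fix a b assume "(a, b) \<in> TG j k"
      then have "a = b" using 1 by (auto simp: transition_graph_def)
      then show "(1 \<noteq> 0 \<longrightarrow> b $ 1 = a $ 1 / 1) \<and> (1 \<noteq> 0 \<longrightarrow> b $ 2 = a $ 2 / 1)" by simp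
    qed (simp_all add: poly_fun_nth w vec2_nth)
  next
    case 2
    have zw: "w $ 2 \<noteq> 0" "z = vector [(ca k + w $ 1 * w $ 2 ^ nj k) / w $ 2, 1 / w $ 2]"
    proof -
      have "Zp z = Qp k w" using eq unfolding 2(1) Qp_0 .
      then show "w $ 2 \<noteq> 0" "z = vector [(ca k + w $ 1 * w $ 2 ^ nj k) / w $ 2, 1 / w $ 2]"
        unfolding Zp_Cp[OF j(2) 2(2)] by blast+
    qed
    have z2: "z $ 2 \<noteq> 0" using zw by simp
    have "Qp k (chart_coord k z) = Qp k w"
    proof -
      have "z \<in> chart_dom k" using z2 by (simp add: chart_dom_def)
      from Qp_chart[OF j(2) this] show ?thesis using eq unfolding 2(1) Qp_0 by (rule trans)
    qed
    from Qp_inj[OF j(2) this] have w: "w = chart_coord k z" by (rule sym)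
    have N: "poly_fun (\<lambda>v. v $ 2 ^ (nj k - 1) * (v $ 1 - ca k * v $ 2))"
      using poly_fun_add[OF poly_fun_mono[of 1 1 "nj k - 1"] poly_fun_mono[of "- ca k" 0 "Suc (nj k - 1)"]]
      by (simp add: algebra_simps)
    show ?thesis
    proof (rule regularI[OF N poly_fun_nth(3)[of 1] poly_fun_nth(3)[of 1] poly_fun_nth(2)])
      fix a b assume "(a, b) \<in> TG j k"
      then have "b = chart_coord k a" using 2 by (auto simp: transition_graph_def chart_coord_0)
      then show "(1 \<noteq> 0 \<longrightarrow> b $ 1 = a $ 2 ^ (nj k - 1) * (a $ 1 - ca k * a $ 2) / 1) \<and> (a $ 2 \<noteq> 0 \<longrightarrow> b $ 2 = 1 / a $ 2)"
        by (simp add: chart_coord_eq[OF j(2) 2(2)])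
    qed (use z2 in "simp_all add: w chart_coord_eq[OF j(2) 2(2)]")
  next
    case 3
    have zw: "z $ 2 \<noteq> 0" "w = vector [(ca j + z $ 1 * z $ 2 ^ nj j) / z $ 2, 1 / z $ 2]"
    proof -
      have "Zp w = Qp j z" using eq unfolding 3(2) Qp_0 by (rule sym)
      then show "z $ 2 \<noteq> 0" "w = vector [(ca j + z $ 1 * z $ 2 ^ nj j) / z $ 2, 1 / z $ 2]"
        unfolding Zp_Cp[OF j(1) 3(1)] by blast+
    qed
    have N: "poly_fun (\<lambda>v. ca j + v $ 1 * v $ 2 ^ nj j)"
      using poly_fun_add[OF poly_fun_nth(3)[of "ca j"] poly_fun_mono[of 1 1 "nj j"]] by simp
    show ?thesis
    proof (rule regularI[OF N poly_fun_nth(2) poly_fun_nth(3)[of 1] poly_fun_nth(2)])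
      fix a b assume "(a, b) \<in> TG j k"
      from Qp_graph[OF j this] have "Zp b = Qp j a" using 3 by (simp add: Qp_def)
      then show "(a $ 2 \<noteq> 0 \<longrightarrow> b $ 1 = (ca j + a $ 1 * a $ 2 ^ nj j) / a $ 2) \<and> (a $ 2 \<noteq> 0 \<longrightarrow> b $ 2 = 1 / a $ 2)"
        unfolding Zp_Cp[OF j(1) 3(1)] by simp
    qed (use zw in simp_all)
  next
    case 4
    note q = Qp_Qp[OF j 4]
    have N: "poly_fun (\<lambda>v. ca j - ca k + v $ 1 * v $ 2 ^ nj j)"
      using poly_fun_add[OF poly_fun_nth(3)[of "ca j - ca k"] poly_fun_mono[of 1 1 "nj j"]] by simp
    have f: "b $ 1 = (ca j - ca k + a $ 1 * a $ 2 ^ nj j) / a $ 2 ^ nj k \<and> b $ 2 = a $ 2"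
      if "Qp j a = Qp k b" for a b
    proof -
      note q' = q[OF that]
      have "ca j - ca k + a $ 1 * a $ 2 ^ nj j = b $ 1 * a $ 2 ^ nj k" using q'(2,3) by (simp add: algebra_simps)
      then show ?thesis using q'(1,2) by simp
    qed
    show ?thesis
    proof (rule regularI[OF N poly_fun_nth(4)[of "nj k"] poly_fun_nth(2) poly_fun_nth(3)[of 1]])
      fix a b assume "(a, b) \<in> TG j k"
      from f[OF Qp_graph[OF j this]]
      show "(a $ 2 ^ nj k \<noteq> 0 \<longrightarrow> b $ 1 = (ca j - ca k + a $ 1 * a $ 2 ^ nj j) / a $ 2 ^ nj k) \<and> (1 \<noteq> 0 \<longrightarrow> b $ 2 = a $ 2 / 1)"
        by simp
    next
      show "z $ 2 ^ nj k \<noteq> 0" using q(1)[OF eq] by simp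
      show "w = vector [(ca j - ca k + z $ 1 * z $ 2 ^ nj j) / z $ 2 ^ nj k, z $ 2 / 1]"
        using f[OF eq] by (simp add: vec_eq_iff forall_2)
    qed simp
  qed
qed

text \<open>This supplies the generic points at which the quotients in a regular representation are
  bound to the actual transition.\<close>

lemma transition_graph_dense:
  assumes j: "j \<in> JJ" "k \<in> JJ" and a: "a $ 2 \<noteq> 0"
  shows "\<exists>b. (a, b) \<in> TG j k"
proof (cases "j = 0")
  case True
  then show ?thesis using a
    by (auto simp: transition_graph_def chart_coord_0 chart_dom_def intro!: exI[of _ "chart_coord k a"] exI[of _ a])
next
  case False
  let ?u = "vector [(ca j + a $ 1 * a $ 2 ^ nj j) / a $ 2, 1 / a $ 2] :: complex^2"
  have u: "?u \<in> chart_dom i" for i using a by (simp add: chart_dom_def)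
  have "Zp ?u = Qp j a" unfolding Zp_Cp[OF j(1) False] using a by simp
  then have "Qp j (chart_coord j ?u) = Qp j a" using Qp_chart[OF j(1) u] by simp
  then have "chart_coord j ?u = a" by (rule Qp_inj[OF j(1)])
  then show ?thesis using u unfolding transition_graph_def
    by (intro exI[of _ "chart_coord k ?u"] CollectI exI[of _ ?u]) simp
qed

lemma Qp_limit:
  assumes "j \<in> JJ" "(f \<longlongrightarrow> z) F"
  shows "limitin (mtop SS) (\<lambda>t. Qp j (f t)) (Qp j z) F"
proof -
  have c: "continuous_map euclidean (mtop SS) (Qp j)"
    using continuous_map_par[OF nf.at par_Qp[OF assms(1)]] by simp
  have "limitin euclidean f z F" using assms(2) by simp
  from continuous_map_limit[OF c this] show ?thesis by (simp add: comp_def)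
qed

text \<open>Both charts embed into the Hausdorff surface \<open>SS\<close>, so a value of a transition can be computed there
  as a limit of generic values.\<close>

lemma eq_of_regular:
  assumes j: "j \<in> JJ" "k \<in> JJ" and reg: "regular_with_value (TG j k) z w"
  shows "Qp j z = Qp k w"
proof -
  let ?G = "TG j k"
  obtain N D where ND: "\<forall>i::2. poly_fun (N i) \<and> poly_fun (D i) \<and> D i z \<noteq> 0 \<and> w $ i = N i z / D i z"
    and G: "\<forall>(a, b)\<in>?G. \<forall>i. D i a \<noteq> 0 \<longrightarrow> b $ i = N i a / D i a"
    using reg unfolding regular_with_value_def by (elim exE conjE) (rule that)
  \<comment> \<open>z is approached by moving its second coordinate only; for small t \<noteq> 0
    that coordinate is nonzero, so f t is a generic point.\<close>
  define f where "f t = (vector [z $ 1, z $ 2 + t] :: complex^2)" for t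
  have f: "(f \<longlongrightarrow> z) (at 0)"
  proof (rule vec_tendstoI)
    fix i :: 2
    show "((\<lambda>t. f t $ i) \<longlongrightarrow> z $ i) (at 0)"
    proof -
      have "(\<lambda>t. f t $ i) = (\<lambda>t. z $ i + (if i = 1 then 0 else t))"
        using exhaust_2[of i] by (auto simp: f_def fun_eq_iff)
      then show ?thesis by (simp only:, cases "i = 1") (auto intro!: tendsto_eq_intros)
    qed
  qed
  have lim: "((\<lambda>t. N i (f t) / D i (f t)) \<longlongrightarrow> w $ i) (at 0)" for i
    using ND poly_fun_isCont by (auto intro!: tendsto_divide isCont_tendsto_compose[OF _ f])
  have D0: "\<forall>\<^sub>F t in at 0. D i (f t) \<noteq> 0" for i
  proof -
    have "((\<lambda>t. D i (f t)) \<longlongrightarrow> D i z) (at 0)"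
      using ND poly_fun_isCont by (auto intro!: isCont_tendsto_compose[OF _ f])
    then show ?thesis using ND by (auto dest: tendsto_imp_eventually_ne)
  qed
  have f2: "\<forall>\<^sub>F t in at 0. f t $ 2 \<noteq> 0"
  proof (cases "z $ 2 = 0")
    case True
    then show ?thesis by (simp add: f_def eventually_at_filter)
  next
    case False
    have "((\<lambda>t. f t $ 2) \<longlongrightarrow> z $ 2) (at 0)" by (intro tendsto_intros f)
    then show ?thesis using False by (rule tendsto_imp_eventually_ne)
  qed
  define g where "g t = (\<chi> i. N i (f t) / D i (f t))" for t
  have g: "(g \<longlongrightarrow> w) (at 0)"
    by (rule vec_tendstoI) (use lim in "simp add: g_def")
  have ev: "\<forall>\<^sub>F t in at 0. Qp j (f t) = Qp k (g t)"
    using f2 D0[of 1] D0[of 2]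
  proof eventually_elim
    case (elim t)
    obtain b where b: "(f t, b) \<in> ?G" using transition_graph_dense[OF j elim(1)] by blast
    have "b = g t" using bspec[OF G b] elim by (simp add: g_def vec_eq_iff forall_2)
    then show ?case using Qp_graph[OF j b] by simp
  qed
  have "limitin (mtop SS) (\<lambda>t. Qp j (f t)) (Qp k w) (at 0)"
    by (rule limitin_transform_eventually[OF _ Qp_limit[OF j(2) g]]) (use ev in eventually_elim, simp)
  moreover have "Hausdorff_space (mtop SS)"
    using nf.complex_manifold_Surf by (simp add: complex_manifold_def)
  ultimately show ?thesis
    using limitin_Hausdorff_unique[OF Qp_limit[OF j(1) f]] at_neq_bot by blast
qed

section \<open>The glued phase space as a complex manifold\<close>

abbreviation "GR \<equiv> glue_rel JJ chart_dom chart_coord"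

text \<open>Equality of points of the surface is visibly an equivalence relation, whereas
  transitivity is not apparent from biregularity of the birational transitions.\<close>

lemma glue_iff: "((j, v), (k, w)) \<in> GR \<longleftrightarrow>
    j \<in> JJ \<and> k \<in> JJ \<and> v $ 3 = w $ 3 \<and> Qp j (xy v) = Qp k (xy w)"
proof
  assume "((j, v), (k, w)) \<in> GR"
  then have "j \<in> JJ" "k \<in> JJ" "v $ 3 = w $ 3"
    "regular_with_value (TG j k) (xy v) (xy w)"
    unfolding glue_rel_def by blast+
  then show "j \<in> JJ \<and> k \<in> JJ \<and> v $ 3 = w $ 3 \<and> Qp j (xy v) = Qp k (xy w)"
    using eq_of_regular by blast
next
  assume a: "j \<in> JJ \<and> k \<in> JJ \<and> v $ 3 = w $ 3 \<and> Qp j (xy v) = Qp k (xy w)"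
  then have jk: "j \<in> JJ" "k \<in> JJ" and v: "v $ 3 = w $ 3" and q: "Qp j (xy v) = Qp k (xy w)"
    by (rule conjunct1, (rule conjunct2 conjunct1)+)?
      (use a in blast)+
  show "((j, v), (k, w)) \<in> GR"
    unfolding glue_rel_def
    using jk v regular_of_eq[OF jk q] regular_of_eq[OF jk(2,1) q[symmetric]] by simp
qed

abbreviation "gc \<equiv> glue_class JJ chart_dom chart_coord"

lemma gc_mem: "j \<in> JJ ==> (k, w) \<in> gc j v \<longleftrightarrow> k \<in> JJ \<and> v $ 3 = w $ 3 \<and> Qp j (xy v) = Qp k (xy w)"
  unfolding glue_class_def Image_singleton_iff glue_iff by blast

lemma gc_eq:
  assumes j: "j \<in> JJ" "k \<in> JJ"
  shows "gc j v = gc k w \<longleftrightarrow> v $ 3 = w $ 3 \<and> Qp j (xy v) = Qp k (xy w)"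
proof
  assume "gc j v = gc k w"
  moreover have "(k, w) \<in> gc k w" using gc_mem[OF j(2)] j(2) by blast
  ultimately have "(k, w) \<in> gc j v" by simp
  then show "v $ 3 = w $ 3 \<and> Qp j (xy v) = Qp k (xy w)" using gc_mem[OF j(1)] by blast
next
  assume e: "v $ 3 = w $ 3 \<and> Qp j (xy v) = Qp k (xy w)"
  have "(l, u) \<in> gc j v \<longleftrightarrow> (l, u) \<in> gc k w" for l u
    unfolding gc_mem[OF j(1)] gc_mem[OF j(2)] using e by simp
  then show "gc j v = gc k w" by auto
qed

lemma equiv_glue: "equiv (JJ \<times> UNIV) (GR)"
proof (rule equivI)
  show "GR \<subseteq> (JJ \<times> UNIV) \<times> (JJ \<times> UNIV)"
    unfolding glue_rel_def by auto
  show "refl_on (JJ \<times> UNIV) (GR)"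
    unfolding refl_on_def by (simp only: split_paired_Ball_Sigma glue_iff) simp
  show "sym (GR)"
    unfolding sym_def split_paired_All glue_iff by simp
  show "trans (GR)"
    unfolding trans_def split_paired_All glue_iff by auto
qed

definition v3 :: "complex^2 \<Rightarrow> complex \<Rightarrow> complex^3" where "v3 z t = vector [z $ 1, z $ 2, t]"

lemma v3_simps [simp]: "xy (v3 z t) = z" "v3 z t $ 3 = t" "v3 (xy v) (v $ 3) = v"
  by (simp_all add: xy_def v3_def vec_eq_iff forall_2 forall_3)

lemma cdv_xy: "cdv xy v"
  unfolding xy_def[abs_def] by (intro cd)

lemma cdv_v3: "cdv f x ==> cdiff g x ==> cdv (\<lambda>y. v3 (f y) (g y)) x"
  unfolding v3_def by (intro cd cdv_nth)

lemma gc_inj: "j \<in> JJ ==> inj (gc j)"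
  by (rule injI) (metis gc_eq Qp_inj v3_simps(3))

lemma glued_patl: "glued_atlas JJ chart_dom chart_coord = patl JJ (\<lambda>_. UNIV) gc"
  by (simp add: glued_atlas_def patl_def)

lemma fac_Qp:
  assumes "j \<in> JJ" "k \<in> JJ" "Qp j z = Qp k w"
  shows "fac (Qp j) z (Qp k) UNIV"
  by (rule par_fac[OF nf.at par_Qp par_Qp UNIV_I UNIV_I]) (use assms in simp_all)

lemma fac_gc:
  assumes j: "j \<in> JJ" "k \<in> JJ" and eq: "gc j v = gc k w"
  shows "fac (gc j) v (gc k) UNIV"
proof -
  have "fac (Qp j) (xy v) (Qp k) UNIV" using fac_Qp[OF j] eq gc_eq[OF j] by blast
  then obtain W \<tau> where W: "open W" "xy v \<in> W" "\<forall>y\<in>W. \<tau> y \<in> UNIV \<and> Qp j y = Qp k (\<tau> y) \<and> cdv \<tau> y"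
    unfolding fac_def by (elim exE conjE) (rule that)
  show ?thesis
  proof (rule facI[where W="{y. xy y \<in> W}" and \<tau>="\<lambda>y. v3 (\<tau> (xy y)) (y $ 3)"])
    show "open {y. xy y \<in> W}" using cdv_open_vimage[OF open_UNIV cdv_xy W(1)] by simp
    fix y assume y: "y \<in> {y. xy y \<in> W}"
    show "gc j y = gc k (v3 (\<tau> (xy y)) (y $ 3))"
      unfolding gc_eq[OF j] using W(3) y by simp
    show "cdv (\<lambda>y. v3 (\<tau> (xy y)) (y $ 3)) y"
      by (intro cdv_v3 cdiff_nth cdv_compose[OF cdv_xy]) (use W(3) y in simp)
  qed (use W in auto)
qed

lemma is_atlas_phase: "is_atlas phase_atlas"
  unfolding phase_atlas_def glued_patl
  by (rule is_atlas_patl[OF open_UNIV gc_inj fac_gc])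

lemma pts_phase: "pts phase_atlas = (\<Union>j\<in>JJ. range (gc j))"
  unfolding phase_atlas_def glued_patl by (rule pts_patl)

lemma lpar_gc: "j \<in> JJ ==> lpar phase_atlas UNIV (gc j)"
  unfolding phase_atlas_def glued_patl by (rule lpar_patl[where I=JJ and V="\<lambda>_. UNIV" and P=gc, OF _ open_UNIV gc_inj])

lemma time_of_gc: "j \<in> JJ ==> time_of (gc j v) = v $ 3"
  unfolding time_of_def
proof (rule the_equality)
  assume j: "j \<in> JJ"
  show "\<exists>k w. (k, w) \<in> gc j v \<and> w $ 3 = v $ 3"
    by (rule exI[of _ j], rule exI[of _ v]) (unfold gc_mem[OF j], use j in blast)
  show "t = v $ 3" if "\<exists>k w. (k, w) \<in> gc j v \<and> w $ 3 = t" for t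
    using that unfolding gc_mem[OF j] by (elim exE conjE) simp
qed

text \<open>All members of a gluing class have the same image in the compact surface; this map takes
  that image and forgets the time.\<close>

definition th :: "glue_point \<Rightarrow> surface_point" where
  "th p = (THE s. \<exists>j v. (j, v) \<in> p \<and> Qp j (xy v) = s)"

lemma th_gc: "j \<in> JJ ==> th (gc j v) = Qp j (xy v)"
  unfolding th_def
proof (rule the_equality)
  assume j: "j \<in> JJ"
  show "\<exists>k w. (k, w) \<in> gc j v \<and> Qp k (xy w) = Qp j (xy v)"
    by (rule exI[of _ j], rule exI[of _ v]) (unfold gc_mem[OF j], use j in blast)
  show "t = Qp j (xy v)" if "\<exists>k w. (k, w) \<in> gc j v \<and> Qp k (xy w) = t" for t
    using that unfolding gc_mem[OF j] by (elim exE conjE) simp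
qed

lemma phase_cases:
  assumes "p \<in> pts phase_atlas"
  obtains j v where "j \<in> JJ" "p = gc j v"
  using assms unfolding pts_phase by blast

lemma continuous_phase:
  assumes "\<And>j. j \<in> JJ ==> continuous_map euclidean X (\<lambda>v. f (gc j v))"
  shows "continuous_map (mtop phase_atlas) X f"
proof (rule continuous_mapI_par[OF is_atlas_phase])
  fix p assume "p \<in> pts phase_atlas"
  then obtain j v where p: "j \<in> JJ" "p = gc j v" by (rule phase_cases)
  show "\<exists>V P. par phase_atlas V P \<and> p \<in> P ` V \<and> continuous_map (top_of_set V) X (\<lambda>z. f (P z))"
    by (rule exI[of _ UNIV], rule exI[of _ "gc j"]) (use lpar_par[OF lpar_gc] assms p in simp)
qed

text \<open>Distinct points differ in time or in their image in the surface, and both are continuous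
  maps to Hausdorff spaces.\<close>

lemma Hausdorff_phase: "Hausdorff_space (mtop phase_atlas)"
  unfolding Hausdorff_space_def topspace_mtop[OF is_atlas_phase]
proof (intro allI impI, elim conjE)
  fix p q assume p: "p \<in> pts phase_atlas" and q: "q \<in> pts phase_atlas" and ne: "p \<noteq> q"
  have tp: "p \<in> topspace (mtop phase_atlas)" "q \<in> topspace (mtop phase_atlas)"
    using p q topspace_mtop[OF is_atlas_phase] by simp_all
  obtain j v where jv: "j \<in> JJ" "p = gc j v" using p by (rule phase_cases)
  obtain k w where kw: "k \<in> JJ" "q = gc k w" using q by (rule phase_cases)
  have "time_of p \<noteq> time_of q \<or> th p \<noteq> th q"
    using ne gc_eq[OF jv(1) kw(1)] unfolding jv(2) kw(2) time_of_gc[OF jv(1)] time_of_gc[OF kw(1)] th_gc[OF jv(1)] th_gc[OF kw(1)]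
    by blast
  then show "\<exists>U V. openin (mtop phase_atlas) U \<and> openin (mtop phase_atlas) V \<and> p \<in> U \<and> q \<in> V \<and> disjnt U V"
  proof
    assume t: "time_of p \<noteq> time_of q"
    have c: "continuous_map (mtop phase_atlas) euclidean time_of"
    proof (rule continuous_phase)
      show "continuous_map euclidean euclidean (\<lambda>v. time_of (gc i v))" if "i \<in> JJ" for i
        unfolding time_of_gc[OF that] by (simp add: continuous_intros)
    qed
    show ?thesis by (rule separated_by_map[OF c Hausdorff_space_euclidean t tp])
  next
    assume t: "th p \<noteq> th q"
    have c: "continuous_map (mtop phase_atlas) (mtop SS) th"
    proof (rule continuous_phase)
      fix i assume i: "i \<in> JJ"
      have 1: "continuous_map euclidean euclidean xy"
        using cdv_isCont[OF cdv_xy] by (simp add: continuous_at_imp_continuous_on)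
      have 2: "continuous_map euclidean (mtop SS) (Qp i)"
        using continuous_map_par[OF nf.at par_Qp[OF i]] by simp
      show "continuous_map euclidean (mtop SS) (\<lambda>v. th (gc i v))"
        unfolding th_gc[OF i] using continuous_map_compose[OF 1 2] by (simp add: comp_def)
    qed
    have H: "Hausdorff_space (mtop SS)"
      using nf.complex_manifold_Surf by (simp add: complex_manifold_def)
    show ?thesis by (rule separated_by_map[OF c H t tp])
  qed
qed

lemma complex_manifold_phase: "complex_manifold phase_atlas"
  unfolding complex_manifold_def
  by (intro conjI is_atlas_phase Hausdorff_phase second_countable_mtop)
    (simp add: phase_atlas_def glued_atlas_def)

section \<open>The system in the four charts\<close>

definition gR :: "nat \<Rightarrow> complex^2 \<Rightarrow> complex^2" where
  "gR j v = (let p = v $ 1; q = v $ 2 in if j = 0 then vector [p * q, 2 * p ^ 2 - q ^ 2]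
     else if j = 1 then vector [2 * p ^ 3 * q ^ 3, 1 - 2 * p ^ 2 * q ^ 4]
     else vector [10 * ca j * p ^ 2 * q ^ 3 + 6 * p ^ 3 * q ^ 7, - 1 - 4 * ca j * p * q ^ 4 - 2 * p ^ 2 * q ^ 8])"

lemma poly_gR: "poly_fun (\<lambda>v. gR j v $ i)"
proof -
  have 1: "poly_fun (\<lambda>v. v $ 1 * v $ 2)" using poly_fun_mono[of 1 1 1] by simp
  have 2: "poly_fun (\<lambda>v. 2 * v $ 1 ^ 2 - v $ 2 ^ 2)"
    using poly_fun_add[OF poly_fun_mono[of 2 2 0] poly_fun_mono[of "- 1" 0 2]] by simp
  have 3: "poly_fun (\<lambda>v. 2 * v $ 1 ^ 3 * v $ 2 ^ 3)" by (rule poly_fun_mono)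
  have 4: "poly_fun (\<lambda>v. 1 - 2 * v $ 1 ^ 2 * v $ 2 ^ 4)"
    using poly_fun_add[OF poly_fun_nth(3)[of 1] poly_fun_mono[of "- 2" 2 4]] by simp
  have 5: "poly_fun (\<lambda>v. 10 * ca j * v $ 1 ^ 2 * v $ 2 ^ 3 + 6 * v $ 1 ^ 3 * v $ 2 ^ 7)"
    by (rule poly_fun_add[OF poly_fun_mono poly_fun_mono])
  have 6: "poly_fun (\<lambda>v. - 1 - 4 * ca j * v $ 1 * v $ 2 ^ 4 - 2 * v $ 1 ^ 2 * v $ 2 ^ 8)"
    using poly_fun_add[OF poly_fun_add[OF poly_fun_nth(3)[of "- 1"] poly_fun_mono[of "- 4 * ca j" 1 4]] poly_fun_mono[of "- 2" 2 8]]
    by simp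
  show ?thesis
    using 1 2 3 4 5 6 exhaust_2[of i] by (cases "j = 0"; cases "j = 1") (auto simp: gR_def Let_def)
qed

lemma poly_rhs_gR: "poly_rhs (\<lambda>_. gR j)"
  unfolding poly_rhs_def
proof
  fix i
  obtain n c where "\<forall>v. gR j v $ i = (\<Sum>a\<le>n. \<Sum>b\<le>n. c a b * v $ 1 ^ a * v $ 2 ^ b)"
    using poly_gR[of j i] unfolding poly_fun_def by (elim exE) (rule that)
  then show "\<exists>(n::nat) c. (\<forall>a b. c a b holomorphic_on UNIV) \<and>
        (\<forall>t v. gR j v $ i = (\<Sum>a\<le>n. \<Sum>b\<le>n. c a b t * (v $ 1) ^ a * (v $ 2) ^ b))"
    by (intro exI[of _ n] exI[of _ "\<lambda>a b _. c a b"]) simp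
qed

lemma rhs_gR: "rhs t = gR 0"
  by (simp add: rhs_def gR_def fun_eq_iff Let_def)

lemma solves_iff: "solves f T u \<longleftrightarrow> (\<forall>t\<in>T. ((\<lambda>s. u s $ 1) has_field_derivative f t (u t) $ 1) (at t) \<and>
    ((\<lambda>s. u s $ 2) has_field_derivative f t (u t) $ 2) (at t))"
  by (simp add: solves_def forall_2)

text \<open>Put W = X - a Y and use a^2 = 1: the two contributions 3 Y^4 W and -3 Y^4 W cancel,
  which is where the exponent 3 is decisive. The remaining terms are polynomial in p = Y^3 W and q =
  1/Y.\<close>

lemma gR_forward_poly:
  fixes X Y a :: complex
  assumes a: "a = 1 \<or> a = - 1"
  shows "3 * Y ^ 2 * (2 * X ^ 2 - Y ^ 2) * (X - a * Y) + Y ^ 3 * (X * Y - a * (2 * X ^ 2 - Y ^ 2)) =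
      10 * a * (Y ^ 3 * (X - a * Y) ^ 2) + 6 * (Y ^ 2 * (X - a * Y) ^ 3)"
  using a by (elim disjE) (simp_all add: algebra_simps eval_nat_numeral)

lemma gR_forward_frac:
  fixes X Y a :: complex
  assumes a: "a = 1 \<or> a = - 1" and Y: "Y \<noteq> 0"
  shows "- (2 * X ^ 2 - Y ^ 2) / Y ^ 2 = - 1 - 4 * a * ((X - a * Y) / Y) - 2 * ((X - a * Y) ^ 2 / Y ^ 2)"
proof -
  define R where "R = X / Y"
  have 1: "(X - a * Y) / Y = R - a" using Y by (simp add: R_def diff_divide_distrib)
  have 2: "(X - a * Y) ^ 2 / Y ^ 2 = (R - a) ^ 2" unfolding 1[symmetric] by (rule power_divide[symmetric])
  have 3: "- (2 * X ^ 2 - Y ^ 2) / Y ^ 2 = 1 - 2 * R ^ 2"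
    using Y by (simp add: R_def power_divide diff_divide_distrib)
  show ?thesis unfolding 1 2 3 using a by (elim disjE) (simp_all add: power2_eq_square algebra_simps)
qed

lemma gR_forward_power:
  fixes Y W :: complex
  assumes "Y \<noteq> 0"
  shows "(Y ^ 3 * W) ^ 2 * (1 / Y) ^ 3 = Y ^ 3 * W ^ 2" "(Y ^ 3 * W) ^ 3 * (1 / Y) ^ 7 = Y ^ 2 * W ^ 3"
    "(Y ^ 3 * W) * (1 / Y) ^ 4 = W / Y" "(Y ^ 3 * W) ^ 2 * (1 / Y) ^ 8 = W ^ 2 / Y ^ 2"
  using assms by (simp_all add: field_simps eval_nat_numeral)

lemma ca_cases: "j \<in> JJ ==> j \<noteq> 0 ==> j = 1 \<or> j \<noteq> 1 \<and> (ca j = 1 \<or> ca j = - 1) \<and> nj j = 4"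
  by (auto simp: ca_def nj_def)

lemma gR_forward:
  fixes X Y :: complex
  assumes j: "j \<in> JJ" "j \<noteq> 0" and Y: "Y \<noteq> 0"
  shows "of_nat (nj j - 1) * Y ^ (nj j - 1 - 1) * (2 * X ^ 2 - Y ^ 2) * (X - ca j * Y)
      + Y ^ (nj j - 1) * (X * Y - ca j * (2 * X ^ 2 - Y ^ 2)) = gR j (vector [Y ^ (nj j - 1) * (X - ca j * Y), 1 / Y]) $ 1"
    and "- (2 * X ^ 2 - Y ^ 2) / Y ^ 2 = gR j (vector [Y ^ (nj j - 1) * (X - ca j * Y), 1 / Y]) $ 2"
proof (atomize(full), cases "j = 1")
  case True
  have "2 * (Y * X) ^ 3 * (1 / Y) ^ 3 = 2 * X ^ 3" "1 - 2 * (Y * X) ^ 2 * (1 / Y) ^ 4 = - (2 * X ^ 2 - Y ^ 2) / Y ^ 2"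
    using Y by (simp_all add: field_simps power2_eq_square power3_eq_cube power4_eq_xxxx)
  moreover have "(2 * X ^ 2 - Y ^ 2) * X + Y * (X * Y) = 2 * X ^ 3"
    by (simp add: algebra_simps power2_eq_square power3_eq_cube)
  ultimately show "of_nat (nj j - 1) * Y ^ (nj j - 1 - 1) * (2 * X ^ 2 - Y ^ 2) * (X - ca j * Y)
      + Y ^ (nj j - 1) * (X * Y - ca j * (2 * X ^ 2 - Y ^ 2)) = gR j (vector [Y ^ (nj j - 1) * (X - ca j * Y), 1 / Y]) $ 1 \<and>
      - (2 * X ^ 2 - Y ^ 2) / Y ^ 2 = gR j (vector [Y ^ (nj j - 1) * (X - ca j * Y), 1 / Y]) $ 2"
    using True by (simp add: gR_def ca_def nj_def)
next
  case False
  then have a: "ca j = 1 \<or> ca j = - 1" and n: "nj j = 4" using ca_cases[OF j] by blast+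
  have g: "gR j (vector [p, q]) = vector [10 * ca j * (p ^ 2 * q ^ 3) + 6 * (p ^ 3 * q ^ 7),
      - 1 - 4 * ca j * (p * q ^ 4) - 2 * (p ^ 2 * q ^ 8)]" for p q
    using j False by (simp add: gR_def mult.assoc)
  have n3: "nj j - 1 = 3" using n by simp
  show "of_nat (nj j - 1) * Y ^ (nj j - 1 - 1) * (2 * X ^ 2 - Y ^ 2) * (X - ca j * Y)
      + Y ^ (nj j - 1) * (X * Y - ca j * (2 * X ^ 2 - Y ^ 2)) = gR j (vector [Y ^ (nj j - 1) * (X - ca j * Y), 1 / Y]) $ 1 \<and>
      - (2 * X ^ 2 - Y ^ 2) / Y ^ 2 = gR j (vector [Y ^ (nj j - 1) * (X - ca j * Y), 1 / Y]) $ 2"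
    using gR_forward_poly[OF a, of Y X] gR_forward_frac[OF a Y, of X]
    unfolding n3 g vector_2 gR_forward_power[OF Y] by simp
qed

text \<open>These are the equations for x = u / q and y = 1 / q, cleared of denominators. In terms
  of s = p q^n, n = \<open>nj j\<close>, both Q and P q^(n + 1) are polynomials in s alone, so the
  identities reduce to one variable.\<close>

lemma gR_backward:
  fixes p q :: complex
  assumes j: "j \<in> JJ" "j \<noteq> 0"
  defines "u \<equiv> ca j + p * q ^ nj j" and "P \<equiv> gR j (vector [p, q]) $ 1" and "Q \<equiv> gR j (vector [p, q]) $ 2"
  shows "(P * q ^ nj j + p * (of_nat (nj j) * q ^ (nj j - 1) * Q)) * q - u * Q = u" and "- Q = 2 * u ^ 2 - 1"
proof (atomize(full), cases "j = 1")
  case True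
  define s where "s = p * q ^ 2"
  have Q: "Q = 1 - 2 * s ^ 2" and P: "P * q ^ 2 * q = 2 * s ^ 3" and u: "u = s" and n: "nj j = 2"
    using True by (simp_all add: gR_def s_def P_def Q_def u_def ca_def nj_def eval_nat_numeral)
  have "(P * q ^ 2 + p * (of_nat 2 * q ^ (2 - 1) * Q)) * q = 2 * s ^ 3 + 2 * s * Q"
    unfolding P[symmetric] by (simp add: s_def power2_eq_square algebra_simps)
  then show "(P * q ^ nj j + p * (of_nat (nj j) * q ^ (nj j - 1) * Q)) * q - u * Q = u \<and> - Q = 2 * u ^ 2 - 1"
    unfolding n by (simp only: u Q) (simp add: algebra_simps power2_eq_square power3_eq_cube)
next
  case False
  then have a: "ca j = 1 \<or> ca j = - 1" and n: "nj j = 4" using ca_cases[OF j] by blast+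
  define s where "s = p * q ^ 4"
  have Q: "Q = - 1 - 4 * ca j * s - 2 * s ^ 2" and u: "u = ca j + s"
    using False j n by (simp_all add: gR_def s_def Q_def u_def power_mult_distrib flip: power_mult)
  have P: "P * q ^ 4 * q = 10 * ca j * s ^ 2 + 6 * s ^ 3"
    using False j by (simp add: gR_def s_def P_def eval_nat_numeral algebra_simps)
  have "(P * q ^ 4 + p * (of_nat 4 * q ^ (4 - 1) * Q)) * q = 10 * ca j * s ^ 2 + 6 * s ^ 3 + 4 * s * Q"
    unfolding P[symmetric] by (simp add: s_def eval_nat_numeral algebra_simps)
  then show "(P * q ^ nj j + p * (of_nat (nj j) * q ^ (nj j - 1) * Q)) * q - u * Q = u \<and> - Q = 2 * u ^ 2 - 1"
    unfolding n using a by (elim disjE; simp only: u Q) (simp_all add: algebra_simps power2_eq_square power3_eq_cube)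
qed

lemma forward_deriv:
  fixes x y :: "complex \<Rightarrow> complex"
  assumes "(x has_field_derivative X) (at t)" "(y has_field_derivative Y) (at t)"
  shows "((\<lambda>s. y s ^ m * (x s - a * y s)) has_field_derivative
      of_nat m * y t ^ (m - 1) * Y * (x t - a * y t) + y t ^ m * (X - a * Y)) (at t)"
  using assms by (auto intro!: derivative_eq_intros simp: mult_ac)

lemma backward_deriv:
  fixes p q :: "complex \<Rightarrow> complex"
  assumes "(p has_field_derivative P) (at t)" "(q has_field_derivative Q) (at t)" "q t \<noteq> 0"
  shows "((\<lambda>s. (a + p s * q s ^ n) / q s) has_field_derivative
      ((P * q t ^ n + p t * (of_nat n * q t ^ (n - 1) * Q)) * q t - (a + p t * q t ^ n) * Q) / (q t * q t)) (at t)"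
  using assms by (auto intro!: derivative_eq_intros simp: mult_ac add_ac)

lemma inverse_deriv:
  fixes q :: "complex \<Rightarrow> complex"
  assumes "(q has_field_derivative Q) (at t)" "q t \<noteq> 0"
  shows "((\<lambda>s. 1 / q s) has_field_derivative - Q / q t ^ 2) (at t)"
  using assms by (auto intro!: derivative_eq_intros simp: power2_eq_square)

lemma solves_chart:
  assumes j: "j \<in> JJ" and T: "open T" "u ` T \<subseteq> chart_dom j"
  shows "solves rhs T u \<longleftrightarrow> solves (\<lambda>_. gR j) T (chart_coord j \<circ> u)"
proof (cases "j = 0")
  case True
  have "chart_coord j \<circ> u = u" unfolding True by (simp add: fun_eq_iff chart_coord_0)
  then show ?thesis unfolding True by (simp add: solves_def rhs_gR)
next
  case False
  define x y where "x s = u s $ 1" and "y s = u s $ 2" for s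
  define p q where "p s = y s ^ (nj j - 1) * (x s - ca j * y s)" and "q s = 1 / y s" for s
  have y0: "y t \<noteq> 0" if "t \<in> T" for t using T(2) that False by (auto simp: chart_dom_def y_def)
  have q0: "q t \<noteq> 0" if "t \<in> T" for t using y0[OF that] by (simp add: q_def)
  have u: "u s = vector [x s, y s]" for s by (simp add: x_def y_def vec2_nth)
  have pq: "chart_coord j (u s) = vector [p s, q s]" for s
    unfolding chart_coord_eq[OF j False] by (simp add: p_def q_def x_def y_def)
  \<comment> \<open>The chart formulas are inverted by comparing points of the surface instead of by
    computation.\<close>
  have xq: "(ca j + p s * q s ^ nj j) / q s = x s" and yq: "1 / q s = y s" if "s \<in> T" for s
  proof -
    have "u s \<in> chart_dom j" using T(2) that by blast
    from Qp_chart[OF j this] have "Zp (u s) = Qp j (vector [p s, q s])" unfolding pq by (rule sym)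
    then have "vector [x s, y s] = (vector [(ca j + p s * q s ^ nj j) / q s, 1 / q s] :: complex^2)"
      unfolding Zp_Cp[OF j False] u by simp
    then show "(ca j + p s * q s ^ nj j) / q s = x s" "1 / q s = y s" by (metis vector_2)+
  qed
  have key: "(x has_field_derivative x t * y t) (at t) \<and> (y has_field_derivative 2 * x t ^ 2 - y t ^ 2) (at t) \<longleftrightarrow>
      (p has_field_derivative gR j (vector [p t, q t]) $ 1) (at t) \<and> (q has_field_derivative gR j (vector [p t, q t]) $ 2) (at t)"
    if t: "t \<in> T" for t
  proof (intro iffI; elim conjE; intro conjI)
    assume dx: "(x has_field_derivative x t * y t) (at t)" and dy: "(y has_field_derivative 2 * x t ^ 2 - y t ^ 2) (at t)"
    show "(p has_field_derivative gR j (vector [p t, q t]) $ 1) (at t)"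
      using forward_deriv[OF dx dy, of "nj j - 1" "ca j"]
      unfolding gR_forward(1)[OF j False y0[OF t]] p_def[symmetric] q_def[symmetric] .
    show "(q has_field_derivative gR j (vector [p t, q t]) $ 2) (at t)"
      using inverse_deriv[OF dy y0[OF t]]
      unfolding gR_forward(2)[OF j False y0[OF t]] p_def[symmetric] q_def[symmetric] .
  next
    assume dp: "(p has_field_derivative gR j (vector [p t, q t]) $ 1) (at t)"
      and dq: "(q has_field_derivative gR j (vector [p t, q t]) $ 2) (at t)"
    have "(ca j + p t * q t ^ nj j) / (q t * q t) = x t * y t"
      unfolding xq[OF t, symmetric] yq[OF t, symmetric] by simp
    then have "((\<lambda>s. (ca j + p s * q s ^ nj j) / q s) has_field_derivative x t * y t) (at t)"
      using backward_deriv[OF dp dq q0[OF t], of "ca j" "nj j"] unfolding gR_backward(1)[OF j False] by (simp only:)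
    then show "(x has_field_derivative x t * y t) (at t)"
      by (rule has_field_derivative_transform_within_open[OF _ T(1) t]) (rule xq)
    have "- gR j (vector [p t, q t]) $ 2 / q t ^ 2 = 2 * x t ^ 2 - y t ^ 2"
      unfolding gR_backward(2)[OF j False] xq[OF t, symmetric] yq[OF t, symmetric]
      by (simp only: diff_divide_distrib power_divide times_divide_eq_right power_one)
    then have "((\<lambda>s. 1 / q s) has_field_derivative 2 * x t ^ 2 - y t ^ 2) (at t)"
      using inverse_deriv[OF dq q0[OF t]] by (simp only:)
    then show "(y has_field_derivative 2 * x t ^ 2 - y t ^ 2) (at t)"
      by (rule has_field_derivative_transform_within_open[OF _ T(1) t]) (rule yq)
  qed
  have g0: "gR 0 (vector [a, b]) = vector [a * b, 2 * a ^ 2 - b ^ 2]" for a b by (simp add: gR_def)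
  have "solves rhs T u \<longleftrightarrow> (\<forall>t\<in>T. (x has_field_derivative x t * y t) (at t) \<and> (y has_field_derivative 2 * x t ^ 2 - y t ^ 2) (at t))"
    unfolding solves_iff rhs_gR u g0 vector_2 by (rule refl)
  also have "\<dots> \<longleftrightarrow> (\<forall>t\<in>T. (p has_field_derivative gR j (vector [p t, q t]) $ 1) (at t) \<and> (q has_field_derivative gR j (vector [p t, q t]) $ 2) (at t))"
    using key by (rule ball_cong[OF refl])
  also have "\<dots> \<longleftrightarrow> solves (\<lambda>_. gR j) T (chart_coord j \<circ> u)"
    unfolding solves_iff comp_def pq vector_2 by (rule refl)
  finally show ?thesis .
qed

lemma solution_extends:
  assumes mer: "\<And>i. (\<lambda>t. u t $ i) meromorphic_on {t0}" and sol: "\<forall>\<^sub>F t in at t0. solves rhs {t} u"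
  shows "\<exists>\<psi>. holo_curve_at phase_atlas \<psi> t0 \<and> (\<forall>\<^sub>F t in at t0. \<psi> t = gc 0 (vector [u t $ 1, u t $ 2, t]))"
proof -
  obtain r where r: "0 < r" "\<And>t. t \<in> ball t0 r - {t0} ==> solves rhs {t} u"
    by (rule eventually_ball[OF sol]) blast
  have d: "((\<lambda>s. u s $ 1) has_field_derivative u t $ 1 * u t $ 2) (at t)"
    "((\<lambda>s. u s $ 2) has_field_derivative 2 * (u t $ 1)\<^sup>2 - (u t $ 2)\<^sup>2) (at t)"
    if "t \<in> ball t0 r - {t0}" for t
    using r(2)[OF that] unfolding solves_iff rhs_gR by (simp_all add: gR_def Let_def)
  have "resolves t0 (\<lambda>t. u t $ 1) (\<lambda>t. u t $ 2)"
    by (rule resolves_solution[OF mer mer r(1) d])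
  then obtain j P Q e where j: "j \<in> JJ" and e: "0 < e" and P: "P holomorphic_on ball t0 e" and Q: "Q holomorphic_on ball t0 e"
    and c: "\<forall>t\<in>ball t0 e - {t0}. (j = 0 \<or> u t $ 2 \<noteq> 0) \<and> chart_coord j (vector [u t $ 1, u t $ 2]) = vector [P t, Q t]"
    unfolding resolves_def by (elim bexE exE conjE) (rule that)
  \<comment> \<open>The curve is defined at t0 as well: in the chart that resolves the solution its
    coordinates are holomorphic there.\<close>
  define \<psi> where "\<psi> t = gc j (v3 (vector [P t, Q t]) t)" for t
  have inv: "inv (gc j) (\<psi> t) = v3 (vector [P t, Q t]) t" for t
    unfolding \<psi>_def by (rule inv_f_f[OF gc_inj[OF j]])
  have "holo_curve_at phase_atlas \<psi> t0"
    unfolding holo_curve_at_def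
  proof (rule bexI[of _ "(range (gc j), inv (gc j))"], unfold prod.case, rule exI[of _ "ball t0 e"], intro conjI allI)
    show "(range (gc j), inv (gc j)) \<in> phase_atlas"
      unfolding phase_atlas_def glued_atlas_def using j by (rule imageI)
    show "\<psi> ` ball t0 e \<subseteq> range (gc j)" by (auto simp: \<psi>_def)
    show "(\<lambda>t. inv (gc j) (\<psi> t) $ i) holomorphic_on ball t0 e" for i
      unfolding inv v3_def using exhaust_3[of i] P Q by auto
  qed (use e in auto)
  moreover have "\<forall>\<^sub>F t in at t0. \<psi> t = gc 0 (vector [u t $ 1, u t $ 2, t])"
    unfolding eventually_at
  proof (rule exI[of _ e], intro conjI e ballI impI)
    fix t assume "t \<noteq> t0 \<and> dist t t0 < e"
    then have "t \<in> ball t0 e - {t0}" by (simp add: dist_commute)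
    from bspec[OF c this] have ut: "u t \<in> chart_dom j" "chart_coord j (u t) = vector [P t, Q t]"
      by (auto simp: chart_dom_def vec2_nth)
    have "Qp j (vector [P t, Q t]) = Qp 0 (u t)" using Qp_chart[OF j ut(1)] unfolding ut(2) by (simp add: Qp_def)
    moreover have "vector [u t $ 1, u t $ 2, t] = v3 (u t) t" by (simp add: v3_def)
    ultimately show "\<psi> t = gc 0 (vector [u t $ 1, u t $ 2, t])"
      unfolding \<psi>_def using gc_eq[OF j, of 0] by simp
  qed
  ultimately show ?thesis by blast
qed

lemma phase_space_main: "phase_space rhs JJ chart_dom chart_coord"
proof -
  have t: "\<phi> p $ 3 = time_of p" if ch: "(U, \<phi>) \<in> glued_atlas JJ chart_dom chart_coord" and p: "p \<in> U" for U \<phi> p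
  proof -
    from ch obtain j where j: "j \<in> JJ" "U = range (gc j)" "\<phi> = inv (gc j)" unfolding glued_atlas_def by blast
    then obtain v where v: "p = gc j v" using p by blast
    show ?thesis unfolding v j(3) inv_f_f[OF gc_inj[OF j(1)]] time_of_gc[OF j(1)] by (rule refl)
  qed
  have s: "time_of ` pts (glued_atlas JJ chart_dom chart_coord) = UNIV"
  proof -
    have "t \<in> time_of ` pts phase_atlas" for t
    proof (rule image_eqI[of _ _ "gc 0 (v3 0 t)"])
      have z: "0 \<in> JJ" by simp
      show "t = time_of (gc 0 (v3 0 t))" unfolding time_of_gc[OF z] by simp
      show "gc 0 (v3 0 t) \<in> pts phase_atlas" unfolding pts_phase using z by blast
    qed
    then show ?thesis unfolding phase_atlas_def by auto
  qed
  have c0: "chart_dom 0 = UNIV" "chart_coord 0 = id" by (simp_all add: chart_dom_def fun_eq_iff chart_coord_0)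
  have sc: "\<forall>j\<in>JJ. \<exists>g. poly_rhs g \<and>
        (\<forall>T u. open T \<and> u ` T \<subseteq> chart_dom j \<longrightarrow> (solves rhs T u \<longleftrightarrow> solves g T (chart_coord j \<circ> u)))"
  proof
    fix j assume j: "j \<in> JJ"
    show "\<exists>g. poly_rhs g \<and>
        (\<forall>T u. open T \<and> u ` T \<subseteq> chart_dom j \<longrightarrow> (solves rhs T u \<longleftrightarrow> solves g T (chart_coord j \<circ> u)))"
      by (rule exI[of _ "\<lambda>_. gR j"], intro conjI poly_rhs_gR allI impI, elim conjE, rule solves_chart[OF j])
  qed
  show ?thesis unfolding phase_space_def
    by (intro conjI c0 equiv_glue complex_manifold_phase[unfolded phase_atlas_def] s sc allI impI
        solution_extends[unfolded phase_atlas_def])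
      (use t in auto)
qed

section \<open>The fibres and their embedding into the compact surface\<close>

lemma fibre_phase: "fibre phase_atlas t =
    (\<lambda>j. ({p \<in> range (gc j). time_of p = t}, \<lambda>p. xy (inv (gc j) p))) ` JJ"
  unfolding fibre_def phase_atlas_def glued_atlas_def image_image prod.case by (rule refl)

lemma fibre_chart:
  assumes "j \<in> JJ"
  shows "{p \<in> range (gc j). time_of p = t} = (\<lambda>z. gc j (v3 z t)) ` UNIV"
proof (intro equalityI subsetI)
  fix p assume "p \<in> {p \<in> range (gc j). time_of p = t}"
  then obtain v where "p = gc j v" "time_of p = t" by blast
  then have "p = gc j (v3 (xy v) t)" using time_of_gc[OF assms] v3_simps(3) by metis
  then show "p \<in> (\<lambda>z. gc j (v3 z t)) ` UNIV" by blast
next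
  fix p assume "p \<in> (\<lambda>z. gc j (v3 z t)) ` UNIV"
  then show "p \<in> {p \<in> range (gc j). time_of p = t}" using time_of_gc[OF assms] by auto
qed

lemma fibre_chart_inv: "j \<in> JJ ==> xy (inv (gc j) (gc j (v3 z t))) = z"
  unfolding inv_f_f[OF gc_inj] by (rule v3_simps(1))

lemma fac_fibre:
  assumes j: "j \<in> JJ" "k \<in> JJ" and eq: "gc j (v3 z t) = gc k (v3 z' t)"
  shows "fac (\<lambda>z. gc j (v3 z t)) z (\<lambda>z. gc k (v3 z t)) UNIV"
proof -
  have "Qp j z = Qp k z'" using eq unfolding gc_eq[OF j] by simp
  then have "fac (Qp j) z (Qp k) UNIV" by (rule fac_Qp[OF j])
  then obtain W \<tau> where W: "open W" "z \<in> W" "\<forall>y\<in>W. \<tau> y \<in> UNIV \<and> Qp j y = Qp k (\<tau> y) \<and> cdv \<tau> y"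
    unfolding fac_def by (elim exE conjE) (rule that)
  show ?thesis
    by (rule facI[OF W(1,2), of \<tau>]) (unfold gc_eq[OF j], use W(3) in auto)
qed

lemma is_atlas_fibre: "is_atlas (fibre phase_atlas t)"
proof (rule is_atlasI[where F="(\<lambda>j. (UNIV, \<lambda>z. gc j (v3 z t))) ` JJ"])
  fix U \<phi> assume "(U, \<phi>) \<in> fibre phase_atlas t"
  then obtain j where j: "j \<in> JJ" "U = {p \<in> range (gc j). time_of p = t}" "\<phi> = (\<lambda>p. xy (inv (gc j) p))"
    unfolding fibre_phase by blast
  show "\<exists>V P. (V, P) \<in> (\<lambda>j. (UNIV, \<lambda>z. gc j (v3 z t))) ` JJ \<and> open V \<and> P ` V = U \<and> (\<forall>z\<in>V. \<phi> (P z) = z)"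
    by (rule exI[of _ UNIV], rule exI[of _ "\<lambda>z. gc j (v3 z t)"], intro conjI imageI j(1) open_UNIV ballI)
      (unfold j(2,3) fibre_chart[OF j(1)] fibre_chart_inv[OF j(1)], rule refl, rule refl)
next
  fix V V' :: "(complex^2) set" and P Q and z z' :: "complex^2"
  assume VP: "(V, P) \<in> (\<lambda>j. (UNIV, \<lambda>z. gc j (v3 z t))) ` JJ" "(V', Q) \<in> (\<lambda>j. (UNIV, \<lambda>z. gc j (v3 z t))) ` JJ"
    and eq: "P z = Q z'"
  from VP(1) obtain j where j: "j \<in> JJ" "V = UNIV" "P = (\<lambda>z. gc j (v3 z t))" by blast
  from VP(2) obtain k where k: "k \<in> JJ" "V' = UNIV" "Q = (\<lambda>z. gc k (v3 z t))" by blast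
  show "fac P z Q V'" unfolding j(3) k(2,3) by (rule fac_fibre[OF j(1) k(1)]) (use eq in "simp only: j(3) k(3)")
qed

lemma pts_fibre: "pts (fibre phase_atlas t) = (\<Union>j\<in>JJ. range (\<lambda>z. gc j (v3 z t)))"
proof -
  have "pts (fibre phase_atlas t) = (\<Union>j\<in>JJ. {p \<in> range (gc j). time_of p = t})"
    unfolding fibre_phase pts_def by (simp only: image_image UN_simps prod.case)
  also have "\<dots> = (\<Union>j\<in>JJ. range (\<lambda>z. gc j (v3 z t)))"
    by (rule SUP_cong[OF refl]) (rule fibre_chart)
  finally show ?thesis .
qed

lemma lpar_fibre:
  assumes j: "j \<in> JJ"
  shows "lpar (fibre phase_atlas t) UNIV (\<lambda>z. gc j (v3 z t))"
  unfolding lpar_def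
proof (intro conjI open_UNIV)
  have m: "({p \<in> range (gc j). time_of p = t}, \<lambda>p. xy (inv (gc j) p)) \<in> fibre phase_atlas t"
    unfolding fibre_phase by (rule imageI[OF j])
  show "\<exists>(U, \<phi>)\<in>fibre phase_atlas t. (\<lambda>z. gc j (v3 z t)) ` UNIV \<subseteq> U \<and> (\<forall>z\<in>UNIV. \<phi> (gc j (v3 z t)) = z)"
    by (rule bexI[OF _ m], unfold prod.case fibre_chart[OF j] fibre_chart_inv[OF j], rule conjI[OF subset_refl], rule ballI, rule refl)
qed

lemma th_v3: "j \<in> JJ ==> th (gc j (v3 z t)) = Qp j z"
  unfolding th_gc v3_simps by (rule refl)

lemma th_image: "th ` pts (fibre phase_atlas t) = (\<Union>j\<in>JJ. range (Qp j))"
  unfolding pts_fibre image_UN image_image by (rule SUP_cong[OF refl]) (simp only: th_v3)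

lemma Qp_range: "(\<Union>j\<in>JJ. range (Qp j)) = range Zp \<union> (\<Union>a\<in>Br. range (Cp a (nf a)))"
  by (auto simp: Qp_def Br_def ca_def nj_def nf_def)

lemma openin_Qp: "openin (mtop SS) (\<Union>j\<in>JJ. range (Qp j))"
  by (intro openin_Union ballI; elim imageE) (auto intro: openin_par_image[OF nf.at par_Qp])

lemma embedding_th: "open_embedding (fibre phase_atlas t) SS th"
  unfolding open_embedding_def th_image
proof (intro conjI openin_Qp biholoI is_atlas_fibre is_atlas_open_restrict[OF nf.at openin_Qp])
  have inj: "inj_on th (pts (fibre phase_atlas t))"
  proof (rule inj_onI)
    fix p q assume "p \<in> pts (fibre phase_atlas t)" "q \<in> pts (fibre phase_atlas t)" and eq: "th p = th q"
    then obtain j z k w where p: "j \<in> JJ" "p = gc j (v3 z t)" and q: "k \<in> JJ" "q = gc k (v3 w t)"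
      unfolding pts_fibre by blast
    show "p = q" using eq unfolding p(2) q(2) th_v3[OF p(1)] th_v3[OF q(1)] gc_eq[OF p(1) q(1)] by simp
  qed
  have "(\<Union>j\<in>JJ. range (Qp j)) \<subseteq> pts SS"
    using openin_subset[OF openin_Qp] unfolding topspace_mtop[OF nf.at] .
  then show "bij_betw th (pts (fibre phase_atlas t)) (pts (open_restrict SS (\<Union>j\<in>JJ. range (Qp j))))"
    unfolding bij_betw_def pts_open_restrict th_image using inj by (intro conjI) (assumption, rule Int_absorb1[symmetric])
next
  fix p assume "p \<in> pts (fibre phase_atlas t)"
  then obtain j z where p: "j \<in> JJ" "p = gc j (v3 z t)" unfolding pts_fibre by blast
  have 1: "par (open_restrict SS (\<Union>j\<in>JJ. range (Qp j))) UNIV (Qp j)"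
    by (rule par_open_restrict[OF nf.at par_Qp[OF p(1)] openin_Qp]) (use p(1) in blast)
  show "\<exists>V P. par (fibre phase_atlas t) V P \<and> p \<in> P ` V \<and> par (open_restrict SS (\<Union>j\<in>JJ. range (Qp j))) V (\<lambda>z. th (P z))"
    by (rule exI[of _ UNIV], rule exI[of _ "\<lambda>z. gc j (v3 z t)"], intro conjI lpar_par[OF lpar_fibre[OF p(1)]])
      (use p(2) in blast, unfold th_v3[OF p(1)], rule 1)
qed

section \<open>The boundary curves as vertices of the diagram\<close>

definition crv :: "nat \<Rightarrow> surface_point set" where
  "crv i = (if i = 3 then Lc else if i = 7 then Ec 0 1 else if i < 3 then Ec 1 (3 - i) else Ec (- 1) (i - 3))"

text \<open>Centre and level translate the numbering of the diagram into the terms of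
  \<open>Ec_Ec'\<close>, where adjacency means the same centre and consecutive levels.\<close>

definition brc :: "nat \<Rightarrow> complex" where "brc i = (if i = 7 then 0 else if i < 3 then 1 else - 1)"
definition lev :: "nat \<Rightarrow> nat" where "lev i = (if i = 7 then 1 else if i < 3 then 3 - i else i - 3)"

lemma crv_eq: "i \<noteq> 3 ==> crv i = Ec (brc i) (lev i)" "crv 3 = Lc"
  by (auto simp: crv_def brc_def lev_def)

lemma E7_cases: "i \<in> E7_vertices \<longleftrightarrow> i = 0 \<or> i = 1 \<or> i = 2 \<or> i = 3 \<or> i = 4 \<or> i = 5 \<or> i = 6 \<or> i = 7"
  by (auto simp: E7_vertices_def)

lemma lev: "i \<in> E7_vertices ==> i \<noteq> 3 ==> brc i \<in> Br \<and> 1 \<le> lev i \<and> lev i < nf (brc i)"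
  unfolding E7_cases by (elim disjE) (simp_all add: Br_def brc_def lev_def nf_def)

lemma brc_lev_inj: "i \<in> E7_vertices ==> j \<in> E7_vertices ==> i \<noteq> 3 ==> j \<noteq> 3 ==> i \<noteq> j ==> brc j \<noteq> brc i \<or> lev j \<noteq> lev i"
  unfolding E7_cases by (elim disjE) (simp_all add: brc_def lev_def)

lemma E7_edge_Lc: "j \<in> E7_vertices ==> j \<noteq> 3 ==> {3, j} \<in> E7_edges \<longleftrightarrow> lev j = 1"
  unfolding E7_cases E7_edges_def by (elim disjE) (simp_all add: doubleton_eq_iff lev_def)

lemma E7_edge: "i \<in> E7_vertices ==> j \<in> E7_vertices ==> i \<noteq> 3 ==> j \<noteq> 3 ==> i \<noteq> j ==>
    {i, j} \<in> E7_edges \<longleftrightarrow> brc j = brc i \<and> (lev j = Suc (lev i) \<or> lev i = Suc (lev j))"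
  unfolding E7_cases E7_edges_def by (elim disjE) (simp_all add: doubleton_eq_iff lev_def brc_def)

lemma nf_pos: "a \<in> Br ==> 1 \<le> nf a"
  by (auto simp: nf_def Br_def)

lemma Ec_inj:
  assumes "1 \<le> k" "1 \<le> l" "Ec a k = Ec b l"
  shows "b = a \<and> l = k"
proof -
  \<comment> \<open>A point of the k-th curve that lies on no other boundary curve: z $ 1 = 0 and z
    $ 2 \<noteq> 0 in the chart that creates the curve.\<close>
  let ?p = "Bp a (k - 1) (vector [0, 1])"
  have "?p \<in> Ec a k" using assms(1) by (simp add: mem_Ec_Bp)
  then have "?p \<in> Ec b l" using assms(3) by simp
  then show ?thesis using assms(1,2) by (auto simp: mem_Ec_Bp)
qed

lemma Ec_ne_Lc:
  assumes "1 \<le> k" "a \<in> Br"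
  shows "Ec a k \<noteq> Lc"
proof
  assume e: "Ec a k = Lc"
  let ?p = "Bp a (k - 1) (vector [0, 1])"
  have V: "vector [0, 1] \<in> BV a (k - 1)"
    by (cases "k - 1") (simp_all add: BV_0 BV_Suc CV.simps)
  have "?p \<in> Ec a k" using assms(1) by (simp add: mem_Ec_Bp)
  then have "?p \<in> Lc" using e by simp
  then show False using mem_Lc_Bp[OF assms(2) V] by simp
qed

lemma crv_inj: "inj_on crv E7_vertices"
proof (rule inj_onI, rule ccontr)
  fix i j assume i: "i \<in> E7_vertices" and j: "j \<in> E7_vertices" and eq: "crv i = crv j" and ne: "i \<noteq> j"
  consider "i = 3" "j \<noteq> 3" | "i \<noteq> 3" "j = 3" | "i \<noteq> 3" "j \<noteq> 3" using ne by auto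
  then show False
  proof cases
    case 1
    then show ?thesis using eq Ec_ne_Lc lev[OF j 1(2)] by (auto simp: crv_eq)
  next
    case 2
    then show ?thesis using eq Ec_ne_Lc lev[OF i 2(1)] by (auto simp: crv_eq)
  next
    case 3
    then show ?thesis
      using eq Ec_inj[of "lev i" "lev j" "brc i" "brc j"] lev[OF i 3(1)] lev[OF j 3(2)] brc_lev_inj[OF i j 3 ne] by (simp add: crv_eq)
  qed
qed

lemma curves_crv: "Lc \<union> (\<Union>a\<in>Br. \<Union>k\<in>{1..<nf a}. Ec a k) = (\<Union>i\<in>E7_vertices. crv i)"
proof (intro equalityI subsetI)
  fix p assume "p \<in> Lc \<union> (\<Union>a\<in>Br. \<Union>k\<in>{1..<nf a}. Ec a k)"
  then consider "p \<in> Lc" | a k where "a \<in> Br" "1 \<le> k" "k < nf a" "p \<in> Ec a k" by auto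
  then show "p \<in> (\<Union>i\<in>E7_vertices. crv i)"
  proof cases
    case 1
    then show ?thesis by (intro UN_I[of 3]) (simp_all add: crv_def E7_cases)
  next
    case (2 a k)
    from 2(1) consider "a = 0" | "a = 1" | "a = - 1" by (auto simp: Br_def)
    then show ?thesis
    proof cases
      case 1
      then have "k = 1" using 2 by (simp add: nf_def)
      then show ?thesis using 1 2(4) by (intro UN_I[of 7]) (simp_all add: crv_def E7_cases)
    next
      case a: 2
      then have k: "k = 1 \<or> k = 2 \<or> k = 3" using 2 by (auto simp: nf_def)
      then have "crv (3 - k) = Ec 1 k" by (auto simp: crv_def)
      then show ?thesis using a 2(4) k by (intro UN_I[of "3 - k"]) (auto simp: E7_cases)
    next
      case 3
      then have k: "k = 1 \<or> k = 2 \<or> k = 3" using 2 by (auto simp: nf_def)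
      then have "crv (3 + k) = Ec (- 1) k" by (auto simp: crv_def)
      then show ?thesis using 3 2(4) k by (intro UN_I[of "3 + k"]) (auto simp: E7_cases)
    qed
  qed
next
  fix p assume "p \<in> (\<Union>i\<in>E7_vertices. crv i)"
  then obtain i where i: "i \<in> E7_vertices" "p \<in> crv i" by blast
  show "p \<in> Lc \<union> (\<Union>a\<in>Br. \<Union>k\<in>{1..<nf a}. Ec a k)"
  proof (cases "i = 3")
    case False
    then show ?thesis using lev[OF i(1) False] i(2) unfolding crv_eq(1)[OF False]
      by (intro UnI2 UN_I[of "brc i"] UN_I[of "lev i"]) auto
  qed (use i in "simp add: crv_eq")
qed

lemma type_E7: "surface_of_type SS (fibre phase_atlas t) th E7_vertices E7_edges"
  unfolding surface_of_type_def
proof (intro conjI nf.rational_Surf nf_pos embedding_th exI[of _ crv] crv_inj ballI impI)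
  show "pts SS - th ` pts (fibre phase_atlas t) = (\<Union>i\<in>E7_vertices. crv i)"
    unfolding th_image Qp_range by (rule trans[OF nf.curves_compl[OF nf_pos] curves_crv])
next
  fix i assume i: "i \<in> E7_vertices"
  show "smooth_rational_curve SS (crv i)"
    using nf.rational_Lc[OF nf_pos] nf.rational_Ec lev[OF i] by (cases "i = 3") (simp_all add: crv_eq)
  show "has_intersection_number SS (crv i) (crv i) (- 2)"
    using nf.Lc_Lc[OF nf_pos] nf.Ec_Ec lev[OF i] by (cases "i = 3") (simp_all add: crv_eq)
  fix j assume j: "j \<in> E7_vertices" and ne: "i \<noteq> j"
  consider "i = 3" "j \<noteq> 3" | "i \<noteq> 3" "j = 3" | "i \<noteq> 3" "j \<noteq> 3" using ne by auto
  then have "has_intersection_number SS (crv i) (crv j) (if {i, j} \<in> E7_edges then 1 else 0) \<and>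
    (crv i \<inter> crv j \<noteq> {} \<longleftrightarrow> {i, j} \<in> E7_edges)"
  proof cases
    case 1
    note l = lev[OF j 1(2)]
    show ?thesis
      unfolding 1(1) crv_eq(1)[OF 1(2)] crv_eq(2) E7_edge_Lc[OF j 1(2)]
      using nf.Lc_Ec[OF nf_pos, of "brc j" "lev j"] Lc_Ec_Int[of "lev j" "brc j"] l by blast
  next
    case 2
    note l = lev[OF i 2(1)]
    have e: "{i, 3} = {3, i}" by blast
    show ?thesis
      unfolding 2(2) crv_eq(1)[OF 2(1)] crv_eq(2) e E7_edge_Lc[OF i 2(1)]
      using nf.Ec_Lc[of "brc i" "lev i"] Lc_Ec_Int[of "lev i" "brc i"] l by (simp add: Int_commute)
  next
    case 3
    note l = lev[OF i 3(1)] lev[OF j 3(2)]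
    show ?thesis
      unfolding crv_eq(1)[OF 3(1)] crv_eq(1)[OF 3(2)] E7_edge[OF i j 3 ne]
      using nf.Ec_Ec'[of "brc i" "lev i" "lev j" "brc j"] Ec_Ec_Int[of "lev i" "lev j" "brc j" "brc i"] l brc_lev_inj[OF i j 3 ne]
      by blast
  qed
  then show "has_intersection_number SS (crv i) (crv j) (if {i, j} \<in> E7_edges then 1 else 0)"
    "crv i \<inter> crv j \<noteq> {} \<longleftrightarrow> {i, j} \<in> E7_edges" by blast+
qed

section \<open>The sequence of ten blow-ups\<close>

definition brk :: "nat \<Rightarrow> complex" where
  "brk k = (if k < 2 then 0 else if k < 6 then 1 else - 1)"

text \<open>Truncated subtraction encodes the order of the steps: 0 and 1 over the centre 0, 2 to 5
  over 1, and 6 to 9 over -1.\<close>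

definition nn :: "nat \<Rightarrow> complex \<Rightarrow> nat" where
  "nn k a = (if a = 0 then min k 2 else if a = 1 then min (k - 2) 4 else if a = - 1 then min (k - 6) 4 else 0)"

lemma nn_Suc: "k < 10 ==> nn (Suc k) = (nn k)(brk k := Suc (nn k (brk k)))"
  by (auto simp: fun_eq_iff nn_def brk_def)

lemma nn_brn: "brn (nn k)"
  by unfold_locales (auto simp: nn_def Br_def)

lemma nn_0: "nn 0 = (\<lambda>_. 0)" and nn_10: "nn 10 = nf"
  by (auto simp: fun_eq_iff nn_def nf_def)

definition cen :: "nat \<Rightarrow> surface_point" where "cen k = Cp (brk k) (nn k (brk k)) 0"
definition prj :: "nat \<Rightarrow> surface_point \<Rightarrow> surface_point" where
  "prj k = contr (cen k) (exc (brk k) (Suc (nn k (brk k))))"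

lemma blowup_step:
  assumes "k < 10"
  shows "is_blowup (Surf (nn k)) (cen k) (Surf (nn (Suc k))) (prj k)"
proof -
  interpret n: brn "nn k" by (rule nn_brn)
  interpret m: brn "nn (Suc k)" by (rule nn_brn)
  have a: "brk k \<in> Br" by (simp add: brk_def Br_def)
  interpret blowup "CV (brk k) (nn k (brk k))" "Cp (brk k) (nn k (brk k))" "exc (brk k) (Suc (nn k (brk k)))" "Rest (nn k) (brk k)"
    by (rule Cp_blowup[OF n.at a Cp_inj])
  show ?thesis
    using is_blowup n.complex_manifold_Surf m.complex_manifold_Surf
    unfolding nn_Suc[OF assms] Surf_blow[OF a] Surf_Rest[OF a, symmetric] cen_def prj_def by blast
qed

text \<open>No point of the affine plane is ever blown up. This yields the final compatibility of
  the embedded fibres with the original coordinates (x, y).\<close>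

lemma prj_Zp: "prj k (Zp z) = Zp z"
  by (auto simp: prj_def contr_def Zp_def exc_def)

lemma contraction_Zp: "contraction prj i m (Zp z) = Zp z"
  by (induction m) (simp_all add: prj_Zp)

text \<open>The second centre lies on the first exceptional curve, so it is infinitely near to the
  first centre.\<close>

lemma infinitely_near: "contraction prj 0 (Suc 0) (cen (0 + Suc 0)) = cen 0"
proof -
  have "cen (Suc 0) = exc 0 1 (pline (vector [0, 1]))"
    unfolding cen_def Cp_eq by (simp add: brk_def nn_def)
  moreover have "pline (vector [0, 1] :: complex^2) \<in> plines" by (rule pline_vec2_plines)
  ultimately show ?thesis by (simp add: prj_def contr_def brk_def nn_def)
qed

theorem theorem6p2:
  shows "phase_space rhs {0, 1, 2, 3} chart_dom chart_coord \<and>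
    (\<exists>(S :: nat \<Rightarrow> (surface_point, 2) atlas) (c :: nat \<Rightarrow> surface_point)
       (\<pi> :: nat \<Rightarrow> surface_point \<Rightarrow> surface_point) (h :: surface_point \<Rightarrow> (complex^3) set).
       biholo (S 0) P2 h \<and>
       (\<forall>i<10. is_blowup (S i) (c i) (S (Suc i)) (\<pi> i)) \<and>
       (\<exists>i m. i + Suc m < 10 \<and> contraction \<pi> i (Suc m) (c (i + Suc m)) = c i) \<and>
       (\<forall>t. \<exists>\<iota>. surface_of_type (S 10) (fibre phase_atlas t) \<iota> E7_vertices E7_edges \<and>
          (\<forall>x y. h (contraction \<pi> 0 10
               (\<iota> (glue_class {0, 1, 2, 3} chart_dom chart_coord 0 (vector [x, y, t])))) =
             pline (vector [x, y, 1]))))"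
proof (rule conjI[OF phase_space_main])
  let ?S = "\<lambda>k. Surf (nn k)"
  have h: "fst (contraction prj 0 10 (th (gc 0 (vector [x, y, t])))) = pline (vector [x, y, 1])" for x y t
  proof -
    have z: "0 \<in> JJ" by simp
    have "th (gc 0 (vector [x, y, t])) = Zp (vector [x, y])"
      unfolding th_gc[OF z] by (simp add: xy_def Qp_def)
    then show ?thesis by (simp only: contraction_Zp) (simp add: Zp_def)
  qed
  show "\<exists>(S :: nat \<Rightarrow> (surface_point, 2) atlas) c \<pi> h.
       biholo (S 0) P2 h \<and>
       (\<forall>i<10. is_blowup (S i) (c i) (S (Suc i)) (\<pi> i)) \<and>
       (\<exists>i m. i + Suc m < 10 \<and> contraction \<pi> i (Suc m) (c (i + Suc m)) = c i) \<and>
       (\<forall>t. \<exists>\<iota>. surface_of_type (S 10) (fibre phase_atlas t) \<iota> E7_vertices E7_edges \<and>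
          (\<forall>x y. h (contraction \<pi> 0 10 (\<iota> (gc 0 (vector [x, y, t])))) = pline (vector [x, y, 1])))"
  proof (rule exI[of _ ?S], rule exI[of _ cen], rule exI[of _ prj], rule exI[of _ fst], intro conjI allI impI)
    show "biholo (Surf (nn 0)) P2 fst" unfolding nn_0 by (rule biholo_Surf_0)
    show "is_blowup (Surf (nn i)) (cen i) (Surf (nn (Suc i))) (prj i)" if "i < 10" for i
      by (rule blowup_step[OF that])
    show "\<exists>i m. i + Suc m < 10 \<and> contraction prj i (Suc m) (cen (i + Suc m)) = cen i"
      by (rule exI[of _ 0], rule exI[of _ 0], rule conjI[OF _ infinitely_near]) simp
    show "\<exists>\<iota>. surface_of_type (Surf (nn 10)) (fibre phase_atlas t) \<iota> E7_vertices E7_edges \<and>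
          (\<forall>x y. fst (contraction prj 0 10 (\<iota> (gc 0 (vector [x, y, t])))) = pline (vector [x, y, 1]))" for t
      unfolding nn_10 by (rule exI[of _ th], intro conjI allI type_E7 h)
  qed
qed

end
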